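(* Consider $\mathrm{RIGC}(\boldsymbol d^{\ell},\mathbf{Com})$ under Assumptions (A), (B), (C), (D) listed in the context, and additionally assume $\mathbb E[\widetilde D^{\ell}]\,\mathbb E[\widetilde D^{r}]>1$. Let $\eta_{\ell}\in[0,1]$ be the smallest solution in $[0,1]$ of $\eta_{\ell}=G_{\widetilde D^{r}}(G_{\widetilde D^{\ell}}(\eta_{\ell}))$ and define $\eta_{r}:=G_{\widetilde D^{\ell}}(\eta_{\ell})$. For $k\in\mathbb Z^+$, $d\in\mathbb N$, define $$A(k,d):=p_k\sum_{H_1,\ldots,H_k\in\mathscr H}\ \sum_{\substack{c_1,\ldots,c_k\in\mathbb N\\ c_1+\cdots+c_k=d}}\Bigl(1-\eta_{r}^{\sum_{i=1}^k(|H_i|-1)}\Bigr)\prod_{i=1}^k\frac{\nu(c_i\,|\,H_i)\,\mu_{H_i}}{\mathbb E[D^{r}]},$$ where $\nu(c\,|\,H)$ is the number of vertices of $H$ having degree $c$ in $H$. Let $\mathscr C_1$ be the largest connected component of the RIGC (by number of vertices, ties broken arbitrarily). Then, for all $k\in\mathbb Z^+$ and $d\in\mathbb N$, as $n\to\infty$, $$\frac{\bigl|\{v\in\mathscr C_1:\ d_v^{\ell}=k,\ d_v^{p}=d\}\bigr|}{N_n}\xrightarrow{\ \mathbb P\ }A(k,d),$$ where $d_v^{p}$ is the degree of $v$ in the RIGC.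
   Context: Notation: $\mathbb Z^+=\{1,2,\dots\}$, $\mathbb N=\{0,1,2,\dots\}$. For an $\mathbb N$-valued random variable $X$ with $0<\mathbb E[X]<\infty$, the size-biased variable $X^\star$ has $\mathbb P(X^\star=k)=k\,\mathbb P(X=k)/\mathbb E[X]$, and $\widetilde X:=X^\star-1$. $G_X(z)=\mathbb E[z^X]$ for $z\in[0,1]$. $\mathbb E[\widetilde D^{\ell}],\mathbb E[\widetilde D^{r}]$ may be $+\infty$ (convention $0\cdot\infty=0$); $0^0=1$. Model. All quantities depend on $n\in\mathbb N$ (often suppressed). There are $N_n$ individuals ($\ell$-vertices) $[N_n]$ and $M_n$ groups ($r$-vertices) $[M_n]$, with $N_n,M_n\to\infty$. Let $\mathscr H$ be the set of finite, simple, connected graphs $H$ with at least one vertex, each vertex-labelled by $[|H|]$, such that isomorphic graphs in $\mathscr H$ are labelled identically ($|H|$ is the number of vertices). Parameters: $\boldsymbol d^{\ell}=(d^{\ell}_v)_{v\in[N_n]}$ with $d^{\ell}_v\in\mathbb Z^+$, and $\mathbf{Com}=(\mathrm{Com}_a)_{a\in[M_n]}$ with $\mathrm{Com}_a\in\mathscr H$; put $d^{r}_a=|\mathrm{Com}_a|$ and assume $\mathscr h_n:=\sum_v d^{\ell}_v=\sum_a d^{r}_a$. Let $\mathscr V(\mathbf{Com})$ and $\mathscr E(\mathbf{Com})$ be the disjoint unions of the vertex sets and edge sets of all $\mathrm{Com}_a$. Give each $v\in[N_n]$ $d_v^{\ell}$ half-edges and let $\omega_n$ be a uniformly random bijection from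 the set of all these $\ell$-half-edges to $\mathscr V(\mathbf{Com})$. Write $v\mapsfrom j$ if a half-edge of $v$ is matched to $j\in\mathscr V(\mathbf{Com})$. The graph $\mathrm{RIGC}(\boldsymbol d^{\ell},\mathbf{Com})$ is the random multigraph on $[N_n]$ in which the pair $(v,w)$ has edge multiplicity $X(v,w)=\sum_{(j_1,j_2)\in\mathscr E(\mathbf{Com})}\mathbf 1_{\{v\mapsfrom j_1,\,w\mapsfrom j_2\}\cup\{v\mapsfrom j_2,\,w\mapsfrom j_1\}}$. The degree of $v$ in the RIGC is $d_v^{p}=2X(v,v)+\sum_{w\ne v}X(v,w)$. Assumptions. Let $D_n^{\ell}=d^{\ell}_{V}$ with $V$ uniform on $[N_n]$ and $D_n^{r}=d^{r}_{W}$ with $W$ uniform on $[M_n]$. Let $\mu^{(n)}_H=|\{a:\mathrm{Com}_a=H\}|/M_n$ for $H\in\mathscr H$. (A) $D_n^{\ell}\to D^{\ell}$ in distribution for a random variable $D^{\ell}$ with pmf $\boldsymbol p=(p_k)_{k\in\mathbb Z^+}$. (B) $\mathbb E[D^{\ell}]<\infty$ and $\mathbb E[D_n^{\ell}]\to\mathbb E[D^{\ell}]$. (C) There is a probability mass function $\boldsymbol\mu$ on $\mathscr H$ with $\mu^{(n)}_H\to\mu_H$ for every $H\in\mathscr H$; consequently $D_n^{r}\to D^{r}$ in distribution, where $D^{r}$ has pmf $q_k=\sum_{H:|H|=k}\mu_H$. (D) $\mathbb E[D^{r}]<\infty$ and $\mathbb E[D_n^{r}]\to\mathbb E[D^{r}]$.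 *)

theory Defs
  imports "HOL-Probability.Probability"
begin

section \<open>Simple graphs and the class of communities\<close>

text \<open>
  A graph with \<open>n\<close> vertices has vertex set \<open>{1..n}\<close>; edges are two-element sets of vertices.
\<close>

datatype lgraph = LGraph (num_verts: nat) (edge_set: "nat set set")

definition verts_of :: "lgraph \<Rightarrow> nat set" where
  "verts_of H = {1..num_verts H}"

definition simple_graph :: "lgraph \<Rightarrow> bool" where
  "simple_graph H \<longleftrightarrow>
     (\<forall>e\<in>edge_set H. \<exists>x y. e = {x, y} \<and> x \<in> verts_of H \<and> y \<in> verts_of H \<and> x \<noteq> y)"

definition connected_graph :: "lgraph \<Rightarrow> bool" where
  "connected_graph H \<longleftrightarrow>
     (\<forall>x\<in>verts_of H. \<forall>y\<in>verts_of H. (x, y) \<in> {(u, w). {u, w} \<in> edge_set H}\<^sup>*)"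

definition graph_iso :: "lgraph \<Rightarrow> lgraph \<Rightarrow> bool" where
  "graph_iso H H' \<longleftrightarrow>
     (\<exists>f. bij_betw f (verts_of H) (verts_of H') \<and>
          (\<forall>x\<in>verts_of H. \<forall>y\<in>verts_of H. {x, y} \<in> edge_set H \<longleftrightarrow> {f x, f y} \<in> edge_set H'))"

text \<open>
  The labelled members of the class are determined only up to the choice of one labelling for each
  isomorphism class, so being such a class is a predicate; results are stated for every choice.
\<close>

definition community_class :: "lgraph set \<Rightarrow> bool" where
  "community_class \<H> \<longleftrightarrow>
     (\<forall>H\<in>\<H>. simple_graph H \<and> connected_graph H \<and> num_verts H \<ge> 1) \<and>
     (\<forall>G. simple_graph G \<and> connected_graph G \<and> num_verts G \<ge> 1 \<longrightarrow> (\<exists>H\<in>\<H>. graph_iso G H)) \<and>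
     (\<forall>H\<in>\<H>. \<forall>H'\<in>\<H>. graph_iso H H' \<longrightarrow> H = H')"

definition vertex_degree :: "lgraph \<Rightarrow> nat \<Rightarrow> nat" where
  "vertex_degree H x = card {e \<in> edge_set H. x \<in> e}"

definition num_of_degree :: "nat \<Rightarrow> lgraph \<Rightarrow> nat" where
  "num_of_degree c H = card {x \<in> verts_of H. vertex_degree H x = c}"


section \<open>The model\<close>

text \<open>
  Parameters at a fixed stage: \<open>N\<close> individuals \<open>{1..N}\<close>, \<open>M\<close> groups \<open>{1..M}\<close>, the
  degrees \<open>dl\<close> of the individuals and the communities \<open>Com\<close> of the groups.
  Half-edge \<open>i\<close> of \<open>v\<close> is the pair \<open>(v, i)\<close>; vertex \<open>j\<close> of \<open>Com a\<close>
  is the pair \<open>(a, j)\<close>.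
\<close>

definition half_edges :: "nat \<Rightarrow> (nat \<Rightarrow> nat) \<Rightarrow> (nat \<times> nat) set" where
  "half_edges N dl = (SIGMA v:{1..N}. {1..dl v})"

definition com_verts :: "nat \<Rightarrow> (nat \<Rightarrow> lgraph) \<Rightarrow> (nat \<times> nat) set" where
  "com_verts M Com = (SIGMA a:{1..M}. verts_of (Com a))"

definition com_edges :: "nat \<Rightarrow> (nat \<Rightarrow> lgraph) \<Rightarrow> (nat \<times> nat set) set" where
  "com_edges M Com = (SIGMA a:{1..M}. edge_set (Com a))"

text \<open>
  Bijections are taken extensional, so that each bijection between the two finite sets is
  represented by exactly one function.
\<close>

definition matchings ::
  "nat \<Rightarrow> nat \<Rightarrow> (nat \<Rightarrow> nat) \<Rightarrow> (nat \<Rightarrow> lgraph) \<Rightarrow> (nat \<times> nat \<Rightarrow> nat \<times> nat) set" where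
  "matchings N M dl Com =
     {\<omega> \<in> half_edges N dl \<rightarrow>\<^sub>E com_verts M Com.
        bij_betw \<omega> (half_edges N dl) (com_verts M Com)}"

definition matched_to ::
  "(nat \<Rightarrow> nat) \<Rightarrow> (nat \<times> nat \<Rightarrow> nat \<times> nat) \<Rightarrow> nat \<Rightarrow> nat \<times> nat \<Rightarrow> bool" where
  "matched_to dl \<omega> v j \<longleftrightarrow> (\<exists>i\<in>{1..dl v}. \<omega> (v, i) = j)"

text \<open>
  The edge \<open>(a, {j\<^sub>1, j\<^sub>2})\<close> is counted once, whichever of its two ends is matched to \<open>v\<close>:
  \<open>j\<^sub>1\<close> and \<open>j\<^sub>2\<close> below range over both orders.
\<close>

definition multiplicity ::
  "nat \<Rightarrow> (nat \<Rightarrow> nat) \<Rightarrow> (nat \<Rightarrow> lgraph) \<Rightarrow> (nat \<times> nat \<Rightarrow> nat \<times> nat) \<Rightarrow> nat \<Rightarrow> nat \<Rightarrow> nat" where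
  "multiplicity M dl Com \<omega> v w =
     card {(a, e) \<in> com_edges M Com.
             \<exists>j\<^sub>1 j\<^sub>2. e = {j\<^sub>1, j\<^sub>2} \<and> matched_to dl \<omega> v (a, j\<^sub>1) \<and> matched_to dl \<omega> w (a, j\<^sub>2)}"

definition rigc_degree ::
  "nat \<Rightarrow> nat \<Rightarrow> (nat \<Rightarrow> nat) \<Rightarrow> (nat \<Rightarrow> lgraph) \<Rightarrow> (nat \<times> nat \<Rightarrow> nat \<times> nat) \<Rightarrow> nat \<Rightarrow> nat" where
  "rigc_degree N M dl Com \<omega> v =
     2 * multiplicity M dl Com \<omega> v v + (\<Sum>w\<in>{1..N} - {v}. multiplicity M dl Com \<omega> v w)"

definition rigc_adj ::
  "nat \<Rightarrow> nat \<Rightarrow> (nat \<Rightarrow> nat) \<Rightarrow> (nat \<Rightarrow> lgraph) \<Rightarrow> (nat \<times> nat \<Rightarrow> nat \<times> nat) \<Rightarrow> (nat \<times> nat) set" where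
  "rigc_adj N M dl Com \<omega> =
     {(v, w). v \<in> {1..N} \<and> w \<in> {1..N} \<and> multiplicity M dl Com \<omega> v w > 0}"

definition rigc_components ::
  "nat \<Rightarrow> nat \<Rightarrow> (nat \<Rightarrow> nat) \<Rightarrow> (nat \<Rightarrow> lgraph) \<Rightarrow> (nat \<times> nat \<Rightarrow> nat \<times> nat) \<Rightarrow> nat set set" where
  "rigc_components N M dl Com \<omega> = (\<lambda>v. (rigc_adj N M dl Com \<omega>)\<^sup>* `` {v}) ` {1..N}"

definition largest_component ::
  "nat \<Rightarrow> nat \<Rightarrow> (nat \<Rightarrow> nat) \<Rightarrow> (nat \<Rightarrow> lgraph) \<Rightarrow> (nat \<times> nat \<Rightarrow> nat \<times> nat) \<Rightarrow> nat set \<Rightarrow> bool" where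
  "largest_component N M dl Com \<omega> C \<longleftrightarrow>
     C \<in> rigc_components N M dl Com \<omega> \<and>
     (\<forall>C'\<in>rigc_components N M dl Com \<omega>. card C' \<le> card C)"


section \<open>Probabilistic notions\<close>

definition uniform_degree :: "nat \<Rightarrow> (nat \<Rightarrow> nat) \<Rightarrow> nat pmf" where
  "uniform_degree N d = map_pmf d (pmf_of_set {1..N})"

definition real_law :: "nat pmf \<Rightarrow> real measure" where
  "real_law p = distr (measure_pmf p) borel real"

definition finite_mean :: "nat pmf \<Rightarrow> bool" where
  "finite_mean p \<longleftrightarrow> integrable (measure_pmf p) real"

definition mean :: "nat pmf \<Rightarrow> real" where
  "mean p = measure_pmf.expectation p real"

definition ext_mean :: "nat pmf \<Rightarrow> ennreal" where
  "ext_mean p = (\<integral>\<^sup>+ k. of_nat k \<partial>measure_pmf p)"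

definition gen_fun :: "nat pmf \<Rightarrow> real \<Rightarrow> real" where
  "gen_fun p z = measure_pmf.expectation p (\<lambda>k. z ^ k)"

text \<open>Meaningful only if the mean of \<open>p\<close> is positive and finite, see below.\<close>

definition size_biased :: "nat pmf \<Rightarrow> nat pmf" where
  "size_biased p = embed_pmf (\<lambda>k. real k * pmf p k / mean p)"

lemma pmf_size_biased:
  assumes "finite_mean p" "mean p > 0"
  shows "pmf (size_biased p) k = real k * pmf p k / mean p"
  unfolding size_biased_def
proof (rule pmf_embed_pmf)
  show "0 \<le> real x * pmf p x / mean p" for x
    using assms by simp
  have "(\<integral>\<^sup>+ x. ennreal (real x) \<partial>measure_pmf p) = ennreal (mean p)"
    using assms unfolding finite_mean_def mean_def by (intro nn_integral_eq_integral) auto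
  then have "(\<integral>\<^sup>+ x. ennreal (pmf p x) * ennreal (real x) \<partial>count_space UNIV) = ennreal (mean p)"
    by (simp add: nn_integral_measure_pmf)
  moreover have "ennreal (real x * pmf p x / mean p)
      = (ennreal (pmf p x) * ennreal (real x)) * ennreal (1 / mean p)" for x
    using assms by (simp flip: ennreal_mult' add: mult_ac)
  ultimately have "(\<integral>\<^sup>+ x. ennreal (real x * pmf p x / mean p) \<partial>count_space UNIV)
      = ennreal (mean p) * ennreal (1 / mean p)"
    by (simp add: nn_integral_multc)
  also have "\<dots> = 1"
    using assms by (simp flip: ennreal_mult')
  finally show "(\<integral>\<^sup>+ x. ennreal (real x * pmf p x / mean p) \<partial>count_space UNIV) = 1" .
qed

text \<open>
  The size-biased variable is at least 1 almost surely, so the truncated subtraction is harmless.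
\<close>

definition excess :: "nat pmf \<Rightarrow> nat pmf" where
  "excess p = map_pmf (\<lambda>k. k - 1) (size_biased p)"

text \<open>The random variables may live on a different probability space for each index.\<close>

definition tendsto_in_prob :: "(nat \<Rightarrow> 'a pmf) \<Rightarrow> (nat \<Rightarrow> 'a \<Rightarrow> real) \<Rightarrow> real \<Rightarrow> bool" where
  "tendsto_in_prob P X c \<longleftrightarrow>
     (\<forall>\<epsilon>>0. (\<lambda>n. measure_pmf.prob (P n) {\<omega>. \<bar>X n \<omega> - c\<bar> > \<epsilon>}) \<longlonglongrightarrow> 0)"


section \<open>The limiting proportion\<close>

text \<open>
  \<open>p\<close> is the limit law of the degrees of the individuals and \<open>\<mu>\<close> that of the
  communities, so that the limiting group size has law \<open>map_pmf num_verts \<mu>\<close>. Tuples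
  \<open>(H\<^sub>1, \<dots>, H\<^sub>k)\<close> and \<open>(c\<^sub>1, \<dots>, c\<^sub>k)\<close> are extensional functions on \<open>{1..k}\<close>.
  The terms are nonnegative, and for fixed \<open>k\<close> their sum is at most \<open>pmf p k\<close>, since
  \<open>num_of_degree c H\<close> summed over \<open>c\<close> is \<open>num_verts H\<close>.
\<close>

definition limit_proportion ::
  "lgraph set \<Rightarrow> nat pmf \<Rightarrow> lgraph pmf \<Rightarrow> real \<Rightarrow> nat \<Rightarrow> nat \<Rightarrow> real" where
  "limit_proportion \<H> p \<mu> \<eta>r k d =
     pmf p k *
     (\<Sum>\<^sub>\<infinity>H \<in> {1..k} \<rightarrow>\<^sub>E \<H>. \<Sum>c \<in> {c \<in> {1..k} \<rightarrow>\<^sub>E UNIV. (\<Sum>i=1..k. c i) = d}.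
        (1 - \<eta>r ^ (\<Sum>i=1..k. (num_verts (H i) - 1))) *
        (\<Prod>i=1..k. real (num_of_degree (c i) (H i)) * pmf \<mu> (H i)
                      / mean (map_pmf num_verts \<mu>)))"

end

theory Submission
  imports Defs
begin

text \<open>
  Put the individuals on the left and the groups on the right of a bipartite graph in which a
  half-edge of an individual is an edge to the group whose community vertex it is matched to.
  Communities are connected, so the components of the random graph are the left parts of the
  components of this bipartite graph (\<open>component_rigc\<close>). A community vertex
  contributes its degree inside its community to the degree of the individual matched to it, so
  the degree of an individual is a sum of labels, one for each of its half-edges
  (\<open>rigc_degree_sum\<close>). The theorem becomes a statement about a uniformly random
  matching of the half-edges of two sides, with labels on the right half-edges: how many left
  vertices with \<open>k\<close> half-edges and label sum \<open>d\<close> lie in a component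
  with the largest left part (\<open>largest_cell_count\<close>).

  Local structure. A procedure that inspects the matching one half-edge at a time is recorded as
  a \<open>strat\<close>. Given what has been revealed, the partner of a new half-edge is
  uniform on the free half-edges of the other side; as long as few half-edges are revealed, it
  may be replaced by a uniform choice among all of them. The cost is of the order of the maximal
  degree over the number of half-edges, which tends to 0 because the means of the degrees
  converge. Running one strategy from two different vertices bounds the variance, so the number
  of vertices at which the exploration has a prescribed outcome is close to its ideal mean
  (\<open>lln\<close>). The ideal outcome of an exploration of bounded depth is computed by a
  branching recursion with size-biased offspring. The exploration stops at vertices of large
  degree. If they are reported as survivors, dying certifies a small component, and the
  probability of dying increases to the extinction probability \<open>\<eta>\<close>. If they
  are reported as dying, survival for \<open>r\<close> generations certifies a component with
  more than \<open>r\<close> vertices, and the probability of dying stays below \<open>\<eta> +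
  \<delta>\<close> for every \<open>r\<close>, because in the supercritical regime some point
  slightly above \<open>\<eta>\<close> is a strict supersolution of the recursion. Together this
  determines, up to \<open>\<delta>\<close>, the proportion of vertices in components with more
  than \<open>K\<close> vertices, for large \<open>K\<close>, also among the vertices with given
  degree and given label sum.

  One giant component. It remains to see that nearly all vertices in large components lie in the
  same component. Flag a small proportion of the right vertices and hide their half-edges. The
  rest of the graph has at most (number of vertices)/\<open>r\<close> components with at least
  \<open>r\<close> vertices. Fix a division of these into two families, both containing linearly
  many hidden left half-edges. A flagged vertex of degree at least 2 joins the two families with
  probability bounded below, so the probability that none does is exponentially small, at a rate
  that does not depend on \<open>r\<close>; for large \<open>r\<close> this beats the number of
  divisions (\<open>merged_whp\<close>). If no division remains, a single component contains
  nearly all flagged vertices that are attached to a large component. The flags are arbitrary,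
  so they may be chosen at random; a random colour class sees every large component in
  proportion to its size, and averaging gives a component containing a proportion \<open>\<rho>
  - \<delta>\<close> of all right vertices, where \<open>\<rho>\<close> is the probability of
  survival from a right vertex (\<open>giant\<close>).

  Conclusion. At most a proportion \<open>\<rho> + \<gamma>\<close> of the right vertices lies
  in large components, so few of them lie outside the giant. Few right vertices have few
  half-edges, by uniform integrability, so few left vertices in large components are outside the
  giant either. The count in the largest component is therefore the count in large components,
  which is the proportion with the prescribed degree and label sum minus the proportion for
  which all explorations die. Written out over tuples of communities and of degrees this is the
  stated sum (\<open>limit_proportion_eq\<close>).
\<close>

section \<open>Matchings revealed step by step\<close>

text \<open>
  A deterministic procedure that asks for the partner of one half-edge at a time and may base
  the next question on the answers. \<open>Query s z f\<close> asks for the partner of half-edge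
  \<open>z\<close> of side \<open>s\<close>; \<open>True\<close> is the left and
  \<open>False\<close> the right side.
\<close>

datatype 'r strat = Ret 'r | Query bool "nat \<times> nat" "nat \<times> nat \<Rightarrow> 'r strat"

primrec sbind :: "'a strat \<Rightarrow> ('a \<Rightarrow> 'b strat) \<Rightarrow> 'b strat" where
  "sbind (Ret r) k = k r"
| "sbind (Query s z f) k = Query s z (\<lambda>z'. sbind (f z') k)"

text \<open>
  Two sides with vertices \<open>{1..sz s}\<close> of degrees \<open>dg s\<close> and equally
  many half-edges; half-edge \<open>i\<close> of \<open>v\<close> is the pair \<open>(v,
  i)\<close>, and a matching maps the left half-edges to the right ones. Tagging the sides by a
  Boolean lets one argument serve both.
\<close>

locale bipartite =
  fixes sz :: "bool \<Rightarrow> nat" and dg :: "bool \<Rightarrow> nat \<Rightarrow> nat"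
  assumes bal: "(\<Sum>v=1..sz True. dg True v) = (\<Sum>v=1..sz False. dg False v)"
begin

definition HE :: "bool \<Rightarrow> (nat \<times> nat) set" where
  "HE s = (SIGMA v:{1..sz s}. {1..dg s v})"

definition h :: nat where "h = (\<Sum>v=1..sz True. dg True v)"

definition MM :: "(nat \<times> nat \<Rightarrow> nat \<times> nat) set" where
  "MM = {\<omega> \<in> HE True \<rightarrow>\<^sub>E HE False. bij_betw \<omega> (HE True) (HE False)}"

definition partner :: "bool \<Rightarrow> (nat \<times> nat \<Rightarrow> nat \<times> nat) \<Rightarrow> nat \<times> nat \<Rightarrow> nat \<times> nat" where
  "partner s \<omega> z = (if s then \<omega> z else inv_into (HE True) \<omega> z)"

lemma finite_HE [simp]: "finite (HE s)"
  by (auto simp: HE_def)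

lemma card_HE: "card (HE s) = h"
  using bal by (cases s) (auto simp: HE_def h_def)

lemma finite_MM [simp]: "finite MM"
  unfolding MM_def by (rule finite_subset[of _ "HE True \<rightarrow>\<^sub>E HE False"]) (auto intro: finite_PiE)

lemma MM_nonempty: "MM \<noteq> {}"
proof -
  obtain f where f: "bij_betw f (HE True) (HE False)"
    using finite_same_card_bij[of "HE True" "HE False"] by (auto simp: card_HE)
  have "restrict f (HE True) \<in> MM"
    using f by (auto simp: MM_def bij_betw_def inj_on_def cong: image_cong)
  then show ?thesis by auto
qed

lemma card_MM_pos: "card MM > 0"
  using MM_nonempty by (simp add: card_gt_0_iff)

lemma MM_bij: "\<omega> \<in> MM \<Longrightarrow> bij_betw \<omega> (HE True) (HE False)"
  by (simp add: MM_def)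

lemma partner_in:
  assumes "\<omega> \<in> MM" "z \<in> HE s" shows "partner s \<omega> z \<in> HE (\<not> s)"
  using assms MM_bij[OF assms(1)] by (cases s) (auto simp: partner_def bij_betw_def inv_into_into)

lemma partner_partner:
  assumes "\<omega> \<in> MM" "z \<in> HE s" shows "partner (\<not> s) \<omega> (partner s \<omega> z) = z"
  using assms MM_bij[OF assms(1)]
  by (cases s) (auto simp: partner_def bij_betw_def f_inv_into_f inv_into_f_f)

subsection \<open>Extensions of a partial matching\<close>

definition ext :: "((nat \<times> nat) \<times> (nat \<times> nat)) set \<Rightarrow> (nat \<times> nat \<Rightarrow> nat \<times> nat) set" where
  "ext u = {\<omega> \<in> MM. \<forall>(x, y)\<in>u. x \<in> HE True \<and> \<omega> x = y}"

lemma finite_ext [simp]: "finite (ext u)"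
  unfolding ext_def by simp

lemma ext_empty: "ext {} = MM" by (auto simp: ext_def)

lemma ext_subset: "ext u \<subseteq> MM" by (auto simp: ext_def)

lemma ext_insert: "x \<in> HE True \<Longrightarrow> ext (insert (x, y) u) = {\<omega> \<in> ext u. \<omega> x = y}"
  by (auto simp: ext_def)

text \<open>
  Exchanging the partners of \<open>y\<close> and \<open>y'\<close> turns a matching with
  \<open>x\<close> matched to \<open>y\<close> into one with \<open>x\<close> matched to
  \<open>y'\<close>, and this is injective. With its mirror image it shows that, given a partial
  matching, all free pairs are equally likely to be matched.
\<close>

lemma card_ext_swap_range:
  assumes x: "x \<in> HE True" "x \<notin> fst ` u" and y: "y \<in> HE False" "y \<notin> snd ` u"
    and y': "y' \<in> HE False" "y' \<notin> snd ` u"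
  shows "card (ext (insert (x, y) u)) \<le> card (ext (insert (x, y') u))"
proof -
  let ?g = "\<lambda>\<omega>. restrict (\<lambda>z. Transposition.transpose y y' (\<omega> z)) (HE True)"
  show ?thesis
  proof (rule card_inj_on_le[where f = ?g])
    show "inj_on ?g (ext (insert (x, y) u))"
    proof (rule inj_onI)
      fix a b assume a: "a \<in> ext (insert (x, y) u)" and b: "b \<in> ext (insert (x, y) u)" and eq: "?g a = ?g b"
      have "a z = b z" for z
      proof (cases "z \<in> HE True")
        case True
        then have "Transposition.transpose y y' (a z) = Transposition.transpose y y' (b z)" using fun_cong[OF eq, of z] by simp
        then show ?thesis by (metis transpose_involutory)
      next
        case False
        moreover have "a \<in> HE True \<rightarrow>\<^sub>E HE False" "b \<in> HE True \<rightarrow>\<^sub>E HE False"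
          using a b by (simp_all add: ext_def MM_def)
        ultimately show ?thesis using PiE_arb by metis
      qed
      then show "a = b" by auto
    qed
    show "?g ` ext (insert (x, y) u) \<subseteq> ext (insert (x, y') u)"
    proof (rule image_subsetI)
      fix \<omega> assume w: "\<omega> \<in> ext (insert (x, y) u)"
      then have wM: "\<omega> \<in> MM" and wx: "\<omega> x = y" and wu: "\<And>a b. (a, b) \<in> u \<Longrightarrow> \<omega> a = b"
        by (auto simp: ext_def)
      have bw: "bij_betw \<omega> (HE True) (HE False)" using wM by (rule MM_bij)
      have bt: "bij_betw (Transposition.transpose y y') (HE False) (HE False)"
        using y y' by (simp add: bij_betw_transpose_iff)
      have "bij_betw (\<lambda>z. Transposition.transpose y y' (\<omega> z)) (HE True) (HE False)"
        using bij_betw_trans[OF bw bt] by (simp add: comp_def)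
      then have bg: "bij_betw (?g \<omega>) (HE True) (HE False)"
        by (simp add: bij_betw_cong[of _ "?g \<omega>" "\<lambda>z. Transposition.transpose y y' (\<omega> z)"])
      then have "?g \<omega> \<in> MM"
        by (auto simp: MM_def bij_betw_def PiE_def Pi_def)
      moreover have "?g \<omega> x = y'" using x wx by simp
      moreover have "?g \<omega> a = b" if "(a, b) \<in> u" for a b
      proof -
        have "b \<noteq> y" "b \<noteq> y'" using that y y' by force+
    moreover have "a \<in> HE True" using that w by (auto simp: ext_def)
        ultimately show ?thesis using wu[OF that] by simp
      qed
      ultimately show "?g \<omega> \<in> ext (insert (x, y') u)" using x w by (auto simp: ext_def)
    qed
  qed simp
qed


lemma card_ext_swap_domain:
  assumes x: "x \<in> HE True" "x \<notin> fst ` u" and x': "x' \<in> HE True" "x' \<notin> fst ` u"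
    and y: "y \<in> HE False" "y \<notin> snd ` u"
  shows "card (ext (insert (x, y) u)) \<le> card (ext (insert (x', y) u))"
proof -
  let ?t = "Transposition.transpose x x'"
  let ?g = "\<lambda>\<omega>. \<omega> \<circ> ?t"
  have bt: "bij_betw ?t (HE True) (HE True)"
    using x x' by (simp add: bij_betw_transpose_iff)
  have tin: "?t z \<in> HE True \<longleftrightarrow> z \<in> HE True" for z
    using x x' by (auto simp: Transposition.transpose_def)
  show ?thesis
  proof (rule card_inj_on_le[where f = ?g])
    show "inj_on ?g (ext (insert (x, y) u))"
    proof (rule inj_onI)
      fix a b assume "?g a = ?g b"
      then have "?g a \<circ> ?t = ?g b \<circ> ?t" by simp
      then show "a = b" by (simp add: comp_assoc)
    qed
    show "?g ` ext (insert (x, y) u) \<subseteq> ext (insert (x', y) u)"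
    proof (rule image_subsetI)
      fix \<omega> assume w: "\<omega> \<in> ext (insert (x, y) u)"
      then have wM: "\<omega> \<in> MM" and wx: "\<omega> x = y" and wu: "\<And>a b. (a, b) \<in> u \<Longrightarrow> a \<in> HE True \<and> \<omega> a = b"
        by (auto simp: ext_def)
      have bg: "bij_betw (?g \<omega>) (HE True) (HE False)"
        using bij_betw_trans[OF bt MM_bij[OF wM]] .
      have "?g \<omega> z = undefined" if "z \<notin> HE True" for z
      proof -
        have "?t z \<notin> HE True" using that tin by simp
        moreover have "\<omega> a = undefined" if "a \<notin> HE True" for a
          using wM that PiE_arb[of \<omega> "HE True" "\<lambda>_. HE False" a] by (simp add: MM_def)
        ultimately show ?thesis by simp
      qed
      then have "?g \<omega> \<in> HE True \<rightarrow>\<^sub>E HE False"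
        using bij_betwE[OF bg] by (intro PiE_I) auto
      with bg have "?g \<omega> \<in> MM" by (simp add: MM_def)
      moreover have "?g \<omega> x' = y" using wx by simp
      moreover have "?g \<omega> a = b \<and> a \<in> HE True" if "(a, b) \<in> u" for a b
      proof -
        have "a \<noteq> x" "a \<noteq> x'" using that x x' by force+
        then show ?thesis using wu[OF that] by simp
      qed
      ultimately show "?g \<omega> \<in> ext (insert (x', y) u)"
        using x' unfolding ext_def by blast
    qed
  qed simp
qed

lemma card_ext_insert_eq:
  assumes x: "x \<in> HE True" "x \<notin> fst ` u" and x': "x' \<in> HE True" "x' \<notin> fst ` u"
    and y: "y \<in> HE False" "y \<notin> snd ` u" and y': "y' \<in> HE False" "y' \<notin> snd ` u"
  shows "card (ext (insert (x, y) u)) = card (ext (insert (x', y') u))"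
proof (rule antisym)
  show "card (ext (insert (x, y) u)) \<le> card (ext (insert (x', y') u))"
    using card_ext_swap_range[OF x y y'] card_ext_swap_domain[OF x x' y'] by linarith
  show "card (ext (insert (x', y') u)) \<le> card (ext (insert (x, y) u))"
    using card_ext_swap_range[OF x' y' y] card_ext_swap_domain[OF x' x y] by linarith
qed

text \<open>
  The conditional probability of a free pair is at least \<open>1 / h\<close>: there are at most
  \<open>h\<close> free partners and they are equally likely. Upper bounds on probabilities will
  come from lower bounds on the complementary events.
\<close>

lemma card_ext_le:
  assumes x: "x \<in> HE True" "x \<notin> fst ` u" and y: "y \<in> HE False" "y \<notin> snd ` u"
  shows "card (ext u) \<le> h * card (ext (insert (x, y) u))"
proof -
  have sub: "ext u \<subseteq> (\<Union>y'\<in>HE False. ext (insert (x, y') u))"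
  proof
    fix \<omega> assume w: "\<omega> \<in> ext u"
    then have "\<omega> x \<in> HE False" using x MM_bij[of \<omega>] by (auto simp: ext_def bij_betw_def)
    then show "\<omega> \<in> (\<Union>y'\<in>HE False. ext (insert (x, y') u))" using w x by (auto simp: ext_insert)
  qed
  have each: "card (ext (insert (x, y') u)) \<le> card (ext (insert (x, y) u))" if y': "y' \<in> HE False" for y'
  proof (cases "y' \<in> snd ` u")
    case True
    then obtain a where a: "(a, y') \<in> u" by auto
    have "ext (insert (x, y') u) = {}"
    proof (rule ccontr)
      assume "ext (insert (x, y') u) \<noteq> {}"
      then obtain \<omega> where w: "\<omega> \<in> ext (insert (x, y') u)" by auto
      then have "\<omega> x = y'" "\<omega> a = y'" "a \<in> HE True" "\<omega> \<in> MM" using a by (auto simp: ext_def)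
      then have "x = a" using MM_bij[of \<omega>] x by (auto simp: bij_betw_def inj_on_def)
      then show False using a x by force
    qed
    then show ?thesis by simp
  next
    case False
    then show ?thesis using card_ext_insert_eq[OF x x y y' False] by simp
  qed
  have "card (ext u) \<le> card (\<Union>y'\<in>HE False. ext (insert (x, y') u))"
    by (rule card_mono[OF _ sub]) auto
  also have "\<dots> \<le> (\<Sum>y'\<in>HE False. card (ext (insert (x, y') u)))"
    by (rule card_UN_le) simp
  also have "\<dots> \<le> (\<Sum>y'\<in>HE False. card (ext (insert (x, y) u)))"
    by (rule sum_mono) (rule each)
  also have "\<dots> = h * card (ext (insert (x, y) u))" by (simp add: card_HE)
  finally show ?thesis .
qed

definition pr :: "bool \<Rightarrow> nat \<times> nat \<Rightarrow> nat \<times> nat \<Rightarrow> (nat \<times> nat) \<times> (nat \<times> nat)" where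
  "pr s z z' = (if s then (z, z') else (z', z))"

lemma ext_insert_pr:
  assumes "z \<in> HE s" "z' \<in> HE (\<not> s)"
  shows "ext (insert (pr s z z') u) = {\<omega> \<in> ext u. partner s \<omega> z = z'}"
proof (cases s)
  case True
  then show ?thesis using assms by (auto simp: pr_def partner_def ext_def)
next
  case False
  have "\<omega> z' = z \<longleftrightarrow> inv_into (HE True) \<omega> z = z'" if "\<omega> \<in> MM" for \<omega>
    using assms False MM_bij[OF that] bij_betw_inv_into_left bij_betw_inv_into_right
    by (metis (full_types))
  then show ?thesis using assms False by (auto simp: pr_def partner_def ext_def)
qed

subsection \<open>Strategies\<close>

primrec run :: "(nat \<times> nat \<Rightarrow> nat \<times> nat) \<Rightarrow> 'r strat \<Rightarrow> 'r" where
  "run \<omega> (Ret r) = r"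
| "run \<omega> (Query s z f) = run \<omega> (f (partner s \<omega> z))"

text \<open>
  No answer leads to a vertex that was known before; \<open>W\<close> collects the known
  vertices.
\<close>

primrec fresh :: "(nat \<times> nat \<Rightarrow> nat \<times> nat) \<Rightarrow> 'r strat \<Rightarrow> (bool \<times> nat) set \<Rightarrow> bool" where
  "fresh \<omega> (Ret r) W = True"
| "fresh \<omega> (Query s z f) W =
     ((\<not> s, fst (partner s \<omega> z)) \<notin> W \<and>
      fresh \<omega> (f (partner s \<omega> z)) (insert (\<not> s, fst (partner s \<omega> z)) W))"

text \<open>
  The expectation of the outcome if every answer were uniform on all half-edges of the other
  side, independently of the previous ones.
\<close>

primrec ideal :: "('r \<Rightarrow> real) \<Rightarrow> 'r strat \<Rightarrow> real" where
  "ideal \<phi> (Ret r) = \<phi> r"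
| "ideal \<phi> (Query s z f) = (\<Sum>z'\<in>HE (\<not> s). ideal \<phi> (f z')) / real h"

text \<open>
  The same expectation, but restricted to runs in which no known vertex is hit; this is what an
  actual matching provides at least.
\<close>

primrec val :: "('r \<Rightarrow> real) \<Rightarrow> 'r strat \<Rightarrow> (bool \<times> nat) set \<Rightarrow> real" where
  "val \<phi> (Ret r) W = \<phi> r"
| "val \<phi> (Query s z f) W =
     (\<Sum>z'\<in>{z'\<in>HE (\<not> s). (\<not> s, fst z') \<notin> W}. val \<phi> (f z') (insert (\<not> s, fst z') W)) / real h"

definition siblings :: "bool \<Rightarrow> nat \<times> nat \<Rightarrow> (bool \<times> (nat \<times> nat)) set" where
  "siblings s z' = {(s, y) | y. y \<in> HE s \<and> fst y = fst z' \<and> y \<noteq> z'}"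

text \<open>
  Only half-edges in the pool \<open>A\<close> are queried. A queried half-edge leaves the pool,
  so none is queried twice, and the other half-edges of a newly found vertex enter it.
\<close>

primrec proper :: "'r strat \<Rightarrow> (bool \<times> (nat \<times> nat)) set \<Rightarrow> (bool \<times> nat) set \<Rightarrow> bool" where
  "proper (Ret r) A W = True"
| "proper (Query s z f) A W =
     ((s, z) \<in> A \<and> (\<forall>z'\<in>HE (\<not> s). (\<not> s, fst z') \<notin> W \<longrightarrow>
        proper (f z') (A - {(s, z)} \<union> siblings (\<not> s) z') (insert (\<not> s, fst z') W)))"

primrec query_bound :: "'r strat \<Rightarrow> nat \<Rightarrow> bool" where
  "query_bound (Ret r) Q = True"
| "query_bound (Query s z f) Q = (Q > 0 \<and> (\<forall>z'\<in>HE (\<not> s). query_bound (f z') (Q - 1)))"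

text \<open>
  An invariant of a run: \<open>u\<close> is the part of the matching revealed so far. The pool
  \<open>A\<close> consists of unmatched half-edges of known vertices, and \<open>W\<close>
  contains every vertex touched.
\<close>

definition valid_state where
  "valid_state u A W \<longleftrightarrow>
     (\<forall>(x, y)\<in>u. (True, x) \<notin> A \<and> (False, y) \<notin> A \<and> (True, fst x) \<in> W \<and> (False, fst y) \<in> W) \<and>
     (\<forall>(s, z)\<in>A. z \<in> HE s \<and> (s, fst z) \<in> W)"

lemma run_sbind: "run \<omega> (sbind m k) = run \<omega> (k (run \<omega> m))"
  by (induct m) auto

lemma ideal_sbind: "ideal \<phi> (sbind m k) = ideal (\<lambda>r. ideal \<phi> (k r)) m"
  by (induct m) auto

lemma fresh_sbind:
  "fresh \<omega> (sbind m k) W \<Longrightarrow> fresh \<omega> m W \<and> (\<exists>W'. W \<subseteq> W' \<and> fresh \<omega> (k (run \<omega> m)) W')"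
proof (induct m arbitrary: W)
  case (Ret r) then show ?case by auto
next
  case (Query s z f)
  let ?z = "partner s \<omega> z"
  have 1: "(\<not> s, fst ?z) \<notin> W" "fresh \<omega> (sbind (f ?z) k) (insert (\<not> s, fst ?z) W)"
    using Query.prems by auto
  have "fresh \<omega> (f ?z) (insert (\<not> s, fst ?z) W) \<and>
      (\<exists>W'. insert (\<not> s, fst ?z) W \<subseteq> W' \<and> fresh \<omega> (k (run \<omega> (f ?z))) W')"
    by (rule Query.hyps[OF _ 1(2)]) simp
  then show ?case using 1(1) by auto
qed

lemma query_bound_mono: "query_bound m Q \<Longrightarrow> Q \<le> Q' \<Longrightarrow> query_bound m Q'"
proof (induct m arbitrary: Q Q')
  case (Query s z f)
  have "query_bound (f z') (Q' - 1)" if "z' \<in> HE (\<not> s)" for z'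
    by (rule Query.hyps[of _ "Q - 1"]) (use Query.prems that in \<open>auto intro: diff_le_mono\<close>)
  then show ?case using Query.prems by auto
qed simp

lemma query_bound_sbind: "query_bound m a \<Longrightarrow> (\<And>r. query_bound (k r) b) \<Longrightarrow> query_bound (sbind m k) (a + b)"
proof (induct m arbitrary: a)
  case (Ret r) then show ?case by (auto intro: query_bound_mono[of "k r" b "a + b"])
next
  case (Query s z f)
  have "query_bound (sbind (f z') k) (a - 1 + b)" if "z' \<in> HE (\<not> s)" for z'
    by (rule Query.hyps) (use Query.prems that in auto)
  then show ?case using Query.prems by auto
qed

lemma proper_mono: "proper m A W \<Longrightarrow> A \<subseteq> A' \<Longrightarrow> W \<subseteq> W' \<Longrightarrow> proper m A' W'"
proof (induct m arbitrary: A A' W W')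
  case (Query s z f)
  have "proper (f z') (A' - {(s, z)} \<union> siblings (\<not> s) z') (insert (\<not> s, fst z') W')"
    if "z' \<in> HE (\<not> s)" "(\<not> s, fst z') \<notin> W'" for z'
  proof -
    have "proper (f z') (A - {(s, z)} \<union> siblings (\<not> s) z') (insert (\<not> s, fst z') W)"
      using Query.prems that by auto
    then show ?thesis by (rule Query.hyps[rotated]) (use Query.prems in auto)
  qed
  then show ?case using Query.prems by auto
qed simp

text \<open>
  Two strategies with disjoint pools can be run one after the other. The roots of the second one
  have to be known from the start: the first one then meets none of them in a fresh run, so it
  cannot use up half-edges of the second pool.
\<close>

lemma proper_sbind:
  assumes "proper m A W" "\<And>r W'. W \<subseteq> W' \<Longrightarrow> proper (k r) B W'" "A \<inter> B = {}"
    "\<And>s z. (s, z) \<in> B \<Longrightarrow> (s, fst z) \<in> W"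
  shows "proper (sbind m k) (A \<union> B) W"
  using assms
proof (induct m arbitrary: A W)
  case (Ret r)
  have "proper (k r) B W" by (rule Ret.prems(2)) simp
  then show ?case by (simp, elim proper_mono) auto
next
  case (Query s z f)
  have "proper (sbind (f z') k) ((A \<union> B) - {(s, z)} \<union> siblings (\<not> s) z') (insert (\<not> s, fst z') W)"
    if z': "z' \<in> HE (\<not> s)" "(\<not> s, fst z') \<notin> W" for z'
  proof -
    have "proper (sbind (f z') k) ((A - {(s, z)} \<union> siblings (\<not> s) z') \<union> B) (insert (\<not> s, fst z') W)"
    proof (rule Query.hyps)
      show "(A - {(s, z)} \<union> siblings (\<not> s) z') \<inter> B = {}"
        using Query.prems(3) Query.prems(4) z' by (fastforce simp: siblings_def)
    qed (use Query.prems z' in auto)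
    moreover have "(s, z) \<notin> B" using Query.prems by auto
    ultimately show ?thesis by (elim proper_mono) auto
  qed
  then show ?case using Query.prems by auto
qed

lemma val_nonneg: "(\<And>r. \<phi> r \<ge> 0) \<Longrightarrow> val \<phi> m W \<ge> 0"
  by (induct m arbitrary: W) (auto intro!: divide_nonneg_nonneg sum_nonneg)

text \<open>
  The principle of deferred decisions: each answer has conditional probability at least \<open>1
  / h\<close> whenever it leads to a new vertex, so averages over matchings dominate
  \<open>val\<close>.
\<close>

lemma val_le:
  assumes "proper st A W" "valid_state u A W" "\<And>r. \<phi> r \<ge> (0::real)"
  shows "val \<phi> st W * real (card (ext u)) \<le>
    (\<Sum>\<omega>\<in>ext u. \<phi> (run \<omega> st) * of_bool (fresh \<omega> st W))"
  using assms
proof (induct st arbitrary: A W u)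
  case (Ret r)
  then show ?case by simp
next
  case (Query s z f)
  let ?W = "\<lambda>z'. insert (\<not> s, fst z') W"
  let ?G = "\<lambda>\<omega>. \<phi> (run \<omega> (Query s z f)) * of_bool (fresh \<omega> (Query s z f) W)"
  let ?Z = "{z'\<in>HE (\<not> s). (\<not> s, fst z') \<notin> W}"
  have uold: "(True, x) \<notin> A \<and> (False, y) \<notin> A \<and> (True, fst x) \<in> W \<and> (False, fst y) \<in> W"
    if "(x, y) \<in> u" for x y using Query.prems(2) that unfolding valid_state_def by blast
  have Aold: "z \<in> HE s \<and> (s, fst z) \<in> W" if "(s, z) \<in> A" for s z
    using Query.prems(2) that unfolding valid_state_def by blast
  have zA: "(s, z) \<in> A" and zH: "z \<in> HE s"
    using Query.prems(1,2) by (auto simp: valid_state_def)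
  have Gnn: "?G \<omega> \<ge> 0" for \<omega> using Query.prems(3) by simp
  have "val \<phi> (Query s z f) W * real (card (ext u)) =
      (\<Sum>z'\<in>?Z. val \<phi> (f z') (?W z') * (real (card (ext u)) / real h))"
    by (simp add: sum_distrib_right sum_divide_distrib)
  also have "\<dots> \<le> (\<Sum>z'\<in>?Z. \<Sum>\<omega>\<in>ext (insert (pr s z z') u). ?G \<omega>)"
  proof (rule sum_mono)
    fix z' assume z': "z' \<in> ?Z"
    let ?u = "insert (pr s z z') u"
    let ?A = "A - {(s, z)} \<union> siblings (\<not> s) z'"
    have pr: "proper (f z') ?A (?W z')" using Query.prems(1) z' by auto
    have vs: "valid_state ?u ?A (?W z')"
      unfolding valid_state_def
    proof (intro conjI ballI)
      fix p assume p: "p \<in> ?u"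
      show "case p of (x, y) \<Rightarrow> (True, x) \<notin> ?A \<and> (False, y) \<notin> ?A \<and>
          (True, fst x) \<in> ?W z' \<and> (False, fst y) \<in> ?W z'"
      proof (cases "p = pr s z z'")
        case True
        have "(\<not> s, z') \<notin> A" "(s, fst z) \<in> W" using Aold[of "\<not> s" z'] Aold[OF zA] z' by auto
        then show ?thesis using True by (cases s) (auto simp: pr_def siblings_def)
      next
        case False
        then obtain x y where xy: "p = (x, y)" "(x, y) \<in> u" using p by (cases p) auto
        show ?thesis using uold[OF xy(2)] z' xy(1) by (cases s) (auto simp: siblings_def)
      qed
    next
      fix p assume "p \<in> ?A"
      then show "case p of (s, z) \<Rightarrow> z \<in> HE s \<and> (s, fst z) \<in> ?W z'"
        using Aold by (cases p) (auto simp: siblings_def)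
    qed
    have le: "card (ext u) \<le> h * card (ext ?u)"
    proof (cases s)
      case True
      have "z \<notin> fst ` u" "z' \<notin> snd ` u"
        using uold zA z' True by force+
      then show ?thesis using card_ext_le[of z u z'] True zH z' by (simp add: pr_def)
    next
      case False
      have "z \<notin> snd ` u" "z' \<notin> fst ` u"
        using uold zA z' False by force+
      then show ?thesis using card_ext_le[of z' u z] False zH z' by (simp add: pr_def)
    qed
    have "z' \<in> HE (\<not> s)" using z' by simp
    then have hpos: "h > 0" using card_HE[of "\<not> s"] by (metis card_gt_0_iff empty_iff finite_HE)
    have "real (card (ext u)) / real h \<le> real (card (ext ?u))"
    proof -
      have "real (card (ext u)) \<le> real h * real (card (ext ?u))"
        using le by (metis of_nat_le_iff of_nat_mult)
      then show ?thesis using hpos by (simp add: divide_le_eq mult.commute)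
    qed
    then have "val \<phi> (f z') (?W z') * (real (card (ext u)) / real h) \<le>
        val \<phi> (f z') (?W z') * real (card (ext ?u))"
      by (rule mult_left_mono) (rule val_nonneg[OF Query.prems(3)])
    also have "\<dots> \<le> (\<Sum>\<omega>\<in>ext ?u. \<phi> (run \<omega> (f z')) * of_bool (fresh \<omega> (f z') (?W z')))"
      by (rule Query.hyps[OF _ pr vs Query.prems(3)]) auto
    also have "\<dots> = (\<Sum>\<omega>\<in>ext ?u. ?G \<omega>)"
    proof (rule sum.cong)
      fix \<omega> assume "\<omega> \<in> ext ?u"
      then have "partner s \<omega> z = z'" using ext_insert_pr[OF zH, of z' u] z' by auto
      then show "\<phi> (run \<omega> (f z')) * of_bool (fresh \<omega> (f z') (?W z')) = ?G \<omega>" using z' by simp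
    qed simp
    finally show "val \<phi> (f z') (?W z') * (real (card (ext u)) / real h) \<le> (\<Sum>\<omega>\<in>ext ?u. ?G \<omega>)" .
  qed
  also have "\<dots> \<le> (\<Sum>z'\<in>HE (\<not> s). \<Sum>\<omega>\<in>ext (insert (pr s z z') u). ?G \<omega>)"
  proof (rule sum_mono2)
    show "0 \<le> (\<Sum>\<omega>\<in>ext (insert (pr s z b) u). ?G \<omega>)" for b
      by (rule sum_nonneg) (rule Gnn)
  qed auto
  also have "\<dots> = (\<Sum>z'\<in>HE (\<not> s). \<Sum>\<omega>\<in>{\<omega> \<in> ext u. partner s \<omega> z = z'}. ?G \<omega>)"
    by (rule sum.cong) (auto simp: ext_insert_pr[OF zH])
  also have "\<dots> = (\<Sum>\<omega>\<in>ext u. ?G \<omega>)"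
  proof (rule sum.group)
    show "(\<lambda>\<omega>. partner s \<omega> z) ` ext u \<subseteq> HE (\<not> s)"
      using partner_in[OF _ zH] ext_subset by blast
  qed simp_all
  finally show ?case .
qed

lemma ideal_nonneg: "(\<And>r. \<phi> r \<ge> 0) \<Longrightarrow> ideal \<phi> m \<ge> 0"
  by (induct m) (auto intro!: divide_nonneg_nonneg sum_nonneg)

lemma ideal_const: "h > 0 \<Longrightarrow> ideal (\<lambda>_. c) m = c"
  by (induct m) (auto simp: card_HE)

lemma ideal_linear: "ideal (\<lambda>r. a * \<phi> r + b * \<psi> r) m = a * ideal \<phi> m + b * ideal \<psi> m"
  by (induct m) (auto simp: sum.distrib sum_distrib_left add_divide_distrib)

lemma ideal_cmult: "ideal (\<lambda>r. a * \<phi> r) m = a * ideal \<phi> m"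
  by (induct m) (auto simp: sum_distrib_left)

lemma ideal_mono: "(\<And>r. \<phi> r \<le> \<psi> r) \<Longrightarrow> ideal \<phi> m \<le> ideal \<psi> m"
  by (induct m) (auto intro!: divide_right_mono sum_mono)

lemma ideal_le_1: "h > 0 \<Longrightarrow> (\<And>r. \<phi> r \<le> 1) \<Longrightarrow> ideal \<phi> m \<le> 1"
  using ideal_mono[of \<phi> "\<lambda>_. 1" m] by (simp add: ideal_const)

lemma card_nonfresh:
  assumes D: "\<And>s v. v \<in> {1..sz s} \<Longrightarrow> dg s v \<le> D" and W: "finite W"
  shows "card {z'\<in>HE s. (s, fst z') \<in> W} \<le> card W * D"
proof -
  have "{z'\<in>HE s. (s, fst z') \<in> W} \<subseteq> (\<Union>w\<in>W. {snd w} \<times> {1..D})"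
    using D by (fastforce simp: HE_def)
  then have "card {z'\<in>HE s. (s, fst z') \<in> W} \<le> card (\<Union>w\<in>W. {snd w} \<times> {1..D})"
    by (intro card_mono) (use W in auto)
  also have "\<dots> \<le> (\<Sum>w\<in>W. card ({snd w} \<times> {1..D}))"
    by (rule card_UN_le[OF W])
  also have "\<dots> = card W * D" by simp
  finally show ?thesis .
qed

text \<open>
  In each of at most \<open>Q\<close> steps at most \<open>card W + Q\<close> vertices are
  known, which occupy at most \<open>(card W + Q) * D\<close> of the \<open>h\<close>
  half-edges.
\<close>

lemma ideal_le_val:
  assumes D: "\<And>s v. v \<in> {1..sz s} \<Longrightarrow> dg s v \<le> D" and hpos: "h > 0"
    and phi: "\<And>r. 0 \<le> \<phi> r" "\<And>r. \<phi> r \<le> (1::real)"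
    and b: "query_bound st Q" and W: "finite W"
  shows "ideal \<phi> st \<le> val \<phi> st W + real Q * (real (card W) + real Q) * real D / real h"
  using b W
proof (induct st arbitrary: Q W)
  case (Ret r)
  then show ?case by simp
next
  case (Query s z f)
  let ?W = "\<lambda>z'. insert (\<not> s, fst z') W"
  let ?Z = "{z'\<in>HE (\<not> s). (\<not> s, fst z') \<notin> W}"
  let ?N = "{z'\<in>HE (\<not> s). (\<not> s, fst z') \<in> W}"
  let ?e = "real (Q - 1) * (real (card W) + real Q) * real D / real h"
  have Q: "Q > 0" and bf: "\<And>z'. z' \<in> HE (\<not> s) \<Longrightarrow> query_bound (f z') (Q - 1)"
    using Query.prems by auto
  have step: "ideal \<phi> (f z') \<le> val \<phi> (f z') (?W z') + ?e" if z': "z' \<in> ?Z" for z'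
  proof -
    have "ideal \<phi> (f z') \<le> val \<phi> (f z') (?W z') +
        real (Q - 1) * (real (card (?W z')) + real (Q - 1)) * real D / real h"
      by (rule Query.hyps) (use z' bf Query.prems in auto)
    also have "card (?W z') = card W + 1" using z' Query.prems by auto
    also have "real (card W + 1) + real (Q - 1) = real (card W) + real Q" using Q by auto
    finally show ?thesis .
  qed
  have "(\<Sum>z'\<in>HE (\<not> s). ideal \<phi> (f z')) = (\<Sum>z'\<in>?Z. ideal \<phi> (f z')) + (\<Sum>z'\<in>?N. ideal \<phi> (f z'))"
    by (subst sum.union_disjoint[symmetric]) (auto intro!: sum.cong)
  also have "(\<Sum>z'\<in>?N. ideal \<phi> (f z')) \<le> (\<Sum>z'\<in>?N. 1)"
    by (rule sum_mono) (use ideal_le_1[OF hpos phi(2)] in auto)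
  also have "(\<Sum>z'\<in>?N. 1::real) \<le> real (card W) * real D"
  proof -
    have "real (card ?N) \<le> real (card W * D)"
      by (intro of_nat_mono card_nonfresh[OF D Query.prems(2)])
    then show ?thesis by simp
  qed
  also have "(\<Sum>z'\<in>?Z. ideal \<phi> (f z')) \<le> (\<Sum>z'\<in>?Z. val \<phi> (f z') (?W z') + ?e)"
    by (rule sum_mono) (rule step)
  also have "\<dots> \<le> (\<Sum>z'\<in>?Z. val \<phi> (f z') (?W z')) + real h * ?e"
  proof -
    have "card ?Z \<le> card (HE (\<not> s))" by (rule card_mono) auto
    then have "real (card ?Z) \<le> real h" by (simp add: card_HE)
    then have "real (card ?Z) * ?e \<le> real h * ?e" by (rule mult_right_mono) simp
    then show ?thesis by (simp add: sum.distrib)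
  qed
  finally have "(\<Sum>z'\<in>HE (\<not> s). ideal \<phi> (f z')) \<le>
      (\<Sum>z'\<in>?Z. val \<phi> (f z') (?W z')) + real h * ?e + real (card W) * real D" by simp
  then have "ideal \<phi> (Query s z f) \<le>
     ((\<Sum>z'\<in>?Z. val \<phi> (f z') (?W z')) + real h * ?e + real (card W) * real D) / real h"
    using hpos by (simp add: divide_right_mono)
  also have "\<dots> = val \<phi> (Query s z f) W + (?e + real (card W) * real D / real h)"
    using hpos by (simp add: add_divide_distrib)
  also have "?e + real (card W) * real D / real h \<le> real Q * (real (card W) + real Q) * real D / real h"
  proof -
    have "real (Q - 1) = real Q - 1" using Q by auto
    then have "real (Q - 1) * (real (card W) + real Q) + real (card W) \<le> real Q * (real (card W) + real Q)"
      by (simp add: algebra_simps)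
    then have "(real (Q - 1) * (real (card W) + real Q) + real (card W)) * (real D / real h) \<le>
        real Q * (real (card W) + real Q) * (real D / real h)"
      by (rule mult_right_mono) simp
    then show ?thesis by (simp add: algebra_simps add_divide_distrib)
  qed
  finally show ?case by simp
qed

subsection \<open>Averages over matchings\<close>

definition avg :: "((nat \<times> nat \<Rightarrow> nat \<times> nat) \<Rightarrow> real) \<Rightarrow> real" where
  "avg X = (\<Sum>\<omega>\<in>MM. X \<omega>) / real (card MM)"

lemma avg_mono: "(\<And>\<omega>. \<omega> \<in> MM \<Longrightarrow> X \<omega> \<le> Y \<omega>) \<Longrightarrow> avg X \<le> avg Y"
  unfolding avg_def by (intro divide_right_mono sum_mono) auto

lemma avg_add: "avg (\<lambda>\<omega>. X \<omega> + Y \<omega>) = avg X + avg Y"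
  unfolding avg_def by (simp add: sum.distrib add_divide_distrib)

lemma avg_diff: "avg (\<lambda>\<omega>. X \<omega> - Y \<omega>) = avg X - avg Y"
  unfolding avg_def by (simp add: sum_subtractf diff_divide_distrib)

lemma avg_cmult: "avg (\<lambda>\<omega>. c * X \<omega>) = c * avg X"
  unfolding avg_def by (simp add: sum_distrib_left)

lemma avg_const [simp]: "avg (\<lambda>\<omega>. c) = c"
  unfolding avg_def using card_MM_pos MM_nonempty by simp

lemma avg_sum: "avg (\<lambda>\<omega>. \<Sum>i\<in>I. X i \<omega>) = (\<Sum>i\<in>I. avg (X i))"
  unfolding avg_def by (simp add: sum.swap[of _ _ MM] sum_divide_distrib)

lemma avg_cong: "(\<And>\<omega>. \<omega> \<in> MM \<Longrightarrow> X \<omega> = Y \<omega>) \<Longrightarrow> avg X = avg Y"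
  unfolding avg_def by simp

text \<open>
  The bound of the previous lemma, for \<open>w\<close> known vertices and \<open>Q\<close>
  queries.
\<close>

definition err :: "nat \<Rightarrow> nat \<Rightarrow> nat \<Rightarrow> real" where
  "err D w Q = real Q * (real w + real Q) * real D / real h"

lemma avg_run_ge:
  assumes D: "\<And>s v. v \<in> {1..sz s} \<Longrightarrow> dg s v \<le> D" and hpos: "h > 0"
    and phi: "\<And>r. 0 \<le> \<phi> r" "\<And>r. \<phi> r \<le> (1::real)"
    and b: "query_bound st Q" and W: "finite W" and p: "proper st A W" and vs: "valid_state {} A W"
  shows "ideal \<phi> st - err D (card W) Q \<le> avg (\<lambda>\<omega>. \<phi> (run \<omega> st) * of_bool (fresh \<omega> st W))"
proof -
  have "ideal \<phi> st - err D (card W) Q \<le> val \<phi> st W"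
  proof -
    have "ideal \<phi> st \<le> val \<phi> st W + real Q * (real (card W) + real Q) * real D / real h"
      by (rule ideal_le_val[OF D hpos phi b W])
    then show ?thesis by (simp add: err_def)
  qed
  also have "\<dots> \<le> avg (\<lambda>\<omega>. \<phi> (run \<omega> st) * of_bool (fresh \<omega> st W))"
    using val_le[OF p vs, of \<phi>] phi card_MM_pos by (simp add: ext_empty avg_def le_divide_eq)
  finally show ?thesis .
qed

lemma avg_nonfresh_le:
  assumes D: "\<And>s v. v \<in> {1..sz s} \<Longrightarrow> dg s v \<le> D" and hpos: "h > 0"
    and b: "query_bound st Q" and W: "finite W" and p: "proper st A W" and vs: "valid_state {} A W"
  shows "avg (\<lambda>\<omega>. of_bool (\<not> fresh \<omega> st W)) \<le> err D (card W) Q"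
proof -
  have "1 - err D (card W) Q \<le> avg (\<lambda>\<omega>. of_bool (fresh \<omega> st W))"
    using avg_run_ge[OF D hpos _ _ b W p vs, of "\<lambda>_. 1"] by (simp add: ideal_const[OF hpos])
  moreover have "avg (\<lambda>\<omega>. of_bool (fresh \<omega> st W)) + avg (\<lambda>\<omega>. of_bool (\<not> fresh \<omega> st W)) = 1"
    unfolding avg_add[symmetric] by (subst avg_cong[of _ "\<lambda>_. 1"]) auto
  ultimately show ?thesis by linarith
qed

text \<open>
  The lower bound applies to an event and to its complement, and so yields the two-sided
  estimate.
\<close>

lemma avg_run_approx:
  assumes D: "\<And>s v. v \<in> {1..sz s} \<Longrightarrow> dg s v \<le> D" and hpos: "h > 0"
    and b: "query_bound st Q" and W: "finite W" and p: "proper st A W" and vs: "valid_state {} A W"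
  shows "\<bar>avg (\<lambda>\<omega>. of_bool (E (run \<omega> st))) - ideal (\<lambda>r. of_bool (E r)) st\<bar> \<le> err D (card W) Q"
proof -
  have ge: "ideal (\<lambda>r. of_bool (E r)) st - err D (card W) Q \<le> avg (\<lambda>\<omega>. of_bool (E (run \<omega> st)))" for E
  proof -
    have "ideal (\<lambda>r. of_bool (E r)) st - err D (card W) Q
        \<le> avg (\<lambda>\<omega>. of_bool (E (run \<omega> st)) * of_bool (fresh \<omega> st W))"
      by (rule avg_run_ge[OF D hpos _ _ b W p vs]) auto
    also have "\<dots> \<le> avg (\<lambda>\<omega>. of_bool (E (run \<omega> st)))" by (rule avg_mono) auto
    finally show ?thesis .
  qed
  have "ideal (\<lambda>r. of_bool (\<not> E r)) st = ideal (\<lambda>r. 1 * 1 + (-1) * of_bool (E r)) st"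
    by (rule arg_cong[of _ _ "\<lambda>f. ideal f st"]) auto
  also have "\<dots> = 1 - ideal (\<lambda>r. of_bool (E r)) st"
    by (subst ideal_linear) (simp add: ideal_const[OF hpos])
  finally have 1: "ideal (\<lambda>r. of_bool (\<not> E r)) st = 1 - ideal (\<lambda>r. of_bool (E r)) st" .
  have 2: "avg (\<lambda>\<omega>. of_bool (\<not> E (run \<omega> st))) = 1 - avg (\<lambda>\<omega>. of_bool (E (run \<omega> st)))"
    by (subst avg_cong[of _ "\<lambda>\<omega>. 1 - of_bool (E (run \<omega> st))"]) (auto simp: avg_diff)
  show ?thesis using ge[of E] ge[of "\<lambda>r. \<not> E r"] 1 2 by linarith
qed

definition half_edges_at :: "bool \<Rightarrow> nat \<Rightarrow> (bool \<times> (nat \<times> nat)) set" where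
  "half_edges_at s v = {(s, y) | y. y \<in> HE s \<and> fst y = v}"

lemma valid_state_root: "valid_state {} (half_edges_at s v) {(s, v)}"
  by (auto simp: valid_state_def half_edges_at_def)

text \<open>
  Running the strategies of two vertices one after the other gives an ideal joint probability
  that is the product of the two. Hence the covariances are of the order of the error term, and
  only the diagonal contributes \<open>card V\<close>.
\<close>

lemma second_moment:
  assumes D: "\<And>s v. v \<in> {1..sz s} \<Longrightarrow> dg s v \<le> D" and hpos: "h > 0"
    and V: "finite V"
    and b: "\<And>v. v \<in> V \<Longrightarrow> query_bound (S v) Q"
    and p: "\<And>v. v \<in> V \<Longrightarrow> proper (S v) (half_edges_at s v) {(s, v)}"
    and ipv: "\<And>v. v \<in> V \<Longrightarrow> ideal (\<lambda>r. of_bool (E r)) (S v) = \<pi>"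
  shows "avg (\<lambda>\<omega>. (real (card {v\<in>V. E (run \<omega> (S v))}) - real (card V) * \<pi>)\<^sup>2)
     \<le> real (card V) + 3 * err D 2 (2 * Q) * (real (card V))\<^sup>2"
proof -
  let ?I = "\<lambda>v \<omega>. of_bool (E (run \<omega> (S v))) :: real"
  let ?e = "err D 2 (2 * Q)"
  have e0: "?e \<ge> 0" by (simp add: err_def)
  have pi01: "0 \<le> \<pi> \<and> \<pi> \<le> 1" if "v \<in> V" for v
    using ipv[OF that] ideal_nonneg[of "\<lambda>r. of_bool (E r)" "S v"] ideal_le_1[OF hpos, of "\<lambda>r. of_bool (E r)" "S v"]
    by auto
  have single: "\<bar>avg (?I v) - \<pi>\<bar> \<le> ?e" if v: "v \<in> V" for v
  proof -
    have "\<bar>avg (?I v) - \<pi>\<bar> \<le> err D (card {(s, v)}) Q"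
      using avg_run_approx[OF D hpos b[OF v] _ p[OF v] valid_state_root, of E] ipv[OF v] by simp
    also have "\<dots> \<le> ?e" unfolding err_def by (intro divide_right_mono mult_right_mono mult_mono) auto
    finally show ?thesis .
  qed
  have pair: "avg (\<lambda>\<omega>. (?I v \<omega> - \<pi>) * (?I w \<omega> - \<pi>)) \<le> 3 * ?e" if v: "v \<in> V" and w: "w \<in> V" and vw: "v \<noteq> w" for v w
  proof -
    let ?m = "sbind (S v) (\<lambda>a. sbind (S w) (\<lambda>b. Ret (a, b)))"
    let ?W = "{(s, v), (s, w)}"
    have pm: "proper ?m (half_edges_at s v \<union> half_edges_at s w) ?W"
    proof (rule proper_sbind)
      show "proper (S v) (half_edges_at s v) ?W" by (rule proper_mono[OF p[OF v]]) auto
      fix r W' assume W': "?W \<subseteq> W'"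
      have "proper (sbind (S w) (\<lambda>b. Ret (r, b))) (half_edges_at s w \<union> {}) W'"
      proof (rule proper_sbind)
        show "proper (S w) (half_edges_at s w) W'" by (rule proper_mono[OF p[OF w]]) (use W' in auto)
      qed auto
      then show "proper (sbind (S w) (\<lambda>b. Ret (r, b))) (half_edges_at s w) W'" by simp
    qed (use vw in \<open>auto simp: half_edges_at_def\<close>)
    have bm: "query_bound ?m (2 * Q)"
    proof -
      have "query_bound (sbind (S w) (\<lambda>b. Ret (a, b))) (Q + 0)" for a
        by (rule query_bound_sbind[OF b[OF w]]) auto
      then have "query_bound ?m (Q + Q)" by (intro query_bound_sbind[OF b[OF v]]) auto
      then show ?thesis by (simp add: mult_2)
    qed
    have vs: "valid_state {} (half_edges_at s v \<union> half_edges_at s w) ?W"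
      by (auto simp: valid_state_def half_edges_at_def)
    have "ideal (\<lambda>(a, b). of_bool (E a \<and> E b)) ?m = \<pi> * \<pi>"
    proof -
      have *: "ideal (\<lambda>b. of_bool (E a \<and> E b)) (S w) = \<pi> * of_bool (E a)" for a
        by (cases "E a") (simp_all add: ipv[OF w] ideal_const[OF hpos])
      have "ideal (\<lambda>(a, b). of_bool (E a \<and> E b)) ?m = ideal (\<lambda>a. \<pi> * of_bool (E a)) (S v)"
        by (simp add: ideal_sbind *)
      also have "\<dots> = \<pi> * \<pi>" by (simp only: ideal_cmult ipv[OF v])
      finally show ?thesis .
    qed
    then have "\<bar>avg (\<lambda>\<omega>. of_bool (case run \<omega> ?m of (a, b) \<Rightarrow> E a \<and> E b)) - \<pi> * \<pi>\<bar> \<le> err D (card ?W) (2 * Q)"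
      using avg_run_approx[OF D hpos bm _ pm vs, of "\<lambda>(a, b). E a \<and> E b"]
      by (simp add: case_prod_unfold)
    moreover have "card ?W = 2" using vw by simp
    moreover have "avg (\<lambda>\<omega>. of_bool (case run \<omega> ?m of (a, b) \<Rightarrow> E a \<and> E b)) = avg (\<lambda>\<omega>. ?I v \<omega> * ?I w \<omega>)"
      by (rule avg_cong) (simp add: run_sbind)
    ultimately have j: "avg (\<lambda>\<omega>. ?I v \<omega> * ?I w \<omega>) \<le> \<pi> * \<pi> + ?e" by simp
    have "avg (\<lambda>\<omega>. (?I v \<omega> - \<pi>) * (?I w \<omega> - \<pi>)) =
       avg (\<lambda>\<omega>. ((?I v \<omega> * ?I w \<omega> - \<pi> * ?I v \<omega>) - \<pi> * ?I w \<omega>) + \<pi> * \<pi>)"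
      by (rule avg_cong) (simp only: algebra_simps)
    also have "\<dots> = avg (\<lambda>\<omega>. ?I v \<omega> * ?I w \<omega>) - \<pi> * avg (?I v) - \<pi> * avg (?I w) + \<pi> * \<pi>"
      unfolding avg_add avg_diff avg_cmult by simp
    also have "\<dots> \<le> \<pi> * \<pi> + ?e - \<pi> * (\<pi> - ?e) - \<pi> * (\<pi> - ?e) + \<pi> * \<pi>"
    proof -
      have "\<pi> * (\<pi> - ?e) \<le> \<pi> * avg (?I v)" "\<pi> * (\<pi> - ?e) \<le> \<pi> * avg (?I w)"
        using single[OF v] single[OF w] pi01[OF v] by (auto intro!: mult_left_mono)
      then show ?thesis using j by linarith
    qed
    also have "\<dots> = ?e + 2 * \<pi> * ?e" by (simp add: algebra_simps)
    also have "\<dots> \<le> 3 * ?e"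
    proof -
      have "\<pi> * ?e \<le> 1 * ?e" using pi01[OF v] e0 by (intro mult_right_mono) auto
      then show ?thesis by simp
    qed
    finally show ?thesis .
  qed
  have diag: "avg (\<lambda>\<omega>. (?I v \<omega> - \<pi>) * (?I v \<omega> - \<pi>)) \<le> 1" if v: "v \<in> V" for v
  proof -
    have "(?I v \<omega> - \<pi>) * (?I v \<omega> - \<pi>) \<le> 1" for \<omega>
    proof -
      have "\<bar>?I v \<omega> - \<pi>\<bar> \<le> 1" using pi01[OF v] by (cases "E (run \<omega> (S v))") auto
      then show ?thesis using abs_square_le_1 power2_eq_square by metis
    qed
    then have "avg (\<lambda>\<omega>. (?I v \<omega> - \<pi>) * (?I v \<omega> - \<pi>)) \<le> avg (\<lambda>_. 1)" by (intro avg_mono)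
    then show ?thesis by simp
  qed
  have expand: "(real (card {v\<in>V. E (run \<omega> (S v))}) - real (card V) * \<pi>)\<^sup>2 =
      (\<Sum>v\<in>V. \<Sum>w\<in>V. (?I v \<omega> - \<pi>) * (?I w \<omega> - \<pi>))" for \<omega>
  proof -
    have "real (card {v\<in>V. E (run \<omega> (S v))}) = (\<Sum>v\<in>V. ?I v \<omega>)"
      using V by (simp add: of_bool_def sum.If_cases Int_def)
    then have "real (card {v\<in>V. E (run \<omega> (S v))}) - real (card V) * \<pi> = (\<Sum>v\<in>V. ?I v \<omega> - \<pi>)"
      by (simp add: sum_subtractf)
    then show ?thesis by (simp add: power2_eq_square sum_product)
  qed
  have "avg (\<lambda>\<omega>. (real (card {v\<in>V. E (run \<omega> (S v))}) - real (card V) * \<pi>)\<^sup>2) =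
      (\<Sum>v\<in>V. \<Sum>w\<in>V. avg (\<lambda>\<omega>. (?I v \<omega> - \<pi>) * (?I w \<omega> - \<pi>)))"
    unfolding expand avg_sum ..
  also have "\<dots> \<le> (\<Sum>v\<in>V. \<Sum>w\<in>V. of_bool (v = w) + 3 * ?e)"
  proof (intro sum_mono)
    fix v w assume "v \<in> V" "w \<in> V"
    then show "avg (\<lambda>\<omega>. (?I v \<omega> - \<pi>) * (?I w \<omega> - \<pi>)) \<le> of_bool (v = w) + 3 * ?e"
      using pair[of v w] diag[of v] e0 by (cases "v = w") auto
  qed
  also have "\<dots> = real (card V) + 3 * ?e * (real (card V))\<^sup>2"
  proof -
    have "(\<Sum>v\<in>V. \<Sum>w\<in>V. of_bool (v = w) :: real) = real (card V)"
    proof -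
      have "(\<Sum>w\<in>V. of_bool (v = w) :: real) = 1" if "v \<in> V" for v
        using V that by (simp add: of_bool_def)
      then show ?thesis by simp
    qed
    then show ?thesis by (simp add: sum.distrib power2_eq_square algebra_simps)
  qed
  finally show ?thesis .
qed

end

section \<open>Exploring the neighbourhood of a vertex\<close>

primrec all_died :: "('z \<Rightarrow> bool strat) \<Rightarrow> 'z list \<Rightarrow> bool strat" where
  "all_died e [] = Ret True"
| "all_died e (z # zs) = sbind (e z) (\<lambda>b. sbind (all_died e zs) (\<lambda>b'. Ret (b \<and> b')))"

text \<open>
  The \<open>k\<close>-fold convolution power of \<open>g\<close>.
\<close>

primrec conv :: "nat \<Rightarrow> (nat \<Rightarrow> real) \<Rightarrow> nat \<Rightarrow> real" where
  "conv 0 g d = of_bool (d = 0)"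
| "conv (Suc k) g d = (\<Sum>c\<le>d. g c * conv k g (d - c))"

text \<open>
  A bound for the number of vertices found in \<open>r\<close> generations when every vertex
  expanded has degree at most \<open>\<Delta>\<close>.
\<close>

primrec explored_size :: "nat \<Rightarrow> nat \<Rightarrow> nat" where
  "explored_size \<Delta> 0 = 0"
| "explored_size \<Delta> (Suc r) = 1 + \<Delta> * explored_size \<Delta> r"

context bipartite
begin

definition all_at :: "bool \<Rightarrow> nat \<Rightarrow> (nat \<times> nat) list" where
  "all_at s v = map (Pair v) [1..<Suc (dg s v)]"

definition others :: "bool \<Rightarrow> nat \<times> nat \<Rightarrow> (nat \<times> nat) list" where
  "others s z' = filter (\<lambda>y. y \<noteq> z') (all_at s (fst z'))"

text \<open>
  Follows half-edge \<open>z\<close> for at most \<open>r\<close> generations and returns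
  whether the exploration dies out. The function \<open>cls\<close> marks vertices at which the
  exploration stops with a given verdict instead of being continued through the remaining
  half-edges. Reaching generation \<open>r\<close> counts as survival. All branches are run,
  even after one has survived, so that the verdict of the ideal exploration is a product.
\<close>

primrec explore :: "(bool \<Rightarrow> nat \<Rightarrow> bool option) \<Rightarrow> nat \<Rightarrow> bool \<Rightarrow> nat \<times> nat \<Rightarrow> bool strat" where
  "explore cls 0 s z = Ret False"
| "explore cls (Suc r) s z = Query s z (\<lambda>z'. case cls (\<not> s) (fst z') of Some b \<Rightarrow> Ret b
      | None \<Rightarrow> all_died (explore cls r (\<not> s)) (others (\<not> s) z'))"

text \<open>
  What \<open>explore\<close> does on arrival at the vertex that owns \<open>z'\<close>.
\<close>

definition visit where
  "visit cls r s z' = (case cls s (fst z') of Some b \<Rightarrow> Ret b | None \<Rightarrow> all_died (explore cls r s) (others s z'))"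

lemma explore_Suc: "explore cls (Suc r) s z = Query s z (visit cls r (\<not> s))"
  by (simp add: visit_def fun_eq_iff)

declare explore.simps(2) [simp del]

text \<open>
  From several half-edges of one vertex: returns the sum of the labels \<open>wt\<close> of
  their partners, and whether all explorations die out.
\<close>

primrec explore_list where
  "explore_list cls wt r s [] = Ret (0::nat, True)"
| "explore_list cls wt r s (z # zs) = Query s z (\<lambda>z'. sbind (visit cls r (\<not> s) z') (\<lambda>b.
      sbind (explore_list cls wt r s zs) (\<lambda>cb. Ret (wt (\<not> s) z' + fst cb, b \<and> snd cb))))"

definition explore_root where "explore_root cls wt r s v = explore_list cls wt r s (all_at s v)"

lemma all_at_simps:
  "distinct (all_at s v)" "length (all_at s v) = dg s v"
  "v \<in> {1..sz s} \<Longrightarrow> set (all_at s v) = {y \<in> HE s. fst y = v}"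
  "z \<in> set (all_at s v) \<Longrightarrow> fst z = v"
  by (auto simp: all_at_def distinct_map inj_on_def HE_def)

lemma others_simps:
  assumes "z' \<in> HE s"
  shows "distinct (others s z')" "length (others s z') = dg s (fst z') - 1"
    "Pair s ` set (others s z') = siblings s z'"
    "z \<in> set (others s z') \<Longrightarrow> fst z = fst z' \<and> z \<in> HE s"
proof -
  have v: "fst z' \<in> {1..sz s}" using assms by (auto simp: HE_def)
  have m: "z' \<in> set (all_at s (fst z'))" using assms all_at_simps(3)[OF v] by auto
  have st: "set (others s z') = {y \<in> HE s. fst y = fst z' \<and> y \<noteq> z'}"
    using all_at_simps(3)[OF v] by (auto simp: others_def)
  show "distinct (others s z')" by (simp add: others_def all_at_simps(1))
  have "length (others s z') = card (set (others s z'))"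
    by (rule distinct_card[symmetric]) (simp add: others_def all_at_simps(1))
  also have "set (others s z') = set (all_at s (fst z')) - {z'}" by (auto simp: others_def)
  also have "card \<dots> = dg s (fst z') - 1"
    using m by (simp add: card_Diff_singleton distinct_card all_at_simps(1,2))
  finally show "length (others s z') = dg s (fst z') - 1" .
  show "Pair s ` set (others s z') = siblings s z'" by (auto simp: st siblings_def)
  show "z \<in> set (others s z') \<Longrightarrow> fst z = fst z' \<and> z \<in> HE s" by (auto simp: st)
qed

lemma proper_sbind_Ret: "proper m A W \<Longrightarrow> proper (sbind m (\<lambda>r. Ret (g r))) A W"
  using proper_sbind[of m A W "\<lambda>r. Ret (g r)" "{}"] by simp

lemma proper_all_died:
  assumes "distinct zs" "\<And>z W'. z \<in> set zs \<Longrightarrow> W \<subseteq> W' \<Longrightarrow> proper (e z) {(s, z)} W'"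
    "\<And>z. z \<in> set zs \<Longrightarrow> (s, fst z) \<in> W"
  shows "proper (all_died e zs) (Pair s ` set zs) W"
  using assms
proof (induct zs arbitrary: W)
  case (Cons z zs)
  have "proper (sbind (e z) (\<lambda>b. sbind (all_died e zs) (\<lambda>b'. Ret (b \<and> b')))) ({(s, z)} \<union> Pair s ` set zs) W"
  proof (rule proper_sbind)
    show "proper (e z) {(s, z)} W" using Cons.prems(2) by auto
    fix r W' assume W': "W \<subseteq> W'"
    have "proper (all_died e zs) (Pair s ` set zs) W'"
    proof (rule Cons.hyps)
      show "distinct zs" using Cons.prems(1) by simp
      fix y W'' assume "y \<in> set zs" "W' \<subseteq> W''"
      then show "proper (e y) {(s, y)} W''" using Cons.prems(2)[of y W''] W' by auto
    next
      fix y assume "y \<in> set zs"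
      then show "(s, fst y) \<in> W'" using Cons.prems(3)[of y] W' by auto
    qed
    then show "proper (sbind (all_died e zs) (\<lambda>b'. Ret (r \<and> b'))) (Pair s ` set zs) W'"
      by (rule proper_sbind_Ret)
  next
    show "{(s, z)} \<inter> Pair s ` set zs = {}" using Cons.prems(1) by auto
    fix s' y assume "(s', y) \<in> Pair s ` set zs"
    then show "(s', fst y) \<in> W" using Cons.prems(3)[of y] by auto
  qed
  then show ?case by simp
qed simp

lemma proper_explore: "proper (explore cls r s z) {(s, z)} W"
proof (induct r arbitrary: W s z)
  case (Suc r)
  have "proper (visit cls r (\<not> s) z') (siblings (\<not> s) z') (insert (\<not> s, fst z') W)"
    if z': "z' \<in> HE (\<not> s)" for z'
  proof -
    have "proper (all_died (explore cls r (\<not> s)) (others (\<not> s) z')) (Pair (\<not> s) ` set (others (\<not> s) z'))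
       (insert (\<not> s, fst z') W)"
      by (rule proper_all_died[OF others_simps(1)[OF z'] Suc]) (use others_simps(4)[OF z'] in auto)
    then show ?thesis by (auto simp: visit_def others_simps(3)[OF z'] split: option.split)
  qed
  then show "proper (explore cls (Suc r) s z) {(s, z)} W" unfolding explore_Suc by simp
qed simp

lemma proper_visit:
  assumes "z' \<in> HE s" "(s, fst z') \<in> W" shows "proper (visit cls r s z') (siblings s z') W"
proof -
  have "proper (all_died (explore cls r s) (others s z')) (Pair s ` set (others s z')) W"
    by (rule proper_all_died[OF others_simps(1)[OF assms(1)] proper_explore]) (use others_simps(4)[OF assms(1)] assms in auto)
  then show ?thesis by (auto simp: visit_def others_simps(3)[OF assms(1)] split: option.split)
qed

lemma proper_explore_list:
  assumes "distinct zs" "\<And>z. z \<in> set zs \<Longrightarrow> (s, fst z) \<in> W"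
  shows "proper (explore_list cls wt r s zs) (Pair s ` set zs) W"
  using assms
proof (induct zs arbitrary: W)
  case (Cons z zs)
  let ?k = "\<lambda>z'. \<lambda>b. sbind (explore_list cls wt r s zs) (\<lambda>cb. Ret (wt (\<not> s) z' + fst cb, b \<and> snd cb))"
  have "proper (sbind (visit cls r (\<not> s) z') (?k z'))
      (Pair s ` set (z # zs) - {(s, z)} \<union> siblings (\<not> s) z') (insert (\<not> s, fst z') W)"
    if z': "z' \<in> HE (\<not> s)" for z'
  proof -
    have "proper (sbind (visit cls r (\<not> s) z') (?k z')) (siblings (\<not> s) z' \<union> Pair s ` set zs) (insert (\<not> s, fst z') W)"
    proof (rule proper_sbind)
      show "proper (visit cls r (\<not> s) z') (siblings (\<not> s) z') (insert (\<not> s, fst z') W)"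
        by (rule proper_visit[OF z']) simp
      fix b W' assume W': "insert (\<not> s, fst z') W \<subseteq> W'"
      have "proper (explore_list cls wt r s zs) (Pair s ` set zs) W'"
        by (rule Cons.hyps) (use Cons.prems W' in auto)
      then show "proper (?k z' b) (Pair s ` set zs) W'" by (rule proper_sbind_Ret)
    next
      show "siblings (\<not> s) z' \<inter> Pair s ` set zs = {}" by (auto simp: siblings_def)
      fix s' y assume "(s', y) \<in> Pair s ` set zs"
      then show "(s', fst y) \<in> insert (\<not> s, fst z') W" using Cons.prems(2)[of y] by auto
    qed
    then show ?thesis by (rule proper_mono) (use Cons.prems(1) in auto)
  qed
  then show ?case by auto
qed simp

lemma proper_explore_root:
  assumes "v \<in> {1..sz s}"
  shows "proper (explore_root cls wt r s v) (half_edges_at s v) {(s, v)}"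
proof -
  have "proper (explore_root cls wt r s v) (Pair s ` set (all_at s v)) {(s, v)}"
    unfolding explore_root_def by (rule proper_explore_list) (auto simp: all_at_simps(1,4))
  moreover have "Pair s ` set (all_at s v) = half_edges_at s v"
    using all_at_simps(3)[OF assms] by (auto simp: half_edges_at_def)
  ultimately show ?thesis by simp
qed

lemma query_bound_all_died: "(\<And>z. query_bound (e z) b) \<Longrightarrow> query_bound (all_died e zs) (length zs * b)"
proof (induct zs)
  case (Cons z zs)
  have "query_bound (sbind (all_died e zs) (\<lambda>b'. Ret (c \<and> b'))) (length zs * b + 0)" for c
    by (rule query_bound_sbind[OF Cons.hyps[OF Cons.prems]]) auto
  then have "query_bound (sbind (e z) (\<lambda>b. sbind (all_died e zs) (\<lambda>b'. Ret (b \<and> b')))) (b + length zs * b)"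
    by (intro query_bound_sbind[OF Cons.prems]) simp
  then show ?case by simp
qed simp

lemma query_bound_visit_gen:
  assumes "\<And>s v. cls s v = None \<Longrightarrow> dg s v \<le> \<Delta>" "z' \<in> HE s"
    "\<And>z. query_bound (explore cls r s z) b"
  shows "query_bound (visit cls r s z') (\<Delta> * b)"
proof (cases "cls s (fst z')")
  case None
  have "query_bound (all_died (explore cls r s) (others s z')) (length (others s z') * b)"
    by (rule query_bound_all_died[OF assms(3)])
  moreover have "length (others s z') \<le> \<Delta>"
    using assms(1)[OF None] others_simps(2)[OF assms(2)] by simp
  ultimately show ?thesis using None by (auto simp: visit_def intro: query_bound_mono[OF _ mult_le_mono1])
qed (auto simp: visit_def)

lemma query_bound_explore:
  assumes "\<And>s v. cls s v = None \<Longrightarrow> dg s v \<le> \<Delta>"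
  shows "query_bound (explore cls r s z) (explored_size \<Delta> r)"
proof (induct r arbitrary: s z)
  case (Suc r)
  show ?case using query_bound_visit_gen[OF assms _ Suc] by (simp add: explore_Suc)
qed simp

lemma query_bound_explore_list:
  assumes "\<And>s v. cls s v = None \<Longrightarrow> dg s v \<le> \<Delta>"
  shows "query_bound (explore_list cls wt r s zs) (length zs * explored_size \<Delta> (Suc r))"
proof (induct zs)
  case (Cons z zs)
  let ?k = "\<lambda>z'. \<lambda>b. sbind (explore_list cls wt r s zs) (\<lambda>cb. Ret (wt (\<not> s) z' + fst cb, b \<and> snd cb))"
  let ?L = "length zs * explored_size \<Delta> (Suc r)"
  have "query_bound (sbind (visit cls r (\<not> s) z') (?k z')) (\<Delta> * explored_size \<Delta> r + ?L)" if "z' \<in> HE (\<not> s)" for z'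
  proof (rule query_bound_sbind)
    show "query_bound (visit cls r (\<not> s) z') (\<Delta> * explored_size \<Delta> r)"
      by (rule query_bound_visit_gen[OF assms that query_bound_explore[OF assms]])
    show "query_bound (?k z' b) ?L" for b
      using query_bound_sbind[OF Cons, of "\<lambda>cb. Ret (wt (\<not> s) z' + fst cb, b \<and> snd cb)" 0] by simp
  qed
  then show ?case by (auto simp: add.left_commute)
qed simp

lemma query_bound_explore_root:
  assumes "\<And>s v. cls s v = None \<Longrightarrow> dg s v \<le> \<Delta>"
  shows "query_bound (explore_root cls wt r s v) (dg s v * explored_size \<Delta> (Suc r))"
  using query_bound_explore_list[OF assms, where wt = wt and r = r and s = s and zs = "all_at s v"] by (simp only: explore_root_def all_at_simps(2))

subsection \<open>Idealised probabilities\<close>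

text \<open>
  The recursion of the branching process with one individual per half-edge: arriving at a vertex
  of degree \<open>j\<close> by one of its half-edges leaves \<open>j - 1\<close> independent
  explorations.
\<close>

primrec dieprob :: "(bool \<Rightarrow> nat \<Rightarrow> bool option) \<Rightarrow> nat \<Rightarrow> bool \<Rightarrow> real" where
  "dieprob cls 0 s = 0"
| "dieprob cls (Suc r) s = (\<Sum>z'\<in>HE (\<not> s). case cls (\<not> s) (fst z') of Some b \<Rightarrow> of_bool b
      | None \<Rightarrow> dieprob cls r (\<not> s) ^ (dg (\<not> s) (fst z') - 1)) / real h"

definition stepval where
  "stepval cls r s z' = (case cls s (fst z') of Some b \<Rightarrow> of_bool b
      | None \<Rightarrow> dieprob cls r s ^ (dg s (fst z') - 1))"

text \<open>
  The ideal probability that the partner of a half-edge carries the label \<open>c\<close> and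
  that the exploration through it dies. With \<open>t\<close> set, the verdict is ignored.
\<close>

definition half_edge_mass where
  "half_edge_mass cls wt r s t c = (\<Sum>z'\<in>HE (\<not> s). of_bool (wt (\<not> s) z' = (c::nat)) *
      (if t then 1 else stepval cls r (\<not> s) z')) / real h"

lemma ideal_bool: "h > 0 \<Longrightarrow> ideal \<phi> m = ideal of_bool m * \<phi> True + (1 - ideal of_bool m) * \<phi> False"
proof -
  assume h: "h > 0"
  have "\<phi> = (\<lambda>r. (\<phi> True - \<phi> False) * of_bool r + \<phi> False * 1)"
    by (auto simp: fun_eq_iff of_bool_def)
  then have "ideal \<phi> m = ideal (\<lambda>r. (\<phi> True - \<phi> False) * of_bool r + \<phi> False * 1) m" by simp
  also have "\<dots> = (\<phi> True - \<phi> False) * ideal of_bool m + \<phi> False"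
    by (subst ideal_linear) (simp add: ideal_const[OF h])
  finally show ?thesis by (simp add: algebra_simps)
qed

lemma ideal_all_died:
  assumes h: "h > 0" and e: "\<And>z. z \<in> set zs \<Longrightarrow> ideal of_bool (e z) = x"
  shows "ideal of_bool (all_died e zs) = x ^ length zs"
  using e
proof (induct zs)
  case (Cons z zs)
  have "ideal of_bool (all_died e (z # zs)) = ideal (\<lambda>b. ideal (\<lambda>b'. of_bool (b \<and> b')) (all_died e zs)) (e z)"
    by (simp add: ideal_sbind del: of_bool_conj)
  also have "\<dots> = x * ideal of_bool (all_died e zs)"
    by (subst ideal_bool[OF h]) (simp add: Cons.prems ideal_const[OF h])
  finally show ?case using Cons by simp
qed (simp add: ideal_const[OF h])

lemma ideal_visit_gen:
  assumes h: "h > 0" and e: "\<And>z. ideal of_bool (explore cls r s z) = dieprob cls r s" and z': "z' \<in> HE s"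
  shows "ideal of_bool (visit cls r s z') = stepval cls r s z'"
  using ideal_all_died[OF h e, where zs = "others s z'"] others_simps(2)[OF z']
  by (auto simp: visit_def stepval_def split: option.split)

lemma ideal_explore:
  assumes h: "h > 0" shows "ideal of_bool (explore cls r s z) = dieprob cls r s"
proof (induct r arbitrary: s z)
  case (Suc r)
  then show ?case using ideal_visit_gen[OF h Suc, of _ "\<not> s"] by (simp add: explore_Suc stepval_def)
qed simp

lemma ideal_visit: "h > 0 \<Longrightarrow> z' \<in> HE s \<Longrightarrow> ideal of_bool (visit cls r s z') = stepval cls r s z'"
  by (rule ideal_visit_gen) (auto simp: ideal_explore)

text \<open>
  In the ideal model the half-edges are independent, so the label sum of a vertex, on the event
  that everything dies, is distributed like a sum of independent contributions.
\<close>

lemma ideal_explore_list: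
  assumes h: "h > 0"
  shows "ideal (\<lambda>cb. of_bool (fst cb = d \<and> (snd cb \<or> t))) (explore_list cls wt r s zs) = conv (length zs) (half_edge_mass cls wt r s t) d"
proof (induct zs arbitrary: d)
  case Nil
  then show ?case by (auto simp: ideal_const[OF h])
next
  case (Cons z zs)
  let ?c = "conv (length zs) (half_edge_mass cls wt r s t)"
  let ?k = "\<lambda>z'. \<lambda>b. sbind (explore_list cls wt r s zs) (\<lambda>cb. Ret (wt (\<not> s) z' + fst cb, b \<and> snd cb))"
  let ?\<phi> = "\<lambda>cb. of_bool (fst cb = d \<and> (snd cb \<or> t)) :: real"
  let ?g = "\<lambda>z'. if t then 1 else stepval cls r (\<not> s) z'"
  have inner: "ideal ?\<phi> (?k z' b) = of_bool (b \<or> t) * (if wt (\<not> s) z' \<le> d then ?c (d - wt (\<not> s) z') else 0)" for z' b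
  proof -
    have "ideal ?\<phi> (?k z' b) =
       ideal (\<lambda>cb. of_bool (b \<or> t) * (of_bool (wt (\<not> s) z' \<le> d) *
           of_bool (fst cb = d - wt (\<not> s) z' \<and> (snd cb \<or> t)))) (explore_list cls wt r s zs)"
      by (simp only: ideal_sbind ideal.simps) (rule arg_cong[of _ _ "\<lambda>f. ideal f (explore_list cls wt r s zs)"], auto simp: fun_eq_iff)
    then show ?thesis by (simp add: ideal_cmult Cons.hyps del: of_bool_conj)
  qed
  have "ideal ?\<phi> (explore_list cls wt r s (z # zs)) =
     (\<Sum>z'\<in>HE (\<not> s). ideal (\<lambda>b. ideal ?\<phi> (?k z' b)) (visit cls r (\<not> s) z')) / real h"
    by (simp add: ideal_sbind del: of_bool_conj)
  also have "\<dots> = (\<Sum>z'\<in>HE (\<not> s). ?g z' * (if wt (\<not> s) z' \<le> d then ?c (d - wt (\<not> s) z') else 0)) / real h"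
    by (rule arg_cong[of _ _ "\<lambda>x. x / real h"], rule sum.cong[OF refl], simp only: inner, subst ideal_bool[OF h])
       (simp add: ideal_visit[OF h] algebra_simps)
  also have "\<dots> = (\<Sum>z'\<in>HE (\<not> s). \<Sum>c\<le>d. of_bool (wt (\<not> s) z' = c) * ?g z' * ?c (d - c)) / real h"
  proof (rule arg_cong[of _ _ "\<lambda>x. x / real h"], rule sum.cong[OF refl])
    fix z'
    have "(\<Sum>c\<le>d. of_bool (wt (\<not> s) z' = c) * ?g z' * ?c (d - c)) =
       (\<Sum>c\<le>d. if wt (\<not> s) z' = c then ?g z' * ?c (d - c) else 0)"
      by (rule sum.cong) auto
    then show "?g z' * (if wt (\<not> s) z' \<le> d then ?c (d - wt (\<not> s) z') else 0) =
       (\<Sum>c\<le>d. of_bool (wt (\<not> s) z' = c) * ?g z' * ?c (d - c))" by simp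
  qed
  also have "\<dots> = (\<Sum>c\<le>d. half_edge_mass cls wt r s t c * ?c (d - c))"
    unfolding half_edge_mass_def[of cls wt r s t c for c]
    by (subst sum.swap) (simp only: sum_divide_distrib[where A = "{..d}"] sum_distrib_right[symmetric] times_divide_eq_left)
  finally show ?case by simp
qed

lemma ideal_explore_root:
  assumes h: "h > 0"
  shows "ideal (\<lambda>cb. of_bool (fst cb = d \<and> (snd cb \<or> t))) (explore_root cls wt r s v) = conv (dg s v) (half_edge_mass cls wt r s t) d"
  unfolding explore_root_def ideal_explore_list[OF h] all_at_simps(2) ..

subsection \<open>What the exploration says about components\<close>

text \<open>
  A set \<open>F\<close> of flagged right vertices is cut out of the graph; adjacency and
  components below are those of the remaining graph.
\<close>

definition blocked :: "nat set \<Rightarrow> bool \<times> nat \<Rightarrow> bool" where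
  "blocked F a \<longleftrightarrow> \<not> fst a \<and> snd a \<in> F"

definition adj :: "nat set \<Rightarrow> (nat \<times> nat \<Rightarrow> nat \<times> nat) \<Rightarrow> ((bool \<times> nat) \<times> (bool \<times> nat)) set" where
  "adj F \<omega> = {(a, b). \<exists>s z. z \<in> HE s \<and> a = (s, fst z) \<and> b = (\<not> s, fst (partner s \<omega> z)) \<and>
      \<not> blocked F a \<and> \<not> blocked F b}"

definition component :: "nat set \<Rightarrow> (nat \<times> nat \<Rightarrow> nat \<times> nat) \<Rightarrow> bool \<times> nat \<Rightarrow> (bool \<times> nat) set" where
  "component F \<omega> a = (adj F \<omega>)\<^sup>* `` {a}"

lemma adjI: "z \<in> HE s \<Longrightarrow> \<not> blocked F (s, fst z) \<Longrightarrow> \<not> blocked F (\<not> s, fst (partner s \<omega> z)) \<Longrightarrow>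
    ((s, fst z), (\<not> s, fst (partner s \<omega> z))) \<in> adj F \<omega>"
  unfolding adj_def by blast

lemma sym_adj: assumes "\<omega> \<in> MM" shows "sym (adj F \<omega>)"
proof (rule symI)
  fix a b assume "(a, b) \<in> adj F \<omega>"
  then obtain s z where z: "z \<in> HE s" "a = (s, fst z)" "b = (\<not> s, fst (partner s \<omega> z))"
    "\<not> blocked F a" "\<not> blocked F b" unfolding adj_def by blast
  have "partner s \<omega> z \<in> HE (\<not> s)" "partner (\<not> s) \<omega> (partner s \<omega> z) = z"
    using assms z(1) partner_in partner_partner by auto
  then show "(b, a) \<in> adj F \<omega>" unfolding adj_def mem_Collect_eq case_prod_conv
    using z by (intro exI[of _ "\<not> s"] exI[of _ "partner s \<omega> z"]) simp
qed

lemma run_all_died: "run \<omega> (all_died e zs) \<longleftrightarrow> (\<forall>z\<in>set zs. run \<omega> (e z))"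
  by (induct zs) (auto simp: run_sbind)

lemma run_explore_list: "run \<omega> (explore_list cls wt r s zs) =
    ((\<Sum>z\<leftarrow>zs. wt (\<not> s) (partner s \<omega> z)), \<forall>z\<in>set zs. run \<omega> (explore cls (Suc r) s z))"
  by (induct zs) (auto simp: run_sbind explore_Suc)

lemma fresh_all_died:
  "fresh \<omega> (all_died e zs) W \<Longrightarrow> z \<in> set zs \<Longrightarrow> \<exists>W'. W \<subseteq> W' \<and> fresh \<omega> (e z) W'"
proof (induct zs arbitrary: W)
  case (Cons y zs)
  from fresh_sbind[OF Cons.prems(1)[unfolded all_died.simps]] obtain W1 where
    1: "fresh \<omega> (e y) W" "W \<subseteq> W1" "fresh \<omega> (sbind (all_died e zs) (\<lambda>b'. Ret (run \<omega> (e y) \<and> b'))) W1" by blast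
  from fresh_sbind[OF 1(3)] have 2: "fresh \<omega> (all_died e zs) W1" by blast
  show ?case
  proof (cases "z = y")
    case True then show ?thesis using 1(1) by blast
  next
    case False
    then have "z \<in> set zs" using Cons.prems by auto
    from Cons.hyps[OF 2 this] 1(2) show ?thesis by blast
  qed
qed simp

lemma fresh_explore_list:
  "fresh \<omega> (explore_list cls wt r s zs) W \<Longrightarrow> z \<in> set zs \<Longrightarrow> \<exists>W'. W \<subseteq> W' \<and> fresh \<omega> (explore cls (Suc r) s z) W'"
proof (induct zs arbitrary: W)
  case (Cons y zs)
  let ?y = "partner s \<omega> y"
  let ?W = "insert (\<not> s, fst ?y) W"
  have 0: "(\<not> s, fst ?y) \<notin> W" and 1: "fresh \<omega> (sbind (visit cls r (\<not> s) ?y) (\<lambda>b.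
      sbind (explore_list cls wt r s zs) (\<lambda>cb. Ret (wt (\<not> s) ?y + fst cb, b \<and> snd cb)))) ?W"
    using Cons.prems(1) by auto
  from fresh_sbind[OF 1] obtain W1 where
    2: "fresh \<omega> (visit cls r (\<not> s) ?y) ?W" "?W \<subseteq> W1" and
    3: "fresh \<omega> (sbind (explore_list cls wt r s zs) (\<lambda>cb. Ret (wt (\<not> s) ?y + fst cb, run \<omega> (visit cls r (\<not> s) ?y) \<and> snd cb))) W1"
    by blast
  from fresh_sbind[OF 3] have 4: "fresh \<omega> (explore_list cls wt r s zs) W1" by blast
  show ?case
  proof (cases "z = y")
    case True
    then have "fresh \<omega> (explore cls (Suc r) s z) W" using 0 2(1) by (simp add: explore_Suc)
    then show ?thesis by blast
  next
    case False
    then have "z \<in> set zs" using Cons.prems by auto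
    from Cons.hyps[OF 4 this] 2(2) show ?thesis by blast
  qed
qed simp

text \<open>
  If no vertex is stopped with the verdict that it dies, then an exploration that dies has seen
  everything behind \<open>z\<close>. The set \<open>S\<close> of vertices seen has no neighbour
  outside \<open>S\<close> except the vertex the exploration came from, whether or not the run
  is fresh.
\<close>

lemma died_closed:
  assumes w: "\<omega> \<in> MM" and cls: "\<And>s v. cls s v = None \<Longrightarrow> dg s v \<le> \<Delta>" "\<And>s v. cls s v \<noteq> Some True"
    and z: "z \<in> HE s" and died: "run \<omega> (explore cls r s z)"
  shows "\<exists>S. finite S \<and> card S \<le> explored_size \<Delta> r \<and> (\<not> s, fst (partner s \<omega> z)) \<in> S \<and>
     (\<forall>a\<in>S. \<forall>b. (a, b) \<in> adj {} \<omega> \<longrightarrow> b \<in> S \<or> b = (s, fst z))"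
  using z died
proof (induct r arbitrary: s z)
  case 0
  then show ?case by simp
next
  case (Suc r)
  let ?z = "partner s \<omega> z"
  let ?w = "(\<not> s, fst ?z)"
  have z': "?z \<in> HE (\<not> s)" using partner_in[OF w Suc.prems(1)] .
  have st: "run \<omega> (visit cls r (\<not> s) ?z)" using Suc.prems(2) by (simp add: explore_Suc)
  have none: "cls (\<not> s) (fst ?z) = None"
    using st cls(2)[of "\<not> s" "fst ?z"] by (cases "cls (\<not> s) (fst ?z)") (auto simp: visit_def)
  have all: "\<forall>y\<in>set (others (\<not> s) ?z). run \<omega> (explore cls r (\<not> s) y)"
    using st none by (simp add: visit_def run_all_died)
  have "\<forall>y\<in>set (others (\<not> s) ?z). \<exists>S. finite S \<and> card S \<le> explored_size \<Delta> r \<and>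
     (s, fst (partner (\<not> s) \<omega> y)) \<in> S \<and> (\<forall>a\<in>S. \<forall>b. (a, b) \<in> adj {} \<omega> \<longrightarrow> b \<in> S \<or> b = ?w)"
  proof
    fix y assume y: "y \<in> set (others (\<not> s) ?z)"
    then have "y \<in> HE (\<not> s)" "fst y = fst ?z" using others_simps(4)[OF z'] by auto
    then show "\<exists>S. finite S \<and> card S \<le> explored_size \<Delta> r \<and>
     (s, fst (partner (\<not> s) \<omega> y)) \<in> S \<and> (\<forall>a\<in>S. \<forall>b. (a, b) \<in> adj {} \<omega> \<longrightarrow> b \<in> S \<or> b = ?w)"
      using Suc.hyps[of y "\<not> s"] all y by simp
  qed
  then obtain T where T: "\<forall>y\<in>set (others (\<not> s) ?z). finite (T y) \<and> card (T y) \<le> explored_size \<Delta> r \<and>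
     (s, fst (partner (\<not> s) \<omega> y)) \<in> T y \<and> (\<forall>a\<in>T y. \<forall>b. (a, b) \<in> adj {} \<omega> \<longrightarrow> b \<in> T y \<or> b = ?w)"
    by metis
  let ?O = "set (others (\<not> s) ?z)"
  let ?S = "insert ?w (\<Union>y\<in>?O. T y)"
  have "card ?S \<le> 1 + card (\<Union>y\<in>?O. T y)" using card_insert_le_m1 T by (simp add: card_insert_if)
  also have "card (\<Union>y\<in>?O. T y) \<le> (\<Sum>y\<in>?O. card (T y))" by (rule card_UN_le) simp
  also have "\<dots> \<le> (\<Sum>y\<in>?O. explored_size \<Delta> r)" by (rule sum_mono) (use T in auto)
  also have "\<dots> = card ?O * explored_size \<Delta> r" by simp
  also have "\<dots> \<le> \<Delta> * explored_size \<Delta> r"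
  proof (rule mult_le_mono1)
    have "card ?O \<le> length (others (\<not> s) ?z)" by (rule card_length)
    also have "\<dots> \<le> \<Delta>" using others_simps(2)[OF z'] cls(1)[OF none] by simp
    finally show "card ?O \<le> \<Delta>" .
  qed
  finally have c: "card ?S \<le> explored_size \<Delta> (Suc r)" by simp
  have closed: "b \<in> ?S \<or> b = (s, fst z)" if a: "a \<in> ?S" and ab: "(a, b) \<in> adj {} \<omega>" for a b
  proof (cases "a = ?w")
    case True
    obtain s' y where y: "y \<in> HE s'" "a = (s', fst y)" "b = (\<not> s', fst (partner s' \<omega> y))"
      using ab by (auto simp: adj_def)
    then have s': "s' = (\<not> s)" "fst y = fst ?z" using True by auto
    show ?thesis
    proof (cases "y = ?z")
      case True
      then show ?thesis using y s' partner_partner[OF w Suc.prems(1)] by simp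
    next
      case False
      moreover have "y \<in> HE (\<not> s)" using y(1) s'(1) by simp
      ultimately have "(\<not> s, y) \<in> siblings (\<not> s) ?z" using s'(2) unfolding siblings_def by blast
      then have "y \<in> ?O" unfolding others_simps(3)[OF z', symmetric] by auto
      then show ?thesis using T y s' by auto
    qed
  next
    case False
    then obtain y where y: "y \<in> ?O" "a \<in> T y" using a by auto
    then have "b \<in> T y \<or> b = ?w" using T ab by blast
    then show ?thesis using y by auto
  qed
  show ?case
    by (rule exI[of _ ?S]) (use c closed T in auto)
qed

lemma died_root_small:
  assumes w: "\<omega> \<in> MM" and cls: "\<And>s v. cls s v = None \<Longrightarrow> dg s v \<le> \<Delta>" "\<And>s v. cls s v \<noteq> Some True"
    and v: "v \<in> {1..sz s}" and died: "snd (run \<omega> (explore_root cls wt r s v))"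
  shows "card (component {} \<omega> (s, v)) \<le> 1 + dg s v * explored_size \<Delta> (Suc r)"
proof -
  let ?O = "set (all_at s v)"
  have O: "z \<in> HE s \<and> fst z = v" if "z \<in> ?O" for z using that all_at_simps(3)[OF v] by auto
  have "\<forall>z\<in>?O. \<exists>S. finite S \<and> card S \<le> explored_size \<Delta> (Suc r) \<and> (\<not> s, fst (partner s \<omega> z)) \<in> S \<and>
     (\<forall>a\<in>S. \<forall>b. (a, b) \<in> adj {} \<omega> \<longrightarrow> b \<in> S \<or> b = (s, v))"
  proof
    fix z assume z: "z \<in> ?O"
    have "run \<omega> (explore cls (Suc r) s z)" using died z by (simp add: explore_root_def run_explore_list)
    from died_closed[OF w cls _ this] O[OF z]
    show "\<exists>S. finite S \<and> card S \<le> explored_size \<Delta> (Suc r) \<and> (\<not> s, fst (partner s \<omega> z)) \<in> S \<and>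
     (\<forall>a\<in>S. \<forall>b. (a, b) \<in> adj {} \<omega> \<longrightarrow> b \<in> S \<or> b = (s, v))" by simp
  qed
  then obtain T where T: "\<forall>z\<in>?O. finite (T z) \<and> card (T z) \<le> explored_size \<Delta> (Suc r) \<and>
     (\<not> s, fst (partner s \<omega> z)) \<in> T z \<and> (\<forall>a\<in>T z. \<forall>b. (a, b) \<in> adj {} \<omega> \<longrightarrow> b \<in> T z \<or> b = (s, v))"
    by metis
  let ?S = "insert (s, v) (\<Union>z\<in>?O. T z)"
  have closed: "b \<in> ?S" if a: "a \<in> ?S" and ab: "(a, b) \<in> adj {} \<omega>" for a b
  proof (cases "a = (s, v)")
    case True
    obtain s' y where y: "y \<in> HE s'" "a = (s', fst y)" "b = (\<not> s', fst (partner s' \<omega> y))"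
      using ab by (auto simp: adj_def)
    then have "y \<in> ?O" "s' = s" using True all_at_simps(3)[OF v] by auto
    then show ?thesis using T y by auto
  next
    case False
    then show ?thesis using a T ab by blast
  qed
  have "component {} \<omega> (s, v) \<subseteq> ?S"
  proof
    fix b assume "b \<in> component {} \<omega> (s, v)"
    then have "((s, v), b) \<in> (adj {} \<omega>)\<^sup>*" by (simp add: component_def)
    then show "b \<in> ?S"
    proof (induct rule: rtrancl_induct)
      case (step y z)
      then show ?case by (rule_tac closed)
    qed simp
  qed
  then have "card (component {} \<omega> (s, v)) \<le> card ?S" by (rule card_mono[rotated]) (use T in auto)
  also have "\<dots> \<le> 1 + card (\<Union>z\<in>?O. T z)" using T by (simp add: card_insert_if)
  also have "card (\<Union>z\<in>?O. T z) \<le> (\<Sum>z\<in>?O. card (T z))" by (rule card_UN_le) simp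
  also have "\<dots> \<le> (\<Sum>z\<in>?O. explored_size \<Delta> (Suc r))" by (rule sum_mono) (use T in auto)
  also have "\<dots> = dg s v * explored_size \<Delta> (Suc r)"
    by (simp add: distinct_card all_at_simps(1,2) del: explored_size.simps)
  finally show ?thesis by simp
qed

text \<open>
  If stopped vertices are never counted as survivors and flagged vertices are always stopped, an
  exploration survives only along a path of unflagged vertices through all \<open>r\<close>
  generations. Freshness makes these vertices distinct.
\<close>

lemma alive_path:
  assumes w: "\<omega> \<in> MM" and cls: "\<And>s v. cls s v \<noteq> Some False" "\<And>s v. blocked F (s, v) \<Longrightarrow> cls s v \<noteq> None"
    and z: "z \<in> HE s" and alive: "\<not> run \<omega> (explore cls r s z)" and fr: "fresh \<omega> (explore cls r s z) W"
  shows "\<exists>S. finite S \<and> card S = r \<and> S \<inter> W = {} \<and> (\<forall>a\<in>S. \<not> blocked F a) \<and>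
     (r > 0 \<longrightarrow> (\<not> s, fst (partner s \<omega> z)) \<in> S) \<and> S \<subseteq> component F \<omega> (\<not> s, fst (partner s \<omega> z))"
  using z alive fr
proof (induct r arbitrary: s z W)
  case 0
  then show ?case by (intro exI[of _ "{}"]) simp
next
  case (Suc r)
  let ?z = "partner s \<omega> z"
  let ?w = "(\<not> s, fst ?z)"
  have z': "?z \<in> HE (\<not> s)" using partner_in[OF w Suc.prems(1)] .
  have st: "\<not> run \<omega> (visit cls r (\<not> s) ?z)" using Suc.prems(2) by (simp add: explore_Suc)
  have fr: "?w \<notin> W" "fresh \<omega> (visit cls r (\<not> s) ?z) (insert ?w W)" using Suc.prems(3) by (auto simp: explore_Suc)
  have none: "cls (\<not> s) (fst ?z) = None"
    using st cls(1)[of "\<not> s" "fst ?z"] by (cases "cls (\<not> s) (fst ?z)") (auto simp: visit_def)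
  have wb: "\<not> blocked F ?w" using cls(2) none by blast
  obtain y where y: "y \<in> set (others (\<not> s) ?z)" and na: "\<not> run \<omega> (explore cls r (\<not> s) y)"
    using st none by (auto simp: visit_def run_all_died)
  have yH: "y \<in> HE (\<not> s)" "fst y = fst ?z" using others_simps(4)[OF z' y] by auto
  obtain W' where W': "insert ?w W \<subseteq> W'" "fresh \<omega> (explore cls r (\<not> s) y) W'"
    using fresh_all_died[OF _ y, of \<omega> "explore cls r (\<not> s)" "insert ?w W"] fr(2) none by (auto simp: visit_def)
  from Suc.hyps[OF yH(1) na W'(2)] obtain S where S: "finite S" "card S = r" "S \<inter> W' = {}"
    "\<forall>a\<in>S. \<not> blocked F a" "r > 0 \<longrightarrow> (s, fst (partner (\<not> s) \<omega> y)) \<in> S"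
    "S \<subseteq> component F \<omega> (s, fst (partner (\<not> s) \<omega> y))" by auto
  have con: "S \<subseteq> component F \<omega> ?w"
  proof (cases "r = 0")
    case True then show ?thesis using S by auto
  next
    case False
    then have "\<not> blocked F (s, fst (partner (\<not> s) \<omega> y))" using S by auto
    then have "(?w, (s, fst (partner (\<not> s) \<omega> y))) \<in> adj F \<omega>"
      using adjI[OF yH(1), of F \<omega>] wb yH(2) by simp
    then show ?thesis using S(6) by (auto simp: component_def intro: converse_rtrancl_into_rtrancl)
  qed
  show ?case
  proof (intro exI[of _ "insert ?w S"] conjI)
    have "?w \<notin> S" using S(3) W'(1) by auto
    then show "card (insert ?w S) = Suc r" using S by simp
    show "insert ?w S \<subseteq> component F \<omega> ?w" using con by (auto simp: component_def)
  qed (use S W' fr wb in auto)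
qed

lemma alive_root:
  assumes w: "\<omega> \<in> MM" and cls: "\<And>s v. cls s v \<noteq> Some False" "\<And>s v. blocked F (s, v) \<Longrightarrow> cls s v \<noteq> None"
    and v: "v \<in> {1..sz s}" and alive: "\<not> snd (run \<omega> (explore_root cls wt r s v))"
    and fr: "fresh \<omega> (explore_root cls wt r s v) W"
  shows "\<exists>z\<in>HE s. fst z = v \<and> \<not> blocked F (\<not> s, fst (partner s \<omega> z)) \<and> (\<exists>S. finite S \<and> card S = Suc r \<and>
       S \<subseteq> component F \<omega> (\<not> s, fst (partner s \<omega> z)))"
proof -
  obtain z where z: "z \<in> set (all_at s v)" and al: "\<not> run \<omega> (explore cls (Suc r) s z)"
    using alive by (auto simp: explore_root_def run_explore_list)
  have zH: "z \<in> HE s" "fst z = v" using z all_at_simps(3)[OF v] by auto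
  obtain W' where "fresh \<omega> (explore cls (Suc r) s z) W'"
    using fresh_explore_list[OF fr[unfolded explore_root_def] z] by blast
  from alive_path[OF w cls zH(1) al this] zH show ?thesis by blast
qed

lemma run_root_weight:
  assumes "v \<in> {1..sz s}"
  shows "fst (run \<omega> (explore_root cls wt r s v)) = (\<Sum>i=1..dg s v. wt (\<not> s) (partner s \<omega> (v, i)))"
proof -
  have "fst (run \<omega> (explore_root cls wt r s v)) = (\<Sum>z\<leftarrow>all_at s v. wt (\<not> s) (partner s \<omega> z))"
    by (simp add: explore_root_def run_explore_list)
  also have "\<dots> = (\<Sum>i\<in>set [1..<Suc (dg s v)]. wt (\<not> s) (partner s \<omega> (v, i)))"
    unfolding all_at_def by (subst sum.distinct_set_conv_list) (simp_all add: comp_def)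
  also have "set [1..<Suc (dg s v)] = {1..dg s v}" by auto
  finally show ?thesis .
qed

end

section \<open>Joining large components through flagged vertices\<close>

lemma card_fibers:
  assumes "finite A" "finite P" "g ` A \<subseteq> P"
  shows "card A = (\<Sum>p\<in>P. card {a\<in>A. g a = p})"
  using sum.group[OF assms, of "\<lambda>_. 1::nat"] by simp

text \<open>
  Colour classes that cannot be divided into two groups both of size at least \<open>a\<close>:
  the union of a minimal number of classes that reaches size \<open>a\<close> must consist of
  one class, since dropping any class makes it small while its total exceeds \<open>2 *
  a\<close>.
\<close>

lemma dominant_class:
  fixes \<kappa> :: "'x \<Rightarrow> 'c"
  assumes X: "finite X" "card X \<ge> 3 * a"
    and split: "\<And>\<G>. card {x\<in>X. \<kappa> x \<in> \<G>} < a \<or> card {x\<in>X. \<kappa> x \<notin> \<G>} < a"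
  shows "\<exists>c. card {x\<in>X. \<kappa> x \<noteq> c} < a"
proof -
  let ?P = "\<lambda>\<G>. finite \<G> \<and> card {x\<in>X. \<kappa> x \<in> \<G>} \<ge> a"
  have "?P (\<kappa> ` X)"
  proof -
    have "{x\<in>X. \<kappa> x \<in> \<kappa> ` X} = X" by auto
    then show ?thesis using X by simp
  qed
  then obtain \<G> where G: "?P \<G>" and min: "\<And>\<G>'. ?P \<G>' \<Longrightarrow> card \<G> \<le> card \<G>'"
    using ex_has_least_nat[of ?P "\<kappa> ` X" card] by blast
  have cmp: "card {x\<in>X. \<kappa> x \<in> \<H>} + card {x\<in>X. \<kappa> x \<notin> \<H>} = card X" for \<H>
    by (subst card_Un_disjoint[symmetric]) (use X in \<open>auto intro: arg_cong[of _ _ card]\<close>)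
  have out: "card {x\<in>X. \<kappa> x \<notin> \<G>} < a" using split[of \<G>] G by auto
  then have big: "card {x\<in>X. \<kappa> x \<in> \<G>} > 2 * a" using cmp[of \<G>] X(2) by linarith
  then have "\<G> \<noteq> {}" by (intro notI) simp
  then obtain c where c: "c \<in> \<G>" by auto
  have "\<not> ?P (\<G> - {c})"
    using min[of "\<G> - {c}"] G c by (metis card_Diff1_less not_le)
  then have small: "card {x\<in>X. \<kappa> x \<in> \<G> - {c}} < a" using G by auto
  have "card {x\<in>X. \<kappa> x \<in> \<G>} \<le> card {x\<in>X. \<kappa> x \<in> \<G> - {c}} + card {x\<in>X. \<kappa> x \<in> {c}}"
    by (rule order_trans[OF card_mono card_Un_le]) (use X in auto)
  then have "card {x\<in>X. \<kappa> x \<in> {c}} \<ge> a" using big small by linarith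
  then have "card {x\<in>X. \<kappa> x \<notin> {c}} < a" using split[of "{c}"] by auto
  then show ?thesis by auto
qed

context bipartite
begin

text \<open>
  Each vertex \<open>b\<close> of the list has two hidden half-edges \<open>(b, 1)\<close> and
  \<open>(b, 2)\<close>. Whatever was revealed, they hit \<open>SA\<close> and \<open>SB\<close>
  with probability at least \<open>(a / h)\<^sup>2\<close>; revealing them removes at most two
  elements from each set, which explains the surplus of \<open>2 * length bs\<close>.
\<close>

lemma pair_miss:
  assumes "distinct bs"
    and "\<And>b. b \<in> set bs \<Longrightarrow> (b, 1) \<in> HE False \<and> (b, 2) \<in> HE False \<and> (b, 1) \<notin> snd ` u \<and> (b, 2) \<notin> snd ` u"
    and "SA \<subseteq> HE True - fst ` u" "SB \<subseteq> HE True - fst ` u" "SA \<inter> SB = {}"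
    and "card SA \<ge> a + 2 * length bs" "card SB \<ge> a + 2 * length bs"
  shows "real (card {\<omega> \<in> ext u. \<forall>b\<in>set bs. \<not> (partner False \<omega> (b, 1) \<in> SA \<and> partner False \<omega> (b, 2) \<in> SB)})
     \<le> (1 - (real a / real h)\<^sup>2) ^ length bs * real (card (ext u))"
  using assms
proof (induct bs arbitrary: u SA SB)
  case Nil
  then show ?case by (auto intro!: card_mono simp: ext_def)
next
  case (Cons b bs)
  let ?q = "1 - (real a / real h)\<^sup>2"
  let ?miss = "\<lambda>bs SA SB \<omega>. \<forall>b\<in>set bs. \<not> (partner False \<omega> (b, 1) \<in> SA \<and> partner False \<omega> (b, 2) \<in> SB)"
  define g where "g = (\<lambda>\<omega>. (partner False \<omega> (b, 1), partner False \<omega> (b, 2)))"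
  define P where "P = {(x, x'). x \<in> HE True - fst ` u \<and> x' \<in> HE True - fst ` u \<and> x \<noteq> x'}"
  define u2 where "u2 = (\<lambda>p. insert (snd p, (b, 2::nat)) (insert (fst p, (b, 1::nat)) u))"
  have fP: "finite P" unfolding P_def by (rule finite_subset[of _ "HE True \<times> HE True"]) auto
  have b: "(b, 1) \<in> HE False" "(b, 2) \<in> HE False" "(b, 1) \<notin> snd ` u" "(b, 2) \<notin> snd ` u"
    using Cons.prems(2)[of b] by auto
  have gP: "g ` ext u \<subseteq> P"
  proof (rule image_subsetI)
    fix \<omega> assume w: "\<omega> \<in> ext u"
    then have wM: "\<omega> \<in> MM" by (auto simp: ext_def)
    have y: "partner False \<omega> y \<in> HE True - fst ` u \<and> \<omega> (partner False \<omega> y) = y"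
      if "y \<in> HE False" "y \<notin> snd ` u" for y
    proof -
      have "partner False \<omega> y \<in> HE True" "\<omega> (partner False \<omega> y) = y"
        using partner_in[OF wM that(1)] partner_partner[OF wM that(1)] by (auto simp: partner_def)
      moreover have "partner False \<omega> y \<notin> fst ` u"
      proof
        assume "partner False \<omega> y \<in> fst ` u"
        then obtain y' where "(partner False \<omega> y, y') \<in> u" by auto
        then have "y' = y" using w calculation by (auto simp: ext_def)
        then show False using \<open>(partner False \<omega> y, y') \<in> u\<close> that by force
      qed
      ultimately show ?thesis by auto
    qed
    have "partner False \<omega> (b, 1) \<noteq> partner False \<omega> (b, 2)"
      using y[OF b(1,3)] y[OF b(2,4)] by (metis Pair_inject one_eq_numeral_iff num.distinct(1))
    then show "g \<omega> \<in> P" using y[OF b(1,3)] y[OF b(2,4)] by (auto simp: g_def P_def)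
  qed
  have fib: "{\<omega> \<in> ext u. g \<omega> = p} = ext (u2 p)" if p: "p \<in> P" for p
  proof -
    obtain x x' where px: "p = (x, x')" by (cases p)
    have x: "x \<in> HE True" "x' \<in> HE True" using p px by (auto simp: P_def)
    show ?thesis
      using ext_insert_pr[of "(b, 1)" False x u] ext_insert_pr[of "(b, 2)" False x' "insert (x, (b, 1)) u"] x b
      by (auto simp: u2_def px g_def pr_def)
  qed
  (* any prescribed pair of partners has conditional probability at least 1/h^2 *)
  have lower: "real (card (ext u)) / (real h)\<^sup>2 \<le> real (card (ext (u2 p)))" if p: "p \<in> P" for p
  proof -
    obtain x x' where px: "p = (x, x')" by (cases p)
    have x: "x \<in> HE True" "x' \<in> HE True" "x \<notin> fst ` u" "x' \<notin> fst ` u" "x \<noteq> x'" using p px by (auto simp: P_def)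
    have hp: "h > 0" using x(1) card_HE[of True] by (metis card_gt_0_iff empty_iff finite_HE)
    have "card (ext u) \<le> h * card (ext (insert (x, (b, 1)) u))"
      by (rule card_ext_le) (use x b in auto)
    also have "card (ext (insert (x, (b, 1)) u)) \<le> h * card (ext (u2 p))"
      unfolding u2_def px fst_conv snd_conv by (rule card_ext_le) (use x b in auto)
    finally have "card (ext u) \<le> h * (h * card (ext (u2 p)))" by simp
    then have "real (card (ext u)) \<le> (real h)\<^sup>2 * real (card (ext (u2 p)))"
      by (metis of_nat_le_iff of_nat_mult mult.assoc power2_eq_square)
    then show ?thesis using hp by (simp add: divide_le_eq mult.commute)
  qed
  have sub: "SA \<times> SB \<subseteq> P" using Cons.prems(3-5) by (auto simp: P_def)
  let ?A = "{\<omega> \<in> ext u. ?miss (b # bs) SA SB \<omega>}"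
  have tot: "real (card (ext u)) = (\<Sum>p\<in>P. real (card (ext (u2 p))))"
    using card_fibers[OF finite_ext fP gP] fib by simp
  have q0: "?q ^ length bs \<ge> 0"
  proof (cases "h = 0 \<or> bs = []")
    case False
    have "a \<le> h"
    proof -
      have "card SA \<le> card (HE True)" by (rule card_mono) (use Cons.prems(3) in auto)
      then show ?thesis using Cons.prems(6) card_HE[of True] by simp
    qed
    then have "(real a / real h)\<^sup>2 \<le> 1\<^sup>2" using False by (intro power_mono) auto
    then show ?thesis by simp
  qed auto
  have "g ` ?A \<subseteq> P" using gP by auto
  moreover have "finite ?A" by (rule finite_subset[OF _ finite_ext[of u]]) auto
  ultimately have cA: "card ?A = (\<Sum>p\<in>P. card {\<omega>\<in>?A. g \<omega> = p})"
    using fP by (intro card_fibers)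
  have "real (card ?A) = (\<Sum>p\<in>P. real (card {\<omega>\<in>?A. g \<omega> = p}))"
    by (simp only: cA of_nat_sum)
  also have "\<dots> = (\<Sum>p\<in>P - SA \<times> SB. real (card {\<omega>\<in>?A. g \<omega> = p}))"
  proof (rule sum.mono_neutral_right)
    show "\<forall>p\<in>P - (P - SA \<times> SB). real (card {\<omega>\<in>?A. g \<omega> = p}) = 0"
    proof
      fix p assume "p \<in> P - (P - SA \<times> SB)"
      then have "{\<omega>\<in>?A. g \<omega> = p} = {}" by (auto simp: g_def)
      then show "real (card {\<omega>\<in>?A. g \<omega> = p}) = 0" by (metis card.empty of_nat_0)
    qed
  qed (use fP in auto)
  also have "\<dots> \<le> (\<Sum>p\<in>P - SA \<times> SB. ?q ^ length bs * real (card (ext (u2 p))))"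
  proof (rule sum_mono)
    fix p assume "p \<in> P - SA \<times> SB"
    then have p: "p \<in> P" by simp
    obtain x x' where px: "p = (x, x')" by (cases p)
    have x: "x \<in> HE True" "x' \<in> HE True" "x \<notin> fst ` u" "x' \<notin> fst ` u" "x \<noteq> x'" using p px by (auto simp: P_def)
    let ?SA = "SA - {x, x'}" and ?SB = "SB - {x, x'}"
    have fs: "finite SA" "finite SB"
      using Cons.prems(3,4) finite_HE[of True] by (meson Diff_subset finite_subset order_trans)+
    have c2: "card {x, x'} = 2" using x by simp
    have "real (card {\<omega>\<in>?A. g \<omega> = p}) \<le> real (card {\<omega> \<in> ext (u2 p). ?miss bs ?SA ?SB \<omega>})"
      by (intro of_nat_mono card_mono) (use fib[OF p] in auto)
    also have "\<dots> \<le> ?q ^ length bs * real (card (ext (u2 p)))"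
    proof (rule Cons.hyps)
      show "distinct bs" using Cons.prems(1) by simp
      show "?SA \<subseteq> HE True - fst ` u2 p" "?SB \<subseteq> HE True - fst ` u2 p" "?SA \<inter> ?SB = {}"
        using Cons.prems(3-5) by (auto simp: u2_def px)
      show "(b', 1) \<in> HE False \<and> (b', 2) \<in> HE False \<and> (b', 1) \<notin> snd ` u2 p \<and> (b', 2) \<notin> snd ` u2 p"
        if "b' \<in> set bs" for b' using Cons.prems(1) Cons.prems(2)[of b'] that by (auto simp: u2_def px)
      have "card SA - card {x, x'} \<le> card ?SA" "card SB - card {x, x'} \<le> card ?SB"
        by (rule diff_card_le_card_Diff, simp)+
      then show "card ?SA \<ge> a + 2 * length bs" "card ?SB \<ge> a + 2 * length bs"
        using Cons.prems(6,7) c2 by simp_all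
    qed
    finally show "real (card {\<omega>\<in>?A. g \<omega> = p}) \<le> ?q ^ length bs * real (card (ext (u2 p)))" .
  qed
  also have "\<dots> = ?q ^ length bs * (real (card (ext u)) - (\<Sum>p\<in>SA \<times> SB. real (card (ext (u2 p)))))"
    unfolding tot sum_distrib_left[symmetric] using sum_diff[OF fP sub, of "\<lambda>p. real (card (ext (u2 p)))"] by simp
  also have "\<dots> \<le> ?q ^ length bs * (real (card (ext u)) * ?q)"
  proof (rule mult_left_mono[OF _ q0])
    have "real a * real a \<le> real (card SA) * real (card SB)"
      using Cons.prems(6,7) by (intro mult_mono) auto
    then have "(real a)\<^sup>2 * (real (card (ext u)) / (real h)\<^sup>2) \<le> real (card SA * card SB) * (real (card (ext u)) / (real h)\<^sup>2)"
      by (intro mult_right_mono) (auto simp: power2_eq_square)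
    also have "\<dots> = (\<Sum>p\<in>SA \<times> SB. real (card (ext u)) / (real h)\<^sup>2)"
      by (simp add: card_cartesian_product)
    also have "\<dots> \<le> (\<Sum>p\<in>SA \<times> SB. real (card (ext (u2 p))))"
      by (rule sum_mono) (use lower sub in auto)
    finally show "real (card (ext u)) - (\<Sum>p\<in>SA \<times> SB. real (card (ext (u2 p)))) \<le> real (card (ext u)) * ?q"
      by (simp add: algebra_simps power_divide)
  qed
  finally show ?case unfolding length_Cons power_Suc by (simp only: mult_ac)
qed

subsection \<open>Revealing everything except the flagged right vertices\<close>

text \<open>
  All matched pairs whose right half-edge belongs to an unflagged vertex. Conditioning on them
  fixes the graph without the flagged vertices and leaves the half-edges of the flagged ones
  uniformly matched to the remaining left half-edges.
\<close>

definition revealed :: "nat set \<Rightarrow> (nat \<times> nat \<Rightarrow> nat \<times> nat) \<Rightarrow> ((nat \<times> nat) \<times> (nat \<times> nat)) set" where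
  "revealed F \<omega> = (\<lambda>x. (x, \<omega> x)) ` {x \<in> HE True. fst (\<omega> x) \<notin> F}"

lemma revealed_iff: "(x, y) \<in> revealed F \<omega> \<longleftrightarrow> x \<in> HE True \<and> y = \<omega> x \<and> fst y \<notin> F"
  by (auto simp: revealed_def)

lemma fst_revealed: "fst ` revealed F \<omega> = {x \<in> HE True. fst (\<omega> x) \<notin> F}"
  by (simp add: revealed_def image_image)

lemma ext_revealed:
  assumes w: "\<omega> \<in> MM" shows "ext (revealed F \<omega>) = {\<omega>' \<in> MM. revealed F \<omega>' = revealed F \<omega>}"
proof
  show "{\<omega>' \<in> MM. revealed F \<omega>' = revealed F \<omega>} \<subseteq> ext (revealed F \<omega>)"
  proof
    fix \<omega>' assume "\<omega>' \<in> {\<omega>' \<in> MM. revealed F \<omega>' = revealed F \<omega>}"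
    then have "\<omega>' \<in> MM" and e: "revealed F \<omega>' = revealed F \<omega>" by auto
    moreover have "x \<in> HE True \<and> \<omega>' x = y" if "(x, y) \<in> revealed F \<omega>" for x y
      using that unfolding e[symmetric] revealed_iff by auto
    ultimately show "\<omega>' \<in> ext (revealed F \<omega>)" by (auto simp: ext_def)
  qed
  show "ext (revealed F \<omega>) \<subseteq> {\<omega>' \<in> MM. revealed F \<omega>' = revealed F \<omega>}"
  proof
    fix \<omega>' assume w': "\<omega>' \<in> ext (revealed F \<omega>)"
    then have wM: "\<omega>' \<in> MM" by (auto simp: ext_def)
    have same: "\<omega>' x = \<omega> x" if "x \<in> HE True" "fst (\<omega> x) \<notin> F" for x
      proof -
      have "(x, \<omega> x) \<in> revealed F \<omega>" using that by (simp add: revealed_iff)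
      then show ?thesis using w' by (fastforce simp: ext_def)
    qed
    have "fst (\<omega> x) \<notin> F" if x: "x \<in> HE True" "fst (\<omega>' x) \<notin> F" for x
    proof -
      have "\<omega>' x \<in> HE False" using MM_bij[OF wM] x by (auto simp: bij_betw_def)
      then obtain x' where x': "x' \<in> HE True" "\<omega> x' = \<omega>' x"
        using MM_bij[OF w] unfolding bij_betw_def by (metis image_iff)
      then have "\<omega>' x' = \<omega>' x" using same[of x'] x by simp
      then have "x' = x" using MM_bij[OF wM] x x' by (auto simp: bij_betw_def inj_on_def)
      then show ?thesis using x' x by simp
    qed
    then have "revealed F \<omega>' = revealed F \<omega>" unfolding revealed_def using same by (intro image_cong) auto
    then show "\<omega>' \<in> {\<omega>' \<in> MM. revealed F \<omega>' = revealed F \<omega>}" using wM by simp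
  qed
qed

lemma adj_revealed:
  assumes w: "\<omega> \<in> MM"
  shows "adj F \<omega> = (\<Union>(x, y)\<in>revealed F \<omega>. {((True, fst x), (False, fst y)), ((False, fst y), (True, fst x))})"
    (is "_ = ?R")
proof
  show "adj F \<omega> \<subseteq> ?R"
  proof
    fix p assume p: "p \<in> adj F \<omega>"
    then obtain s z where z: "z \<in> HE s" "p = ((s, fst z), (\<not> s, fst (partner s \<omega> z)))"
      "\<not> blocked F (s, fst z)" "\<not> blocked F (\<not> s, fst (partner s \<omega> z))" by (auto simp: adj_def)
    show "p \<in> ?R"
    proof (cases s)
      case True
      then have "(z, \<omega> z) \<in> revealed F \<omega>" using z by (simp add: revealed_iff partner_def blocked_def)
      then show ?thesis using z True by (intro UN_I[of "(z, \<omega> z)"]) (simp_all add: partner_def)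
    next
      case False
      let ?x = "partner False \<omega> z"
      have "?x \<in> HE True" "\<omega> ?x = z"
        using partner_in[OF w z(1)] partner_partner[OF w z(1)] False by (auto simp: partner_def)
      then have "(?x, z) \<in> revealed F \<omega>" using z False by (simp add: revealed_iff blocked_def)
      then show ?thesis using z False by (intro UN_I[of "(?x, z)"]) simp_all
    qed
  qed
  show "?R \<subseteq> adj F \<omega>"
  proof
    fix p assume "p \<in> ?R"
    then obtain x where x: "x \<in> HE True" "fst (\<omega> x) \<notin> F"
      "p = ((True, fst x), (False, fst (\<omega> x))) \<or> p = ((False, fst (\<omega> x)), (True, fst x))"
      by (auto simp: revealed_def)
    have "((True, fst x), (False, fst (\<omega> x))) \<in> adj F \<omega>"
      using adjI[of x True F \<omega>] x by (simp add: blocked_def partner_def)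
    then show "p \<in> adj F \<omega>" using x(3) sym_adj[OF w, of F] by (auto dest: symD)
  qed
qed

lemma component_eq:
  assumes w: "\<omega> \<in> MM" and b: "b \<in> component F \<omega> a"
  shows "component F \<omega> b = component F \<omega> a"
proof -
  have s: "sym ((adj F \<omega>)\<^sup>*)" using sym_adj[OF w] by (rule sym_rtrancl)
  have ab: "(a, b) \<in> (adj F \<omega>)\<^sup>*" using b by (simp add: component_def)
  then have ba: "(b, a) \<in> (adj F \<omega>)\<^sup>*" using s by (meson symD)
  show ?thesis unfolding component_def using ab ba by (auto intro: rtrancl_trans)
qed

lemma component_mono: "component F \<omega> a \<subseteq> component {} \<omega> a"
proof -
  have "adj F \<omega> \<subseteq> adj {} \<omega>" by (auto simp: adj_def blocked_def)
  then have "(adj F \<omega>)\<^sup>* \<subseteq> (adj {} \<omega>)\<^sup>*" by (rule rtrancl_mono)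
  then show ?thesis unfolding component_def by blast
qed

lemma component_self: "a \<in> component F \<omega> a"
  by (simp add: component_def)

definition vertex_set :: "(bool \<times> nat) set" where "vertex_set = (SIGMA s:UNIV. {1..sz s})"

lemma finite_vertex_set [simp]: "finite vertex_set" and card_vertex_set: "card vertex_set = sz True + sz False"
proof -
  show "finite vertex_set" by (simp add: vertex_set_def)
  have "card vertex_set = (\<Sum>s\<in>UNIV. card {1..sz s})" unfolding vertex_set_def by (rule card_SigmaI) auto
  then show "card vertex_set = sz True + sz False" by (simp add: UNIV_bool)
qed

lemma component_vertex_set:
  assumes w: "\<omega> \<in> MM" and a: "a \<in> vertex_set" shows "component F \<omega> a \<subseteq> vertex_set"
proof
  fix b assume "b \<in> component F \<omega> a"
  then have "(a, b) \<in> (adj F \<omega>)\<^sup>*" by (simp add: component_def)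
  then show "b \<in> vertex_set"
  proof (induct rule: rtrancl_induct)
    case (step y z)
    from step(2) obtain s x where x: "x \<in> HE s" "z = (\<not> s, fst (partner s \<omega> x))" by (auto simp: adj_def)
    then show ?case using partner_in[OF w x(1)] by (auto simp: HE_def vertex_set_def)
  qed (rule a)
qed

lemma finite_component: "\<omega> \<in> MM \<Longrightarrow> a \<in> vertex_set \<Longrightarrow> finite (component F \<omega> a)"
  using component_vertex_set finite_vertex_set finite_subset by metis

definition big_components :: "nat set \<Rightarrow> nat \<Rightarrow> (nat \<times> nat \<Rightarrow> nat \<times> nat) \<Rightarrow> (bool \<times> nat) set set" where
  "big_components F r \<omega> = {B. \<exists>v\<in>{1..sz True}. B = component F \<omega> (True, v) \<and> card B \<ge> r}"

lemma finite_big_components [simp]: "finite (big_components F r \<omega>)"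
  by (rule finite_subset[of _ "(\<lambda>v. component F \<omega> (True, v)) ` {1..sz True}"]) (auto simp: big_components_def)

lemma big_components_eq: "\<omega> \<in> MM \<Longrightarrow> B \<in> big_components F r \<omega> \<Longrightarrow> b \<in> B \<Longrightarrow> B = component F \<omega> b"
proof -
  assume w: "\<omega> \<in> MM" and B: "B \<in> big_components F r \<omega>" and b: "b \<in> B"
  obtain v where "B = component F \<omega> (True, v)" using B by (auto simp: big_components_def)
  then show "B = component F \<omega> b" using component_eq[OF w] b by simp
qed

lemma card_big_components:
  assumes w: "\<omega> \<in> MM"
  shows "card (big_components F r \<omega>) * r \<le> sz True + sz False"
proof -
  have fin: "finite B" and sub: "B \<subseteq> vertex_set" if "B \<in> big_components F r \<omega>" for B
    using that component_vertex_set[OF w] finite_component[OF w] by (auto simp: big_components_def vertex_set_def)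
  have disj: "B \<inter> B' = {}" if "B \<in> big_components F r \<omega>" "B' \<in> big_components F r \<omega>" "B \<noteq> B'" for B B'
  proof (rule ccontr)
    assume "B \<inter> B' \<noteq> {}"
    then obtain b where "b \<in> B" "b \<in> B'" by auto
    then show False using that big_components_eq[OF w] by metis
  qed
  have "card (big_components F r \<omega>) * r = (\<Sum>B\<in>big_components F r \<omega>. r)" by simp
  also have "\<dots> \<le> (\<Sum>B\<in>big_components F r \<omega>. card B)" by (rule sum_mono) (auto simp: big_components_def)
  also have "\<dots> = card (\<Union>(big_components F r \<omega>))"
    by (rule card_Union_disjoint[symmetric]) (use fin disj in \<open>auto simp: pairwise_def disjnt_def\<close>)
  also have "\<dots> \<le> card vertex_set" by (rule card_mono) (use sub in auto)
  finally show ?thesis by (simp add: card_vertex_set)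
qed

text \<open>
  The left half-edges matched to flagged vertices whose owners lie in one of the sets in
  \<open>\<A>\<close>. Which half-edges these are is determined by \<open>revealed\<close>,
  although their partners are not.
\<close>

definition loose :: "nat set \<Rightarrow> (nat \<times> nat \<Rightarrow> nat \<times> nat) \<Rightarrow> (bool \<times> nat) set set \<Rightarrow> (nat \<times> nat) set" where
  "loose F \<omega> \<A> = {x \<in> HE True - fst ` revealed F \<omega>. (True, fst x) \<in> \<Union>\<A>}"

lemma loose_iff: "x \<in> loose F \<omega> \<A> \<longleftrightarrow> x \<in> HE True \<and> fst (\<omega> x) \<in> F \<and> (True, fst x) \<in> \<Union>\<A>"
proof -
  show ?thesis unfolding loose_def fst_revealed by blast
qed

lemma finite_loose [simp]: "finite (loose F \<omega> \<A>)"
  by (rule finite_subset[of _ "HE True"]) (auto simp: loose_def)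

text \<open>
  Every division of the large components into two families, each with at least \<open>a\<close>
  loose half-edges, is bridged by one of the flagged vertices in \<open>bs\<close>.
\<close>

definition merged :: "nat set \<Rightarrow> nat \<Rightarrow> nat \<Rightarrow> nat list \<Rightarrow> (nat \<times> nat \<Rightarrow> nat \<times> nat) \<Rightarrow> bool" where
  "merged F r a bs \<omega> \<longleftrightarrow> (\<forall>\<A>\<subseteq>big_components F r \<omega>. a \<le> card (loose F \<omega> \<A>) \<longrightarrow>
     a \<le> card (loose F \<omega> (big_components F r \<omega> - \<A>)) \<longrightarrow>
     (\<exists>b\<in>set bs. partner False \<omega> (b, 1) \<in> loose F \<omega> \<A> \<and>
        partner False \<omega> (b, 2) \<in> loose F \<omega> (big_components F r \<omega> - \<A>)))"

text \<open>
  Condition on the revealed pairs; the large components are then fixed, and there are at most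
  (number of vertices)/\<open>r\<close> of them. The bound is a union bound over the divisions,
  each of which survives all vertices of \<open>bs\<close> with the probability of
  \<open>pair_miss\<close>.
\<close>

lemma not_merged_bound:
  assumes r: "r > 0" and bs: "distinct bs" "\<And>b. b \<in> set bs \<Longrightarrow> b \<in> F \<and> b \<in> {1..sz False} \<and> dg False b \<ge> 2"
    and a: "a \<ge> a0 + 2 * length bs" and a0: "a0 \<le> h"
  shows "real (card {\<omega> \<in> MM. \<not> merged F r a bs \<omega>}) \<le>
    2 ^ ((sz True + sz False) div r) * (1 - (real a0 / real h)\<^sup>2) ^ length bs * real (card MM)"
proof -
  let ?q = "(1 - (real a0 / real h)\<^sup>2) ^ length bs"
  let ?m = "(sz True + sz False) div r"
  have q0: "?q \<ge> 0"
  proof -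
    have "(real a0 / real h)\<^sup>2 \<le> 1\<^sup>2"
    proof (rule power_mono)
      show "real a0 / real h \<le> 1" using a0 by (cases "h = 0") auto
    qed simp
    then show ?thesis by simp
  qed
  have each: "real (card {\<omega> \<in> ext (revealed F \<omega>0). \<not> merged F r a bs \<omega>}) \<le> 2 ^ ?m * ?q * real (card (ext (revealed F \<omega>0)))"
    if w0: "\<omega>0 \<in> MM" for \<omega>0
  proof -
    let ?u = "revealed F \<omega>0"
    let ?B = "big_components F r \<omega>0"
    let ?L = "loose F \<omega>0"
    have same: "big_components F r \<omega> = ?B \<and> loose F \<omega> = ?L" if "\<omega> \<in> ext ?u" for \<omega>
    proof -
      have wM: "\<omega> \<in> MM" and e: "revealed F \<omega> = ?u" using that ext_revealed[OF w0] by auto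
      have "adj F \<omega> = adj F \<omega>0" unfolding adj_revealed[OF wM] adj_revealed[OF w0] e ..
      then have "component F \<omega> = component F \<omega>0" by (simp add: component_def fun_eq_iff)
      then show ?thesis using e by (simp add: big_components_def loose_def fun_eq_iff)
    qed
    let ?I = "{\<A> \<in> Pow ?B. a \<le> card (?L \<A>) \<and> a \<le> card (?L (?B - \<A>))}"
    let ?M = "\<lambda>\<A>. {\<omega> \<in> ext ?u. \<forall>b\<in>set bs. \<not> (partner False \<omega> (b, 1) \<in> ?L \<A> \<and> partner False \<omega> (b, 2) \<in> ?L (?B - \<A>))}"
    have "{\<omega> \<in> ext ?u. \<not> merged F r a bs \<omega>} \<subseteq> (\<Union>\<A>\<in>?I. ?M \<A>)"
    proof
      fix \<omega> assume w: "\<omega> \<in> {\<omega> \<in> ext ?u. \<not> merged F r a bs \<omega>}"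
      then have e: "big_components F r \<omega> = ?B" "loose F \<omega> = ?L" using same by auto
      have "\<not> merged F r a bs \<omega>" using w by simp
      then obtain \<A> where A: "\<A> \<subseteq> ?B" "a \<le> card (?L \<A>)" "a \<le> card (?L (?B - \<A>))"
        "\<not> (\<exists>b\<in>set bs. partner False \<omega> (b, 1) \<in> ?L \<A> \<and> partner False \<omega> (b, 2) \<in> ?L (?B - \<A>))"
        unfolding merged_def e by blast
      show "\<omega> \<in> (\<Union>\<A>\<in>?I. ?M \<A>)"
      proof (rule UN_I)
        show "\<A> \<in> ?I" using A(1-3) by simp
        show "\<omega> \<in> ?M \<A>" using w A(4) by simp
      qed
    qed
    then have "card {\<omega> \<in> ext ?u. \<not> merged F r a bs \<omega>} \<le> card (\<Union>\<A>\<in>?I. ?M \<A>)"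
      by (rule card_mono[rotated]) auto
    also have "\<dots> \<le> (\<Sum>\<A>\<in>?I. card (?M \<A>))" by (rule card_UN_le) simp
    finally have "real (card {\<omega> \<in> ext ?u. \<not> merged F r a bs \<omega>}) \<le> (\<Sum>\<A>\<in>?I. real (card (?M \<A>)))"
      unfolding of_nat_sum[symmetric] by (rule of_nat_mono)
    also have "\<dots> \<le> (\<Sum>\<A>\<in>?I. ?q * real (card (ext ?u)))"
    proof (rule sum_mono, rule pair_miss[OF bs(1)])
      fix \<A> assume A: "\<A> \<in> ?I"
      show "a0 + 2 * length bs \<le> card (?L \<A>)" "a0 + 2 * length bs \<le> card (?L (?B - \<A>))" using A a by auto
      show "?L \<A> \<subseteq> HE True - fst ` ?u" "?L (?B - \<A>) \<subseteq> HE True - fst ` ?u" by (auto simp: loose_def)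
      show "?L \<A> \<inter> ?L (?B - \<A>) = {}"
      proof (rule ccontr)
        assume "?L \<A> \<inter> ?L (?B - \<A>) \<noteq> {}"
        then obtain x where x: "x \<in> ?L \<A>" "x \<in> ?L (?B - \<A>)" by blast
        then obtain B B' where B: "(True, fst x) \<in> B" "(True, fst x) \<in> B'" "B \<in> \<A>" "B' \<in> ?B" "B' \<notin> \<A>"
          unfolding loose_def by blast
        then have "B \<in> ?B" using A by auto
        then have "B = component F \<omega>0 (True, fst x)" using B(1) by (rule big_components_eq[OF w0])
        moreover have "B' = component F \<omega>0 (True, fst x)" using B(4,2) by (rule big_components_eq[OF w0])
        ultimately show False using B by simp
      qed
      fix b assume b: "b \<in> set bs"
      show "(b, 1) \<in> HE False \<and> (b, 2) \<in> HE False \<and> (b, 1) \<notin> snd ` ?u \<and> (b, 2) \<notin> snd ` ?u"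
      proof -
        have "snd ` ?u \<subseteq> {y. fst y \<notin> F}" by (auto simp: revealed_def)
        moreover have "(b, 1) \<notin> {y. fst y \<notin> F}" "(b, 2) \<notin> {y. fst y \<notin> F}" using bs(2)[OF b] by auto
        ultimately have "(b, 1) \<notin> snd ` ?u" "(b, 2) \<notin> snd ` ?u" by blast+
        then show ?thesis using bs(2)[OF b] by (auto simp: HE_def)
      qed
    qed
    also have "\<dots> = real (card ?I) * (?q * real (card (ext ?u)))" by (rule sum_constant)
    also have "\<dots> \<le> 2 ^ ?m * (?q * real (card (ext ?u)))"
    proof (rule mult_right_mono)
      have "card ?I \<le> card (Pow ?B)" by (rule card_mono) auto
      also have "\<dots> = 2 ^ card ?B" by (rule card_Pow) simp
      also have "\<dots> \<le> 2 ^ ?m"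
      proof (rule power_increasing)
        show "card ?B \<le> ?m" using card_big_components[OF w0, of F r] r by (simp add: less_eq_div_iff_mult_less_eq)
      qed simp
      finally have "real (card ?I) \<le> real (2 ^ ?m)" by (rule of_nat_mono)
      then show "real (card ?I) \<le> 2 ^ ?m" by (simp only: of_nat_power of_nat_numeral)
    qed (use q0 in auto)
    finally show ?thesis by (simp only: mult.assoc)
  qed
  let ?U = "revealed F ` MM"
  have cls: "{\<omega> \<in> MM. revealed F \<omega> = u} = ext u" if "u \<in> ?U" for u
  proof -
    from that obtain \<omega>0 where "\<omega>0 \<in> MM" "u = revealed F \<omega>0" by (rule imageE)
    then show ?thesis using ext_revealed[of \<omega>0 F] by (simp only:)
  qed
  have "real (card {\<omega> \<in> MM. \<not> merged F r a bs \<omega>}) =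
      (\<Sum>u\<in>?U. real (card {\<omega> \<in> {\<omega> \<in> MM. \<not> merged F r a bs \<omega>}. revealed F \<omega> = u}))"
  proof -
    have "card {\<omega> \<in> MM. \<not> merged F r a bs \<omega>} =
      (\<Sum>u\<in>?U. card {\<omega> \<in> {\<omega> \<in> MM. \<not> merged F r a bs \<omega>}. revealed F \<omega> = u})"
      by (rule card_fibers) (simp_all add: image_mono)
    then show ?thesis by (simp only: of_nat_sum)
  qed
  also have "\<dots> \<le> (\<Sum>u\<in>?U. 2 ^ ?m * ?q * real (card (ext u)))"
  proof (rule sum_mono)
    fix u assume u: "u \<in> ?U"
    then obtain \<omega>0 where w0: "\<omega>0 \<in> MM" "u = revealed F \<omega>0" by (rule imageE)
    have "{\<omega> \<in> {\<omega> \<in> MM. \<not> merged F r a bs \<omega>}. revealed F \<omega> = u} = {\<omega> \<in> ext u. \<not> merged F r a bs \<omega>}"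
      unfolding cls[OF u, symmetric] by blast
    then show "real (card {\<omega> \<in> {\<omega> \<in> MM. \<not> merged F r a bs \<omega>}. revealed F \<omega> = u}) \<le> 2 ^ ?m * ?q * real (card (ext u))"
      using each[OF w0(1)] w0(2) by simp
  qed
  also have "\<dots> = 2 ^ ?m * ?q * (\<Sum>u\<in>?U. real (card (ext u)))" by (simp add: sum_distrib_left)
  also have "(\<Sum>u\<in>?U. real (card (ext u))) = real (card MM)"
  proof -
    have "card MM = (\<Sum>u\<in>?U. card {\<omega> \<in> MM. revealed F \<omega> = u})" by (rule card_fibers) simp_all
    also have "\<dots> = (\<Sum>u\<in>?U. card (ext u))" by (rule sum.cong) (simp_all only: cls)
    finally show ?thesis by simp
  qed
  finally show ?thesis .
qed

text \<open>
  Colour each loose half-edge by the component of the full graph that contains it. This colour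
  is constant on components of the reduced graph, so a division of the colours induces a
  division of the large components, and a vertex of \<open>bs\<close> that bridges the latter
  would give one component two colours. Hence the colours cannot be divided and one of them
  dominates. Every vertex of \<open>L\<close> owns a half-edge matched to a loose one, by an
  injective assignment, so the same colour dominates on \<open>L\<close>.
\<close>

lemma merged_dominant:
  assumes w: "\<omega> \<in> MM" and m: "merged F r a bs \<omega>" and bs: "\<And>b. b \<in> set bs \<Longrightarrow> b \<in> {1..sz False} \<and> dg False b \<ge> 2"
    and L: "L \<subseteq> F" "card L \<ge> 3 * a"
    and att: "\<And>b. b \<in> L \<Longrightarrow> \<exists>z\<in>HE False. fst z = b \<and> card (component F \<omega> (True, fst (partner False \<omega> z))) \<ge> r"
  shows "\<exists>c. card {b\<in>L. component {} \<omega> (False, b) \<noteq> c} < a"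
proof -
  let ?B = "big_components F r \<omega>"
  let ?X = "loose F \<omega> ?B"
  define \<kappa> where "\<kappa> = (\<lambda>x::nat \<times> nat. component {} \<omega> (True, fst x))"
  obtain zz where zz: "\<And>b. b \<in> L \<Longrightarrow> zz b \<in> HE False \<and> fst (zz b) = b \<and>
      card (component F \<omega> (True, fst (partner False \<omega> (zz b)))) \<ge> r"
    using att by metis
  define f where "f = (\<lambda>b. partner False \<omega> (zz b))"
  have f: "f b \<in> HE True" "\<omega> (f b) = zz b" "f b \<in> ?X" "\<kappa> (f b) = component {} \<omega> (False, b)" if b: "b \<in> L" for b
  proof -
    have z: "zz b \<in> HE False" "fst (zz b) = b" using zz[OF b] by auto
    show 1: "f b \<in> HE True" "\<omega> (f b) = zz b"
      using partner_in[OF w z(1)] partner_partner[OF w z(1)] by (auto simp: f_def partner_def)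
    have v: "fst (f b) \<in> {1..sz True}" using 1(1) by (auto simp: HE_def)
    have "r \<le> card (component F \<omega> (True, fst (f b)))" using zz[OF b] unfolding f_def by (elim conjE)
    then have B: "component F \<omega> (True, fst (f b)) \<in> ?B"
      unfolding big_components_def mem_Collect_eq using v by (intro bexI[of _ "fst (f b)"] conjI refl)
    have "fst (\<omega> (f b)) \<in> F" unfolding 1(2) z(2) using b L(1) by (rule subsetD[rotated])
    then show "f b \<in> ?X" unfolding loose_iff using 1(1) UnionI[OF B component_self] by (intro conjI)
    have "((True, fst (f b)), (False, b)) \<in> adj {} \<omega>"
      using adjI[OF 1(1), of "{}" \<omega>] 1(2) z(2) by (simp add: blocked_def partner_def)
    then have "(False, b) \<in> component {} \<omega> (True, fst (f b))"
      unfolding component_def by (intro ImageI[OF r_into_rtrancl]) simp_all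
    then show "\<kappa> (f b) = component {} \<omega> (False, b)"
      unfolding \<kappa>_def by (rule component_eq[OF w, symmetric])
  qed
  have inj: "inj_on f L"
  proof (rule inj_onI)
    fix b b' assume b: "b \<in> L" "b' \<in> L" "f b = f b'"
    have "fst (\<omega> (f b)) = b" unfolding f(2)[OF b(1)] using zz[OF b(1)] by (elim conjE)
    moreover have "fst (\<omega> (f b')) = b'" unfolding f(2)[OF b(2)] using zz[OF b(2)] by (elim conjE)
    ultimately show "b = b'" unfolding b(3) by (rule trans[OF sym])
  qed
  have cX: "card ?X \<ge> 3 * a"
  proof -
    have "f ` L \<subseteq> ?X" using f(3) by (rule image_subsetI)
    then have "card L \<le> card ?X" by (rule card_inj_on_le[OF inj]) simp
    then show ?thesis using L(2) by linarith
  qed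
  have split: "card {x\<in>?X. \<kappa> x \<in> \<G>} < a \<or> card {x\<in>?X. \<kappa> x \<notin> \<G>} < a" for \<G>
  proof (rule ccontr)
    assume n: "\<not> ?thesis"
    define \<A> where "\<A> = {B \<in> ?B. \<exists>v. (True, v) \<in> B \<and> component {} \<omega> (True, v) \<in> \<G>}"
    have const: "component {} \<omega> (True, v) = component {} \<omega> (True, v')"
      if "B \<in> ?B" "(True, v) \<in> B" "(True, v') \<in> B" for B v v'
    proof -
      have "(True, v') \<in> component F \<omega> (True, v)"
        using that(3) big_components_eq[OF w that(1,2)] by (simp only:)
      then have "(True, v') \<in> component {} \<omega> (True, v)" using component_mono by (rule subsetD[rotated])
      then show ?thesis by (rule component_eq[OF w, symmetric])
    qed
    have in_A: "B \<in> \<A> \<longleftrightarrow> \<kappa> x \<in> \<G>" if "B \<in> ?B" "(True, fst x) \<in> B" for B x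
      proof
      assume "B \<in> \<A>"
      then obtain v where "(True, v) \<in> B" "component {} \<omega> (True, v) \<in> \<G>" by (auto simp: \<A>_def)
      then show "\<kappa> x \<in> \<G>" using const[OF that(1) _ that(2)] by (simp add: \<kappa>_def)
    next
      assume "\<kappa> x \<in> \<G>"
      then show "B \<in> \<A>" using that by (auto simp: \<A>_def \<kappa>_def)
    qed
    have sub: "\<A> \<subseteq> ?B" by (auto simp: \<A>_def)
    have A: "loose F \<omega> \<A> = {x\<in>?X. \<kappa> x \<in> \<G>}" and A': "loose F \<omega> (?B - \<A>) = {x\<in>?X. \<kappa> x \<notin> \<G>}"
    proof -
      have "(\<exists>B\<in>\<A>. (True, fst x) \<in> B) \<longleftrightarrow> (\<exists>B\<in>?B. (True, fst x) \<in> B) \<and> \<kappa> x \<in> \<G>" for x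
      proof
        assume "\<exists>B\<in>\<A>. (True, fst x) \<in> B"
        then obtain B where "B \<in> \<A>" "(True, fst x) \<in> B" by (elim bexE)
        then show "(\<exists>B\<in>?B. (True, fst x) \<in> B) \<and> \<kappa> x \<in> \<G>"
          using sub in_A[of B x] by (intro conjI bexI[of _ B]) auto
      next
        assume "(\<exists>B\<in>?B. (True, fst x) \<in> B) \<and> \<kappa> x \<in> \<G>"
        then obtain B where "B \<in> ?B" "(True, fst x) \<in> B" "\<kappa> x \<in> \<G>" by (elim bexE conjE)
        then show "\<exists>B\<in>\<A>. (True, fst x) \<in> B" using in_A[of B x] by (intro bexI[of _ B]) auto
      qed
      then show "loose F \<omega> \<A> = {x\<in>?X. \<kappa> x \<in> \<G>}"
        unfolding set_eq_iff mem_Collect_eq loose_iff Union_iff by simp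
      have "(\<exists>B\<in>?B - \<A>. (True, fst x) \<in> B) \<longleftrightarrow> (\<exists>B\<in>?B. (True, fst x) \<in> B) \<and> \<kappa> x \<notin> \<G>" for x
      proof
        assume "\<exists>B\<in>?B - \<A>. (True, fst x) \<in> B"
        then obtain B where "B \<in> ?B" "B \<notin> \<A>" "(True, fst x) \<in> B" by (elim bexE DiffE)
        then show "(\<exists>B\<in>?B. (True, fst x) \<in> B) \<and> \<kappa> x \<notin> \<G>"
          using in_A[of B x] by (intro conjI bexI[of _ B]) auto
      next
        assume "(\<exists>B\<in>?B. (True, fst x) \<in> B) \<and> \<kappa> x \<notin> \<G>"
        then obtain B where "B \<in> ?B" "(True, fst x) \<in> B" "\<kappa> x \<notin> \<G>" by (elim bexE conjE)
        then show "\<exists>B\<in>?B - \<A>. (True, fst x) \<in> B" using in_A[of B x] by (intro bexI[of _ B]) auto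
      qed
      then show "loose F \<omega> (?B - \<A>) = {x\<in>?X. \<kappa> x \<notin> \<G>}"
        unfolding set_eq_iff mem_Collect_eq loose_iff Union_iff by simp
    qed
    have big: "a \<le> card (loose F \<omega> \<A>)" "a \<le> card (loose F \<omega> (?B - \<A>))" unfolding A A' using n by linarith+
    from m[unfolded merged_def, rule_format, OF sub big] obtain b where b: "b \<in> set bs"
      "partner False \<omega> (b, 1) \<in> loose F \<omega> \<A>" "partner False \<omega> (b, 2) \<in> loose F \<omega> (?B - \<A>)" by (elim bexE conjE)
    have kb: "\<kappa> (partner False \<omega> y) = component {} \<omega> (False, b)" if y: "y \<in> HE False" "fst y = b" for y
    proof -
      have "((False, b), (True, fst (partner False \<omega> y))) \<in> adj {} \<omega>"
        using adjI[OF y(1), of "{}" \<omega>] y(2) by (simp add: blocked_def)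
      then have "(True, fst (partner False \<omega> y)) \<in> component {} \<omega> (False, b)" by (auto simp: component_def)
      then show ?thesis unfolding \<kappa>_def by (rule component_eq[OF w])
    qed
    have "(b, 1) \<in> HE False" "(b, 2) \<in> HE False" using bs[OF b(1)] by (auto simp: HE_def)
    then have "\<kappa> (partner False \<omega> (b, 1)) = \<kappa> (partner False \<omega> (b, 2))" using kb by simp
    then show False using b(2,3) unfolding A A' by auto
  qed
  obtain c where c: "card {x\<in>?X. \<kappa> x \<noteq> c} < a"
    using dominant_class[OF finite_loose cX split] by (elim exE)
  have "card {b\<in>L. component {} \<omega> (False, b) \<noteq> c} \<le> card {x\<in>?X. \<kappa> x \<noteq> c}"
  proof (rule card_inj_on_le[of f])
    show "inj_on f {b\<in>L. component {} \<omega> (False, b) \<noteq> c}" using inj by (rule inj_on_subset) auto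
    show "f ` {b\<in>L. component {} \<omega> (False, b) \<noteq> c} \<subseteq> {x\<in>?X. \<kappa> x \<noteq> c}"
    proof (rule image_subsetI)
      fix b assume "b \<in> {b\<in>L. component {} \<omega> (False, b) \<noteq> c}"
      then show "f b \<in> {x\<in>?X. \<kappa> x \<noteq> c}" using f(3,4)[of b] by simp
    qed
  qed simp
  then show ?thesis using c by (intro exI[of _ c]) linarith
qed

end

section \<open>Sequences of matchings and the law of large numbers\<close>

lemma pmf_expectation_sums:
  fixes f :: "nat \<Rightarrow> real"
  assumes "integrable (measure_pmf p) f"
  shows "(\<lambda>j. pmf p j * f j) sums measure_pmf.expectation p f"
proof -
  have d: "measure_pmf p = density (count_space UNIV) (\<lambda>x. ennreal (pmf p x))"
    by (rule measure_pmf_eq_density)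
  have "integrable (count_space UNIV) (\<lambda>j. pmf p j *\<^sub>R f j)"
    using assms unfolding d by (subst (asm) integrable_density) auto
  then have "(\<lambda>j. pmf p j *\<^sub>R f j) sums (\<integral>j. pmf p j *\<^sub>R f j \<partial>count_space UNIV)"
    by (rule sums_integral_count_space_nat)
  moreover have "(\<integral>j. pmf p j *\<^sub>R f j \<partial>count_space UNIV) = measure_pmf.expectation p f"
    unfolding d by (subst integral_density) auto
  ultimately show ?thesis by simp
qed

context bipartite
begin

lemma avg_markov:
  assumes "\<And>\<omega>. \<omega> \<in> MM \<Longrightarrow> 0 \<le> X \<omega>" "e > 0"
  shows "real (card {\<omega>\<in>MM. X \<omega> > e}) / real (card MM) \<le> avg X / e"
proof -
  have "e * real (card {\<omega>\<in>MM. X \<omega> > e}) = (\<Sum>\<omega>\<in>{\<omega>\<in>MM. X \<omega> > e}. e)" by simp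
  also have "\<dots> \<le> (\<Sum>\<omega>\<in>{\<omega>\<in>MM. X \<omega> > e}. X \<omega>)" by (rule sum_mono) auto
  also have "\<dots> \<le> (\<Sum>\<omega>\<in>MM. X \<omega>)" by (rule sum_mono2) (use assms in auto)
  finally have "real (card {\<omega>\<in>MM. X \<omega> > e}) \<le> (\<Sum>\<omega>\<in>MM. X \<omega>) / e"
    using assms(2) by (simp add: le_divide_eq mult.commute)
  then have "real (card {\<omega>\<in>MM. X \<omega> > e}) / real (card MM) \<le> (\<Sum>\<omega>\<in>MM. X \<omega>) / e / real (card MM)"
    by (rule divide_right_mono) simp
  then show ?thesis by (simp add: avg_def mult.commute)
qed

lemma h_eq: "h = (\<Sum>v=1..sz s. dg s v)"
  using bal by (cases s) (auto simp: h_def)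

lemma sum_HE: "(\<Sum>z\<in>HE s. f (fst z)) = (\<Sum>v=1..sz s. real (dg s v) * (f v :: real))"
proof -
  have "(\<Sum>z\<in>HE s. f (fst z)) = (\<Sum>(v, i)\<in>(SIGMA v:{1..sz s}. {1..dg s v}). f v)"
    unfolding HE_def by (rule sum.cong) auto
  also have "\<dots> = (\<Sum>v=1..sz s. \<Sum>i=1..dg s v. f v)" by (rule sum.Sigma[symmetric]) auto
  finally show ?thesis by simp
qed

lemma card_HE_at_degree:
  "card {z\<in>HE s. dg s (fst z) = j \<and> P (fst z)} = j * card {v\<in>{1..sz s}. dg s v = j \<and> P v}"
proof -
  have "{z\<in>HE s. dg s (fst z) = j \<and> P (fst z)} = {v\<in>{1..sz s}. dg s v = j \<and> P v} \<times> {1..j}"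
    by (auto simp: HE_def)
  then show ?thesis by (simp add: card_cartesian_product mult.commute)
qed

end

text \<open>
  The exploration stops at vertices of degree more than \<open>\<Delta>\<close> and at flagged
  right vertices, with the verdict \<open>b\<close> (\<open>True\<close> for dying).
\<close>

definition cls_of :: "nat \<Rightarrow> nat set \<Rightarrow> bool \<Rightarrow> (bool \<Rightarrow> nat \<Rightarrow> nat) \<Rightarrow> bool \<Rightarrow> nat \<Rightarrow> bool option" where
  "cls_of \<Delta> F b dg s v = (if dg s v > \<Delta> \<or> (\<not> s \<and> v \<in> F) then Some b else None)"

lemma cls_of_None: "cls_of \<Delta> F b dg s v = None \<Longrightarrow> dg s v \<le> \<Delta>"
  by (auto simp: cls_of_def split: if_splits)

text \<open>
  Sorting the half-edges by the degree of their owner separates the stopped ones, which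
  contribute their verdict, from the others, whose contribution depends on the degree alone.
\<close>

lemma (in bipartite) sum_stepval:
  assumes deg1: "\<And>z. z \<in> HE s \<Longrightarrow> dg s (fst z) \<ge> 1"
  shows "(\<Sum>z\<in>{z\<in>HE s. \<psi> z}. stepval (cls_of \<Delta> F b dg) r s z) =
    of_bool b * (real (card {z\<in>HE s. \<psi> z}) -
       (\<Sum>j=1..\<Delta>. real (card {z\<in>HE s. \<psi> z \<and> dg s (fst z) = j \<and> \<not> (\<not> s \<and> fst z \<in> F)}))) +
    (\<Sum>j=1..\<Delta>. real (card {z\<in>HE s. \<psi> z \<and> dg s (fst z) = j \<and> \<not> (\<not> s \<and> fst z \<in> F)}) *
       dieprob (cls_of \<Delta> F b dg) r s ^ (j - 1))"
proof -
  let ?c = "cls_of \<Delta> F b dg"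
  let ?A = "{z\<in>HE s. \<psi> z}"
  let ?E = "{z\<in>?A. ?c s (fst z) = None}"
  let ?C = "\<lambda>j. {z\<in>HE s. \<psi> z \<and> dg s (fst z) = j \<and> \<not> (\<not> s \<and> fst z \<in> F)}"
  have E: "{z\<in>?E. dg s (fst z) = j} = ?C j" if "j \<in> {1..\<Delta>}" for j
    using that by (auto simp: cls_of_def split: if_splits)
  have maps: "(\<lambda>z. dg s (fst z)) ` ?E \<subseteq> {1..\<Delta>}"
    using deg1 by (auto dest: cls_of_None)
  have "(\<Sum>z\<in>?A. stepval ?c r s z) = (\<Sum>z\<in>?A - ?E. stepval ?c r s z) + (\<Sum>z\<in>?E. stepval ?c r s z)"
    by (rule sum.subset_diff) auto
  also have "(\<Sum>z\<in>?A - ?E. stepval ?c r s z) = (\<Sum>z\<in>?A - ?E. of_bool b)"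
    by (rule sum.cong) (auto simp: stepval_def cls_of_def)
  also have "\<dots> = of_bool b * (real (card ?A) - real (card ?E))"
  proof -
    have "card ?E \<le> card ?A" by (rule card_mono) auto
    moreover have "card (?A - ?E) = card ?A - card ?E" by (rule card_Diff_subset) auto
    ultimately show ?thesis by (simp add: of_nat_diff mult.commute)
  qed
  also have "real (card ?E) = (\<Sum>j=1..\<Delta>. real (card (?C j)))"
  proof -
    have "card ?E = (\<Sum>j\<in>{1..\<Delta>}. card {z\<in>?E. dg s (fst z) = j})"
      by (rule card_fibers[OF _ _ maps]) auto
    also have "\<dots> = (\<Sum>j=1..\<Delta>. card (?C j))" by (rule sum.cong) (simp_all only: E)
    finally show ?thesis by simp
  qed
  also have "(\<Sum>z\<in>?E. stepval ?c r s z) = (\<Sum>z\<in>?E. dieprob ?c r s ^ (dg s (fst z) - 1))"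
    by (rule sum.cong) (auto simp: stepval_def)
  also have "\<dots> = (\<Sum>j\<in>{1..\<Delta>}. \<Sum>z\<in>{z\<in>?E. dg s (fst z) = j}. dieprob ?c r s ^ (dg s (fst z) - 1))"
    by (rule sum.group[symmetric, OF _ _ maps]) auto
  also have "\<dots> = (\<Sum>j=1..\<Delta>. real (card (?C j)) * dieprob ?c r s ^ (j - 1))"
  proof (rule sum.cong[OF refl])
    fix j assume j: "j \<in> {1..\<Delta>}"
    have "(\<Sum>z\<in>{z\<in>?E. dg s (fst z) = j}. dieprob ?c r s ^ (dg s (fst z) - 1)) =
        (\<Sum>z\<in>{z\<in>?E. dg s (fst z) = j}. dieprob ?c r s ^ (j - 1))"
      by (rule sum.cong) auto
    then show "(\<Sum>z\<in>{z\<in>?E. dg s (fst z) = j}. dieprob ?c r s ^ (dg s (fst z) - 1)) =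
        real (card (?C j)) * dieprob ?c r s ^ (j - 1)" unfolding E[OF j] by simp
  qed
  finally show ?thesis .
qed

text \<open>
  The proportions of the degrees on both sides converge to laws with finite mean, and so do the
  mean degrees; there are no vertices of degree 0, neither at any stage nor in the limit.
\<close>

locale bipartite_seq =
  fixes sz :: "nat \<Rightarrow> bool \<Rightarrow> nat" and dg :: "nat \<Rightarrow> bool \<Rightarrow> nat \<Rightarrow> nat" and law :: "bool \<Rightarrow> nat pmf"
  assumes balanced: "\<And>n. (\<Sum>v=1..sz n True. dg n True v) = (\<Sum>v=1..sz n False. dg n False v)"
    and sz_lim: "\<And>s. filterlim (\<lambda>n. sz n s) at_top sequentially"
    and dg_pos: "\<And>n s v. v \<in> {1..sz n s} \<Longrightarrow> dg n s v \<ge> 1"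
    and law0: "\<And>s. pmf (law s) 0 = 0"
    and count_lim: "\<And>s j. (\<lambda>n. real (card {v\<in>{1..sz n s}. dg n s v = j}) / real (sz n s)) \<longlonglongrightarrow> pmf (law s) j"
    and fin_mean: "\<And>s. finite_mean (law s)"
    and mean_lim: "\<And>s. (\<lambda>n. (\<Sum>v=1..sz n s. real (dg n s v)) / real (sz n s)) \<longlonglongrightarrow> mean (law s)"
begin

sublocale B: bipartite "sz n" "dg n" for n
  by unfold_locales (rule balanced)

lemma sz_real_lim: "filterlim (\<lambda>n. real (sz n s)) at_top sequentially"
  using filterlim_compose[OF filterlim_real_sequentially sz_lim] .

lemma sz_pos: "\<forall>\<^sub>F n in sequentially. sz n s > 0"
proof -
  have "\<forall>\<^sub>F n in sequentially. 1 \<le> sz n s" using sz_lim[of s] unfolding filterlim_at_top by blast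
  then show ?thesis by eventually_elim simp
qed

lemma inv_sz: "(\<lambda>n. 1 / real (sz n s)) \<longlonglongrightarrow> 0"
  by (rule real_tendsto_divide_at_top[OF tendsto_const sz_real_lim])

lemma h_real: "real (B.h n) = (\<Sum>v=1..sz n s. real (dg n s v))"
  unfolding B.h_eq[of n s] by simp

lemma h_over_sz: "(\<lambda>n. real (B.h n) / real (sz n s)) \<longlonglongrightarrow> mean (law s)"
  using mean_lim[of s] by (simp only: h_real[of _ s])

lemma sz_le_h: "sz n s \<le> B.h n"
proof -
  have "(\<Sum>v=1..sz n s. 1) \<le> (\<Sum>v=1..sz n s. dg n s v)" by (rule sum_mono) (use dg_pos in auto)
  then show ?thesis by (simp add: B.h_eq[of n s])
qed

lemma h_pos: "\<forall>\<^sub>F n in sequentially. B.h n > 0"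
  using sz_pos[of True] by eventually_elim (use sz_le_h[of _ True] in \<open>auto intro: less_le_trans\<close>)

lemma mean_ge_1: "mean (law s) \<ge> 1"
proof (rule tendsto_lowerbound[OF h_over_sz])
  show "\<forall>\<^sub>F n in sequentially. 1 \<le> real (B.h n) / real (sz n s)"
    using sz_pos[of s] by eventually_elim (use sz_le_h[of _ s] in \<open>auto simp: le_divide_eq\<close>)
qed simp

lemma sz_over_h: "(\<lambda>n. real (sz n s) / real (B.h n)) \<longlonglongrightarrow> 1 / mean (law s)"
proof -
  have "(\<lambda>n. inverse (real (B.h n) / real (sz n s))) \<longlonglongrightarrow> inverse (mean (law s))"
    by (rule tendsto_inverse[OF h_over_sz]) (use mean_ge_1[of s] in auto)
  then show ?thesis by (simp add: inverse_eq_divide)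
qed

lemma over_h:
  assumes "(\<lambda>n. a n / real (sz n s)) \<longlonglongrightarrow> (x::real)"
  shows "(\<lambda>n. a n / real (B.h n)) \<longlonglongrightarrow> x / mean (law s)"
proof -
  have 1: "(\<lambda>n. (a n / real (sz n s)) * (real (sz n s) / real (B.h n))) \<longlonglongrightarrow> x * (1 / mean (law s))"
    by (rule tendsto_mult[OF assms sz_over_h])
  have 2: "\<forall>\<^sub>F n in sequentially. (a n / real (sz n s)) * (real (sz n s) / real (B.h n)) = a n / real (B.h n)"
    using sz_pos[of s] by eventually_elim auto
  show ?thesis using Lim_transform_eventually[OF 1 2] by simp
qed

text \<open>
  The size-biased law: the limiting proportion of half-edges whose owner has degree
  \<open>j\<close>.
\<close>

definition w :: "bool \<Rightarrow> nat \<Rightarrow> real" where "w s j = real j * pmf (law s) j / mean (law s)"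

lemma mean_sums: "(\<lambda>j. real j * pmf (law s) j) sums mean (law s)"
  using pmf_expectation_sums[of "law s" real] fin_mean[of s]
  by (simp add: finite_mean_def mean_def mult.commute)

lemma w_sums: "w s sums 1"
proof -
  have "(\<lambda>j. real j * pmf (law s) j / mean (law s)) sums (mean (law s) / mean (law s))"
    by (rule sums_divide[OF mean_sums])
  then show ?thesis using mean_ge_1[of s] by (simp add: w_def[abs_def])
qed

lemma w_nonneg: "w s j \<ge> 0" using mean_ge_1[of s] by (simp add: w_def)

subsection \<open>Uniform integrability of the degrees\<close>

text \<open>
  No mass escapes to large degrees: the mean of the degrees up to \<open>T\<close> converges to
  the truncated mean of the limit, and the full means converge as well.
\<close>

lemma degree_tail:
  assumes e: "e > 0"
  shows "\<exists>T. \<forall>\<^sub>F n in sequentially. (\<Sum>v\<in>{v\<in>{1..sz n s}. dg n s v > T}. real (dg n s v)) \<le> e * real (sz n s)"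
proof -
  have "(\<lambda>T. \<Sum>j<T. real j * pmf (law s) j) \<longlonglongrightarrow> mean (law s)"
    using mean_sums by (simp add: sums_def)
  then have "\<forall>\<^sub>F T in sequentially. (\<Sum>j<T. real j * pmf (law s) j) > mean (law s) - e / 2"
    by (rule order_tendstoD) (use e in auto)
  then obtain T where T: "(\<Sum>j<T. real j * pmf (law s) j) > mean (law s) - e / 2"
    by (auto simp: eventually_sequentially)
  let ?c = "\<lambda>n j. real (card {v\<in>{1..sz n s}. dg n s v = j})"
  let ?t = "\<lambda>n. \<Sum>v\<in>{v\<in>{1..sz n s}. dg n s v > T}. real (dg n s v)"
  have le: "?t n \<le> real (B.h n) - (\<Sum>j<T. real j * ?c n j)" for n
  proof -
    let ?L = "{v\<in>{1..sz n s}. dg n s v < T}"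
    have "real (B.h n) = (\<Sum>v\<in>{1..sz n s}. real (dg n s v))" by (rule h_real)
    also have "\<dots> \<ge> (\<Sum>v\<in>?L \<union> {v\<in>{1..sz n s}. dg n s v > T}. real (dg n s v))"
      by (rule sum_mono2) auto
    also have "(\<Sum>v\<in>?L \<union> {v\<in>{1..sz n s}. dg n s v > T}. real (dg n s v)) = (\<Sum>v\<in>?L. real (dg n s v)) + ?t n"
      by (rule sum.union_disjoint) auto
    also have "(\<Sum>v\<in>?L. real (dg n s v)) = (\<Sum>j\<in>{..<T}. \<Sum>v\<in>{v\<in>?L. dg n s v = j}. real (dg n s v))"
      by (rule sum.group[symmetric]) auto
    also have "\<dots> = (\<Sum>j<T. real j * ?c n j)"
    proof (rule sum.cong[OF refl])
      fix j assume "j \<in> {..<T}"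
      then have "{v\<in>?L. dg n s v = j} = {v\<in>{1..sz n s}. dg n s v = j}" by auto
      then show "(\<Sum>v\<in>{v\<in>?L. dg n s v = j}. real (dg n s v)) = real j * ?c n j" by simp
    qed
    finally show ?thesis by linarith
  qed
  have "(\<lambda>n. real (B.h n) / real (sz n s) - (\<Sum>j<T. real j * (?c n j / real (sz n s))))
     \<longlonglongrightarrow> mean (law s) - (\<Sum>j<T. real j * pmf (law s) j)"
    by (intro tendsto_diff h_over_sz tendsto_sum tendsto_mult tendsto_const count_lim)
  then have "\<forall>\<^sub>F n in sequentially. real (B.h n) / real (sz n s) - (\<Sum>j<T. real j * (?c n j / real (sz n s))) < e"
    by (rule order_tendstoD) (use T e in auto)
  then have "\<forall>\<^sub>F n in sequentially. ?t n \<le> e * real (sz n s)"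
    using sz_pos[of s]
  proof eventually_elim
    case (elim n)
    have "real (B.h n) / real (sz n s) - (\<Sum>j<T. real j * (?c n j / real (sz n s))) =
       (real (B.h n) - (\<Sum>j<T. real j * ?c n j)) / real (sz n s)"
      by (simp add: diff_divide_distrib sum_divide_distrib)
    then have "(real (B.h n) - (\<Sum>j<T. real j * ?c n j)) / real (sz n s) < e" using elim by simp
    then have "real (B.h n) - (\<Sum>j<T. real j * ?c n j) < e * real (sz n s)"
      using elim(2) by (simp add: divide_less_eq)
    then show ?case using le[of n] by linarith
  qed
  then show ?thesis by blast
qed

lemma uniform_integrability:
  assumes e: "e > 0"
  shows "\<exists>\<delta>>0. \<forall>\<^sub>F n in sequentially. \<forall>A. A \<subseteq> {1..sz n s} \<longrightarrow> real (card A) \<le> \<delta> * real (sz n s) \<longrightarrow>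
     (\<Sum>v\<in>A. real (dg n s v)) \<le> e * real (sz n s)"
proof -
  obtain T where T: "\<forall>\<^sub>F n in sequentially. (\<Sum>v\<in>{v\<in>{1..sz n s}. dg n s v > T}. real (dg n s v)) \<le> (e / 2) * real (sz n s)"
    using degree_tail[of "e / 2" s] e by auto
  let ?d = "e / (2 * (real T + 1))"
  have "\<forall>\<^sub>F n in sequentially. \<forall>A. A \<subseteq> {1..sz n s} \<longrightarrow> real (card A) \<le> ?d * real (sz n s) \<longrightarrow>
     (\<Sum>v\<in>A. real (dg n s v)) \<le> e * real (sz n s)"
    using T
  proof eventually_elim
    case (elim n)
    show ?case
    proof (intro allI impI)
      fix A assume A: "A \<subseteq> {1..sz n s}" "real (card A) \<le> ?d * real (sz n s)"
      have fA: "finite A" using A(1) finite_subset by blast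
      have "(\<Sum>v\<in>A. real (dg n s v)) \<le> (\<Sum>v\<in>A. real T + (if dg n s v > T then real (dg n s v) else 0))"
        by (rule sum_mono) auto
      also have "\<dots> = real T * real (card A) + (\<Sum>v\<in>{v\<in>A. dg n s v > T}. real (dg n s v))"
        using fA by (simp add: sum.distrib sum.inter_filter)
      also have "(\<Sum>v\<in>{v\<in>A. dg n s v > T}. real (dg n s v)) \<le> (\<Sum>v\<in>{v\<in>{1..sz n s}. dg n s v > T}. real (dg n s v))"
        by (rule sum_mono2) (use A in auto)
      also note elim
      also have "real T * real (card A) \<le> real T * (?d * real (sz n s))"
        by (rule mult_left_mono[OF A(2)]) simp
      also have "\<dots> \<le> (e / 2) * real (sz n s)"
      proof -
        have "real T * ?d \<le> e / 2" using e by (simp add: field_simps)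
        then have "real T * ?d * real (sz n s) \<le> (e / 2) * real (sz n s)" by (rule mult_right_mono) simp
        then show ?thesis by (simp add: mult.assoc)
      qed
      finally show "(\<Sum>v\<in>A. real (dg n s v)) \<le> e * real (sz n s)" by simp
    qed
  qed
  moreover have "?d > 0" using e by simp
  ultimately show ?thesis by blast
qed

definition dmax :: "nat \<Rightarrow> nat" where
  "dmax n = (\<Sum>s\<in>UNIV. Max (insert 0 (dg n s ` {1..sz n s})))"

lemma dg_le_dmax: "v \<in> {1..sz n s} \<Longrightarrow> dg n s v \<le> dmax n"
proof -
  assume v: "v \<in> {1..sz n s}"
  have "dg n s v \<le> Max (insert 0 (dg n s ` {1..sz n s}))" by (rule Max_ge) (use v in auto)
  also have "\<dots> \<le> dmax n" unfolding dmax_def by (rule member_le_sum) auto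
  finally show ?thesis .
qed

text \<open>
  A single vertex of degree more than \<open>T\<close> is bounded by the tail of the degrees,
  and the others by \<open>T\<close>.
\<close>

lemma dmax_over_h: "(\<lambda>n. real (dmax n) / real (B.h n)) \<longlonglongrightarrow> 0"
proof -
  have one: "(\<lambda>n. real (Max (insert 0 (dg n s ` {1..sz n s}))) / real (sz n s)) \<longlonglongrightarrow> 0" for s
  proof (rule tendstoI)
    fix e :: real assume e: "e > 0"
    obtain T where T: "\<forall>\<^sub>F n in sequentially. (\<Sum>v\<in>{v\<in>{1..sz n s}. dg n s v > T}. real (dg n s v)) \<le> (e / 4) * real (sz n s)"
      using degree_tail[of "e / 4" s] e by auto
    have "(\<lambda>n. real T / real (sz n s)) \<longlonglongrightarrow> 0"
      by (rule real_tendsto_divide_at_top[OF tendsto_const sz_real_lim])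
    then have "\<forall>\<^sub>F n in sequentially. real T / real (sz n s) < e / 4"
      by (rule order_tendstoD) (use e in auto)
    with T sz_pos[of s] show "\<forall>\<^sub>F n in sequentially.
       dist (real (Max (insert 0 (dg n s ` {1..sz n s}))) / real (sz n s)) 0 < e"
    proof eventually_elim
      case (elim n)
      let ?S = "insert 0 (dg n s ` {1..sz n s})"
      have "Max ?S \<in> ?S" by (rule Max_in) auto
      moreover have "real d \<le> real T + (e / 4) * real (sz n s)" if d: "d \<in> ?S" for d
      proof (cases "d \<le> T")
        case True
        then show ?thesis using e by (simp add: add_increasing2)
      next
        case False
        then obtain v where v: "v \<in> {1..sz n s}" "d = dg n s v" using d by auto
        have "real (dg n s v) \<le> (\<Sum>v\<in>{v\<in>{1..sz n s}. dg n s v > T}. real (dg n s v))"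
          by (rule member_le_sum) (use v False in auto)
        then show ?thesis using elim(1) v by simp
      qed
      ultimately have "real (Max ?S) \<le> real T + (e / 4) * real (sz n s)" by blast
      then have "real (Max ?S) / real (sz n s) \<le> (real T + (e / 4) * real (sz n s)) / real (sz n s)"
        by (rule divide_right_mono) simp
      also have "\<dots> = real T / real (sz n s) + e / 4" using elim(2) by (simp add: add_divide_distrib)
      also have "\<dots> < e" using elim(3) e by linarith
      finally show ?case by (simp add: dist_real_def)
    qed
  qed
  have "(\<lambda>n. \<Sum>s\<in>UNIV. real (Max (insert 0 (dg n s ` {1..sz n s}))) / real (B.h n)) \<longlonglongrightarrow> (\<Sum>s\<in>(UNIV::bool set). 0 / mean (law s))"
    by (intro tendsto_sum over_h one)
  then show ?thesis by (simp add: dmax_def sum_divide_distrib)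
qed

lemma err_lim: "(\<lambda>n. B.err n (dmax n) k Q) \<longlonglongrightarrow> 0"
proof -
  have "(\<lambda>n. real Q * (real k + real Q) * (real (dmax n) / real (B.h n))) \<longlonglongrightarrow> real Q * (real k + real Q) * 0"
    by (intro tendsto_mult tendsto_const dmax_over_h)
  then show ?thesis by (simp add: B.err_def)
qed

subsection \<open>Events of probability tending to one\<close>

text \<open>
  The matching is uniform, so probabilities are proportions of \<open>B.MM n\<close>.
\<close>

definition whp :: "(nat \<Rightarrow> (nat \<times> nat \<Rightarrow> nat \<times> nat) \<Rightarrow> bool) \<Rightarrow> bool" where
  "whp P \<longleftrightarrow> (\<lambda>n. real (card {\<omega>\<in>B.MM n. \<not> P n \<omega>}) / real (card (B.MM n))) \<longlonglongrightarrow> 0"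

lemma whp_bound:
  assumes "\<forall>\<^sub>F n in sequentially. real (card {\<omega>\<in>B.MM n. \<not> P n \<omega>}) / real (card (B.MM n)) \<le> a n" "a \<longlonglongrightarrow> 0"
  shows "whp P"
  unfolding whp_def by (rule tendsto_sandwich[OF _ assms(1) tendsto_const assms(2)]) (auto intro: always_eventually)

lemma whp_mono:
  assumes "whp P" "\<forall>\<^sub>F n in sequentially. \<forall>\<omega>\<in>B.MM n. P n \<omega> \<longrightarrow> Q n \<omega>"
  shows "whp Q"
proof (rule whp_bound[OF _ assms(1)[unfolded whp_def]])
  show "\<forall>\<^sub>F n in sequentially. real (card {\<omega>\<in>B.MM n. \<not> Q n \<omega>}) / real (card (B.MM n)) \<le>
      real (card {\<omega>\<in>B.MM n. \<not> P n \<omega>}) / real (card (B.MM n))"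
    using assms(2)
  proof eventually_elim
    case (elim n)
    have "card {\<omega>\<in>B.MM n. \<not> Q n \<omega>} \<le> card {\<omega>\<in>B.MM n. \<not> P n \<omega>}"
      by (rule card_mono) (use elim in auto)
    then show ?case by (intro divide_right_mono) auto
  qed
qed

lemma whp_conj:
  assumes "whp P" "whp Q" shows "whp (\<lambda>n \<omega>. P n \<omega> \<and> Q n \<omega>)"
proof (rule whp_bound[OF always_eventually])
  show "(\<lambda>n. real (card {\<omega>\<in>B.MM n. \<not> P n \<omega>}) / real (card (B.MM n)) +
      real (card {\<omega>\<in>B.MM n. \<not> Q n \<omega>}) / real (card (B.MM n))) \<longlonglongrightarrow> 0"
    using tendsto_add[OF assms[unfolded whp_def]] by simp
  show "\<forall>n. real (card {\<omega>\<in>B.MM n. \<not> (P n \<omega> \<and> Q n \<omega>)}) / real (card (B.MM n)) \<le>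
      real (card {\<omega>\<in>B.MM n. \<not> P n \<omega>}) / real (card (B.MM n)) +
      real (card {\<omega>\<in>B.MM n. \<not> Q n \<omega>}) / real (card (B.MM n))"
  proof
    fix n
    have "{\<omega>\<in>B.MM n. \<not> (P n \<omega> \<and> Q n \<omega>)} = {\<omega>\<in>B.MM n. \<not> P n \<omega>} \<union> {\<omega>\<in>B.MM n. \<not> Q n \<omega>}" by auto
    then have "card {\<omega>\<in>B.MM n. \<not> (P n \<omega> \<and> Q n \<omega>)} \<le> card {\<omega>\<in>B.MM n. \<not> P n \<omega>} + card {\<omega>\<in>B.MM n. \<not> Q n \<omega>}"
      by (simp add: card_Un_le)
    then have "real (card {\<omega>\<in>B.MM n. \<not> (P n \<omega> \<and> Q n \<omega>)}) \<le>
       real (card {\<omega>\<in>B.MM n. \<not> P n \<omega>}) + real (card {\<omega>\<in>B.MM n. \<not> Q n \<omega>})" by linarith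
    then show "real (card {\<omega>\<in>B.MM n. \<not> (P n \<omega> \<and> Q n \<omega>)}) / real (card (B.MM n)) \<le>
      real (card {\<omega>\<in>B.MM n. \<not> P n \<omega>}) / real (card (B.MM n)) +
      real (card {\<omega>\<in>B.MM n. \<not> Q n \<omega>}) / real (card (B.MM n))"
      unfolding add_divide_distrib[symmetric] by (rule divide_right_mono) simp
  qed
qed

lemma whp_sure: "\<forall>\<^sub>F n in sequentially. \<forall>\<omega>\<in>B.MM n. Q n \<omega> \<Longrightarrow> whp Q"
  by (rule whp_mono[of "\<lambda>_ _. True"]) (auto simp: whp_def)

lemma whp_ball:
  assumes "finite I" "\<And>i. i \<in> I \<Longrightarrow> whp (P i)"
  shows "whp (\<lambda>n \<omega>. \<forall>i\<in>I. P i n \<omega>)"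
  using assms
proof (induct I)
  case empty
  then show ?case by (intro whp_sure) auto
next
  case (insert i I)
  have "whp (\<lambda>n \<omega>. P i n \<omega> \<and> (\<forall>i\<in>I. P i n \<omega>))" by (rule whp_conj) (use insert in auto)
  then show ?case by simp
qed

lemma whp_markov:
  assumes "\<And>n \<omega>. \<omega> \<in> B.MM n \<Longrightarrow> 0 \<le> X n \<omega>"
    "\<forall>\<^sub>F n in sequentially. B.avg n (X n) \<le> a n" "a \<longlonglongrightarrow> 0" "e > 0"
  shows "whp (\<lambda>n \<omega>. X n \<omega> \<le> e)"
proof (rule whp_bound[where a = "\<lambda>n. a n / e"])
  show "\<forall>\<^sub>F n in sequentially. real (card {\<omega>\<in>B.MM n. \<not> X n \<omega> \<le> e}) / real (card (B.MM n)) \<le> a n / e"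
    using assms(2)
  proof eventually_elim
    case (elim n)
    have "real (card {\<omega>\<in>B.MM n. X n \<omega> > e}) / real (card (B.MM n)) \<le> B.avg n (X n) / e"
      by (rule B.avg_markov[OF assms(1) assms(4)])
    also have "\<dots> \<le> a n / e" using elim assms(4) by (simp add: divide_right_mono)
    finally show ?case by (simp only: not_le)
  qed
  have "(\<lambda>n. a n / e) \<longlonglongrightarrow> 0 / e" by (intro tendsto_divide assms(3) tendsto_const) (use assms(4) in auto)
  then show "(\<lambda>n. a n / e) \<longlonglongrightarrow> 0" by simp
qed

subsection \<open>Law of large numbers for local events\<close>

text \<open>
  Chebyshev's inequality with \<open>second_moment\<close>. With \<open>t\<close> set the
  verdict of the exploration is ignored, and only the label sum is prescribed.
\<close>

lemma lln:
  fixes wt :: "nat \<Rightarrow> bool \<Rightarrow> nat \<times> nat \<Rightarrow> nat"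
  assumes V: "\<And>n. V n \<subseteq> {v\<in>{1..sz n s}. dg n s v = k}"
    and Vlim: "(\<lambda>n. real (card (V n)) / real (sz n s)) \<longlonglongrightarrow> \<beta>"
    and cls: "\<And>n s v. cls n s v = None \<Longrightarrow> dg n s v \<le> \<Delta>"
    and Glim: "(\<lambda>n. conv k (B.half_edge_mass n (cls n) (wt n) r s t) d) \<longlonglongrightarrow> \<gamma>"
    and e: "e > 0"
  shows "whp (\<lambda>n \<omega>. \<bar>real (card {v\<in>V n. fst (B.run n \<omega> (B.explore_root n (cls n) (wt n) r s v)) = d \<and>
      (snd (B.run n \<omega> (B.explore_root n (cls n) (wt n) r s v)) \<or> t)}) - \<beta> * \<gamma> * real (sz n s)\<bar> \<le> e * real (sz n s))"
proof -
  define Q where "Q = k * explored_size \<Delta> (Suc r)"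
  define E where "E = (\<lambda>cb. fst cb = d \<and> (snd cb \<or> t))"
  define S where "S = (\<lambda>n. B.explore_root n (cls n) (wt n) r s)"
  define \<pi> where "\<pi> = (\<lambda>n. conv k (B.half_edge_mass n (cls n) (wt n) r s t) d)"
  define c where "c = (\<lambda>n \<omega>. real (card {v\<in>V n. E (B.run n \<omega> (S n v))}))"
  define Y where "Y = (\<lambda>n \<omega>. ((c n \<omega> - real (card (V n)) * \<pi> n) / real (sz n s))\<^sup>2)"
  have fV: "finite (V n)" for n using V finite_subset by fastforce
  have cV: "card (V n) \<le> sz n s" for n
  proof -
    have "card (V n) \<le> card {1..sz n s}" by (rule card_mono) (use V[of n] in auto)
    then show ?thesis by simp
  qed
  have avgY: "B.avg n (Y n) \<le> 1 / real (sz n s) + 3 * B.err n (dmax n) 2 (2 * Q)"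
    if hp: "B.h n > 0" and sp: "sz n s > 0" for n
  proof -
    have "B.avg n (Y n) = B.avg n (\<lambda>\<omega>. (1 / real (sz n s))\<^sup>2 * (c n \<omega> - real (card (V n)) * \<pi> n)\<^sup>2)"
      by (rule B.avg_cong) (simp add: Y_def power_divide)
    also have "\<dots> = (1 / real (sz n s))\<^sup>2 * B.avg n (\<lambda>\<omega>. (c n \<omega> - real (card (V n)) * \<pi> n)\<^sup>2)"
      by (rule B.avg_cmult)
    also have "\<dots> \<le> (1 / real (sz n s))\<^sup>2 * (real (card (V n)) + 3 * B.err n (dmax n) 2 (2 * Q) * (real (card (V n)))\<^sup>2)"
      unfolding c_def
    proof (intro mult_left_mono B.second_moment[OF dg_le_dmax hp fV])
      fix v assume "v \<in> V n"
      then have v: "v \<in> {1..sz n s}" "dg n s v = k" using V[of n] by auto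
      have "B.query_bound n (S n v) (dg n s v * explored_size \<Delta> (Suc r))"
        unfolding S_def by (rule B.query_bound_explore_root) (rule cls)
      then show "B.query_bound n (S n v) Q" unfolding v(2) Q_def .
      show "B.proper n (S n v) (B.half_edges_at n s v) {(s, v)}"
        unfolding S_def by (rule B.proper_explore_root[OF v(1)])
      show "B.ideal n (\<lambda>r. of_bool (E r)) (S n v) = \<pi> n"
        unfolding E_def S_def \<pi>_def v(2)[symmetric] by (rule B.ideal_explore_root[OF hp])
    qed simp_all
    also have "\<dots> = (1 / real (sz n s))\<^sup>2 * real (card (V n)) +
       3 * B.err n (dmax n) 2 (2 * Q) * (real (card (V n)) / real (sz n s))\<^sup>2"
      by (simp add: algebra_simps power_divide)
    also have "\<dots> \<le> (1 / real (sz n s))\<^sup>2 * real (sz n s) + 3 * B.err n (dmax n) 2 (2 * Q) * 1\<^sup>2"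
    proof (intro add_mono mult_left_mono power_mono)
      show "real (card (V n)) \<le> real (sz n s)" using cV by simp
      then show "real (card (V n)) / real (sz n s) \<le> 1" using sp by simp
    qed (auto simp: B.err_def)
    also have "\<dots> = 1 / real (sz n s) + 3 * B.err n (dmax n) 2 (2 * Q)"
      using sp by (simp add: power2_eq_square)
    finally show ?thesis .
  qed
  have "whp (\<lambda>n \<omega>. Y n \<omega> \<le> (e / 2)\<^sup>2)"
  proof (rule whp_markov)
    show "0 \<le> Y n \<omega>" for n \<omega> by (simp add: Y_def)
    show "\<forall>\<^sub>F n in sequentially. B.avg n (Y n) \<le> 1 / real (sz n s) + 3 * B.err n (dmax n) 2 (2 * Q)"
      using h_pos sz_pos[of s] by eventually_elim (rule avgY)
    have "(\<lambda>n. 1 / real (sz n s) + 3 * B.err n (dmax n) 2 (2 * Q)) \<longlonglongrightarrow> 0 + 3 * 0"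
      by (intro tendsto_add tendsto_mult tendsto_const inv_sz err_lim)
    then show "(\<lambda>n. 1 / real (sz n s) + 3 * B.err n (dmax n) 2 (2 * Q)) \<longlonglongrightarrow> 0" by simp
  qed (use e in simp)
  moreover have "\<forall>\<^sub>F n in sequentially. \<bar>real (card (V n)) / real (sz n s) * \<pi> n - \<beta> * \<gamma>\<bar> < e / 2"
  proof -
    have "(\<lambda>n. real (card (V n)) / real (sz n s) * \<pi> n) \<longlonglongrightarrow> \<beta> * \<gamma>"
      unfolding \<pi>_def by (rule tendsto_mult[OF Vlim Glim])
    from tendstoD[OF this, of "e / 2"] e show ?thesis by (simp add: dist_real_def)
  qed
  then have "\<forall>\<^sub>F n in sequentially. \<forall>\<omega>\<in>B.MM n. Y n \<omega> \<le> (e / 2)\<^sup>2 \<longrightarrow>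
      \<bar>c n \<omega> - \<beta> * \<gamma> * real (sz n s)\<bar> \<le> e * real (sz n s)"
    using sz_pos[of s]
  proof eventually_elim
    case (elim n)
    show ?case
    proof (intro ballI impI)
      fix \<omega> assume "Y n \<omega> \<le> (e / 2)\<^sup>2"
      then have "\<bar>(c n \<omega> - real (card (V n)) * \<pi> n) / real (sz n s)\<bar> \<le> \<bar>e / 2\<bar>"
        unfolding Y_def by (simp only: abs_le_square_iff)
      then have 1: "\<bar>c n \<omega> / real (sz n s) - real (card (V n)) / real (sz n s) * \<pi> n\<bar> \<le> e / 2"
        using e by (simp add: diff_divide_distrib)
      have tri: "\<bar>x - z\<bar> \<le> e" if "\<bar>x - y\<bar> \<le> e / 2" "\<bar>y - z\<bar> < e / 2" for x y z :: real
        using that by linarith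
      have "\<bar>c n \<omega> / real (sz n s) - \<beta> * \<gamma>\<bar> \<le> e" by (rule tri[OF 1 elim(1)])
      then have "\<bar>c n \<omega> / real (sz n s) - \<beta> * \<gamma>\<bar> * real (sz n s) \<le> e * real (sz n s)"
        by (rule mult_right_mono) simp
      moreover have "\<bar>c n \<omega> / real (sz n s) - \<beta> * \<gamma>\<bar> * real (sz n s) = \<bar>(c n \<omega> / real (sz n s) - \<beta> * \<gamma>) * real (sz n s)\<bar>"
        by (simp add: abs_mult)
      moreover have "(c n \<omega> / real (sz n s) - \<beta> * \<gamma>) * real (sz n s) = c n \<omega> - \<beta> * \<gamma> * real (sz n s)"
        using elim(2) by (simp add: left_diff_distrib)
      ultimately show "\<bar>c n \<omega> - \<beta> * \<gamma> * real (sz n s)\<bar> \<le> e * real (sz n s)" by simp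
    qed
  qed
  ultimately have "whp (\<lambda>n \<omega>. \<bar>c n \<omega> - \<beta> * \<gamma> * real (sz n s)\<bar> \<le> e * real (sz n s))"
    by (rule whp_mono)
  then show ?thesis unfolding c_def E_def S_def .
qed

lemma few_nonfresh:
  fixes wt :: "nat \<Rightarrow> bool \<Rightarrow> nat \<times> nat \<Rightarrow> nat"
  assumes V: "\<And>n. V n \<subseteq> {v\<in>{1..sz n s}. dg n s v = k}"
    and cls: "\<And>n s v. cls n s v = None \<Longrightarrow> dg n s v \<le> \<Delta>" and e: "e > 0"
  shows "whp (\<lambda>n \<omega>. real (card {v\<in>V n. \<not> B.fresh n \<omega> (B.explore_root n (cls n) (wt n) r s v) {(s, v)}}) \<le> e * real (sz n s))"
proof -
  define Q where "Q = k * explored_size \<Delta> (Suc r)"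
  define S where "S = (\<lambda>n. B.explore_root n (cls n) (wt n) r s)"
  define c where "c = (\<lambda>n \<omega>. real (card {v\<in>V n. \<not> B.fresh n \<omega> (S n v) {(s, v)}}))"
  have fV: "finite (V n)" for n using V finite_subset by fastforce
  have cV: "card (V n) \<le> sz n s" for n
  proof -
    have "card (V n) \<le> card {1..sz n s}" by (rule card_mono) (use V[of n] in auto)
    then show ?thesis by simp
  qed
  have "whp (\<lambda>n \<omega>. c n \<omega> / real (sz n s) \<le> e)"
  proof (rule whp_markov)
    show "0 \<le> c n \<omega> / real (sz n s)" for n \<omega> by (simp add: c_def)
    show "\<forall>\<^sub>F n in sequentially. B.avg n (\<lambda>\<omega>. c n \<omega> / real (sz n s)) \<le> B.err n (dmax n) 1 Q"
      using h_pos sz_pos[of s]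
    proof eventually_elim
      case (elim n)
      have "c n \<omega> = (\<Sum>v\<in>V n. of_bool (\<not> B.fresh n \<omega> (S n v) {(s, v)}))" for \<omega>
        unfolding c_def using fV[of n] by (simp add: of_bool_def sum.If_cases Int_def)
      then have "B.avg n (\<lambda>\<omega>. c n \<omega> / real (sz n s)) =
         B.avg n (\<lambda>\<omega>. (1 / real (sz n s)) * (\<Sum>v\<in>V n. of_bool (\<not> B.fresh n \<omega> (S n v) {(s, v)})))"
        by (intro B.avg_cong) simp
      also have "\<dots> = (1 / real (sz n s)) * (\<Sum>v\<in>V n. B.avg n (\<lambda>\<omega>. of_bool (\<not> B.fresh n \<omega> (S n v) {(s, v)})))"
        by (simp only: B.avg_cmult B.avg_sum)
      also have "\<dots> \<le> (1 / real (sz n s)) * (\<Sum>v\<in>V n. B.err n (dmax n) 1 Q)"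
      proof (intro mult_left_mono sum_mono)
        fix v assume "v \<in> V n"
        then have v: "v \<in> {1..sz n s}" "dg n s v = k" using V[of n] by auto
        have "B.query_bound n (S n v) (dg n s v * explored_size \<Delta> (Suc r))"
          unfolding S_def by (rule B.query_bound_explore_root) (rule cls)
        then have b: "B.query_bound n (S n v) Q" unfolding v(2) Q_def .
        have p: "B.proper n (S n v) (B.half_edges_at n s v) {(s, v)}"
          unfolding S_def by (rule B.proper_explore_root[OF v(1)])
        have "B.avg n (\<lambda>\<omega>. of_bool (\<not> B.fresh n \<omega> (S n v) {(s, v)})) \<le> B.err n (dmax n) (card {(s, v)}) Q"
          by (rule B.avg_nonfresh_le[OF dg_le_dmax elim(1) b _ p B.valid_state_root]) simp_all
        then show "B.avg n (\<lambda>\<omega>. of_bool (\<not> B.fresh n \<omega> (S n v) {(s, v)})) \<le> B.err n (dmax n) 1 Q" by simp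
      qed simp
      also have "\<dots> = (real (card (V n)) / real (sz n s)) * B.err n (dmax n) 1 Q" by simp
      also have "\<dots> \<le> 1 * B.err n (dmax n) 1 Q"
        by (rule mult_right_mono) (use cV[of n] elim in \<open>auto simp: B.err_def\<close>)
      finally show ?case by simp
    qed
    show "(\<lambda>n. B.err n (dmax n) 1 Q) \<longlonglongrightarrow> 0" by (rule err_lim)
  qed (rule e)
  then have "whp (\<lambda>n \<omega>. c n \<omega> \<le> e * real (sz n s))"
    by (rule whp_mono) (use sz_pos[of s] in \<open>eventually_elim, auto simp: divide_le_eq\<close>)
  then show ?thesis unfolding c_def S_def .
qed

end

section \<open>Extinction and survival in the limit\<close>

lemma conv_tendsto:
  assumes "\<And>c. (\<lambda>n. g n c) \<longlonglongrightarrow> g' c"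
  shows "(\<lambda>n. conv k (g n) d) \<longlonglongrightarrow> conv k g' d"
proof (induct k arbitrary: d)
  case (Suc k)
  show ?case unfolding conv.simps by (intro tendsto_sum tendsto_mult assms Suc)
qed simp

lemma conv_nonneg: "(\<And>c. 0 \<le> g c) \<Longrightarrow> 0 \<le> conv k g d"
  by (induct k arbitrary: d) (auto intro!: sum_nonneg)

lemma conv_mono:
  assumes "\<And>c. 0 \<le> g c" "\<And>c. g c \<le> g' c"
  shows "conv k g d \<le> conv k g' d"
proof (induct k arbitrary: d)
  case (Suc k)
  have "0 \<le> g' c" for c using assms order_trans by blast
  then show ?case unfolding conv.simps
    by (intro sum_mono mult_mono assms Suc conv_nonneg) auto
qed simp

lemma conv_0: "conv k g 0 = g 0 ^ k"
  by (induct k) auto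

lemma power_convex:
  fixes x y t :: real
  assumes "0 \<le> x" "0 \<le> y" "0 \<le> t" "t \<le> 1"
  shows "((1 - t) * x + t * y) ^ k \<le> (1 - t) * x ^ k + t * y ^ k"
proof -
  have "convex_on {0::real..} (\<lambda>x. x ^ k)"
  proof (cases "even k")
    case True
    then show ?thesis using convex_power_even convex_on_subset by (metis convex_real_interval(1) subset_UNIV)
  next
    case False
    then show ?thesis by (rule convex_power_odd)
  qed
  from convex_onD[OF this, of t x y] assms show ?thesis by simp
qed

context bipartite_seq
begin

text \<open>
  The generating function of the offspring of a half-edge on side \<open>s\<close>.
\<close>

definition \<phi> :: "bool \<Rightarrow> real \<Rightarrow> real" where "\<phi> s = gen_fun (excess (law s))"

lemma w0: "w s 0 = 0" by (simp add: w_def)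

lemma summable_w: "summable (w s)" using w_sums sums_summable by blast

lemma pmf_size_biased_law: "pmf (size_biased (law s)) j = w s j"
  using pmf_size_biased[OF fin_mean, of s j] mean_ge_1[of s] by (simp add: w_def)

lemma \<phi>_sums:
  assumes z: "z \<in> {0..1}"
  shows "(\<lambda>j. w s j * z ^ (j - 1)) sums \<phi> s z"
proof -
  have "integrable (measure_pmf (size_biased (law s))) (\<lambda>k. z ^ (k - 1))"
  proof (rule measure_pmf.integrable_const_bound[where B = 1])
    show "AE k in measure_pmf (size_biased (law s)). norm (z ^ (k - 1)) \<le> 1"
      using z by (intro AE_I2) (auto intro: power_le_one)
  qed simp
  then have "(\<lambda>j. pmf (size_biased (law s)) j * z ^ (j - 1)) sums
      measure_pmf.expectation (size_biased (law s)) (\<lambda>k. z ^ (k - 1))"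
    by (rule pmf_expectation_sums)
  then show ?thesis by (simp add: pmf_size_biased_law \<phi>_def gen_fun_def excess_def)
qed

lemma \<phi>_mono: "0 \<le> x \<Longrightarrow> x \<le> y \<Longrightarrow> y \<le> 1 \<Longrightarrow> \<phi> s x \<le> \<phi> s y"
  by (rule sums_le[OF _ \<phi>_sums \<phi>_sums]) (auto intro!: mult_left_mono power_mono w_nonneg)

lemma \<phi>_1: "\<phi> s 1 = 1"
  using \<phi>_sums[of 1 s] w_sums[of s] by (auto dest: sums_unique2)

lemma \<phi>_range: "z \<in> {0..1} \<Longrightarrow> \<phi> s z \<in> {0..1}"
proof -
  assume z: "z \<in> {0..1}"
  have "0 \<le> \<phi> s z" by (rule sums_le[OF _ sums_zero \<phi>_sums[OF z]]) (use z in \<open>auto intro!: mult_nonneg_nonneg w_nonneg\<close>)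
  moreover have "\<phi> s z \<le> 1" using \<phi>_mono[of z 1 s] z by (simp add: \<phi>_1)
  ultimately show ?thesis by simp
qed

lemma \<phi>_convex:
  assumes "x \<in> {0..1}" "y \<in> {0..1}" "t \<in> {0..1}"
  shows "\<phi> s ((1 - t) * x + t * y) \<le> (1 - t) * \<phi> s x + t * \<phi> s y"
proof (rule sums_le)
  have "(1 - t) * x + t * y \<le> (1 - t) * 1 + t * 1" using assms by (intro add_mono mult_left_mono) auto
  then have m: "(1 - t) * x + t * y \<in> {0..1}" using assms by auto
  show "(\<lambda>j. w s j * ((1 - t) * x + t * y) ^ (j - 1)) sums \<phi> s ((1 - t) * x + t * y)" by (rule \<phi>_sums[OF m])
  show "(\<lambda>j. (1 - t) * (w s j * x ^ (j - 1)) + t * (w s j * y ^ (j - 1))) sums ((1 - t) * \<phi> s x + t * \<phi> s y)"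
    by (intro sums_add sums_mult \<phi>_sums assms)
  show "w s j * ((1 - t) * x + t * y) ^ (j - 1) \<le> (1 - t) * (w s j * x ^ (j - 1)) + t * (w s j * y ^ (j - 1))" for j
  proof -
    have "w s j * ((1 - t) * x + t * y) ^ (j - 1) \<le> w s j * ((1 - t) * x ^ (j - 1) + t * y ^ (j - 1))"
      by (intro mult_left_mono w_nonneg power_convex) (use assms in auto)
    then show ?thesis by (simp add: algebra_simps)
  qed
qed

lemma \<phi>_continuous: "continuous_on {0..1} (\<phi> s)"
proof -
  have u: "uniform_limit {0..1::real} (\<lambda>n x. \<Sum>j<n. w s j * x ^ (j - 1)) (\<lambda>x. \<Sum>j. w s j * x ^ (j - 1)) sequentially"
  proof (rule Weierstrass_m_test[where M = "w s"])
    show "summable (w s)" by (rule summable_w)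
    fix j x assume "x \<in> {0..1::real}"
    then show "norm (w s j * x ^ (j - 1)) \<le> w s j"
      using w_nonneg[of s j] by (auto simp: abs_mult power_le_one intro!: mult_left_le)
  qed
  have "continuous_on {0..1} (\<lambda>x::real. \<Sum>j. w s j * x ^ (j - 1))"
    by (rule uniform_limit_theorem[OF _ u]) (auto intro!: always_eventually continuous_intros)
  then show ?thesis
    by (rule continuous_on_cong[THEN iffD1, rotated 2]) (auto simp: sums_unique[OF \<phi>_sums])
qed

text \<open>
  The limit of \<open>dieprob\<close> when the exploration stops, with the verdict
  \<open>b\<close>, at degrees above \<open>\<Delta>\<close> and at all but a proportion
  \<open>\<theta> s\<close> of the other vertices on side \<open>s\<close>.
\<close>

primrec die_limit :: "(bool \<Rightarrow> real) \<Rightarrow> nat \<Rightarrow> bool \<Rightarrow> nat \<Rightarrow> bool \<Rightarrow> real" where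
  "die_limit \<theta> \<Delta> b 0 s = 0"
| "die_limit \<theta> \<Delta> b (Suc r) s = of_bool b * (1 - (\<Sum>j=1..\<Delta>. \<theta> (\<not> s) * w (\<not> s) j)) +
     (\<Sum>j=1..\<Delta>. \<theta> (\<not> s) * w (\<not> s) j * die_limit \<theta> \<Delta> b r (\<not> s) ^ (j - 1))"

lemma sum_w_le_1: "(\<Sum>j=1..\<Delta>. w s j) \<le> 1"
proof -
  have "(\<Sum>j=1..\<Delta>. w s j) \<le> suminf (w s)"
    by (rule sum_le_suminf[OF summable_w]) (auto intro: w_nonneg)
  then show ?thesis using w_sums[of s] by (simp add: sums_unique[symmetric])
qed

lemma partial_le_\<phi>:
  assumes "z \<in> {0..1}" shows "(\<Sum>j=1..\<Delta>. w s j * z ^ (j - 1)) \<le> \<phi> s z"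
proof -
  have "(\<Sum>j=1..\<Delta>. w s j * z ^ (j - 1)) \<le> suminf (\<lambda>j. w s j * z ^ (j - 1))"
    by (rule sum_le_suminf) (use \<phi>_sums[OF assms, of s] assms in \<open>auto intro!: mult_nonneg_nonneg w_nonneg simp: sums_iff\<close>)
  then show ?thesis using \<phi>_sums[OF assms, of s] by (simp add: sums_iff)
qed

lemma partial_lim_\<phi>:
  assumes "z \<in> {0..1}" shows "(\<lambda>\<Delta>. \<Sum>j=1..\<Delta>. w s j * z ^ (j - 1)) \<longlonglongrightarrow> \<phi> s z"
proof -
  have "(\<lambda>\<Delta>. \<Sum>j<Suc \<Delta>. w s j * z ^ (j - 1)) \<longlonglongrightarrow> \<phi> s z"
    using \<phi>_sums[OF assms, of s] unfolding sums_def by (rule LIMSEQ_Suc)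
  moreover have "(\<Sum>j<Suc \<Delta>. w s j * z ^ (j - 1)) = (\<Sum>j=1..\<Delta>. w s j * z ^ (j - 1))" for \<Delta>
    by (rule sum.mono_neutral_right) (auto simp: w0 Suc_le_eq)
  ultimately show ?thesis by simp
qed

lemma partial_lim_w: "(\<lambda>\<Delta>. \<Sum>j=1..\<Delta>. w s j) \<longlonglongrightarrow> 1"
  using partial_lim_\<phi>[of 1 s] by (simp add: \<phi>_1)

end

locale supercritical_seq = bipartite_seq +
  fixes \<eta>l \<eta>r :: real
  assumes eta_l: "\<eta>l \<in> {0..1}" "\<eta>l = \<phi> False (\<phi> True \<eta>l)"
    and least: "\<And>x. x \<in> {0..1} \<Longrightarrow> x = \<phi> False (\<phi> True x) \<Longrightarrow> \<eta>l \<le> x"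
    and eta_r: "\<eta>r = \<phi> True \<eta>l"
    and supercritical: "ext_mean (excess (law True)) * ext_mean (excess (law False)) > 1"
begin

lemma eta_r_range: "\<eta>r \<in> {0..1}" using \<phi>_range[OF eta_l(1)] by (simp add: eta_r)

lemma ff_continuous: "continuous_on {0..1} (\<lambda>x. \<phi> False (\<phi> True x))"
  by (rule continuous_on_compose2[OF \<phi>_continuous \<phi>_continuous]) (use \<phi>_range in auto)

text \<open>
  A supersolution has a solution below it, by the intermediate value theorem, as the map is
  nonnegative at 0.
\<close>

lemma super_ge_eta:
  assumes x: "x \<in> {0..1}" "\<phi> False (\<phi> True x) \<le> x" shows "\<eta>l \<le> x"
proof -
  have "\<exists>y. 0 \<le> y \<and> y \<le> x \<and> y - \<phi> False (\<phi> True y) = 0"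
  proof (rule IVT')
    show "0 - \<phi> False (\<phi> True 0) \<le> 0" using \<phi>_range[OF \<phi>_range[of 0 True], of False] by simp
    show "0 \<le> x - \<phi> False (\<phi> True x)" using x by simp
    show "continuous_on {0..x} (\<lambda>y. y - \<phi> False (\<phi> True y))"
      by (intro continuous_intros continuous_on_subset[OF ff_continuous]) (use x in auto)
  qed (use x in auto)
  then obtain y where y: "0 \<le> y" "y \<le> x" "y = \<phi> False (\<phi> True y)" by auto
  then have "\<eta>l \<le> y" by (intro least) (use x in auto)
  then show ?thesis using y by simp
qed

text \<open>
  The extinction probability behind a half-edge of side \<open>s\<close>, whose partner belongs
  to the opposite side.
\<close>

definition eta :: "bool \<Rightarrow> real" where "eta s = (if s then \<eta>l else \<eta>r)"

lemma eta_range: "eta s \<in> {0..1}" using eta_l eta_r_range by (simp add: eta_def)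

lemma eta_fix: "eta s = \<phi> (\<not> s) (eta (\<not> s))"
proof -
  have "\<phi> False \<eta>r = \<eta>l" using eta_l(2) unfolding eta_r[symmetric] by (rule sym)
  then show ?thesis by (cases s) (simp_all add: eta_def eta_r[symmetric])
qed

lemma die_limit_died_bounds: "0 \<le> die_limit (\<lambda>_. 1) \<Delta> False r s \<and> die_limit (\<lambda>_. 1) \<Delta> False r s \<le> eta s"
proof (induct r arbitrary: s)
  case 0
  then show ?case using eta_range[of s] by simp
next
  case (Suc r)
  let ?x = "die_limit (\<lambda>_. 1) \<Delta> False r (\<not> s)"
  have "(\<Sum>j=1..\<Delta>. w (\<not> s) j * ?x ^ (j - 1)) \<le> (\<Sum>j=1..\<Delta>. w (\<not> s) j * eta (\<not> s) ^ (j - 1))"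
    by (intro sum_mono mult_left_mono power_mono w_nonneg) (use Suc[of "\<not> s"] in auto)
  also have "\<dots> \<le> \<phi> (\<not> s) (eta (\<not> s))" by (rule partial_le_\<phi>[OF eta_range])
  finally show ?case using Suc[of "\<not> s"] unfolding eta_fix[of s, symmetric]
    by (auto intro!: sum_nonneg mult_nonneg_nonneg w_nonneg)
qed

lemma die_limit_died_mono:
  "\<Delta> \<le> \<Delta>' \<Longrightarrow> r \<le> r' \<Longrightarrow> die_limit (\<lambda>_. 1) \<Delta> False r s \<le> die_limit (\<lambda>_. 1) \<Delta>' False r' s"
proof (induct r arbitrary: s r')
  case 0
  then show ?case using die_limit_died_bounds by simp
next
  case (Suc r)
  obtain r'' where r'': "r' = Suc r''" "r \<le> r''" using Suc.prems(2) by (cases r') auto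
  let ?x = "die_limit (\<lambda>_. 1) \<Delta> False r (\<not> s)" and ?y = "die_limit (\<lambda>_. 1) \<Delta>' False r'' (\<not> s)"
  have xy: "?x \<le> ?y" by (rule Suc.hyps[OF Suc.prems(1) r''(2)])
  have b: "0 \<le> ?x" "0 \<le> ?y" using die_limit_died_bounds by auto
  have "(\<Sum>j=1..\<Delta>. w (\<not> s) j * ?x ^ (j - 1)) \<le> (\<Sum>j=1..\<Delta>. w (\<not> s) j * ?y ^ (j - 1))"
    by (intro sum_mono mult_left_mono power_mono w_nonneg xy b)
  also have "\<dots> \<le> (\<Sum>j=1..\<Delta>'. w (\<not> s) j * ?y ^ (j - 1))"
    by (rule sum_mono2) (use Suc.prems b in \<open>auto intro!: mult_nonneg_nonneg w_nonneg\<close>)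
  finally show ?case by (simp add: r'')
qed

text \<open>
  With large degrees counted as surviving, the recursion started from 0 increases and stays
  below \<open>eta\<close>. Raising the depth and the truncation level together, its limit is a
  supersolution of the untruncated equation, so it equals the smallest fixed point.
\<close>

lemma die_limit_died_lim: "(\<lambda>r. die_limit (\<lambda>_. 1) r False r s) \<longlonglongrightarrow> eta s"
proof -
  let ?a = "\<lambda>r s. die_limit (\<lambda>_. 1) r False r s"
  have inc: "incseq (\<lambda>r. ?a r s)" for s by (rule incseq_SucI) (rule die_limit_died_mono, auto)
  have bd: "?a r s \<le> eta s" for r s using die_limit_died_bounds by blast
  have "\<exists>L. (\<lambda>r. ?a r s) \<longlonglongrightarrow> L" for s
    using incseq_convergent[OF inc, of s "eta s"] bd by metis
  then obtain L where L: "\<And>s. (\<lambda>r. ?a r s) \<longlonglongrightarrow> L s" by metis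
  have Lr: "L s \<in> {0..1}" and Le: "L s \<le> eta s" for s
  proof -
    show e: "L s \<le> eta s" by (rule LIMSEQ_le_const2[OF L]) (use bd in auto)
    have "0 \<le> L s" by (rule LIMSEQ_le_const[OF L]) (use die_limit_died_bounds in auto)
    then show "L s \<in> {0..1}" using e eta_range[of s] by auto
  qed
  have ge: "\<phi> (\<not> s) (L (\<not> s)) \<le> L s" for s
  proof (rule LIMSEQ_le_const2[OF partial_lim_\<phi>[OF Lr]], intro exI allI impI)
    fix T assume "T \<ge> (0::nat)"
    have "(\<lambda>r. \<Sum>j=1..T. w (\<not> s) j * ?a r (\<not> s) ^ (j - 1)) \<longlonglongrightarrow> (\<Sum>j=1..T. w (\<not> s) j * L (\<not> s) ^ (j - 1))"
      by (intro tendsto_sum tendsto_mult tendsto_power tendsto_const L)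
    moreover have "(\<Sum>j=1..T. w (\<not> s) j * ?a r (\<not> s) ^ (j - 1)) \<le> ?a (Suc r) s" if "r \<ge> T" for r
    proof -
      have b: "0 \<le> ?a r (\<not> s)" "?a r (\<not> s) \<le> die_limit (\<lambda>_. 1) (Suc r) False r (\<not> s)"
        using die_limit_died_bounds die_limit_died_mono by auto
      have "(\<Sum>j=1..T. w (\<not> s) j * ?a r (\<not> s) ^ (j - 1)) \<le> (\<Sum>j=1..Suc r. w (\<not> s) j * ?a r (\<not> s) ^ (j - 1))"
        by (rule sum_mono2) (use that b in \<open>auto intro!: mult_nonneg_nonneg w_nonneg\<close>)
      also have "\<dots> \<le> (\<Sum>j=1..Suc r. w (\<not> s) j * die_limit (\<lambda>_. 1) (Suc r) False r (\<not> s) ^ (j - 1))"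
        by (intro sum_mono mult_left_mono power_mono w_nonneg b)
      finally show ?thesis by simp
    qed
    ultimately show "(\<Sum>j=1..T. w (\<not> s) j * L (\<not> s) ^ (j - 1)) \<le> L s"
      by (intro LIMSEQ_le[OF _ LIMSEQ_Suc[OF L[of s]]]) auto
  qed
  have "\<phi> False (\<phi> True (L True)) \<le> \<phi> False (L False)"
    by (rule \<phi>_mono) (use ge[of False] Lr \<phi>_range[OF Lr] in auto)
  also have "\<dots> \<le> L True" using ge[of True] by simp
  finally have "\<eta>l \<le> L True" by (rule super_ge_eta[OF Lr])
  then have 1: "L True = eta True" using Le[of True] by (simp add: eta_def)
  have "eta False = \<phi> True (L True)" using eta_fix[of False] 1 by simp
  also have "\<dots> \<le> L False" using ge[of False] by simp
  finally have "L False = eta False" using Le[of False] by simp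
  then have "L s = eta s" using 1 by (cases s) auto
  then show ?thesis using L[of s] by simp
qed

text \<open>
  The probability that one of the truncated number of children survives when each survives with
  probability \<open>u\<close>. Being a polynomial, it is differentiable at 0 even if the
  offspring law has infinite mean.
\<close>

definition \<psi> :: "nat \<Rightarrow> bool \<Rightarrow> real \<Rightarrow> real" where
  "\<psi> T s u = (\<Sum>j=1..T. w s j * (1 - (1 - u) ^ (j - 1)))"

lemma \<psi>_le:
  assumes "u \<in> {0..1}" shows "\<psi> T s u \<le> 1 - \<phi> s (1 - u)" "\<psi> T s u \<in> {0..1}"
proof -
  have z: "1 - u \<in> {0..1}" using assms by auto
  have nn: "0 \<le> w s j * (1 - (1 - u) ^ (j - 1))" for j
    using z by (intro mult_nonneg_nonneg w_nonneg) (auto simp: power_le_one)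
  have sm: "(\<lambda>j. w s j - w s j * (1 - u) ^ (j - 1)) sums (1 - \<phi> s (1 - u))"
    by (intro sums_diff w_sums \<phi>_sums z)
  have "\<psi> T s u \<le> suminf (\<lambda>j. w s j - w s j * (1 - u) ^ (j - 1))"
    unfolding \<psi>_def right_diff_distrib mult_1_right
    by (rule sum_le_suminf) (use sm nn in \<open>auto simp: sums_iff right_diff_distrib\<close>)
  then show 1: "\<psi> T s u \<le> 1 - \<phi> s (1 - u)" using sm by (simp add: sums_iff)
  show "\<psi> T s u \<in> {0..1}" using 1 \<phi>_range[OF z, of s] nn by (auto simp: \<psi>_def intro!: sum_nonneg)
qed

lemma \<psi>_deriv:
  "(\<psi> T s has_real_derivative (\<Sum>j=1..T. w s j * (real (j - 1) * (1 - u) ^ (j - 1 - 1)))) (at u)"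
  unfolding \<psi>_def[abs_def]
  by (rule derivative_eq_intros refl sum.cong | simp)+

lemma partial_mean_lim:
  "(\<lambda>T. ennreal (\<Sum>j=1..T. w s j * real (j - 1))) \<longlonglongrightarrow> ext_mean (excess (law s))"
proof -
  have "ext_mean (excess (law s)) = (\<integral>\<^sup>+ k. of_nat (k - 1) \<partial>measure_pmf (size_biased (law s)))"
    by (simp add: ext_mean_def excess_def)
  also have "\<dots> = (\<integral>\<^sup>+ k. ennreal (w s k) * of_nat (k - 1) \<partial>count_space UNIV)"
    by (simp add: nn_integral_measure_pmf pmf_size_biased_law)
  also have "\<dots> = (\<Sum>k. ennreal (w s k) * of_nat (k - 1))" by (rule nn_integral_count_space_nat)
  finally have e: "ext_mean (excess (law s)) = (\<Sum>k. ennreal (w s k) * of_nat (k - 1))" .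
  have "(\<lambda>k. ennreal (w s k) * of_nat (k - 1)) sums ext_mean (excess (law s))"
    unfolding e by (rule summable_sums) (rule summableI)
  then have "(\<lambda>T. \<Sum>k<Suc T. ennreal (w s k) * of_nat (k - 1)) \<longlonglongrightarrow> ext_mean (excess (law s))"
    unfolding sums_def by (rule LIMSEQ_Suc)
  moreover have "(\<Sum>k<Suc T. ennreal (w s k) * of_nat (k - 1)) = ennreal (\<Sum>j=1..T. w s j * real (j - 1))" for T
  proof -
    have "(\<Sum>k<Suc T. ennreal (w s k) * of_nat (k - 1)) = (\<Sum>k<Suc T. ennreal (w s k * real (k - 1)))"
      by (intro sum.cong refl) (simp add: ennreal_mult w_nonneg ennreal_of_nat_eq_real_of_nat)
    also have "\<dots> = ennreal (\<Sum>k<Suc T. w s k * real (k - 1))"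
      by (rule sum_ennreal) (simp add: w_nonneg)
    also have "(\<Sum>k<Suc T. w s k * real (k - 1)) = (\<Sum>j=1..T. w s j * real (j - 1))"
      by (rule sum.mono_neutral_right) (auto simp: w0)
    finally show ?thesis .
  qed
  ultimately show ?thesis by simp
qed

text \<open>
  Truncate so that the product of the two truncated means still exceeds 1; this is possible also
  for infinite means. The two-step survival map then has slope more than 1 at 0, so it lies
  above the diagonal for small \<open>u\<close>, and \<open>1 - u\<close> is the required point.
\<close>

lemma subcritical_point: "\<exists>z. 0 < z \<and> z < 1 \<and> \<phi> False (\<phi> True z) < z"
proof -
  let ?S = "\<lambda>T s. \<Sum>j=1..T. w s j * real (j - 1)"
  have "(\<lambda>T. ennreal (?S T True) * ennreal (?S T False)) \<longlonglongrightarrow> ext_mean (excess (law True)) * ext_mean (excess (law False))"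
    by (rule tendsto_mult_ennreal[OF partial_mean_lim partial_mean_lim]) (use supercritical in auto)
  then have "\<forall>\<^sub>F T in sequentially. ennreal (?S T True) * ennreal (?S T False) > 1"
    by (rule order_tendstoD) (rule supercritical)
  then obtain T where "ennreal (?S T True) * ennreal (?S T False) > 1" by (auto simp: eventually_sequentially)
  moreover have nn: "?S T s \<ge> 0" for s by (intro sum_nonneg mult_nonneg_nonneg w_nonneg) auto
  ultimately have "ennreal (?S T True * ?S T False) > ennreal 1" by (simp add: ennreal_mult)
  then have S: "?S T True * ?S T False > 1" by (subst (asm) ennreal_less_iff) auto
  let ?F = "\<lambda>u. \<psi> T False (\<psi> T True u) - u"
  have z: "\<psi> T True 0 = 0" "\<psi> T False 0 = 0" by (simp_all add: \<psi>_def)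
  have d1: "(\<psi> T s has_real_derivative ?S T s) (at 0)" for s
    using \<psi>_deriv[of T s 0] by simp
  have "((\<lambda>u. \<psi> T False (\<psi> T True u)) has_real_derivative ?S T False * ?S T True) (at 0)"
    by (rule DERIV_chain2[OF _ d1]) (simp only: z d1)
  then have "(?F has_real_derivative ?S T False * ?S T True - 1) (at 0)"
    by (rule DERIV_diff) (rule DERIV_ident)
  from DERIV_pos_inc_right[OF this] S obtain d where d: "d > 0" "\<And>h. 0 < h \<Longrightarrow> h < d \<Longrightarrow> ?F 0 < ?F (0 + h)"
    by (auto simp: mult.commute)
  define u where "u = min (1/2) (d / 2)"
  have u: "0 < u" "u < d" "u < 1" "u \<in> {0..1}" using d(1) by (auto simp: u_def)
  have "?F 0 < ?F (0 + u)" by (rule d(2)[OF u(1,2)])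
  then have gt: "u < \<psi> T False (\<psi> T True u)" by (simp add: z)
  have r: "\<psi> T True u \<in> {0..1}" "\<psi> T True u \<le> 1 - \<phi> True (1 - u)" using \<psi>_le[OF u(4)] by auto
  have pr: "\<phi> True (1 - u) \<in> {0..1}" by (rule \<phi>_range) (use u in auto)
  have "\<phi> False (\<phi> True (1 - u)) \<le> \<phi> False (1 - \<psi> T True u)"
    by (rule \<phi>_mono) (use r pr in auto)
  also have "\<dots> \<le> 1 - \<psi> T False (\<psi> T True u)" using \<psi>_le(1)[OF r(1), of T False] by simp
  also have "\<dots> < 1 - u" using gt by simp
  finally show ?thesis using u by (intro exI[of _ "1 - u"]) auto
qed

lemma eta_l_less_1: "\<eta>l < 1"
proof -
  obtain z where z: "0 < z" "z < 1" "\<phi> False (\<phi> True z) < z" using subcritical_point by blast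
  have "\<eta>l \<le> z" by (rule super_ge_eta) (use z in auto)
  then show ?thesis using z by simp
qed

text \<open>
  By convexity the whole segment between the fixed point \<open>\<eta>l\<close> and the point of
  \<open>subcritical_point\<close> consists of strict supersolutions, and those near
  \<open>\<eta>l\<close> have an image near \<open>\<eta>r\<close>.
\<close>

lemma near_supersolution:
  assumes d: "\<delta> > 0"
  shows "\<exists>z. \<eta>l < z \<and> z < 1 \<and> \<phi> False (\<phi> True z) < z \<and> \<phi> True z \<le> \<eta>r + \<delta>"
proof -
  obtain z0 where z0: "0 < z0" "z0 < 1" "\<phi> False (\<phi> True z0) < z0" using subcritical_point by blast
  have "\<eta>l \<le> z0" by (rule super_ge_eta) (use z0 in auto)
  moreover have "\<eta>l \<noteq> z0" using z0(3) eta_l(2) by auto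
  ultimately have lt: "\<eta>l < z0" by simp
  let ?m = "\<lambda>t. (1 - t) * \<eta>l + t * z0"
  have "continuous_on {0..1} (\<lambda>t. \<phi> True (?m t))"
  proof (rule continuous_on_compose2[OF \<phi>_continuous])
    show "?m ` {0..1} \<subseteq> {0..1}"
    proof (rule image_subsetI)
      fix t :: real assume t: "t \<in> {0..1}"
      have "?m t \<le> (1 - t) * 1 + t * 1" using t z0 eta_l by (intro add_mono mult_left_mono) auto
      then show "?m t \<in> {0..1}" using t z0 eta_l by auto
    qed
  qed (intro continuous_intros)
  then have "((\<lambda>t. \<phi> True (?m t)) \<longlongrightarrow> \<phi> True (?m 0)) (at 0 within {0..1})"
    unfolding continuous_on_def by (rule bspec) simp
  from tendstoD[OF this d] obtain e where e: "e > 0"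
    "\<And>t. t \<in> {0..1} \<Longrightarrow> t \<noteq> 0 \<Longrightarrow> dist t 0 < e \<Longrightarrow> dist (\<phi> True (?m t)) (\<phi> True (?m 0)) < \<delta>"
    by (auto simp: eventually_at)
  define t where "t = min (1/2) (e / 2)"
  have t: "0 < t" "t < 1" "t < e" "t \<in> {0..1}" using e(1) by (auto simp: t_def)
  have z0r: "z0 \<in> {0..1}" using z0 by auto
  have "?m t - \<eta>l = t * (z0 - \<eta>l)" by (simp add: algebra_simps)
  moreover have "t * (z0 - \<eta>l) > 0" using t lt by simp
  ultimately have 1: "\<eta>l < ?m t" by linarith
  have "z0 - ?m t = (1 - t) * (z0 - \<eta>l)" by (simp add: algebra_simps)
  moreover have "(1 - t) * (z0 - \<eta>l) > 0" using t lt by simp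
  ultimately have 2: "?m t < 1" using z0 by linarith
  have c: "\<phi> True (?m t) \<le> (1 - t) * \<phi> True \<eta>l + t * \<phi> True z0"
    by (rule \<phi>_convex[OF eta_l(1) z0r t(4)])
  have m: "?m t \<in> {0..1}" using 1 2 eta_l(1) by auto
  have rr: "(1 - t) * \<phi> True \<eta>l + t * \<phi> True z0 \<le> (1 - t) * 1 + t * 1"
    using \<phi>_range[OF eta_l(1), of True] \<phi>_range[OF z0r, of True] t by (intro add_mono mult_left_mono) auto
  have "\<phi> False (\<phi> True (?m t)) \<le> \<phi> False ((1 - t) * \<phi> True \<eta>l + t * \<phi> True z0)"
    by (rule \<phi>_mono) (use c rr \<phi>_range[OF m, of True] in auto)
  also have "\<dots> \<le> (1 - t) * \<phi> False (\<phi> True \<eta>l) + t * \<phi> False (\<phi> True z0)"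
    by (rule \<phi>_convex[OF \<phi>_range[OF eta_l(1)] \<phi>_range[OF z0r] t(4)])
  also have "\<dots> < ?m t" using z0(3) eta_l(2) t(1) by simp
  finally have 3: "\<phi> False (\<phi> True (?m t)) < ?m t" .
  have "dist (\<phi> True (?m t)) (\<phi> True (?m 0)) < \<delta>" by (rule e(2)) (use t in auto)
  then have "\<phi> True (?m t) \<le> \<eta>r + \<delta>" by (simp add: eta_r dist_real_def)
  then show ?thesis using 1 2 3 by blast
qed

lemma eta_r_less_1: "\<eta>r < 1"
proof (rule ccontr)
  assume "\<not> \<eta>r < 1"
  then have "\<eta>r = 1" using eta_r_range by auto
  then have "\<eta>l = 1" using eta_l(2) eta_r \<phi>_1 by simp
  then show False using eta_l_less_1 by simp
qed

text \<open>
  Here large degrees and flagged vertices count as dying, which raises the probability of dying.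
  A strict supersolution has room for this: for large \<open>\<Delta>\<close> and small
  \<open>\<epsilon>\<close> the pair \<open>(z, y)\<close> is still a supersolution of the
  perturbed recursion, and the recursion, started at 0, stays below it in every generation.
\<close>

lemma die_limit_alive_bound:
  assumes d: "\<delta> > 0"
  shows "\<exists>\<epsilon>0>0. \<exists>\<Delta>\<ge>\<Delta>0. \<forall>\<epsilon>. 0 \<le> \<epsilon> \<longrightarrow> \<epsilon> \<le> \<epsilon>0 \<longrightarrow>
     (\<forall>r. die_limit (\<lambda>s. if s then 1 else 1 - \<epsilon>) \<Delta> True r False \<le> \<eta>r + \<delta>)"
proof -
  obtain z where z: "\<eta>l < z" "z < 1" "\<phi> False (\<phi> True z) < z" "\<phi> True z \<le> \<eta>r + \<delta> / 2"
    using near_supersolution[of "\<delta> / 2"] d by auto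
  have zr: "z \<in> {0..1}" using z eta_l(1) by auto
  let ?y = "\<phi> True z"
  have yr: "?y \<in> {0..1}" by (rule \<phi>_range[OF zr])
  have y1: "?y < 1"
  proof (rule ccontr)
    assume "\<not> ?y < 1"
    then have "?y = 1" using yr by auto
    then show False using z \<phi>_1 by simp
  qed
  have "(\<phi> False \<longlongrightarrow> \<phi> False ?y) (at ?y within {0..1})" using \<phi>_continuous yr by (auto simp: continuous_on_def)
  from tendstoD[OF this, of "z - \<phi> False ?y"] z(3) obtain e where e: "e > 0"
    "\<And>x. x \<in> {0..1} \<Longrightarrow> x \<noteq> ?y \<Longrightarrow> dist x ?y < e \<Longrightarrow> dist (\<phi> False x) (\<phi> False ?y) < z - \<phi> False ?y"
    by (auto simp: eventually_at)
  (* strictly above the image of z, yet mapped below z, below 1, and within delta of eta_r *)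
  define y where "y = ?y + min (min (e / 2) (\<delta> / 2)) ((1 - ?y) / 2)"
  have y: "?y < y" "y < 1" "y \<in> {0..1}" "dist y ?y < e" "y \<le> ?y + \<delta> / 2"
    using e(1) d y1 yr by (auto simp: y_def dist_real_def min_def field_simps split: if_splits)
  have "dist (\<phi> False y) (\<phi> False ?y) < z - \<phi> False ?y" by (rule e(2)) (use y in auto)
  then have fy: "\<phi> False y < z" by (simp add: dist_real_def)
  have lim: "(\<lambda>\<Delta>. 1 - ((\<Sum>j=1..\<Delta>. w s j) - (\<Sum>j=1..\<Delta>. w s j * x ^ (j - 1)))) \<longlonglongrightarrow> 1 - (1 - \<phi> s x)"
    if "x \<in> {0..1}" for s x
    by (intro tendsto_diff tendsto_const partial_lim_w partial_lim_\<phi> that)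
  have ev1: "\<forall>\<^sub>F \<Delta> in sequentially. 1 - ((\<Sum>j=1..\<Delta>. w True j) - (\<Sum>j=1..\<Delta>. w True j * z ^ (j - 1))) < y"
    using order_tendstoD(2)[OF lim[OF zr, of True], of y] y(1) by simp
  (* half of the room below z absorbs the truncation, the other half the flagged vertices *)
  define g where "g = (z - \<phi> False y) / 2"
  have g: "g > 0" using fy by (simp add: g_def)
  have ev2: "\<forall>\<^sub>F \<Delta> in sequentially. 1 - ((\<Sum>j=1..\<Delta>. w False j) - (\<Sum>j=1..\<Delta>. w False j * y ^ (j - 1))) < z - g"
    using order_tendstoD(2)[OF lim[OF y(3), of False], of "z - g"] fy by (simp add: g_def field_simps)
  obtain \<Delta> where \<Delta>: "\<Delta> \<ge> \<Delta>0" "1 - ((\<Sum>j=1..\<Delta>. w True j) - (\<Sum>j=1..\<Delta>. w True j * z ^ (j - 1))) < y"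
    "1 - ((\<Sum>j=1..\<Delta>. w False j) - (\<Sum>j=1..\<Delta>. w False j * y ^ (j - 1))) < z - g"
    using eventually_conj[OF eventually_conj[OF ev1 ev2] eventually_ge_at_top[of \<Delta>0]]
    by (auto simp: eventually_sequentially)
  have main: "die_limit (\<lambda>s. if s then 1 else 1 - \<epsilon>) \<Delta> True r True \<le> z \<and> die_limit (\<lambda>s. if s then 1 else 1 - \<epsilon>) \<Delta> True r False \<le> y
     \<and> 0 \<le> die_limit (\<lambda>s. if s then 1 else 1 - \<epsilon>) \<Delta> True r True \<and> 0 \<le> die_limit (\<lambda>s. if s then 1 else 1 - \<epsilon>) \<Delta> True r False"
    if \<epsilon>: "0 \<le> \<epsilon>" "\<epsilon> \<le> min g 1" for r \<epsilon>
  proof (induct r)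
    case 0
    then show ?case using zr y by simp
  next
    case (Suc r)
    let ?X = "die_limit (\<lambda>s. if s then 1 else 1 - \<epsilon>) \<Delta> True r"
    have e1: "0 \<le> 1 - \<epsilon>" "1 - \<epsilon> \<le> 1" using \<epsilon> by auto
    have sF: "(\<Sum>j=1..\<Delta>. w False j * ?X False ^ (j - 1)) \<le> (\<Sum>j=1..\<Delta>. w False j * y ^ (j - 1))"
      by (intro sum_mono mult_left_mono power_mono w_nonneg) (use Suc in auto)
    have sT: "(\<Sum>j=1..\<Delta>. w True j * ?X True ^ (j - 1)) \<le> (\<Sum>j=1..\<Delta>. w True j * z ^ (j - 1))"
      by (intro sum_mono mult_left_mono power_mono w_nonneg) (use Suc in auto)
    have nF: "0 \<le> (\<Sum>j=1..\<Delta>. w False j * ?X False ^ (j - 1))" and nT: "0 \<le> (\<Sum>j=1..\<Delta>. w True j * ?X True ^ (j - 1))"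
      using Suc by (auto intro!: sum_nonneg mult_nonneg_nonneg w_nonneg)
    have XT: "die_limit (\<lambda>s. if s then 1 else 1 - \<epsilon>) \<Delta> True (Suc r) True =
       1 - (1 - \<epsilon>) * ((\<Sum>j=1..\<Delta>. w False j) - (\<Sum>j=1..\<Delta>. w False j * ?X False ^ (j - 1)))"
      by (simp add: sum_distrib_left algebra_simps)
    have XF: "die_limit (\<lambda>s. if s then 1 else 1 - \<epsilon>) \<Delta> True (Suc r) False =
       1 - ((\<Sum>j=1..\<Delta>. w True j) - (\<Sum>j=1..\<Delta>. w True j * ?X True ^ (j - 1)))"
      by simp
    have Fy: "die_limit (\<lambda>s. if s then 1 else 1 - \<epsilon>) \<Delta> True (Suc r) False \<le> y" unfolding XF using sT \<Delta>(2) by linarith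
    let ?D = "(\<Sum>j=1..\<Delta>. w False j) - (\<Sum>j=1..\<Delta>. w False j * ?X False ^ (j - 1))"
    have D1: "?D \<le> 1" using nF sum_w_le_1[where s=False and \<Delta>=\<Delta>] by linarith
    have D2: "1 - ?D < z - g" using sF \<Delta>(3) by linarith
    have "\<epsilon> * ?D \<le> \<epsilon> * 1" by (rule mult_left_mono[OF D1 \<epsilon>(1)])
    moreover have "(1 - \<epsilon>) * ?D = ?D - \<epsilon> * ?D" by (simp only: left_diff_distrib mult_1_left)
    ultimately have Tz: "1 - (1 - \<epsilon>) * ?D \<le> z" using D2 \<epsilon> by (auto simp: min_def split: if_splits)
    have "(1 - \<epsilon>) * ?D \<le> 1"
    proof (cases "?D \<ge> 0")
      case True
      then have "(1 - \<epsilon>) * ?D \<le> 1 * 1" by (intro mult_mono e1 D1) auto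
      then show ?thesis by simp
    next
      case False
      then have "(1 - \<epsilon>) * ?D \<le> 0" using e1 by (intro mult_nonneg_nonpos) auto
      then show ?thesis by simp
    qed
    then have T0: "0 \<le> 1 - (1 - \<epsilon>) * ?D" by simp
    have F0: "0 \<le> die_limit (\<lambda>s. if s then 1 else 1 - \<epsilon>) \<Delta> True (Suc r) False"
      unfolding XF using nT sum_w_le_1[where s=True and \<Delta>=\<Delta>] by linarith
    show ?case unfolding XT using Tz T0 Fy F0 by blast
  qed
  have "die_limit (\<lambda>s. if s then 1 else 1 - \<epsilon>) \<Delta> True r False \<le> \<eta>r + \<delta>" if "0 \<le> \<epsilon>" "\<epsilon> \<le> min g 1" for \<epsilon> r
    using main[OF that, of r] y(5) z(4) by linarith
  then show ?thesis using g \<Delta>(1) by (intro exI[of _ "min g 1"] conjI exI[of _ \<Delta>]) auto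
qed

end

section \<open>How many vertices lie in large components\<close>

context bipartite_seq
begin

text \<open>
  Stopped half-edges are counted through their complement, because the assumptions give limits
  for each single degree only.
\<close>

lemma stepval_avg_lim:
  assumes tot: "(\<lambda>n. real (card {z\<in>B.HE n s. \<psi> n z}) / real (B.h n)) \<longlonglongrightarrow> \<kappa>t"
    and part: "\<And>j. (\<lambda>n. real (card {z\<in>B.HE n s. \<psi> n z \<and> dg n s (fst z) = j \<and> \<not> (\<not> s \<and> fst z \<in> F n)}) / real (B.h n)) \<longlonglongrightarrow> \<kappa> j"
    and x: "(\<lambda>n. B.dieprob n (cls_of \<Delta> (F n) b (dg n)) r s) \<longlonglongrightarrow> x"
  shows "(\<lambda>n. (\<Sum>z\<in>{z\<in>B.HE n s. \<psi> n z}. B.stepval n (cls_of \<Delta> (F n) b (dg n)) r s z) / real (B.h n))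
    \<longlonglongrightarrow> of_bool b * (\<kappa>t - (\<Sum>j=1..\<Delta>. \<kappa> j)) + (\<Sum>j=1..\<Delta>. \<kappa> j * x ^ (j - 1))"
proof -
  let ?c = "\<lambda>n j. real (card {z\<in>B.HE n s. \<psi> n z \<and> dg n s (fst z) = j \<and> \<not> (\<not> s \<and> fst z \<in> F n)})"
  let ?x = "\<lambda>n. B.dieprob n (cls_of \<Delta> (F n) b (dg n)) r s"
  have eq: "(\<Sum>z\<in>{z\<in>B.HE n s. \<psi> n z}. B.stepval n (cls_of \<Delta> (F n) b (dg n)) r s z) / real (B.h n) =
     of_bool b * (real (card {z\<in>B.HE n s. \<psi> n z}) / real (B.h n) - (\<Sum>j=1..\<Delta>. ?c n j / real (B.h n))) +
     (\<Sum>j=1..\<Delta>. ?c n j / real (B.h n) * ?x n ^ (j - 1))" for n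
  proof -
    have "dg n s (fst z) \<ge> 1" if "z \<in> B.HE n s" for z
      by (rule dg_pos) (use that in \<open>auto simp: B.HE_def\<close>)
    then show ?thesis
      by (subst B.sum_stepval) (auto simp: add_divide_distrib diff_divide_distrib sum_divide_distrib)
  qed
  show ?thesis unfolding eq
    by (intro tendsto_add tendsto_mult tendsto_diff tendsto_sum tendsto_power tendsto_const tot part x)
qed

lemma dieprob_lim:
  assumes F: "\<And>s j. (\<lambda>n. real (card {v\<in>{1..sz n s}. dg n s v = j \<and> \<not> (\<not> s \<and> v \<in> F n)}) / real (sz n s)) \<longlonglongrightarrow> \<theta> s * pmf (law s) j"
  shows "(\<lambda>n. B.dieprob n (cls_of \<Delta> (F n) b (dg n)) r s) \<longlonglongrightarrow> die_limit \<theta> \<Delta> b r s"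
proof (induct r arbitrary: s)
  case (Suc r)
  let ?s = "\<not> s"
  have tot: "(\<lambda>n. real (card {z\<in>B.HE n ?s. True}) / real (B.h n)) \<longlonglongrightarrow> 1"
  proof (rule tendsto_eventually)
    show "\<forall>\<^sub>F n in sequentially. real (card {z\<in>B.HE n ?s. True}) / real (B.h n) = 1"
      using h_pos by eventually_elim (simp add: B.card_HE)
  qed
  have part: "(\<lambda>n. real (card {z\<in>B.HE n ?s. True \<and> dg n ?s (fst z) = j \<and> \<not> (\<not> ?s \<and> fst z \<in> F n)}) / real (B.h n))
     \<longlonglongrightarrow> \<theta> ?s * w ?s j" for j
  proof -
    have "(\<lambda>n. real j * (real (card {v\<in>{1..sz n ?s}. dg n ?s v = j \<and> \<not> (\<not> ?s \<and> v \<in> F n)}) / real (B.h n))) \<longlonglongrightarrow>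
       real j * (\<theta> ?s * pmf (law ?s) j / mean (law ?s))"
      by (intro tendsto_mult tendsto_const over_h F)
    then show ?thesis
      using B.card_HE_at_degree[of _ ?s j "\<lambda>v. \<not> (\<not> ?s \<and> v \<in> F _)"]
      by (simp add: B.card_HE_at_degree[where P = "\<lambda>v. \<not> (\<not> ?s \<and> v \<in> F n)" for n, simplified] w_def mult_ac)
  qed
  have "(\<lambda>n. (\<Sum>z\<in>{z\<in>B.HE n ?s. True}. B.stepval n (cls_of \<Delta> (F n) b (dg n)) r ?s z) / real (B.h n))
     \<longlonglongrightarrow> of_bool b * (1 - (\<Sum>j=1..\<Delta>. \<theta> ?s * w ?s j)) + (\<Sum>j=1..\<Delta>. \<theta> ?s * w ?s j * die_limit \<theta> \<Delta> b r ?s ^ (j - 1))"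
    by (rule stepval_avg_lim[OF tot part Suc])
  then show ?case by (simp add: B.stepval_def)
qed simp

lemma count_empty:
  "(\<lambda>n. real (card {v\<in>{1..sz n s}. dg n s v = j \<and> \<not> (\<not> s \<and> v \<in> {})}) / real (sz n s)) \<longlonglongrightarrow> 1 * pmf (law s) j"
  using count_lim[of s j] by simp

lemma half_edge_mass_0: "B.half_edge_mass n cls (\<lambda>_ _. 0) r s False 0 = B.dieprob n cls (Suc r) s"
  by (simp add: B.half_edge_mass_def B.stepval_def)

lemma law_gen_sums:
  assumes z: "z \<in> {0..1}"
  shows "(\<lambda>k. pmf (law s) k * z ^ k) sums gen_fun (law s) z"
proof -
  have "integrable (measure_pmf (law s)) (\<lambda>k. z ^ k)"
  proof (rule measure_pmf.integrable_const_bound[where B = 1])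
    show "AE k in measure_pmf (law s). norm (z ^ k) \<le> 1"
      using z by (intro AE_I2) (auto intro: power_le_one)
  qed simp
  then show ?thesis unfolding gen_fun_def by (rule pmf_expectation_sums)
qed

lemma law_partial_lim:
  assumes z: "z \<in> {0..1}"
  shows "(\<lambda>T. \<Sum>k=1..T. pmf (law s) k * z ^ k) \<longlonglongrightarrow> gen_fun (law s) z"
proof -
  have "(\<lambda>T. \<Sum>k<Suc T. pmf (law s) k * z ^ k) \<longlonglongrightarrow> gen_fun (law s) z"
    using law_gen_sums[OF z, of s] unfolding sums_def by (rule LIMSEQ_Suc)
  moreover have "(\<Sum>k<Suc T. pmf (law s) k * z ^ k) = (\<Sum>k=1..T. pmf (law s) k * z ^ k)" for T
    by (rule sum.mono_neutral_right) (auto simp: law0 Suc_le_eq)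
  ultimately show ?thesis by simp
qed

lemma gen_fun_1: "gen_fun (law s) 1 = 1"
  by (simp add: gen_fun_def)

lemma card_by_degree:
  assumes "A \<subseteq> {1..sz n s}"
  shows "(\<Sum>k=1..T. real (card {v\<in>A. dg n s v = k})) \<le> real (card A)"
proof -
  have fA: "finite A" using assms finite_subset by blast
  have "(\<Sum>k\<in>{1..T}. card {v\<in>A. dg n s v = k}) = (\<Sum>k\<in>{1..T}. card {v\<in>{v\<in>A. dg n s v \<in> {1..T}}. dg n s v = k})"
    by (rule sum.cong[OF refl], rule arg_cong[of _ _ card]) auto
  also have "\<dots> = card {v\<in>A. dg n s v \<in> {1..T}}"
    by (rule card_fibers[symmetric]) (use fA in auto)
  also have "\<dots> \<le> card A" by (rule card_mono) (use fA in auto)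
  finally show ?thesis unfolding of_nat_sum[symmetric] by (rule of_nat_mono)
qed

end

context supercritical_seq
begin

text \<open>
  The survival probability of a uniformly chosen right vertex.
\<close>

definition \<rho> :: real where "\<rho> = 1 - gen_fun (law False) \<eta>r"

lemma \<rho>_pos: "\<rho> > 0"
proof -
  have "gen_fun (law False) \<eta>r < 1"
  proof -
    have e: "\<eta>r \<in> {0..1}" by (rule eta_r_range)
    have s: "(\<lambda>k. pmf (law False) k - pmf (law False) k * \<eta>r ^ k) sums (1 - gen_fun (law False) \<eta>r)"
      using sums_diff[OF law_gen_sums[of 1 False] law_gen_sums[OF e, of False]] by (simp add: gen_fun_1)
    have "\<exists>k. pmf (law False) k > 0"
    proof (rule ccontr)
      assume "\<not> ?thesis"
      then have "pmf (law False) k = 0" for k by (metis pmf_nonneg less_eq_real_def)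
      then show False using law_gen_sums[of 1 False] by (simp add: gen_fun_1 sums_iff)
    qed
    then obtain k where k: "pmf (law False) k > 0" by blast
    then have "k \<noteq> 0" using law0[of False] by (intro notI) simp
    then have "\<eta>r ^ k < 1" using e eta_r_less_1 by (simp add: power_less_one_iff)
    then have p: "0 < pmf (law False) k - pmf (law False) k * \<eta>r ^ k" using k by simp
    have "0 < (\<Sum>k. pmf (law False) k - pmf (law False) k * \<eta>r ^ k)"
    proof (rule suminf_pos2[where i = k])
      show "0 \<le> pmf (law False) n - pmf (law False) n * \<eta>r ^ n" for n
        using e by (simp add: mult_left_le power_le_one)
    qed (use s p in \<open>simp_all add: sums_iff\<close>)
    then show ?thesis using s by (simp add: sums_iff)
  qed
  then show ?thesis by (simp add: \<rho>_def)
qed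

lemma died_large_complement:
  assumes w: "\<omega> \<in> B.MM n" and v: "v \<in> {1..sz n s}"
    and d: "snd (B.run n \<omega> (B.explore_root n (cls_of \<Delta> {} False (dg n)) wt r s v))"
    and K: "1 + dg n s v * explored_size \<Delta> (Suc r) \<le> K"
  shows "card (B.component n {} \<omega> (s, v)) \<le> K"
proof -
  have "card (B.component n {} \<omega> (s, v)) \<le> 1 + dg n s v * explored_size \<Delta> (Suc r)"
    by (rule B.died_root_small[OF w _ _ v d]) (auto simp: cls_of_def split: if_splits)
  then show ?thesis using K by simp
qed

text \<open>
  Count vertices of degree up to \<open>T\<close> from which all explorations die. Their
  proportion is close to \<open>1 - \<rho>\<close>, and their components have bounded size by
  \<open>died_root_small\<close>.
\<close>

lemma right_large_upper:
  assumes \<delta>: "\<delta> > 0"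
  shows "\<exists>K0. \<forall>K\<ge>K0. whp (\<lambda>n \<omega>. real (card {v\<in>{1..sz n False}. card (B.component n {} \<omega> (False, v)) > K})
      \<le> (\<rho> + \<delta>) * real (sz n False))"
proof -
  have "\<forall>\<^sub>F T in sequentially. (\<Sum>k=1..T. pmf (law False) k * \<eta>r ^ k) > gen_fun (law False) \<eta>r - \<delta> / 3"
    by (rule order_tendstoD[OF law_partial_lim[OF eta_r_range]]) (use \<delta> in simp)
  then obtain T where T: "(\<Sum>k=1..T. pmf (law False) k * \<eta>r ^ k) > gen_fun (law False) \<eta>r - \<delta> / 3"
    by (auto simp: eventually_sequentially)
  have "(\<lambda>r. \<Sum>k=1..T. pmf (law False) k * die_limit (\<lambda>_. 1) r False r False ^ k) \<longlonglongrightarrow> (\<Sum>k=1..T. pmf (law False) k * eta False ^ k)"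
    by (intro tendsto_sum tendsto_mult tendsto_const tendsto_power die_limit_died_lim)
  then have "\<forall>\<^sub>F r in sequentially. (\<Sum>k=1..T. pmf (law False) k * die_limit (\<lambda>_. 1) r False r False ^ k)
     > gen_fun (law False) \<eta>r - 2 * \<delta> / 3"
    by (rule order_tendstoD) (use T \<delta> in \<open>simp add: eta_def\<close>)
  then obtain r where r: "(\<Sum>k=1..T. pmf (law False) k * die_limit (\<lambda>_. 1) r False r False ^ k) > gen_fun (law False) \<eta>r - 2 * \<delta> / 3"
    by (auto simp: eventually_sequentially)
  let ?x = "die_limit (\<lambda>_. 1) r False (Suc r) False"
  have "(\<Sum>k=1..T. pmf (law False) k * die_limit (\<lambda>_. 1) r False r False ^ k) \<le> (\<Sum>k=1..T. pmf (law False) k * ?x ^ k)"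
    by (intro sum_mono mult_left_mono power_mono die_limit_died_mono) (use die_limit_died_bounds in auto)
  then have r': "(\<Sum>k=1..T. pmf (law False) k * ?x ^ k) > gen_fun (law False) \<eta>r - 2 * \<delta> / 3" using r by linarith
  define e where "e = \<delta> / (3 * (real T + 1))"
  have e: "e > 0" using \<delta> by (simp add: e_def)
  let ?run = "\<lambda>n \<omega> v. B.run n \<omega> (B.explore_root n (cls_of r {} False (dg n)) (\<lambda>_ _. 0) r False v)"
  let ?V = "\<lambda>k n. {v\<in>{1..sz n False}. dg n False v = k}"
  have one: "whp (\<lambda>n \<omega>. \<bar>real (card {v\<in>?V k n. fst (?run n \<omega> v) = 0 \<and> (snd (?run n \<omega> v) \<or> False)})
      - pmf (law False) k * ?x ^ k * real (sz n False)\<bar> \<le> e * real (sz n False))" for k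
  proof (rule lln[where V = "?V k" and k = k and cls = "\<lambda>n. cls_of r {} False (dg n)" and \<Delta> = r and wt = "\<lambda>_ _ _. 0"])
    show "(\<lambda>n. real (card (?V k n)) / real (sz n False)) \<longlonglongrightarrow> pmf (law False) k" by (rule count_lim)
    have "(\<lambda>n. B.dieprob n (cls_of r {} False (dg n)) (Suc r) False) \<longlonglongrightarrow> ?x"
      by (rule dieprob_lim[where F = "\<lambda>_. {}"]) (rule count_empty)
    then show "(\<lambda>n. conv k (B.half_edge_mass n (cls_of r {} False (dg n)) (\<lambda>_ _. 0) r False False) 0) \<longlonglongrightarrow> ?x ^ k"
      unfolding conv_0 half_edge_mass_0 by (rule tendsto_power)
  qed (auto simp: cls_of_None e)
  have all: "whp (\<lambda>n \<omega>. \<forall>k\<in>{1..T}. \<bar>real (card {v\<in>?V k n. fst (?run n \<omega> v) = 0 \<and> (snd (?run n \<omega> v) \<or> False)})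
      - pmf (law False) k * ?x ^ k * real (sz n False)\<bar> \<le> e * real (sz n False))"
    by (rule whp_ball) (use one in auto)
  define K0 where "K0 = 1 + T * explored_size r (Suc r)"
  have "whp (\<lambda>n \<omega>. real (card {v\<in>{1..sz n False}. card (B.component n {} \<omega> (False, v)) > K})
      \<le> (\<rho> + \<delta>) * real (sz n False))" if K: "K \<ge> K0" for K
  proof (rule whp_mono[OF all], intro always_eventually allI ballI impI)
    fix n \<omega>
    assume w: "\<omega> \<in> B.MM n" and h: "\<forall>k\<in>{1..T}. \<bar>real (card {v\<in>?V k n. fst (?run n \<omega> v) = 0 \<and> (snd (?run n \<omega> v) \<or> False)})
      - pmf (law False) k * ?x ^ k * real (sz n False)\<bar> \<le> e * real (sz n False)"
    let ?S = "{v\<in>{1..sz n False}. card (B.component n {} \<omega> (False, v)) \<le> K}"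
    let ?N = "real (sz n False)"
    have "(\<Sum>k=1..T. pmf (law False) k * ?x ^ k * ?N - e * ?N) \<le> (\<Sum>k=1..T. real (card {v\<in>?S. dg n False v = k}))"
    proof (rule sum_mono)
      fix k assume k: "k \<in> {1..T}"
      have "pmf (law False) k * ?x ^ k * ?N - e * ?N \<le>
          real (card {v\<in>?V k n. fst (?run n \<omega> v) = 0 \<and> (snd (?run n \<omega> v) \<or> False)})"
        using bspec[OF h k] by linarith
      also have "\<dots> \<le> real (card {v\<in>?S. dg n False v = k})"
      proof (intro of_nat_mono card_mono subsetI)
        fix v assume v: "v \<in> {v\<in>?V k n. fst (?run n \<omega> v) = 0 \<and> (snd (?run n \<omega> v) \<or> False)}"
        have "dg n False v * explored_size r (Suc r) \<le> T * explored_size r (Suc r)"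
          by (rule mult_le_mono1) (use v k in auto)
        then have "card (B.component n {} \<omega> (False, v)) \<le> K"
          by (intro died_large_complement[OF w]) (use v K K0_def in auto)
        then show "v \<in> {v\<in>?S. dg n False v = k}" using v by auto
      qed auto
      finally show "pmf (law False) k * ?x ^ k * ?N - e * ?N \<le> real (card {v\<in>?S. dg n False v = k})" .
    qed
    also have "\<dots> \<le> real (card ?S)" by (rule card_by_degree) auto
    finally have 1: "(\<Sum>k=1..T. pmf (law False) k * ?x ^ k * ?N - e * ?N) \<le> real (card ?S)" .
    have 2: "(\<Sum>k=1..T. pmf (law False) k * ?x ^ k * ?N - e * ?N) =
       ((\<Sum>k=1..T. pmf (law False) k * ?x ^ k) - real T * e) * ?N"
      by (simp add: sum_subtractf sum_distrib_right left_diff_distrib)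
    have "real T * e \<le> \<delta> / 3" unfolding e_def using \<delta> by (simp add: field_simps)
    then have "gen_fun (law False) \<eta>r - \<delta> \<le> (\<Sum>k=1..T. pmf (law False) k * ?x ^ k) - real T * e"
      using r' by linarith
    then have 3: "(gen_fun (law False) \<eta>r - \<delta>) * ?N \<le> ((\<Sum>k=1..T. pmf (law False) k * ?x ^ k) - real T * e) * ?N"
      by (rule mult_right_mono) simp
    have "{1..sz n False} = {v\<in>{1..sz n False}. card (B.component n {} \<omega> (False, v)) > K} \<union> ?S" by auto
    then have "card {1..sz n False} = card ({v\<in>{1..sz n False}. card (B.component n {} \<omega> (False, v)) > K} \<union> ?S)"
      by (rule arg_cong)
    also have "\<dots> = card {v\<in>{1..sz n False}. card (B.component n {} \<omega> (False, v)) > K} + card ?S"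
      by (rule card_Un_disjoint) auto
    finally have "card {1..sz n False} = card {v\<in>{1..sz n False}. card (B.component n {} \<omega> (False, v)) > K} + card ?S" .
    then have "real (card {v\<in>{1..sz n False}. card (B.component n {} \<omega> (False, v)) > K}) = ?N - real (card ?S)"
      by simp
    also have "\<dots> \<le> ?N - (gen_fun (law False) \<eta>r - \<delta>) * ?N" using 1 2 3 by linarith
    also have "\<dots> = (\<rho> + \<delta>) * ?N" by (simp add: \<rho>_def algebra_simps)
    finally show "real (card {v\<in>{1..sz n False}. card (B.component n {} \<omega> (False, v)) > K}) \<le> (\<rho> + \<delta>) * ?N" .
  qed
  then show ?thesis by blast
qed

text \<open>
  Flags take the same proportion \<open>\<epsilon>\<close> of every degree class.
\<close>

definition flag_density :: "(nat \<Rightarrow> nat set) \<Rightarrow> real \<Rightarrow> bool" where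
  "flag_density F \<epsilon> \<longleftrightarrow> (\<forall>n. F n \<subseteq> {1..sz n False}) \<and>
     (\<forall>j. (\<lambda>n. real (card {v\<in>F n. dg n False v = j}) / real (sz n False)) \<longlonglongrightarrow> \<epsilon> * pmf (law False) j)"

lemma flag_count:
  assumes "flag_density F \<epsilon>"
  shows "(\<lambda>n. real (card {v\<in>{1..sz n s}. dg n s v = j \<and> \<not> (\<not> s \<and> v \<in> F n)}) / real (sz n s))
     \<longlonglongrightarrow> (if s then 1 else 1 - \<epsilon>) * pmf (law s) j"
proof (cases s)
  case True
  then show ?thesis using count_lim[of True j] by simp
next
  case False
  have "card {v\<in>{1..sz n False}. dg n False v = j} =
    card {v\<in>{1..sz n False}. dg n False v = j \<and> v \<notin> F n} + card {v\<in>F n. dg n False v = j}" for n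
  proof -
    have FV: "F n \<subseteq> {1..sz n False}" using assms by (simp add: flag_density_def)
    then have "finite (F n)" using finite_subset by blast
    then show ?thesis
      by (subst card_Un_disjoint[symmetric]) (use FV in \<open>auto intro!: arg_cong[of _ _ card]\<close>)
  qed
  then have eq: "real (card {v\<in>{1..sz n False}. dg n False v = j \<and> v \<notin> F n}) / real (sz n False) =
     real (card {v\<in>{1..sz n False}. dg n False v = j}) / real (sz n False) - real (card {v\<in>F n. dg n False v = j}) / real (sz n False)" for n
    by (simp add: add_divide_distrib)
  have "(\<lambda>n. real (card {v\<in>{1..sz n False}. dg n False v = j \<and> v \<notin> F n}) / real (sz n False)) \<longlonglongrightarrow>
     pmf (law False) j - \<epsilon> * pmf (law False) j"
    unfolding eq by (intro tendsto_diff count_lim) (use assms in \<open>simp add: flag_density_def\<close>)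
  then show ?thesis using False by (simp add: left_diff_distrib)
qed

text \<open>
  The flagged vertex \<open>v\<close> has a half-edge into a component, with at least
  \<open>r\<close> vertices, of the graph without flagged vertices.
\<close>

definition attached :: "nat \<Rightarrow> nat set \<Rightarrow> nat \<Rightarrow> (nat \<times> nat \<Rightarrow> nat \<times> nat) \<Rightarrow> nat \<Rightarrow> bool" where
  "attached n F r \<omega> v \<longleftrightarrow> (\<exists>z\<in>B.HE n False. fst z = v \<and>
     card (B.component n F \<omega> (True, fst (B.partner n False \<omega> z))) \<ge> r)"

lemma alive_attached:
  assumes w: "\<omega> \<in> B.MM n" and v: "v \<in> {1..sz n s}"
    and al: "\<not> snd (B.run n \<omega> (B.explore_root n (cls_of \<Delta> F True (dg n)) wt r s v))"
    and fr: "B.fresh n \<omega> (B.explore_root n (cls_of \<Delta> F True (dg n)) wt r s v) {(s, v)}"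
  shows "\<exists>z\<in>B.HE n s. fst z = v \<and> \<not> B.blocked F (\<not> s, fst (B.partner n s \<omega> z)) \<and>
     card (B.component n F \<omega> (\<not> s, fst (B.partner n s \<omega> z))) \<ge> Suc r"
proof -
  have "\<exists>z\<in>B.HE n s. fst z = v \<and> \<not> B.blocked F (\<not> s, fst (B.partner n s \<omega> z)) \<and> (\<exists>S. finite S \<and> card S = Suc r \<and>
       S \<subseteq> B.component n F \<omega> (\<not> s, fst (B.partner n s \<omega> z)))"
    by (rule B.alive_root[OF w _ _ v al fr]) (auto simp: cls_of_def B.blocked_def)
  then obtain z S where z: "z \<in> B.HE n s" "fst z = v" "\<not> B.blocked F (\<not> s, fst (B.partner n s \<omega> z))" "card S = Suc r"
    "S \<subseteq> B.component n F \<omega> (\<not> s, fst (B.partner n s \<omega> z))" by blast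
  have "(\<not> s, fst (B.partner n s \<omega> z)) \<in> B.vertex_set n"
    using B.partner_in[OF w z(1)] by (auto simp: B.vertex_set_def B.HE_def)
  then have "finite (B.component n F \<omega> (\<not> s, fst (B.partner n s \<omega> z)))" by (rule B.finite_component[OF w])
  then have "Suc r \<le> card (B.component n F \<omega> (\<not> s, fst (B.partner n s \<omega> z)))"
    using card_mono[OF _ z(5)] z(4) by metis
  then show ?thesis using z by blast
qed

text \<open>
  Explorations from flagged vertices, stopped at flagged ones. The density
  \<open>\<epsilon>0\<close> does not depend on \<open>r\<close>, which is what allows
  \<open>r\<close> to be chosen afterwards, large in terms of \<open>\<epsilon>\<close>.
\<close>

lemma flagged_attached_lower:
  assumes \<delta>: "\<delta> > 0"
  shows "\<exists>\<epsilon>0>0. \<forall>\<epsilon> F. 0 < \<epsilon> \<longrightarrow> \<epsilon> \<le> \<epsilon>0 \<longrightarrow> flag_density F \<epsilon> \<longrightarrow> (\<forall>r.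
     whp (\<lambda>n \<omega>. real (card {v\<in>F n. attached n (F n) r \<omega> v}) \<ge> \<epsilon> * (\<rho> - \<delta>) * real (sz n False)))"
proof -
  have "\<forall>\<^sub>F T in sequentially. (\<Sum>k=1..T. pmf (law False) k) > 1 - \<delta> / 4"
    using order_tendstoD(1)[OF law_partial_lim[of 1 False], of "1 - \<delta> / 4"] \<delta> by (simp add: gen_fun_1)
  then obtain T where T: "(\<Sum>k=1..T. pmf (law False) k) > 1 - \<delta> / 4" by (auto simp: eventually_sequentially)
  have "((\<lambda>t. \<Sum>k=1..T. pmf (law False) k * (\<eta>r + t) ^ k) \<longlongrightarrow> (\<Sum>k=1..T. pmf (law False) k * (\<eta>r + 0) ^ k)) (at 0)"
    by (intro tendsto_intros)
  from tendstoD[OF this, of "\<delta> / 4"] \<delta> obtain d where d: "d > 0"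
    "\<And>t. t \<noteq> 0 \<Longrightarrow> dist t 0 < d \<Longrightarrow>
       dist (\<Sum>k=1..T. pmf (law False) k * (\<eta>r + t) ^ k) (\<Sum>k=1..T. pmf (law False) k * (\<eta>r + 0) ^ k) < \<delta> / 4"
    by (auto simp: eventually_at)
  define t where "t = d / 2"
  have t: "t > 0" using d by (simp add: t_def)
  have "dist (\<Sum>k=1..T. pmf (law False) k * (\<eta>r + t) ^ k) (\<Sum>k=1..T. pmf (law False) k * (\<eta>r + 0) ^ k) < \<delta> / 4"
    by (rule d(2)) (use d(1) in \<open>auto simp: t_def\<close>)
  then have "(\<Sum>k=1..T. pmf (law False) k * (\<eta>r + t) ^ k) < (\<Sum>k=1..T. pmf (law False) k * \<eta>r ^ k) + \<delta> / 4"
    by (simp add: dist_real_def abs_if split: if_splits)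
  also have "(\<Sum>k=1..T. pmf (law False) k * \<eta>r ^ k) \<le> gen_fun (law False) \<eta>r"
  proof -
    have "(\<Sum>k=1..T. pmf (law False) k * \<eta>r ^ k) \<le> suminf (\<lambda>k. pmf (law False) k * \<eta>r ^ k)"
      by (rule sum_le_suminf) (use law_gen_sums[OF eta_r_range, of False] eta_r_range in \<open>auto simp: sums_iff\<close>)
    then show ?thesis using law_gen_sums[OF eta_r_range, of False] by (simp add: sums_iff)
  qed
  finally have tk: "(\<Sum>k=1..T. pmf (law False) k * (\<eta>r + t) ^ k) < 1 - \<rho> + \<delta> / 4" by (simp add: \<rho>_def)
  obtain \<epsilon>0 \<Delta> where eD: "\<epsilon>0 > 0" and XB: "\<And>\<epsilon> r. 0 \<le> \<epsilon> \<Longrightarrow> \<epsilon> \<le> \<epsilon>0 \<Longrightarrow>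
      die_limit (\<lambda>s. if s then 1 else 1 - \<epsilon>) \<Delta> True r False \<le> \<eta>r + t"
    using die_limit_alive_bound[OF t, of 0] by blast
  have XL0: "0 \<le> die_limit (\<lambda>s. if s then 1 else 1 - \<epsilon>) \<Delta> True r s" if "0 \<le> \<epsilon>" "\<epsilon> \<le> 1" for \<epsilon> r s
  proof (induct r arbitrary: s)
    case (Suc r)
    have "(\<Sum>j=1..\<Delta>. (if \<not> s then 1 else 1 - \<epsilon>) * w (\<not> s) j) \<le> (\<Sum>j=1..\<Delta>. 1 * w (\<not> s) j)"
      by (intro sum_mono mult_right_mono w_nonneg) (use that in auto)
    also have "\<dots> \<le> 1" using sum_w_le_1[where s = "\<not> s" and \<Delta> = \<Delta>] by simp
    finally show ?case using Suc[of "\<not> s"] that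
      by (auto intro!: add_nonneg_nonneg sum_nonneg mult_nonneg_nonneg w_nonneg)
  qed simp
  (* a flagged vertex from which some exploration survives is attached, unless its run is not fresh *)
  have main: "whp (\<lambda>n \<omega>. real (card {v\<in>F n. attached n (F n) r \<omega> v}) \<ge> \<epsilon> * (\<rho> - \<delta>) * real (sz n False))"
    if eps: "0 < \<epsilon>" "\<epsilon> \<le> min \<epsilon>0 1" and F: "flag_density F \<epsilon>" for \<epsilon> F r
  proof -
    have FV: "F n \<subseteq> {1..sz n False}" for n using F by (simp add: flag_density_def)
    let ?x = "die_limit (\<lambda>s. if s then 1 else 1 - \<epsilon>) \<Delta> True (Suc r) False"
    have x: "0 \<le> ?x" "?x \<le> \<eta>r + t" using XL0[of \<epsilon> "Suc r" False] XB[of \<epsilon> "Suc r"] eps by auto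
    define e where "e = \<epsilon> * \<delta> / (8 * (real T + 1))"
    have e: "e > 0" using \<delta> eps by (simp add: e_def)
    let ?cls = "\<lambda>n. cls_of \<Delta> (F n) True (dg n)"
    let ?explore_root = "\<lambda>n v. B.explore_root n (?cls n) (\<lambda>_ _. 0) r False v"
    let ?V = "\<lambda>k n. {v\<in>F n. dg n False v = k}"
    let ?D = "\<lambda>k n \<omega>. {v\<in>?V k n. fst (B.run n \<omega> (?explore_root n v)) = 0 \<and> (snd (B.run n \<omega> (?explore_root n v)) \<or> False)}"
    let ?U = "\<lambda>k n \<omega>. {v\<in>?V k n. \<not> B.fresh n \<omega> (?explore_root n v) {(False, v)}}"
    have Vs: "?V k n \<subseteq> {v\<in>{1..sz n False}. dg n False v = k}" for k n using FV[of n] by auto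
    have one: "whp (\<lambda>n \<omega>. \<bar>real (card (?D k n \<omega>)) - (\<epsilon> * pmf (law False) k) * ?x ^ k * real (sz n False)\<bar> \<le> e * real (sz n False))" for k
    proof (rule lln[where V = "?V k" and k = k and cls = ?cls and \<Delta> = \<Delta> and wt = "\<lambda>_ _ _. 0", OF Vs])
      show "(\<lambda>n. real (card (?V k n)) / real (sz n False)) \<longlonglongrightarrow> \<epsilon> * pmf (law False) k"
        using F by (simp add: flag_density_def)
      have "(\<lambda>n. B.dieprob n (?cls n) (Suc r) False) \<longlonglongrightarrow> ?x"
        by (rule dieprob_lim) (rule flag_count[OF F])
      then show "(\<lambda>n. conv k (B.half_edge_mass n (?cls n) (\<lambda>_ _. 0) r False False) 0) \<longlonglongrightarrow> ?x ^ k"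
        unfolding conv_0 half_edge_mass_0 by (rule tendsto_power)
    qed (auto simp: cls_of_None e)
    have two: "whp (\<lambda>n \<omega>. real (card (?U k n \<omega>)) \<le> e * real (sz n False))" for k
      by (rule few_nonfresh[where V = "?V k" and k = k and cls = ?cls and \<Delta> = \<Delta> and wt = "\<lambda>_ _ _. 0", OF Vs])
         (auto simp: cls_of_None e)
    have three: "\<forall>\<^sub>F n in sequentially. real (card (?V k n)) \<ge> (\<epsilon> * pmf (law False) k - e) * real (sz n False)" for k
    proof -
      have "\<forall>\<^sub>F n in sequentially. real (card (?V k n)) / real (sz n False) > \<epsilon> * pmf (law False) k - e"
        by (rule order_tendstoD[where y = "\<epsilon> * pmf (law False) k"]) (use F e in \<open>simp_all add: flag_density_def\<close>)
      then show ?thesis using sz_pos[of False] by eventually_elim (simp add: less_divide_eq)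
    qed
    have ev: "\<forall>\<^sub>F n in sequentially. \<forall>k\<in>{1..T}. real (card (?V k n)) \<ge> (\<epsilon> * pmf (law False) k - e) * real (sz n False)"
      by (rule eventually_ball_finite) (use three in auto)
    have all: "whp (\<lambda>n \<omega>. \<forall>k\<in>{1..T}. \<bar>real (card (?D k n \<omega>)) - (\<epsilon> * pmf (law False) k) * ?x ^ k * real (sz n False)\<bar> \<le> e * real (sz n False)
        \<and> real (card (?U k n \<omega>)) \<le> e * real (sz n False))"
      by (rule whp_ball) (use one two in \<open>auto intro!: whp_conj\<close>)
    show ?thesis
    proof (rule whp_mono[OF all], use ev in eventually_elim, intro ballI impI)
      fix n \<omega>
      assume ev: "\<forall>k\<in>{1..T}. real (card (?V k n)) \<ge> (\<epsilon> * pmf (law False) k - e) * real (sz n False)"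
        and w: "\<omega> \<in> B.MM n"
        and h: "\<forall>k\<in>{1..T}. \<bar>real (card (?D k n \<omega>)) - (\<epsilon> * pmf (law False) k) * ?x ^ k * real (sz n False)\<bar> \<le> e * real (sz n False)
        \<and> real (card (?U k n \<omega>)) \<le> e * real (sz n False)"
      let ?A = "{v\<in>F n. attached n (F n) r \<omega> v}"
      let ?N = "real (sz n False)"
      have fF: "finite (F n)" using FV[of n] finite_subset by blast
      have "(\<Sum>k=1..T. (\<epsilon> * pmf (law False) k - \<epsilon> * pmf (law False) k * (\<eta>r + t) ^ k - 3 * e) * ?N)
         \<le> (\<Sum>k=1..T. real (card {v\<in>?A. dg n False v = k}))"
      proof (rule sum_mono)
        fix k assume k: "k \<in> {1..T}"
        have "?V k n - ?D k n \<omega> - ?U k n \<omega> \<subseteq> {v\<in>?A. dg n False v = k}"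
        proof
          fix v assume v: "v \<in> ?V k n - ?D k n \<omega> - ?U k n \<omega>"
          have v1: "v \<in> {1..sz n False}" using v FV[of n] by auto
          have "fst (B.run n \<omega> (?explore_root n v)) = 0" using B.run_root_weight[OF v1] by simp
          then have al: "\<not> snd (B.run n \<omega> (?explore_root n v))" using v by auto
          have fr: "B.fresh n \<omega> (?explore_root n v) {(False, v)}" using v by auto
          from alive_attached[OF w v1 al fr] have "attached n (F n) r \<omega> v" by (auto simp: attached_def)
          then show "v \<in> {v\<in>?A. dg n False v = k}" using v by auto
        qed
        then have "card (?V k n - ?D k n \<omega> - ?U k n \<omega>) \<le> card {v\<in>?A. dg n False v = k}"
          by (rule card_mono[rotated]) (use fF in auto)
        moreover have "card (?V k n) - card (?D k n \<omega>) - card (?U k n \<omega>) \<le> card (?V k n - ?D k n \<omega> - ?U k n \<omega>)"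
        proof -
          have "card (?V k n) - card (?D k n \<omega>) \<le> card (?V k n - ?D k n \<omega>)"
            by (rule diff_card_le_card_Diff) (use fF in auto)
          moreover have "card (?V k n - ?D k n \<omega>) - card (?U k n \<omega>) \<le> card (?V k n - ?D k n \<omega> - ?U k n \<omega>)"
            by (rule diff_card_le_card_Diff) (use fF in auto)
          ultimately show ?thesis by linarith
        qed
        ultimately have "real (card (?V k n)) - real (card (?D k n \<omega>)) - real (card (?U k n \<omega>)) \<le> real (card {v\<in>?A. dg n False v = k})"
          by linarith
        moreover have "\<epsilon> * pmf (law False) k * ?x ^ k * ?N \<le> \<epsilon> * pmf (law False) k * (\<eta>r + t) ^ k * ?N"
          by (intro mult_right_mono mult_left_mono power_mono x) (use eps in auto)
        ultimately show "(\<epsilon> * pmf (law False) k - \<epsilon> * pmf (law False) k * (\<eta>r + t) ^ k - 3 * e) * ?N \<le> real (card {v\<in>?A. dg n False v = k})"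
          using bspec[OF h k] bspec[OF ev k] by (simp add: left_diff_distrib abs_le_iff)
      qed
      also have "\<dots> \<le> real (card ?A)" by (rule card_by_degree) (use FV[of n] in auto)
      finally have 1: "(\<Sum>k=1..T. (\<epsilon> * pmf (law False) k - \<epsilon> * pmf (law False) k * (\<eta>r + t) ^ k - 3 * e) * ?N) \<le> real (card ?A)" .
      have 2: "(\<Sum>k=1..T. (\<epsilon> * pmf (law False) k - \<epsilon> * pmf (law False) k * (\<eta>r + t) ^ k - 3 * e) * ?N) =
         (\<epsilon> * ((\<Sum>k=1..T. pmf (law False) k) - (\<Sum>k=1..T. pmf (law False) k * (\<eta>r + t) ^ k)) - real T * (3 * e)) * ?N"
        by (simp add: sum_distrib_right[symmetric] sum_subtractf sum_distrib_left right_diff_distrib mult.assoc)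
      have "real T * (3 * e) \<le> \<epsilon> * \<delta> / 2"
      proof -
        have "real T * (3 * e) = (\<epsilon> * \<delta>) * (3 * real T / (8 * (real T + 1)))" by (simp add: e_def)
        also have "\<dots> \<le> (\<epsilon> * \<delta>) * (1 / 2)"
          by (rule mult_left_mono) (use eps \<delta> in \<open>auto simp: field_simps\<close>)
        finally show ?thesis by simp
      qed
      moreover have "\<epsilon> * (\<rho> - \<delta> / 2) \<le> \<epsilon> * ((\<Sum>k=1..T. pmf (law False) k) - (\<Sum>k=1..T. pmf (law False) k * (\<eta>r + t) ^ k))"
        by (rule mult_left_mono) (use T tk eps in auto)
      moreover have "\<epsilon> * (\<rho> - \<delta>) = \<epsilon> * (\<rho> - \<delta> / 2) - \<epsilon> * \<delta> / 2" by (simp add: algebra_simps)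
      ultimately have "\<epsilon> * (\<rho> - \<delta>) \<le> \<epsilon> * ((\<Sum>k=1..T. pmf (law False) k) - (\<Sum>k=1..T. pmf (law False) k * (\<eta>r + t) ^ k)) - real T * (3 * e)"
        by linarith
      then have "\<epsilon> * (\<rho> - \<delta>) * ?N \<le> (\<epsilon> * ((\<Sum>k=1..T. pmf (law False) k) - (\<Sum>k=1..T. pmf (law False) k * (\<eta>r + t) ^ k)) - real T * (3 * e)) * ?N"
        by (rule mult_right_mono) simp
      then show "real (card ?A) \<ge> \<epsilon> * (\<rho> - \<delta>) * ?N" using 1 2 by linarith
    qed
  qed
  show ?thesis
    by (rule exI[of _ "min \<epsilon>0 1"]) (use eD main in auto)
qed

end

section \<open>The giant component\<close>

text \<open>
  Colour 0 will mark the flags: a uniform colouring flags each vertex independently with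
  probability \<open>1 / Q\<close>.
\<close>

definition colourings :: "nat set \<Rightarrow> nat \<Rightarrow> (nat \<Rightarrow> nat) set" where
  "colourings I Q = I \<rightarrow>\<^sub>E {0..<Q}"

lemma finite_colourings: "finite I \<Longrightarrow> finite (colourings I Q)"
  by (simp add: colourings_def finite_PiE)

lemma card_colourings_pos: "finite I \<Longrightarrow> Q > 0 \<Longrightarrow> card (colourings I Q) > 0"
  by (simp add: colourings_def card_PiE)

text \<open>
  The centred indicators of colour 0 at two different points are uncorrelated.
\<close>

lemma colouring_second_moment:
  assumes I: "finite I" and S: "S \<subseteq> I" and Q: "Q > 0"
  shows "(\<Sum>f\<in>colourings I Q. (real (card {b\<in>S. f b = 0}) - real (card S) / real Q)\<^sup>2)
     \<le> real (card S) * real (card (colourings I Q))"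
proof -
  let ?C = "colourings I Q"
  let ?g = "\<lambda>x::nat. of_bool (x = 0) - 1 / real Q"
  have fS: "finite S" using I S finite_subset by blast
  have g0: "(\<Sum>x\<in>{0..<Q}. ?g x) = 0"
  proof -
    have "(\<Sum>x\<in>{0..<Q}. of_bool (x = 0) :: real) = 1"
      using Q by (simp add: of_bool_def)
    then show ?thesis using Q by (simp add: sum_subtractf)
  qed
  have off: "(\<Sum>f\<in>?C. ?g (f b) * ?g (f b')) = 0" if b: "b \<in> I" "b' \<in> I" "b \<noteq> b'" for b b'
  proof -
    have "(\<Sum>f\<in>?C. ?g (f b) * ?g (f b')) = (\<Sum>f\<in>?C. \<Prod>i\<in>I. if i \<in> {b, b'} then ?g (f i) else 1)"
    proof (rule sum.cong[OF refl])
      fix f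
      have "(\<Prod>i\<in>I. if i \<in> {b, b'} then ?g (f i) else 1) = (\<Prod>i\<in>{b, b'}. ?g (f i))"
        using I b by (intro prod.mono_neutral_cong_right) auto
      then show "?g (f b) * ?g (f b') = (\<Prod>i\<in>I. if i \<in> {b, b'} then ?g (f i) else 1)" using b(3) by simp
    qed
    also have "\<dots> = (\<Prod>i\<in>I. \<Sum>x\<in>{0..<Q}. if i \<in> {b, b'} then ?g x else 1)"
      unfolding colourings_def by (rule prod_sum_PiE[symmetric]) (use I in auto)
    also have "\<dots> = 0"
    proof (rule prod_zero[OF I])
      show "\<exists>i\<in>I. (\<Sum>x\<in>{0..<Q}. if i \<in> {b, b'} then ?g x else 1) = 0"
        by (rule bexI[of _ b]) (use b g0 in simp_all)
    qed
    finally show ?thesis .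
  qed
  have diag: "(\<Sum>f\<in>?C. ?g (f b) * ?g (f b)) \<le> real (card ?C)" for b
  proof -
    have "?g (f b) * ?g (f b) \<le> 1" for f
    proof -
      have "1 / real Q \<le> 1" "0 \<le> 1 / real Q" using Q by auto
      then have "\<bar>?g (f b)\<bar> \<le> 1" by (cases "f b = 0") auto
      then show ?thesis using abs_square_le_1 power2_eq_square by metis
    qed
    then have "(\<Sum>f\<in>?C. ?g (f b) * ?g (f b)) \<le> (\<Sum>f\<in>?C. 1)" by (intro sum_mono)
    then show ?thesis by simp
  qed
  have "(real (card {b\<in>S. f b = 0}) - real (card S) / real Q)\<^sup>2 = (\<Sum>b\<in>S. \<Sum>b'\<in>S. ?g (f b) * ?g (f b'))" for f
  proof -
    have "real (card {b\<in>S. f b = 0}) = (\<Sum>b\<in>S. of_bool (f b = 0))"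
      using fS by (simp add: of_bool_def sum.If_cases Int_def)
    then have "real (card {b\<in>S. f b = 0}) - real (card S) / real Q = (\<Sum>b\<in>S. ?g (f b))"
      by (simp add: sum_subtractf)
    then show ?thesis by (simp add: power2_eq_square sum_product)
  qed
  then have "(\<Sum>f\<in>?C. (real (card {b\<in>S. f b = 0}) - real (card S) / real Q)\<^sup>2) =
      (\<Sum>f\<in>?C. \<Sum>b\<in>S. \<Sum>b'\<in>S. ?g (f b) * ?g (f b'))" by simp
  also have "\<dots> = (\<Sum>b\<in>S. \<Sum>f\<in>?C. \<Sum>b'\<in>S. ?g (f b) * ?g (f b'))" by (rule sum.swap)
  also have "\<dots> = (\<Sum>b\<in>S. \<Sum>b'\<in>S. \<Sum>f\<in>?C. ?g (f b) * ?g (f b'))" by (rule sum.cong[OF refl], rule sum.swap)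
  also have "\<dots> \<le> (\<Sum>b\<in>S. \<Sum>b'\<in>S. if b' = b then real (card ?C) else 0)"
  proof (intro sum_mono)
    fix b b' assume "b \<in> S" "b' \<in> S"
    then have "b \<in> I" "b' \<in> I" using S by auto
    then show "(\<Sum>f\<in>?C. ?g (f b) * ?g (f b')) \<le> (if b' = b then real (card ?C) else 0)"
      using off[of b b'] diag[of b] S by (cases "b' = b") auto
  qed
  also have "\<dots> = real (card S) * real (card ?C)" using fS by simp
  finally show ?thesis .
qed

lemma colouring_chebyshev:
  assumes I: "finite I" and S: "S \<subseteq> I" and Q: "Q > 0" and c: "c > 0"
  shows "real (card {f\<in>colourings I Q. (real (card {b\<in>S. f b = 0}) - real (card S) / real Q)\<^sup>2 \<ge> c}) * c
     \<le> real (card S) * real (card (colourings I Q))"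
proof -
  let ?C = "colourings I Q"
  let ?d = "\<lambda>f. (real (card {b\<in>S. f b = 0}) - real (card S) / real Q)\<^sup>2"
  have "real (card {f\<in>?C. ?d f \<ge> c}) * c = (\<Sum>f\<in>{f\<in>?C. ?d f \<ge> c}. c)" by simp
  also have "\<dots> \<le> (\<Sum>f\<in>{f\<in>?C. ?d f \<ge> c}. ?d f)" by (rule sum_mono) auto
  also have "\<dots> \<le> (\<Sum>f\<in>?C. ?d f)" by (rule sum_mono2) (use finite_colourings[OF I] in auto)
  also have "\<dots> \<le> real (card S) * real (card ?C)" by (rule colouring_second_moment[OF I S Q])
  finally show ?thesis .
qed

text \<open>
  The union bound as an exponential: \<open>2 ^ m \<le> exp m\<close> divisions against failures
  of probability \<open>1 - x\<^sup>2 \<le> exp (- \<beta>\<^sup>2)\<close> each.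
\<close>

lemma exp_bound_union:
  fixes m t :: nat
  assumes x: "0 \<le> \<beta>" "\<beta> \<le> x" "x \<le> 1" and t: "real t \<ge> T" and m: "real m \<le> M"
  shows "2 ^ m * (1 - x\<^sup>2) ^ t \<le> exp (M - \<beta>\<^sup>2 * T)"
proof -
  have "(2::real) ^ m \<le> exp 1 ^ m"
    by (rule power_mono) (use exp_ge_add_one_self[of 1] in auto)
  also have "\<dots> = exp (real m)" by (simp add: exp_of_nat_mult[symmetric])
  also have "\<dots> \<le> exp M" using m by simp
  finally have 1: "(2::real) ^ m \<le> exp M" .
  have b: "\<beta>\<^sup>2 \<le> x\<^sup>2" using x by (intro power_mono) auto
  have "x\<^sup>2 \<le> 1\<^sup>2" using x by (intro power_mono) auto
  then have x1: "0 \<le> 1 - x\<^sup>2" by simp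
  have "1 - x\<^sup>2 \<le> exp (- \<beta>\<^sup>2)" using exp_ge_add_one_self[of "- \<beta>\<^sup>2"] b by linarith
  then have "(1 - x\<^sup>2) ^ t \<le> exp (- \<beta>\<^sup>2) ^ t" by (rule power_mono[OF _ x1])
  also have "\<dots> = exp (real t * - \<beta>\<^sup>2)" by (rule exp_of_nat_mult[symmetric])
  also have "\<dots> \<le> exp (- \<beta>\<^sup>2 * T)"
  proof -
    have "\<beta>\<^sup>2 * T \<le> \<beta>\<^sup>2 * real t" using t by (intro mult_left_mono) auto
    then show ?thesis by (simp add: mult.commute)
  qed
  finally have 2: "(1 - x\<^sup>2) ^ t \<le> exp (- \<beta>\<^sup>2 * T)" .
  have "2 ^ m * (1 - x\<^sup>2) ^ t \<le> exp M * exp (- \<beta>\<^sup>2 * T)"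
    using 1 2 x1 by (intro mult_mono) auto
  then show ?thesis by (simp add: exp_add[symmetric])
qed

context supercritical_seq
begin

text \<open>
  Otherwise the right side would have no offspring and the product of the mean offspring numbers
  would vanish.
\<close>

lemma degree_ge_2: "\<exists>j\<ge>2. pmf (law False) j > 0"
proof (rule ccontr)
  assume n: "\<not> ?thesis"
  have "w False j * real (j - 1) = 0" for j
  proof (cases "j \<ge> 2")
    case True
    then have "pmf (law False) j = 0" using n pmf_nonneg[of "law False" j] by (metis less_eq_real_def)
    then show ?thesis by (simp add: w_def)
  next
    case False
    then show ?thesis by auto
  qed
  then have z: "(\<Sum>j=1..T. w False j * real (j - 1)) = 0" for T by (intro sum.neutral) blast
  have "(\<lambda>T::nat. 0) \<longlonglongrightarrow> ext_mean (excess (law False))"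
    using partial_mean_lim[of False] unfolding z by simp
  then have "ext_mean (excess (law False)) = 0"
    using LIMSEQ_unique[OF _ tendsto_const] by metis
  then show False using supercritical by simp
qed

text \<open>
  The bridging vertices \<open>bs\<close> are a linear number of flagged vertices of one degree
  \<open>j \<ge> 2\<close>. Their number, and the success probability of each, depend on
  \<open>\<alpha>\<close> and \<open>\<epsilon>\<close> but not on \<open>r\<close>, so
  \<open>r\<close> can be taken so large that the entropy of the divisions is at most half of
  the exponent.
\<close>

lemma merged_whp:
  assumes F: "flag_density F \<epsilon>" and eps: "\<epsilon> > 0" and \<alpha>: "0 < \<alpha>" "\<alpha> \<le> 1"
  shows "\<exists>r bs. (\<forall>n. \<forall>b\<in>set (bs n). b \<in> {1..sz n False} \<and> dg n False b \<ge> 2) \<and>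
     whp (\<lambda>n. B.merged n (F n) r (nat \<lceil>\<alpha> * real (sz n False)\<rceil>) (bs n))"
proof -
  obtain j where j: "j \<ge> 2" "pmf (law False) j > 0" using degree_ge_2 by blast
  have FV: "F n \<subseteq> {1..sz n False}" for n using F by (simp add: flag_density_def)
  have fF: "finite (F n)" for n using FV[of n] finite_subset by blast
  define N where "N = (\<lambda>n. real (sz n False))"
  define q where "q = \<epsilon> * pmf (law False) j"
  have q: "q > 0" using eps j by (simp add: q_def)
  define \<tau> where "\<tau> = min (\<alpha> / 8) (q / 2)"
  have tau: "\<tau> > 0" "\<tau> \<le> \<alpha> / 8" "\<tau> \<le> q / 2" using q \<alpha> by (auto simp: \<tau>_def)
  define t where "t = (\<lambda>n. nat \<lfloor>\<tau> * N n\<rfloor>)"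
  define Vj where "Vj = (\<lambda>n. {v\<in>F n. dg n False v = j})"
  define bs where "bs = (\<lambda>n. take (t n) (sorted_list_of_set (Vj n)))"
  have fV: "finite (Vj n)" for n using fF[of n] by (simp add: Vj_def)
  have bsV: "set (bs n) \<subseteq> Vj n" for n
    unfolding bs_def using set_take_subset[of "t n" "sorted_list_of_set (Vj n)"] fV[of n] by simp
  have bs1: "b \<in> F n \<and> b \<in> {1..sz n False} \<and> dg n False b \<ge> 2" if "b \<in> set (bs n)" for n b
    using that bsV[of n] FV[of n] j by (auto simp: Vj_def)
  have bsd: "distinct (bs n)" for n unfolding bs_def by (simp add: distinct_take)
  define \<mu> where "\<mu> = mean (law False)"
  have mu: "\<mu> \<ge> 1" unfolding \<mu>_def by (rule mean_ge_1)
  (* a lower bound for a0 n / h, the chance of hitting a family of a0 n half-edges *)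
  define \<beta> where "\<beta> = \<alpha> / (16 * \<mu>)"
  have beta: "\<beta> > 0" using \<alpha> mu by (simp add: \<beta>_def)
  (* there are at most 4 * mu * N n vertices, hence at most 4 * mu * N n / r large components *)
  define r where "r = nat \<lceil>8 * \<mu> / (\<beta>\<^sup>2 * \<tau>)\<rceil> + 1"
  have r: "r > 0" by (simp add: r_def)
  have r8: "8 * \<mu> / (\<beta>\<^sup>2 * \<tau>) \<le> real r" unfolding r_def using real_nat_ceiling_ge[of "8 * \<mu> / (\<beta>\<^sup>2 * \<tau>)"] by linarith
  have bt: "\<beta>\<^sup>2 * \<tau> > 0" using beta tau by simp
  have mr: "4 * \<mu> / real r \<le> \<beta>\<^sup>2 * \<tau> / 2"
  proof -
    have "8 * \<mu> \<le> real r * (\<beta>\<^sup>2 * \<tau>)" using r8 bt by (simp add: divide_le_eq)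
    then show ?thesis using r by (simp add: divide_le_eq algebra_simps)
  qed
  define a where "a = (\<lambda>n. nat \<lceil>\<alpha> * N n\<rceil>)"
  define a0 where "a0 = (\<lambda>n. nat \<lfloor>\<alpha> / 4 * N n\<rfloor>)"
  have N0: "N n \<ge> 0" for n by (simp add: N_def)
  have Ntop: "filterlim N at_top sequentially" unfolding N_def by (rule sz_real_lim)
  have ev1: "\<forall>\<^sub>F n in sequentially. real (card (Vj n)) / N n > q / 2"
    by (rule order_tendstoD[where y = q]) (use F q in \<open>simp_all add: flag_density_def q_def N_def Vj_def\<close>)
  have ev2: "\<forall>\<^sub>F n in sequentially. real (B.h n) / N n < 2 * \<mu>"
  proof (rule order_tendstoD(2))
    show "(\<lambda>n. real (B.h n) / N n) \<longlonglongrightarrow> \<mu>" using h_over_sz[of False] by (simp add: N_def \<mu>_def)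
  qed (use mu in simp)
  have ev3: "\<forall>\<^sub>F n in sequentially. N n \<ge> 8 / \<alpha> + 1" using Ntop by (simp add: filterlim_at_top)
  have bound: "\<forall>\<^sub>F n in sequentially. real (card {\<omega>\<in>B.MM n. \<not> B.merged n (F n) r (a n) (bs n) \<omega>}) / real (card (B.MM n))
     \<le> exp (\<beta>\<^sup>2 - \<beta>\<^sup>2 * \<tau> / 2 * N n)"
    using ev1 ev2 ev3
  proof eventually_elim
    case (elim n)
    have Np: "N n > 0" using elim(3) \<alpha> by (smt (verit) divide_pos_pos)
    have hN: "real (B.h n) \<le> 2 * \<mu> * N n" using elim(2) Np by (simp add: divide_less_eq)
    have Nh: "N n \<le> real (B.h n)" using sz_le_h[of n False] by (simp add: N_def)
    have tN: "real (t n) \<le> \<tau> * N n" "real (t n) \<ge> \<tau> * N n - 1"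
      using tau N0[of n] by (auto simp: t_def of_nat_nat)
    have "\<tau> * N n \<le> q / 2 * N n" by (rule mult_right_mono[OF tau(3) N0])
    also have "\<dots> \<le> real (card (Vj n))" using elim(1) Np by (simp add: less_divide_eq)
    finally have "t n \<le> card (Vj n)" using tN(1) by linarith
    then have len: "length (bs n) = t n" using fV[of n] by (simp add: bs_def)
    have a0N: "real (a0 n) \<le> \<alpha> / 4 * N n" "real (a0 n) \<ge> \<alpha> / 4 * N n - 1"
    proof -
      have y: "0 \<le> \<alpha> / 4 * N n" using \<alpha> N0[of n] by simp
      show "real (a0 n) \<le> \<alpha> / 4 * N n" unfolding a0_def by (rule of_nat_floor[OF y])
      show "real (a0 n) \<ge> \<alpha> / 4 * N n - 1" unfolding a0_def using y by linarith
    qed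
    have "8 / \<alpha> \<le> N n" using elim(3) by simp
    then have "8 \<le> N n * \<alpha>" using \<alpha> by (simp add: divide_le_eq)
    then have aa: "real (a0 n) \<ge> \<alpha> / 8 * N n" using a0N(2) by (simp add: mult.commute)
    have sum: "real (a0 n) + 2 * real (t n) \<le> \<alpha> * N n"
    proof -
      have "\<tau> * N n \<le> \<alpha> / 8 * N n" by (rule mult_right_mono[OF tau(2) N0])
      moreover have "\<alpha> / 4 * N n + 2 * (\<alpha> / 8 * N n) \<le> \<alpha> * N n" using \<alpha> N0[of n] by (simp add: field_simps)
      ultimately show ?thesis using a0N(1) tN(1) by linarith
    qed
    have an: "a n \<ge> a0 n + 2 * length (bs n)"
    proof -
      have "\<alpha> * N n \<le> real (a n)" unfolding a_def by (rule real_nat_ceiling_ge)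
      then show ?thesis using sum unfolding len by linarith
    qed
    have "\<alpha> / 4 * N n \<le> 1 * N n" by (rule mult_right_mono) (use \<alpha> N0[of n] in auto)
    then have a0h: "real (a0 n) \<le> real (B.h n)" using a0N(1) Nh by linarith
    have "real (card {\<omega>\<in>B.MM n. \<not> B.merged n (F n) r (a n) (bs n) \<omega>}) \<le>
       2 ^ ((sz n True + sz n False) div r) * (1 - (real (a0 n) / real (B.h n))\<^sup>2) ^ length (bs n) * real (card (B.MM n))"
      by (rule B.not_merged_bound[OF r bsd _ an]) (use bs1 a0h in auto)
    then have "real (card {\<omega>\<in>B.MM n. \<not> B.merged n (F n) r (a n) (bs n) \<omega>}) / real (card (B.MM n)) \<le>
       2 ^ ((sz n True + sz n False) div r) * (1 - (real (a0 n) / real (B.h n))\<^sup>2) ^ length (bs n)"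
      using B.card_MM_pos[of n] by (simp add: divide_le_eq)
    also have "\<dots> \<le> exp (\<beta>\<^sup>2 * \<tau> / 2 * N n - \<beta>\<^sup>2 * (\<tau> * N n - 1))"
    proof (rule exp_bound_union)
      have hp: "real (B.h n) > 0" using Np Nh by linarith
      show "\<beta> \<le> real (a0 n) / real (B.h n)"
      proof -
        have "\<beta> * real (B.h n) \<le> \<beta> * (2 * \<mu> * N n)" by (rule mult_left_mono[OF hN]) (use beta in simp)
        also have "\<dots> = \<alpha> / 8 * N n" using mu by (simp add: \<beta>_def field_simps)
        finally show ?thesis using aa hp by (simp add: le_divide_eq)
      qed
      show "real (a0 n) / real (B.h n) \<le> 1" using a0h hp by simp
      show "real (length (bs n)) \<ge> \<tau> * N n - 1" using tN(2) len by simp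
      have "real ((sz n True + sz n False) div r) \<le> real (sz n True + sz n False) / real r" by (rule of_nat_div_le_of_nat)
      also have "\<dots> \<le> (2 * (2 * \<mu> * N n)) / real r"
        by (rule divide_right_mono) (use sz_le_h[of n True] sz_le_h[of n False] hN in linarith, simp)
      also have "\<dots> = 4 * \<mu> / real r * N n" by simp
      also have "\<dots> \<le> \<beta>\<^sup>2 * \<tau> / 2 * N n" by (rule mult_right_mono[OF mr N0])
      finally show "real ((sz n True + sz n False) div r) \<le> \<beta>\<^sup>2 * \<tau> / 2 * N n" .
    qed (use beta in simp)
    also have "\<beta>\<^sup>2 * \<tau> / 2 * N n - \<beta>\<^sup>2 * (\<tau> * N n - 1) = \<beta>\<^sup>2 - \<beta>\<^sup>2 * \<tau> / 2 * N n" by (simp add: algebra_simps)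
    finally show ?case .
  qed
  have "(\<lambda>n. exp (\<beta>\<^sup>2 - \<beta>\<^sup>2 * \<tau> / 2 * N n)) \<longlonglongrightarrow> 0"
  proof (rule filterlim_compose[OF exp_at_bot])
    have "filterlim (\<lambda>n. (\<beta>\<^sup>2 * \<tau> / 2) * N n) at_top sequentially"
      by (rule filterlim_tendsto_pos_mult_at_top[OF tendsto_const _ Ntop]) (use bt in simp)
    then have "filterlim (\<lambda>n. - \<beta>\<^sup>2 + (\<beta>\<^sup>2 * \<tau> / 2) * N n) at_top sequentially"
      by (rule filterlim_tendsto_add_at_top[OF tendsto_const])
    then have "filterlim (\<lambda>n. - (- \<beta>\<^sup>2 + (\<beta>\<^sup>2 * \<tau> / 2) * N n)) at_bot sequentially"
      by (simp only: filterlim_uminus_at_bot_at_top filterlim_uminus_at_top[symmetric] filterlim_uminus_at_bot minus_minus)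
    then show "filterlim (\<lambda>n. \<beta>\<^sup>2 - \<beta>\<^sup>2 * \<tau> / 2 * N n) at_bot sequentially" by simp
  qed
  from whp_bound[OF bound this] show ?thesis
    using bs1 unfolding a_def N_def by blast
qed

text \<open>
  The flagged vertices attached to a large component play the role of \<open>L\<close> in
  \<open>merged_dominant\<close>; the loss \<open>a\<close> is small compared with their number.
\<close>

lemma giant_among_flags:
  assumes \<delta>: "\<delta> > 0"
  shows "\<exists>\<epsilon>0>0. \<forall>\<epsilon> F. 0 < \<epsilon> \<longrightarrow> \<epsilon> \<le> \<epsilon>0 \<longrightarrow> flag_density F \<epsilon> \<longrightarrow>
     whp (\<lambda>n \<omega>. \<exists>c. real (card {b\<in>F n. B.component n {} \<omega> (False, b) = c}) \<ge> \<epsilon> * (\<rho> - \<delta>) * real (sz n False))"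
proof -
  define d where "d = min \<delta> \<rho>"
  have d: "d > 0" "d \<le> \<delta>" "d \<le> \<rho>" using \<delta> \<rho>_pos by (auto simp: d_def)
  obtain \<epsilon>0 where e0: "\<epsilon>0 > 0" and att: "\<And>\<epsilon> F r. 0 < \<epsilon> \<Longrightarrow> \<epsilon> \<le> \<epsilon>0 \<Longrightarrow> flag_density F \<epsilon> \<Longrightarrow>
     whp (\<lambda>n \<omega>. real (card {v\<in>F n. attached n (F n) r \<omega> v}) \<ge> \<epsilon> * (\<rho> - d / 2) * real (sz n False))"
    using flagged_attached_lower[of "d / 2"] d by auto
  have rho1: "\<rho> \<le> 1"
  proof -
    have "0 \<le> gen_fun (law False) \<eta>r"
      by (rule sums_le[OF _ sums_zero law_gen_sums[OF eta_r_range]]) (use eta_r_range in auto)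
    then show ?thesis by (simp add: \<rho>_def)
  qed
  have "whp (\<lambda>n \<omega>. \<exists>c. real (card {b\<in>F n. B.component n {} \<omega> (False, b) = c}) \<ge> \<epsilon> * (\<rho> - \<delta>) * real (sz n False))"
    if eps: "0 < \<epsilon>" "\<epsilon> \<le> min \<epsilon>0 1" and F: "flag_density F \<epsilon>" for \<epsilon> F
  proof -
    have FV: "F n \<subseteq> {1..sz n False}" for n using F by (simp add: flag_density_def)
    define \<alpha> where "\<alpha> = \<epsilon> * d / 8"
    have "\<epsilon> * d \<le> 1 * 1" by (intro mult_mono) (use eps d rho1 in auto)
    then have \<alpha>: "0 < \<alpha>" "\<alpha> \<le> 1" using eps d by (auto simp: \<alpha>_def)
    obtain r bs where bs: "\<And>n b. b \<in> set (bs n) \<Longrightarrow> b \<in> {1..sz n False} \<and> dg n False b \<ge> 2"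
      and m: "whp (\<lambda>n. B.merged n (F n) r (nat \<lceil>\<alpha> * real (sz n False)\<rceil>) (bs n))"
      using merged_whp[OF F eps(1) \<alpha>] by blast
    have at: "whp (\<lambda>n \<omega>. real (card {v\<in>F n. attached n (F n) r \<omega> v}) \<ge> \<epsilon> * (\<rho> - d / 2) * real (sz n False))"
      by (rule att) (use eps F in auto)
    have "\<forall>\<^sub>F n in sequentially. 4 / \<alpha> \<le> real (sz n False)"
      using sz_real_lim[of False] by (simp add: filterlim_at_top)
    then show ?thesis
    proof (intro whp_mono[OF whp_conj[OF m at]], eventually_elim, intro ballI impI)
      fix n \<omega>
      assume N4: "4 / \<alpha> \<le> real (sz n False)" and w: "\<omega> \<in> B.MM n"
        and h: "B.merged n (F n) r (nat \<lceil>\<alpha> * real (sz n False)\<rceil>) (bs n) \<omega> \<and>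
           real (card {v\<in>F n. attached n (F n) r \<omega> v}) \<ge> \<epsilon> * (\<rho> - d / 2) * real (sz n False)"
      let ?N = "real (sz n False)"
      let ?a = "nat \<lceil>\<alpha> * ?N\<rceil>"
      let ?L = "{v\<in>F n. attached n (F n) r \<omega> v}"
      have aN: "4 \<le> \<alpha> * ?N" using N4 \<alpha>(1) by (simp add: divide_le_eq mult.commute)
      have a1: "real ?a \<le> \<alpha> * ?N + 1" using aN by linarith
      have "\<epsilon> * (d / 2) * ?N \<le> \<epsilon> * (\<rho> - d / 2) * ?N"
        by (intro mult_right_mono mult_left_mono) (use d eps in auto)
      moreover have "\<epsilon> * (d / 2) * ?N = 4 * (\<alpha> * ?N)" by (simp add: \<alpha>_def)
      ultimately have "4 * (\<alpha> * ?N) \<le> real (card ?L)" using h by linarith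
      then have "3 * real ?a \<le> real (card ?L)" using a1 aN by linarith
      then have cL: "card ?L \<ge> 3 * ?a" by linarith
      have "\<exists>c. card {b\<in>?L. B.component n {} \<omega> (False, b) \<noteq> c} < ?a"
      proof (rule B.merged_dominant[OF w conjunct1[OF h] _ _ cL])
        show "\<And>b. b \<in> set (bs n) \<Longrightarrow> b \<in> {1..sz n False} \<and> dg n False b \<ge> 2" by (rule bs)
        show "?L \<subseteq> F n" by auto
        show "\<And>b. b \<in> ?L \<Longrightarrow> \<exists>z\<in>B.HE n False. fst z = b \<and> card (B.component n (F n) \<omega> (True, fst (B.partner n False \<omega> z))) \<ge> r"
          by (auto simp: attached_def)
      qed
      then obtain c where c: "card {b\<in>?L. B.component n {} \<omega> (False, b) \<noteq> c} < ?a" ..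
      have fF: "finite (F n)" using FV[of n] finite_subset by blast
      have "?L = {b\<in>?L. B.component n {} \<omega> (False, b) = c} \<union> {b\<in>?L. B.component n {} \<omega> (False, b) \<noteq> c}" by auto
      then have "card ?L = card ({b\<in>?L. B.component n {} \<omega> (False, b) = c} \<union> {b\<in>?L. B.component n {} \<omega> (False, b) \<noteq> c})"
        by (rule arg_cong)
      also have "\<dots> \<le> card {b\<in>?L. B.component n {} \<omega> (False, b) = c} + card {b\<in>?L. B.component n {} \<omega> (False, b) \<noteq> c}"
        by (rule card_Un_le)
      finally have 1: "real (card ?L) \<le> real (card {b\<in>?L. B.component n {} \<omega> (False, b) = c}) + (\<alpha> * ?N + 1)"
        using c a1 by linarith
      have 2: "card {b\<in>?L. B.component n {} \<omega> (False, b) = c} \<le> card {b\<in>F n. B.component n {} \<omega> (False, b) = c}"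
        by (rule card_mono) (use fF in auto)
      have "\<epsilon> * (\<rho> - \<delta>) * ?N \<le> \<epsilon> * (\<rho> - d) * ?N"
        by (intro mult_right_mono mult_left_mono) (use d eps in auto)
      also have "\<dots> = \<epsilon> * (\<rho> - d / 2) * ?N - 4 * (\<alpha> * ?N)" by (simp add: \<alpha>_def algebra_simps)
      also have "\<dots> \<le> real (card {b\<in>F n. B.component n {} \<omega> (False, b) = c})" using h 1 2 aN by linarith
      finally show "\<exists>c. real (card {b\<in>F n. B.component n {} \<omega> (False, b) = c}) \<ge> \<epsilon> * (\<rho> - \<delta>) * ?N" by blast
    qed
  qed
  then show ?thesis using e0 by (intro exI[of _ "min \<epsilon>0 1"]) auto
qed


definition flags :: "nat \<Rightarrow> (nat \<Rightarrow> nat) \<Rightarrow> nat set" where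
  "flags n f = {b\<in>{1..sz n False}. f b = 0}"

text \<open>
  The colouring flags nearly the proportion \<open>1 / Q\<close> of every degree class. The
  bound \<open>N * sqrt N\<close> is below \<open>N\<^sup>2\<close>, so regularity implies the
  right density, and above the variance \<open>N\<close>, so most colourings are regular.
\<close>

definition regular :: "nat \<Rightarrow> nat \<Rightarrow> (nat \<Rightarrow> nat) \<Rightarrow> bool" where
  "regular Q n f \<longleftrightarrow> (\<forall>j. (real (card {v\<in>flags n f. dg n False v = j}) -
      real (card {v\<in>{1..sz n False}. dg n False v = j}) / real Q)\<^sup>2 < real (sz n False) * sqrt (real (sz n False)))"

abbreviation cols where "cols Q n \<equiv> colourings {1..sz n False} Q"

text \<open>
  Chebyshev's inequality for each degree class; the variances add up to the number of vertices.
\<close>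

lemma few_irregular:
  assumes Q: "Q > 0" and N: "sz n False > 0"
  shows "real (card {f\<in>cols Q n. \<not> regular Q n f}) \<le> real (card (cols Q n)) / sqrt (real (sz n False))"
proof -
  let ?I = "{1..sz n False}"
  let ?c = "real (sz n False) * sqrt (real (sz n False))"
  have c: "?c > 0" using N by simp
  let ?S = "\<lambda>j. {v\<in>?I. dg n False v = j}"
  let ?J = "{0..dmax n}"
  let ?dev = "\<lambda>f j. (real (card {b\<in>?S j. f b = 0}) - real (card (?S j)) / real Q)\<^sup>2"
  let ?B = "\<lambda>j. {f\<in>cols Q n. ?dev f j \<ge> ?c}"
  have fl: "{v\<in>flags n f. dg n False v = j} = {b\<in>?S j. f b = 0}" for f j by (auto simp: flags_def)
  have sub: "{f\<in>cols Q n. \<not> regular Q n f} \<subseteq> (\<Union>j\<in>?J. ?B j)"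
  proof
    fix f assume f: "f \<in> {f\<in>cols Q n. \<not> regular Q n f}"
    then obtain j where j: "?dev f j \<ge> ?c" unfolding regular_def fl by (auto simp: not_less)
    have "?S j \<noteq> {}"
    proof
      assume e: "?S j = {}"
      then have "?dev f j = 0" unfolding e by simp
      then show False using j c by linarith
    qed
    then have "j \<in> ?J" using dg_le_dmax[of _ n False] by auto
    then show "f \<in> (\<Union>j\<in>?J. ?B j)" using f j by blast
  qed
  have fin: "finite (cols Q n)" by (rule finite_colourings) simp
  have "card {f\<in>cols Q n. \<not> regular Q n f} \<le> card (\<Union>j\<in>?J. ?B j)"
    by (rule card_mono[OF _ sub]) (use fin in auto)
  also have "\<dots> \<le> (\<Sum>j\<in>?J. card (?B j))" by (rule card_UN_le) simp
  finally have "real (card {f\<in>cols Q n. \<not> regular Q n f}) \<le> (\<Sum>j\<in>?J. real (card (?B j)))"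
    unfolding of_nat_sum[symmetric] by (rule of_nat_mono)
  also have "\<dots> \<le> (\<Sum>j\<in>?J. real (card (?S j)) * real (card (cols Q n)) / ?c)"
  proof (rule sum_mono)
    fix j assume "j \<in> ?J"
    have "real (card (?B j)) * ?c \<le> real (card (?S j)) * real (card (cols Q n))"
      by (rule colouring_chebyshev[OF _ _ Q c]) auto
    then show "real (card (?B j)) \<le> real (card (?S j)) * real (card (cols Q n)) / ?c"
      using c by (simp add: le_divide_eq)
  qed
  also have "\<dots> = (\<Sum>j\<in>?J. real (card (?S j))) * (real (card (cols Q n)) / ?c)"
    by (simp only: sum_distrib_right) (simp only: times_divide_eq_right)
  also have "(\<Sum>j\<in>?J. real (card (?S j))) = real (sz n False)"
  proof -
    have "card ?I = (\<Sum>j\<in>?J. card (?S j))"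
    proof (rule card_fibers)
      show "dg n False ` ?I \<subseteq> ?J"
      proof (rule image_subsetI)
        fix v assume "v \<in> ?I"
        then show "dg n False v \<in> ?J" using dg_le_dmax[of v n False] by simp
      qed
    qed auto
    then show ?thesis by (simp only: of_nat_sum[symmetric] card_atLeastAtMost diff_Suc_1)
  qed
  also have "real (sz n False) * (real (card (cols Q n)) / ?c) = real (card (cols Q n)) / sqrt (real (sz n False))"
    using N by simp
  finally show ?thesis .
qed

lemma regular_density:
  assumes Q: "Q > 0" and F: "\<And>n. F n \<subseteq> {1..sz n False}"
    and reg: "\<forall>\<^sub>F n in sequentially. \<exists>f. F n = flags n f \<and> regular Q n f"
  shows "flag_density F (1 / real Q)"
  unfolding flag_density_def
proof (intro conjI allI F)
  fix j
  let ?N = "\<lambda>n. real (sz n False)"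
  let ?a = "\<lambda>n. real (card {v\<in>F n. dg n False v = j})"
  let ?c = "\<lambda>n. real (card {v\<in>{1..sz n False}. dg n False v = j})"
  have "(\<lambda>n. ((?a n - ?c n / real Q) / ?N n)\<^sup>2) \<longlonglongrightarrow> 0"
  proof (rule tendsto_sandwich[OF _ _ tendsto_const])
    show "\<forall>\<^sub>F n in sequentially. ((?a n - ?c n / real Q) / ?N n)\<^sup>2 \<le> 1 / sqrt (?N n)"
      using reg sz_pos[of False]
    proof eventually_elim
      case (elim n)
      then obtain f where f: "F n = flags n f" "regular Q n f" by blast
      have "(?a n - ?c n / real Q)\<^sup>2 \<le> ?N n * sqrt (?N n)"
        using f(2) unfolding regular_def f(1) by (simp add: less_imp_le)
      then have "(?a n - ?c n / real Q)\<^sup>2 / (?N n)\<^sup>2 \<le> ?N n * sqrt (?N n) / (?N n)\<^sup>2"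
        by (rule divide_right_mono) simp
      also have "\<dots> = sqrt (?N n) / ?N n" using elim(2) by (simp add: power2_eq_square)
      also have "\<dots> = 1 / sqrt (?N n)" using elim(2) by (simp add: real_div_sqrt field_simps)
      finally show ?case by (simp add: power_divide)
    qed
    have "filterlim (\<lambda>n. sqrt (?N n)) at_top sequentially"
      by (rule filterlim_compose[OF sqrt_at_top sz_real_lim])
    then show "(\<lambda>n. 1 / sqrt (?N n)) \<longlonglongrightarrow> 0" by (rule real_tendsto_divide_at_top[OF tendsto_const])
  qed (auto intro: always_eventually)
  then have 1: "(\<lambda>n. (?a n - ?c n / real Q) / ?N n) \<longlonglongrightarrow> 0" by simp
  have 2: "(\<lambda>n. 1 / real Q * (?c n / ?N n)) \<longlonglongrightarrow> 1 / real Q * pmf (law False) j"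
    by (intro tendsto_mult tendsto_const count_lim)
  have "(\<lambda>n. (?a n - ?c n / real Q) / ?N n + 1 / real Q * (?c n / ?N n)) \<longlonglongrightarrow> 0 + 1 / real Q * pmf (law False) j"
    by (rule tendsto_add[OF 1 2])
  moreover have "(?a n - ?c n / real Q) / ?N n + 1 / real Q * (?c n / ?N n) = ?a n / ?N n" for n
    by (simp add: diff_divide_distrib mult.commute)
  ultimately show "(\<lambda>n. ?a n / ?N n) \<longlonglongrightarrow> 1 / real Q * pmf (law False) j" by simp
qed

text \<open>
  Let \<open>\<omega>\<close> be a matching without a component of the claimed size. By
  Chebyshev's inequality at least half of all colourings then flag no component as often as
  \<open>giant_among_flags\<close> promises. Averaging over matchings and colourings, the
  probability of such \<open>\<omega>\<close> is at most twice the failure probability of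
  \<open>giant_among_flags\<close>, for the worst regular colouring, plus the proportion of
  irregular ones.
\<close>

lemma giant:
  assumes \<delta>: "\<delta> > 0"
  shows "whp (\<lambda>n \<omega>. \<exists>c. real (card {b\<in>{1..sz n False}. B.component n {} \<omega> (False, b) = c}) \<ge> (\<rho> - \<delta>) * real (sz n False))"
proof -
  define d where "d = min \<delta> \<rho> / 2"
  have d: "d > 0" "2 * d \<le> \<delta>" "d < \<rho>" using \<delta> \<rho>_pos by (auto simp: d_def)
  obtain \<epsilon>0 where e0: "\<epsilon>0 > 0" and gf: "\<And>\<epsilon> F. 0 < \<epsilon> \<Longrightarrow> \<epsilon> \<le> \<epsilon>0 \<Longrightarrow> flag_density F \<epsilon> \<Longrightarrow>
     whp (\<lambda>n \<omega>. \<exists>c. real (card {b\<in>F n. B.component n {} \<omega> (False, b) = c}) \<ge> \<epsilon> * (\<rho> - d) * real (sz n False))"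
    using giant_among_flags[OF d(1)] by blast
  obtain Q0 where "inverse (real (Suc Q0)) < \<epsilon>0" using reals_Archimedean[OF e0] by blast
  then obtain Q where Q: "Q > 0" "1 / real Q \<le> \<epsilon>0" by (intro that[of "Suc Q0"]) (auto simp: inverse_eq_divide)
  let ?N = "\<lambda>n. real (sz n False)"
  define bad where "bad = (\<lambda>n f \<omega>. \<not> (\<exists>c. real (card {b\<in>flags n f. B.component n {} \<omega> (False, b) = c}) \<ge> 1 / real Q * (\<rho> - d) * ?N n))"
  define pb where "pb = (\<lambda>n f. real (card {\<omega>\<in>B.MM n. bad n f \<omega>}) / real (card (B.MM n)))"
  define Reg where "Reg = (\<lambda>n. {f\<in>cols Q n. regular Q n f})"
  have fin: "finite (cols Q n)" for n by (rule finite_colourings) simp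
  have cpos: "card (cols Q n) > 0" for n by (rule card_colourings_pos) (use Q in auto)
  have fReg: "finite (Reg n)" for n using fin[of n] by (simp add: Reg_def)
  (* The statement on flags holds for each sequence of regular colourings, hence uniformly: apply it
     to the sequence of those with the largest failure probability. *)
  define fm where "fm = (\<lambda>n. SOME f. f \<in> Reg n \<and> (\<forall>g\<in>Reg n. pb n g \<le> pb n f))"
  have fm: "fm n \<in> Reg n \<and> (\<forall>g\<in>Reg n. pb n g \<le> pb n (fm n))" if ne: "Reg n \<noteq> {}" for n
  proof -
    have "Max (pb n ` Reg n) \<in> pb n ` Reg n" by (rule Max_in) (use fReg ne in auto)
    then obtain f where f: "f \<in> Reg n" "pb n f = Max (pb n ` Reg n)" by (metis imageE)
    have "pb n g \<le> pb n f" if "g \<in> Reg n" for g unfolding f(2) by (rule Max_ge) (use fReg that in auto)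
    then have "f \<in> Reg n \<and> (\<forall>g\<in>Reg n. pb n g \<le> pb n f)" using f(1) by blast
    from someI[where P = "\<lambda>f. f \<in> Reg n \<and> (\<forall>g\<in>Reg n. pb n g \<le> pb n f)", OF this]
    show ?thesis unfolding fm_def .
  qed
  define \<pi> where "\<pi> = (\<lambda>n. pb n (fm n))"
  have N4: "\<forall>\<^sub>F n in sequentially. ?N n \<ge> 4" using sz_real_lim[of False] unfolding filterlim_at_top by blast
  have ne: "\<forall>\<^sub>F n in sequentially. Reg n \<noteq> {}"
    using N4
  proof eventually_elim
    case (elim n)
    show ?case
    proof
      assume "Reg n = {}"
      then have "{f\<in>cols Q n. \<not> regular Q n f} = cols Q n" by (auto simp: Reg_def)
      then have "real (card (cols Q n)) \<le> real (card (cols Q n)) / sqrt (?N n)"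
        using few_irregular[OF Q(1), of n] elim by simp
      moreover have "sqrt (?N n) \<ge> 2" using elim real_le_rsqrt[of 2 "?N n"] by simp
      then have "real (card (cols Q n)) / sqrt (?N n) \<le> real (card (cols Q n)) / 2"
        by (intro divide_left_mono) (use elim in auto)
      moreover have "real (card (cols Q n)) > 0" using cpos[of n] by simp
      ultimately show False by linarith
    qed
  qed
  have "flag_density (\<lambda>n. flags n (fm n)) (1 / real Q)"
  proof (rule regular_density[OF Q(1)])
    show "flags n (fm n) \<subseteq> {1..sz n False}" for n by (auto simp: flags_def)
    show "\<forall>\<^sub>F n in sequentially. \<exists>f. flags n (fm n) = flags n f \<and> regular Q n f"
      using ne by eventually_elim (use fm in \<open>auto simp: Reg_def\<close>)
  qed
  then have "whp (\<lambda>n \<omega>. \<not> bad n (fm n) \<omega>)"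
    unfolding bad_def not_not by (intro gf) (use Q in auto)
  then have pi0: "\<pi> \<longlonglongrightarrow> 0" by (simp add: whp_def \<pi>_def pb_def)
  let ?lack = "\<lambda>n \<omega>. \<not> (\<exists>c. real (card {b\<in>{1..sz n False}. B.component n {} \<omega> (False, b) = c}) \<ge> (\<rho> - \<delta>) * ?N n)"
  have N5: "\<forall>\<^sub>F n in sequentially. ?N n \<ge> 2 * (real Q)\<^sup>2 / d\<^sup>2" using sz_real_lim[of False] unfolding filterlim_at_top by blast
  have key: "\<forall>\<^sub>F n in sequentially. real (card {\<omega>\<in>B.MM n. ?lack n \<omega>}) / real (card (B.MM n)) \<le> 2 * (\<pi> n + 1 / sqrt (?N n))"
    using N4 N5 ne
  proof eventually_elim
    case (elim n)
    let ?I = "{1..sz n False}"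
    let ?C = "cols Q n"
    have Np: "?N n > 0" using elim(1) by linarith
    have half: "real (card {f\<in>?C. bad n f \<omega>}) \<ge> real (card ?C) / 2" if l: "?lack n \<omega>" for \<omega>
    proof -
      let ?comp = "\<lambda>b. B.component n {} \<omega> (False, b)"
      let ?S = "\<lambda>c. {b\<in>?I. ?comp b = c}"
      let ?z = "(d * ?N n / real Q)\<^sup>2"
      have z: "?z > 0" using d Np Q by simp
      let ?E = "\<lambda>c. {f\<in>?C. (real (card {b\<in>?S c. f b = 0}) - real (card (?S c)) / real Q)\<^sup>2 \<ge> ?z}"
      have sub: "{f\<in>?C. \<not> bad n f \<omega>} \<subseteq> (\<Union>c\<in>?comp ` ?I. ?E c)"
      proof
        fix f assume f: "f \<in> {f\<in>?C. \<not> bad n f \<omega>}"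
        then obtain c where c: "real (card {b\<in>flags n f. ?comp b = c}) \<ge> 1 / real Q * (\<rho> - d) * ?N n"
          by (auto simp: bad_def)
        have fl: "{b\<in>flags n f. ?comp b = c} = {b\<in>?S c. f b = 0}" by (auto simp: flags_def)
        have "1 / real Q * (\<rho> - d) * ?N n > 0" using Q d Np by simp
        then have "real (card {b\<in>?S c. f b = 0}) > 0" using c unfolding fl by linarith
        then have "{b\<in>?S c. f b = 0} \<noteq> {}" by (metis card.empty less_irrefl of_nat_0)
        then have cI: "c \<in> ?comp ` ?I" by auto
        have "real (card (?S c)) < (\<rho> - \<delta>) * ?N n" using l by (auto simp: not_le)
        also have "\<dots> \<le> (\<rho> - 2 * d) * ?N n" by (rule mult_right_mono) (use d in auto)
        finally have "real (card (?S c)) / real Q \<le> (\<rho> - 2 * d) * ?N n / real Q" by (intro divide_right_mono) auto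
        moreover have "1 / real Q * (\<rho> - d) * ?N n - (\<rho> - 2 * d) * ?N n / real Q = d * ?N n / real Q"
          by (simp add: diff_divide_distrib[symmetric] algebra_simps)
        ultimately have "d * ?N n / real Q \<le> real (card {b\<in>?S c. f b = 0}) - real (card (?S c)) / real Q"
          using c unfolding fl by linarith
        then have "?z \<le> (real (card {b\<in>?S c. f b = 0}) - real (card (?S c)) / real Q)\<^sup>2"
          by (rule power_mono) (use d Np Q in simp)
        then show "f \<in> (\<Union>c\<in>?comp ` ?I. ?E c)" using f cI by blast
      qed
      have "card {f\<in>?C. \<not> bad n f \<omega>} \<le> card (\<Union>c\<in>?comp ` ?I. ?E c)"
        by (rule card_mono[OF _ sub]) (use fin[of n] in auto)
      also have "\<dots> \<le> (\<Sum>c\<in>?comp ` ?I. card (?E c))" by (rule card_UN_le) simp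
      finally have "real (card {f\<in>?C. \<not> bad n f \<omega>}) \<le> (\<Sum>c\<in>?comp ` ?I. real (card (?E c)))"
        unfolding of_nat_sum[symmetric] by (rule of_nat_mono)
      also have "\<dots> \<le> (\<Sum>c\<in>?comp ` ?I. real (card (?S c)) * real (card ?C) / ?z)"
      proof (rule sum_mono)
        fix c assume "c \<in> ?comp ` ?I"
        have "real (card (?E c)) * ?z \<le> real (card (?S c)) * real (card ?C)"
          by (rule colouring_chebyshev[OF _ _ Q(1) z]) auto
        then show "real (card (?E c)) \<le> real (card (?S c)) * real (card ?C) / ?z" using z by (simp add: le_divide_eq)
      qed
      also have "\<dots> = (\<Sum>c\<in>?comp ` ?I. real (card (?S c))) * (real (card ?C) / ?z)"
        by (simp only: sum_distrib_right) (simp only: times_divide_eq_right)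
      also have "(\<Sum>c\<in>?comp ` ?I. real (card (?S c))) = ?N n"
      proof -
        have "card ?I = (\<Sum>c\<in>?comp ` ?I. card (?S c))" by (rule card_fibers) auto
        then show ?thesis by (simp only: of_nat_sum[symmetric] card_atLeastAtMost diff_Suc_1)
      qed
      also have "?N n * (real (card ?C) / ?z) \<le> real (card ?C) / 2"
      proof -
        have "2 * (real Q)\<^sup>2 \<le> ?N n * d\<^sup>2" using elim(2) d by (simp add: divide_le_eq)
        then have "2 * (real Q)\<^sup>2 * ?N n \<le> ?N n * d\<^sup>2 * ?N n" by (rule mult_right_mono) simp
        then have "?N n * 2 \<le> ?z" using Q by (simp add: power_mult_distrib power_divide le_divide_eq power2_eq_square algebra_simps)
        then have "?N n / ?z \<le> 1 / 2" using z by (simp add: divide_le_eq)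
        then have "real (card ?C) * (?N n / ?z) \<le> real (card ?C) * (1 / 2)" by (rule mult_left_mono) simp
        then show ?thesis by (simp add: mult.commute)
      qed
      finally have 1: "real (card {f\<in>?C. \<not> bad n f \<omega>}) \<le> real (card ?C) / 2" .
      have "?C = {f\<in>?C. bad n f \<omega>} \<union> {f\<in>?C. \<not> bad n f \<omega>}" by auto
      then have "card ?C = card ({f\<in>?C. bad n f \<omega>} \<union> {f\<in>?C. \<not> bad n f \<omega>})" by (rule arg_cong)
      also have "\<dots> \<le> card {f\<in>?C. bad n f \<omega>} + card {f\<in>?C. \<not> bad n f \<omega>}" by (rule card_Un_le)
      finally show ?thesis using 1 by linarith
    qed
    let ?Lk = "{\<omega>\<in>B.MM n. ?lack n \<omega>}"
    have "real (card ?Lk) * (real (card ?C) / 2) = (\<Sum>\<omega>\<in>?Lk. real (card ?C) / 2)" by simp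
    also have "\<dots> \<le> (\<Sum>\<omega>\<in>?Lk. real (card {f\<in>?C. bad n f \<omega>}))" by (rule sum_mono) (use half in auto)
    also have "\<dots> \<le> (\<Sum>\<omega>\<in>B.MM n. real (card {f\<in>?C. bad n f \<omega>}))" by (rule sum_mono2) auto
    also have "\<dots> = (\<Sum>\<omega>\<in>B.MM n. \<Sum>f\<in>?C. of_bool (bad n f \<omega>))"
      using fin[of n] by (simp add: of_bool_def sum.If_cases Int_def)
    also have "\<dots> = (\<Sum>f\<in>?C. \<Sum>\<omega>\<in>B.MM n. of_bool (bad n f \<omega>))" by (rule sum.swap)
    also have "\<dots> = (\<Sum>f\<in>?C. pb n f * real (card (B.MM n)))"
      using B.card_MM_pos[of n] by (intro sum.cong refl) (simp add: pb_def of_bool_def sum.If_cases Int_def)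
    also have "\<dots> \<le> (\<Sum>f\<in>?C. (\<pi> n + of_bool (\<not> regular Q n f)) * real (card (B.MM n)))"
    proof (intro sum_mono mult_right_mono)
      fix f assume f: "f \<in> ?C"
      have "pb n f \<le> 1"
      proof -
        have "card {\<omega>\<in>B.MM n. bad n f \<omega>} \<le> card (B.MM n)" by (rule card_mono) auto
        then show ?thesis by (simp add: pb_def divide_le_eq)
      qed
      moreover have "pb n f \<le> \<pi> n" if "regular Q n f" using fm[OF elim(3)] f that by (simp add: Reg_def \<pi>_def)
      moreover have "0 \<le> \<pi> n" by (simp add: \<pi>_def pb_def)
      ultimately show "pb n f \<le> \<pi> n + of_bool (\<not> regular Q n f)" by (cases "regular Q n f") auto
    qed simp
    also have "\<dots> = (real (card ?C) * \<pi> n + real (card {f\<in>?C. \<not> regular Q n f})) * real (card (B.MM n))"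
      using fin[of n] by (simp add: sum_distrib_right[symmetric] sum.distrib of_bool_def sum.If_cases Int_def)
    also have "\<dots> \<le> (real (card ?C) * \<pi> n + real (card ?C) / sqrt (?N n)) * real (card (B.MM n))"
      by (intro mult_right_mono add_left_mono few_irregular Q) (use Np in auto)
    finally have "real (card ?Lk) * (real (card ?C) / 2) \<le> (real (card ?C) * \<pi> n + real (card ?C) / sqrt (?N n)) * real (card (B.MM n))" .
    then have "real (card ?C) * real (card ?Lk) \<le> real (card ?C) * (2 * (\<pi> n + 1 / sqrt (?N n)) * real (card (B.MM n)))"
      by (simp add: algebra_simps)
    then have "real (card ?Lk) \<le> 2 * (\<pi> n + 1 / sqrt (?N n)) * real (card (B.MM n))"
      using cpos[of n] by (simp only: mult_le_cancel_left_pos of_nat_0_less_iff)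
    then show ?case using B.card_MM_pos[of n] by (simp add: divide_le_eq)
  qed
  show ?thesis
  proof (rule whp_bound[OF key])
    have "filterlim (\<lambda>n. sqrt (?N n)) at_top sequentially"
      by (rule filterlim_compose[OF sqrt_at_top sz_real_lim])
    then have "(\<lambda>n. 1 / sqrt (?N n)) \<longlonglongrightarrow> 0" by (rule real_tendsto_divide_at_top[OF tendsto_const])
    then have "(\<lambda>n. 2 * (\<pi> n + 1 / sqrt (?N n))) \<longlonglongrightarrow> 2 * (0 + 0)"
      by (intro tendsto_mult tendsto_const tendsto_add pi0)
    then show "(\<lambda>n. 2 * (\<pi> n + 1 / sqrt (?N n))) \<longlonglongrightarrow> 0" by simp
  qed
qed

end

section \<open>Labels inside the giant component\<close>

text \<open>
  Right half-edges carry labels \<open>wt\<close>; \<open>\<kappa> c j\<close> is the limiting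
  proportion of the right half-edges with label \<open>c\<close> at vertices of degree
  \<open>j\<close>.
\<close>

locale labelled_seq = supercritical_seq +
  fixes wt :: "nat \<Rightarrow> bool \<Rightarrow> nat \<times> nat \<Rightarrow> nat" and \<kappa> :: "nat \<Rightarrow> nat \<Rightarrow> real"
  assumes \<kappa>_lim: "\<And>c j. (\<lambda>n. real (card {z\<in>B.HE n False. wt n False z = c \<and> dg n False (fst z) = j}) / real (B.h n)) \<longlonglongrightarrow> \<kappa> c j"
begin

lemma degree_share_lim:
  "(\<lambda>n. real (card {z\<in>B.HE n s. dg n s (fst z) = j \<and> True}) / real (B.h n)) \<longlonglongrightarrow> w s j"
proof -
  have "(\<lambda>n. real j * (real (card {v\<in>{1..sz n s}. dg n s v = j}) / real (B.h n))) \<longlonglongrightarrow>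
       real j * (pmf (law s) j / mean (law s))"
    by (intro tendsto_mult tendsto_const over_h count_lim)
  moreover have "card {z\<in>B.HE n s. dg n s (fst z) = j \<and> True} = j * card {v\<in>{1..sz n s}. dg n s v = j}" for n
    using B.card_HE_at_degree[of n s j "\<lambda>_. True"] by simp
  ultimately show ?thesis by (simp add: w_def)
qed

lemma \<kappa>_nonneg: "0 \<le> \<kappa> c j"
  by (rule LIMSEQ_le_const[OF \<kappa>_lim]) auto

lemma \<kappa>_le: "\<kappa> c j \<le> w False j"
proof (rule LIMSEQ_le[OF \<kappa>_lim degree_share_lim], intro exI allI impI)
  fix n
  have "card {z\<in>B.HE n False. wt n False z = c \<and> dg n False (fst z) = j} \<le> card {z\<in>B.HE n False. dg n False (fst z) = j \<and> True}"
    by (rule card_mono) auto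
  then show "real (card {z\<in>B.HE n False. wt n False z = c \<and> dg n False (fst z) = j}) / real (B.h n) \<le>
     real (card {z\<in>B.HE n False. dg n False (fst z) = j \<and> True}) / real (B.h n)"
    by (intro divide_right_mono) auto
qed

lemma \<kappa>_0: "\<kappa> c 0 = 0"
  using \<kappa>_le[of c 0] \<kappa>_nonneg[of c 0] w0 by simp

lemma summable_\<kappa>: "summable (\<kappa> c)"
  by (rule summable_comparison_test'[OF summable_w[of False], of 0]) (use \<kappa>_le \<kappa>_nonneg in auto)

text \<open>
  The limiting proportion of right half-edges that carry the label \<open>c\<close> and whose
  sibling half-edges all have an independent property of probability \<open>y\<close>. The
  property is dying for \<open>y = \<eta>r\<close>, and no condition for \<open>y = 1\<close>.
\<close>

definition share :: "nat \<Rightarrow> real \<Rightarrow> real" where "share c y = (\<Sum>j. \<kappa> c j * y ^ (j - 1))"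

lemma summable_share: "y \<in> {0..1} \<Longrightarrow> summable (\<lambda>j. \<kappa> c j * y ^ (j - 1))"
  by (rule summable_comparison_test'[OF summable_\<kappa>[of c], of 0])
     (use \<kappa>_nonneg in \<open>auto simp: abs_mult power_le_one intro!: mult_left_le\<close>)

lemma share_1: "share c 1 = suminf (\<kappa> c)" by (simp add: share_def)

lemma share_continuous: "continuous_on {0..1} (share c)"
proof -
  have u: "uniform_limit {0..1::real} (\<lambda>n x. \<Sum>j<n. \<kappa> c j * x ^ (j - 1)) (\<lambda>x. \<Sum>j. \<kappa> c j * x ^ (j - 1)) sequentially"
  proof (rule Weierstrass_m_test[where M = "\<kappa> c"])
    show "summable (\<kappa> c)" by (rule summable_\<kappa>)
    fix j x assume "x \<in> {0..1::real}"
    then show "norm (\<kappa> c j * x ^ (j - 1)) \<le> \<kappa> c j"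
      using \<kappa>_nonneg[of c j] by (auto simp: abs_mult power_le_one intro!: mult_left_le)
  qed
  show ?thesis unfolding share_def[abs_def]
    by (rule uniform_limit_theorem[OF _ u]) (auto intro!: always_eventually continuous_intros)
qed

lemma \<kappa>_partial_lim: "(\<lambda>\<Delta>. \<Sum>j=1..\<Delta>. \<kappa> c j) \<longlonglongrightarrow> share c 1"
proof -
  have "(\<lambda>\<Delta>. \<Sum>j<Suc \<Delta>. \<kappa> c j) \<longlonglongrightarrow> share c 1"
    unfolding share_1 using summable_LIMSEQ[OF summable_\<kappa>[of c]] by (rule LIMSEQ_Suc)
  moreover have "(\<Sum>j<Suc \<Delta>. \<kappa> c j) = (\<Sum>j=1..\<Delta>. \<kappa> c j)" for \<Delta>
    by (rule sum.mono_neutral_right) (auto simp: \<kappa>_0 Suc_le_eq)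
  ultimately show ?thesis by simp
qed

text \<open>
  Truncating at \<open>\<Delta>\<close> costs at most the tail of the label's mass.
\<close>

lemma partial_share_bounds:
  assumes y: "y \<in> {0..1}"
  shows "(\<Sum>j=1..\<Delta>. \<kappa> c j * y ^ (j - 1)) \<le> share c y"
    "share c y - (share c 1 - (\<Sum>j=1..\<Delta>. \<kappa> c j)) \<le> (\<Sum>j=1..\<Delta>. \<kappa> c j * y ^ (j - 1))"
proof -
  show "(\<Sum>j=1..\<Delta>. \<kappa> c j * y ^ (j - 1)) \<le> share c y"
    unfolding share_def by (rule sum_le_suminf[OF summable_share[OF y]]) (use y \<kappa>_nonneg in auto)
  have s: "summable (\<lambda>j. \<kappa> c j - \<kappa> c j * y ^ (j - 1))"
    by (rule summable_diff[OF summable_\<kappa> summable_share[OF y]])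
  have "(\<Sum>j=1..\<Delta>. \<kappa> c j - \<kappa> c j * y ^ (j - 1)) \<le> (\<Sum>j. \<kappa> c j - \<kappa> c j * y ^ (j - 1))"
    by (rule sum_le_suminf[OF s]) (use y \<kappa>_nonneg in \<open>auto intro!: mult_left_le simp: power_le_one\<close>)
  also have "\<dots> = suminf (\<kappa> c) - (\<Sum>j. \<kappa> c j * y ^ (j - 1))"
    by (rule suminf_diff[symmetric, OF summable_\<kappa> summable_share[OF y]])
  also have "\<dots> = share c 1 - share c y" by (subst share_1) (simp only: share_def)
  finally show "share c y - (share c 1 - (\<Sum>j=1..\<Delta>. \<kappa> c j)) \<le> (\<Sum>j=1..\<Delta>. \<kappa> c j * y ^ (j - 1))"
    by (simp add: sum_subtractf)
qed

lemma truncated_share_lim: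
  assumes y: "\<And>m. y m \<in> {0..1}" "y \<longlonglongrightarrow> \<eta>r" and \<Delta>: "filterlim \<Delta> at_top sequentially"
  shows "(\<lambda>m. \<Sum>j=1..\<Delta> m. \<kappa> c j * y m ^ (j - 1)) \<longlonglongrightarrow> share c \<eta>r"
    "(\<lambda>m. share c 1 - (\<Sum>j=1..\<Delta> m. \<kappa> c j)) \<longlonglongrightarrow> 0"
proof -
  have "(\<lambda>m. share c 1 - (\<Sum>j=1..\<Delta> m. \<kappa> c j)) \<longlonglongrightarrow> share c 1 - share c 1"
    by (intro tendsto_diff tendsto_const filterlim_compose[OF \<kappa>_partial_lim \<Delta>])
  then show t: "(\<lambda>m. share c 1 - (\<Sum>j=1..\<Delta> m. \<kappa> c j)) \<longlonglongrightarrow> 0" by simp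
  have s: "(\<lambda>m. share c (y m)) \<longlonglongrightarrow> share c \<eta>r"
    by (rule continuous_on_tendsto_compose[OF share_continuous y(2) eta_r_range]) (use y(1) in auto)
  have "(\<lambda>m. share c (y m) - (share c 1 - (\<Sum>j=1..\<Delta> m. \<kappa> c j))) \<longlonglongrightarrow> share c \<eta>r - 0"
    by (intro tendsto_diff s t)
  then have l: "(\<lambda>m. share c (y m) - (share c 1 - (\<Sum>j=1..\<Delta> m. \<kappa> c j))) \<longlonglongrightarrow> share c \<eta>r" by simp
  show "(\<lambda>m. \<Sum>j=1..\<Delta> m. \<kappa> c j * y m ^ (j - 1)) \<longlonglongrightarrow> share c \<eta>r"
    by (rule tendsto_sandwich[OF _ _ l s])
       (rule always_eventually, rule allI, rule partial_share_bounds[OF y(1)])+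
qed

text \<open>
  Summing the limits over all degrees is allowed by uniform integrability.
\<close>

lemma total_share_lim:
  "(\<lambda>n. real (card {z\<in>B.HE n False. wt n False z = c}) / real (B.h n)) \<longlonglongrightarrow> share c 1"
proof (rule tendstoI)
  fix e :: real assume e: "e > 0"
  let ?h = "\<lambda>n. real (B.h n)"
  let ?p = "\<lambda>n j. real (card {z\<in>B.HE n False. wt n False z = c \<and> dg n False (fst z) = j})"
  obtain T1 where T1: "\<forall>\<^sub>F n in sequentially. (\<Sum>v\<in>{v\<in>{1..sz n False}. dg n False v > T1}. real (dg n False v)) \<le> (e / 3) * real (sz n False)"
    using degree_tail[of "e / 3" False] e by auto
  have "\<forall>\<^sub>F T in sequentially. (\<Sum>j=1..T. \<kappa> c j) > share c 1 - e / 3"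
    by (rule order_tendstoD[OF \<kappa>_partial_lim]) (use e in simp)
  then obtain T2 where T2: "\<And>T. T \<ge> T2 \<Longrightarrow> (\<Sum>j=1..T. \<kappa> c j) > share c 1 - e / 3" by (auto simp: eventually_sequentially)
  define T where "T = max T1 T2"
  have k1: "(\<Sum>j=1..T. \<kappa> c j) > share c 1 - e / 3" by (rule T2) (simp add: T_def)
  have k2: "(\<Sum>j=1..T. \<kappa> c j) \<le> share c 1" unfolding share_1 by (rule sum_le_suminf[OF summable_\<kappa>]) (auto simp: \<kappa>_nonneg)
  have "(\<lambda>n. \<Sum>j=1..T. ?p n j / ?h n) \<longlonglongrightarrow> (\<Sum>j=1..T. \<kappa> c j)" by (intro tendsto_sum \<kappa>_lim)
  from tendstoD[OF this, of "e / 3"] e have ev: "\<forall>\<^sub>F n in sequentially. \<bar>(\<Sum>j=1..T. ?p n j / ?h n) - (\<Sum>j=1..T. \<kappa> c j)\<bar> < e / 3"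
    by (simp add: dist_real_def)
  show "\<forall>\<^sub>F n in sequentially. dist (real (card {z\<in>B.HE n False. wt n False z = c}) / ?h n) (share c 1) < e"
    using T1 ev h_pos
  proof eventually_elim
    case (elim n)
    let ?A = "{z\<in>B.HE n False. wt n False z = c}"
    let ?S = "{z\<in>?A. dg n False (fst z) \<in> {1..T}}"
    let ?L = "{z\<in>B.HE n False. dg n False (fst z) > T}"
    have pos: "dg n False (fst z) \<ge> 1" if "z \<in> B.HE n False" for z
      by (rule dg_pos) (use that in \<open>auto simp: B.HE_def\<close>)
    have S: "real (card ?S) = (\<Sum>j=1..T. ?p n j)"
    proof -
      have "card ?S = (\<Sum>j\<in>{1..T}. card {z\<in>?S. dg n False (fst z) = j})" by (rule card_fibers) auto
      also have "\<dots> = (\<Sum>j\<in>{1..T}. card {z\<in>B.HE n False. wt n False z = c \<and> dg n False (fst z) = j})"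
        by (rule sum.cong[OF refl], rule arg_cong[of _ _ card]) auto
      finally show ?thesis by simp
    qed
    have lo: "card ?S \<le> card ?A" by (rule card_mono) auto
    have "?A \<subseteq> ?S \<union> ?L" using pos by (auto simp: not_le)
    then have "card ?A \<le> card (?S \<union> ?L)" by (rule card_mono[rotated]) auto
    also have "\<dots> \<le> card ?S + card ?L" by (rule card_Un_le)
    finally have up: "real (card ?A) \<le> real (card ?S) + real (card ?L)" by linarith
    have "real (card ?L) = (\<Sum>z\<in>B.HE n False. of_bool (dg n False (fst z) > T))"
      by (simp add: of_bool_def sum.If_cases Int_def)
    also have "\<dots> = (\<Sum>v=1..sz n False. real (dg n False v) * of_bool (dg n False v > T))" by (rule B.sum_HE)
    also have "\<dots> = (\<Sum>v\<in>{v\<in>{1..sz n False}. dg n False v > T}. real (dg n False v))"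
      by (intro sum.mono_neutral_cong_right) auto
    also have "\<dots> \<le> (\<Sum>v\<in>{v\<in>{1..sz n False}. dg n False v > T1}. real (dg n False v))"
      by (rule sum_mono2) (auto simp: T_def)
    also have "\<dots> \<le> (e / 3) * real (sz n False)" by (rule elim(1))
    also have "\<dots> \<le> (e / 3) * ?h n" by (rule mult_left_mono) (use sz_le_h[of n False] e in auto)
    finally have L: "real (card ?L) / ?h n \<le> e / 3" using elim(3) by (simp add: divide_le_eq)
    have "real (card ?A) / ?h n \<le> (real (card ?S) + real (card ?L)) / ?h n" by (rule divide_right_mono[OF up]) simp
    then have 1: "real (card ?A) / ?h n \<le> real (card ?S) / ?h n + e / 3" using L unfolding add_divide_distrib by linarith
    have 2: "real (card ?S) / ?h n \<le> real (card ?A) / ?h n" using lo by (intro divide_right_mono) auto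
    have 3: "real (card ?S) / ?h n = (\<Sum>j=1..T. ?p n j / ?h n)" unfolding S by (rule sum_divide_distrib)
    show ?case unfolding dist_real_def using 1 2 k1 k2 elim(2) unfolding 3 by linarith
  qed
qed

text \<open>
  The limit of \<open>half_edge_mass\<close> for the exploration without flags that stops at
  degrees above \<open>\<Delta>\<close> with the verdict \<open>b\<close>.
\<close>

definition half_edge_limit :: "nat \<Rightarrow> bool \<Rightarrow> nat \<Rightarrow> nat \<Rightarrow> real" where
  "half_edge_limit \<Delta> b r c = of_bool b * (share c 1 - (\<Sum>j=1..\<Delta>. \<kappa> c j)) +
     (\<Sum>j=1..\<Delta>. \<kappa> c j * die_limit (\<lambda>_. 1) \<Delta> b r False ^ (j - 1))"

lemma half_edge_mass_lim_died:
  "(\<lambda>n. B.half_edge_mass n (cls_of \<Delta> {} b (dg n)) (wt n) r True False c) \<longlonglongrightarrow> half_edge_limit \<Delta> b r c"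
proof -
  have "(\<lambda>n. (\<Sum>z\<in>{z\<in>B.HE n False. wt n False z = c}. B.stepval n (cls_of \<Delta> {} b (dg n)) r False z) / real (B.h n)) \<longlonglongrightarrow> half_edge_limit \<Delta> b r c"
    unfolding half_edge_limit_def
  proof (rule stepval_avg_lim[where F = "\<lambda>_. {}"])
    show "(\<lambda>n. real (card {z\<in>B.HE n False. wt n False z = c}) / real (B.h n)) \<longlonglongrightarrow> share c 1" by (rule total_share_lim)
    show "(\<lambda>n. real (card {z\<in>B.HE n False. wt n False z = c \<and> dg n False (fst z) = j \<and> \<not> (\<not> False \<and> fst z \<in> {})}) / real (B.h n)) \<longlonglongrightarrow> \<kappa> c j" for j
      using \<kappa>_lim[of c j] by simp
    show "(\<lambda>n. B.dieprob n (cls_of \<Delta> {} b (dg n)) r False) \<longlonglongrightarrow> die_limit (\<lambda>_. 1) \<Delta> b r False"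
      by (rule dieprob_lim[where F = "\<lambda>_. {}"]) (rule count_empty)
  qed
  moreover have "B.half_edge_mass n (cls_of \<Delta> {} b (dg n)) (wt n) r True False c =
     (\<Sum>z\<in>{z\<in>B.HE n False. wt n False z = c}. B.stepval n (cls_of \<Delta> {} b (dg n)) r False z) / real (B.h n)" for n
  proof -
    have "(\<Sum>z\<in>B.HE n False. of_bool (wt n False z = c) * B.stepval n (cls_of \<Delta> {} b (dg n)) r False z) =
      (\<Sum>z\<in>{z\<in>B.HE n False. wt n False z = c}. B.stepval n (cls_of \<Delta> {} b (dg n)) r False z)"
      by (intro sum.mono_neutral_cong_right) auto
    then show ?thesis by (simp only: B.half_edge_mass_def not_True_eq_False if_False)
  qed
  ultimately show ?thesis by simp
qed

lemma half_edge_mass_lim_all: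
  "(\<lambda>n. B.half_edge_mass n (cls n) (wt n) r True True c) \<longlonglongrightarrow> share c 1"
proof -
  have "B.half_edge_mass n cls (wt n) r True True c = real (card {z\<in>B.HE n False. wt n False z = c}) / real (B.h n)" for n cls
    by (simp add: B.half_edge_mass_def of_bool_def sum.If_cases Int_def)
  then show ?thesis using total_share_lim[of c] by simp
qed

lemma die_limit_alive_range: "0 \<le> die_limit (\<lambda>_. 1) \<Delta> True r s \<and> die_limit (\<lambda>_. 1) \<Delta> True r s \<le> 1"
proof (induct r arbitrary: s)
  case (Suc r)
  let ?x = "die_limit (\<lambda>_. 1) \<Delta> True r (\<not> s)"
  have "(\<Sum>j=1..\<Delta>. w (\<not> s) j * ?x ^ (j - 1)) \<le> (\<Sum>j=1..\<Delta>. w (\<not> s) j * 1)"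
    by (intro sum_mono mult_left_mono w_nonneg power_le_one) (use Suc[of "\<not> s"] in auto)
  moreover have "0 \<le> (\<Sum>j=1..\<Delta>. w (\<not> s) j * ?x ^ (j - 1))"
    by (intro sum_nonneg mult_nonneg_nonneg w_nonneg) (use Suc[of "\<not> s"] in auto)
  ultimately show ?case using sum_w_le_1[where s = "\<not> s" and \<Delta> = \<Delta>] by simp
qed simp

lemma half_edge_limit_nonneg: "0 \<le> half_edge_limit \<Delta> b r c"
proof -
  have "0 \<le> die_limit (\<lambda>_. 1) \<Delta> b r False" using die_limit_alive_range die_limit_died_bounds by (cases b) auto
  moreover have "(\<Sum>j=1..\<Delta>. \<kappa> c j) \<le> share c 1" unfolding share_1 by (rule sum_le_suminf[OF summable_\<kappa>]) (auto simp: \<kappa>_nonneg)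
  ultimately show ?thesis unfolding half_edge_limit_def
    by (intro add_nonneg_nonneg mult_nonneg_nonneg sum_nonneg \<kappa>_nonneg) auto
qed

lemma half_edge_limit_died_lim: "(\<lambda>r. half_edge_limit r False r c) \<longlonglongrightarrow> share c \<eta>r"
proof -
  have "die_limit (\<lambda>_. 1) m False m False \<in> {0..1}" for m
  proof -
    have "0 \<le> die_limit (\<lambda>_. 1) m False m False" "die_limit (\<lambda>_. 1) m False m False \<le> eta False" using die_limit_died_bounds by auto
    then show ?thesis using eta_range[of False] by auto
  qed
  then have "(\<lambda>r. \<Sum>j=1..r. \<kappa> c j * die_limit (\<lambda>_. 1) r False r False ^ (j - 1)) \<longlonglongrightarrow> share c \<eta>r"
    by (intro truncated_share_lim(1)) (use die_limit_died_lim[of False] in \<open>auto simp: eta_def filterlim_ident\<close>)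
  then show ?thesis by (simp add: half_edge_limit_def)
qed

text \<open>
  By \<open>die_limit_alive_bound\<close> with \<open>\<epsilon> = 0\<close>, along levels
  \<open>\<Delta>\<close> tending to infinity. One level serves all depths \<open>r\<close>, so
  that it can be fixed before \<open>K\<close>.
\<close>

lemma half_edge_limit_alive_bound:
  assumes e: "e > 0"
  shows "\<exists>\<Delta>. \<forall>r. conv k (half_edge_limit \<Delta> True r) d \<le> conv k (\<lambda>c. share c \<eta>r) d + e"
proof -
  have "\<exists>\<Delta>\<ge>m. \<forall>r. die_limit (\<lambda>_. 1) \<Delta> True r False \<le> \<eta>r + inverse (real (Suc m))" for m
  proof -
    have "inverse (real (Suc m)) > 0" by simp
    from die_limit_alive_bound[OF this, of m] obtain \<epsilon>0 \<Delta> where ed: "\<epsilon>0 > 0" "\<Delta> \<ge> m"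
      "\<forall>\<epsilon>. 0 \<le> \<epsilon> \<longrightarrow> \<epsilon> \<le> \<epsilon>0 \<longrightarrow> (\<forall>r. die_limit (\<lambda>s. if s then 1 else 1 - \<epsilon>) \<Delta> True r False \<le> \<eta>r + inverse (real (Suc m)))"
      by blast
    have "(\<lambda>s. if s then 1 else 1 - 0) = (\<lambda>_::bool. 1::real)" by (simp add: fun_eq_iff)
    then have "\<forall>r. die_limit (\<lambda>_. 1) \<Delta> True r False \<le> \<eta>r + inverse (real (Suc m))" using ed(3)[rule_format, of 0] ed(1) by simp
    then show ?thesis using ed(2) by blast
  qed
  then obtain \<Delta> where \<Delta>: "\<And>m. \<Delta> m \<ge> m" "\<And>m r. die_limit (\<lambda>_. 1) (\<Delta> m) True r False \<le> \<eta>r + inverse (real (Suc m))"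
    by metis
  define y where "y = (\<lambda>m. min 1 (\<eta>r + inverse (real (Suc m))))"
  have y: "y m \<in> {0..1}" for m using eta_r_range by (auto simp: y_def)
  have "(\<lambda>m. min 1 (\<eta>r + inverse (real (Suc m)))) \<longlonglongrightarrow> min 1 (\<eta>r + 0)"
    by (intro tendsto_min tendsto_const tendsto_add LIMSEQ_inverse_real_of_nat)
  then have yl: "y \<longlonglongrightarrow> \<eta>r" using eta_r_range by (simp add: y_def)
  have \<Delta>top: "filterlim \<Delta> at_top sequentially"
    by (rule filterlim_at_top_mono[OF filterlim_ident]) (use \<Delta>(1) in auto)
  define U where "U = (\<lambda>m c. (share c 1 - (\<Sum>j=1..\<Delta> m. \<kappa> c j)) + (\<Sum>j=1..\<Delta> m. \<kappa> c j * y m ^ (j - 1)))"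
  have Ul: "(\<lambda>m. U m c) \<longlonglongrightarrow> share c \<eta>r" for c
    using tendsto_add[OF truncated_share_lim(2)[OF y yl \<Delta>top, of c] truncated_share_lim(1)[OF y yl \<Delta>top, of c]]
    by (simp add: U_def)
  have "\<forall>\<^sub>F m in sequentially. conv k (U m) d < conv k (\<lambda>c. share c \<eta>r) d + e"
    by (rule order_tendstoD[OF conv_tendsto[OF Ul]]) (use e in simp)
  then obtain m where m: "conv k (U m) d < conv k (\<lambda>c. share c \<eta>r) d + e" by (auto simp: eventually_sequentially)
  have "conv k (half_edge_limit (\<Delta> m) True r) d \<le> conv k (U m) d" for r
  proof (rule conv_mono[OF half_edge_limit_nonneg])
    fix c
    have "die_limit (\<lambda>_. 1) (\<Delta> m) True r False \<le> y m" using \<Delta>(2) die_limit_alive_range by (simp add: y_def)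
    then show "half_edge_limit (\<Delta> m) True r c \<le> U m c" unfolding half_edge_limit_def U_def
      using die_limit_alive_range by (simp, intro sum_mono mult_left_mono power_mono \<kappa>_nonneg) auto
  qed
  then show ?thesis using m by (intro exI[of _ "\<Delta> m"]) (use less_imp_le order_trans in blast)
qed

definition label_sum :: "nat \<Rightarrow> (nat \<times> nat \<Rightarrow> nat \<times> nat) \<Rightarrow> nat \<Rightarrow> nat" where
  "label_sum n \<omega> v = (\<Sum>i=1..dg n True v. wt n False (B.partner n True \<omega> (v, i)))"

definition cell :: "nat \<Rightarrow> nat \<Rightarrow> nat \<Rightarrow> (nat \<times> nat \<Rightarrow> nat \<times> nat) \<Rightarrow> nat set" where
  "cell k d n \<omega> = {v\<in>{1..sz n True}. dg n True v = k \<and> label_sum n \<omega> v = d}"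

text \<open>
  The proportion of left vertices of degree \<open>k\<close> and label sum \<open>d\<close>,
  less the proportion of those from which everything dies.
\<close>

definition cell_limit :: "nat \<Rightarrow> nat \<Rightarrow> real" where
  "cell_limit k d = pmf (law True) k * (conv k (\<lambda>c. share c 1) d - conv k (\<lambda>c. share c \<eta>r) d)"

definition large :: "nat \<Rightarrow> nat \<Rightarrow> (nat \<times> nat \<Rightarrow> nat \<times> nat) \<Rightarrow> bool \<times> nat \<Rightarrow> bool" where
  "large K n \<omega> a \<longleftrightarrow> card (B.component n {} \<omega> a) > K"

lemma run_label_sum: "v \<in> {1..sz n True} \<Longrightarrow> fst (B.run n \<omega> (B.explore_root n cls (wt n) r True v)) = label_sum n \<omega> v"
  using B.run_root_weight[of v n True \<omega> cls "wt n" r] by (simp add: label_sum_def)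

text \<open>
  The law of large numbers for the cell itself, for the vertices of the cell whose exploration
  dies, and for those whose run is not fresh.
\<close>

lemma cell_lln:
  assumes e: "e > 0"
  shows "whp (\<lambda>n \<omega>. \<bar>real (card (cell k d n \<omega>)) - pmf (law True) k * conv k (\<lambda>c. share c 1) d * real (sz n True)\<bar> \<le> e * real (sz n True))"
    and "whp (\<lambda>n \<omega>. \<bar>real (card {v\<in>cell k d n \<omega>. snd (B.run n \<omega> (B.explore_root n (cls_of \<Delta> {} b (dg n)) (wt n) r True v))})
        - pmf (law True) k * conv k (half_edge_limit \<Delta> b r) d * real (sz n True)\<bar> \<le> e * real (sz n True))"
    and "whp (\<lambda>n \<omega>. real (card {v\<in>cell k d n \<omega>. \<not> B.fresh n \<omega> (B.explore_root n (cls_of \<Delta> {} b (dg n)) (wt n) r True v) {(True, v)}}) \<le> e * real (sz n True))"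
proof -
  let ?V = "\<lambda>n. {v\<in>{1..sz n True}. dg n True v = k}"
  have eq: "{v\<in>?V n. fst (B.run n \<omega> (B.explore_root n cls (wt n) r True v)) = d \<and> P v} = {v\<in>cell k d n \<omega>. P v}" for n \<omega> cls P
    by (auto simp: cell_def run_label_sum)
  have "whp (\<lambda>n \<omega>. \<bar>real (card {v\<in>?V n. fst (B.run n \<omega> (B.explore_root n (cls_of \<Delta> {} b (dg n)) (wt n) r True v)) = d \<and>
      (snd (B.run n \<omega> (B.explore_root n (cls_of \<Delta> {} b (dg n)) (wt n) r True v)) \<or> True)}) - pmf (law True) k * conv k (\<lambda>c. share c 1) d * real (sz n True)\<bar> \<le> e * real (sz n True))"
  proof (rule lln[where V = ?V and s = True and k = k and cls = "\<lambda>n. cls_of \<Delta> {} b (dg n)" and \<Delta> = \<Delta> and wt = wt and t = True])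
    show "(\<lambda>n. real (card (?V n)) / real (sz n True)) \<longlonglongrightarrow> pmf (law True) k" by (rule count_lim)
    show "(\<lambda>n. conv k (B.half_edge_mass n (cls_of \<Delta> {} b (dg n)) (wt n) r True True) d) \<longlonglongrightarrow> conv k (\<lambda>c. share c 1) d"
      by (rule conv_tendsto) (rule half_edge_mass_lim_all)
  qed (auto simp: cls_of_None e)
  then show "whp (\<lambda>n \<omega>. \<bar>real (card (cell k d n \<omega>)) - pmf (law True) k * conv k (\<lambda>c. share c 1) d * real (sz n True)\<bar> \<le> e * real (sz n True))"
    unfolding eq by simp
  have "whp (\<lambda>n \<omega>. \<bar>real (card {v\<in>?V n. fst (B.run n \<omega> (B.explore_root n (cls_of \<Delta> {} b (dg n)) (wt n) r True v)) = d \<and>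
      (snd (B.run n \<omega> (B.explore_root n (cls_of \<Delta> {} b (dg n)) (wt n) r True v)) \<or> False)}) - pmf (law True) k * conv k (half_edge_limit \<Delta> b r) d * real (sz n True)\<bar> \<le> e * real (sz n True))"
  proof (rule lln[where V = ?V and s = True and k = k and cls = "\<lambda>n. cls_of \<Delta> {} b (dg n)" and \<Delta> = \<Delta> and wt = wt and t = False])
    show "(\<lambda>n. real (card (?V n)) / real (sz n True)) \<longlonglongrightarrow> pmf (law True) k" by (rule count_lim)
    show "(\<lambda>n. conv k (B.half_edge_mass n (cls_of \<Delta> {} b (dg n)) (wt n) r True False) d) \<longlonglongrightarrow> conv k (half_edge_limit \<Delta> b r) d"
      by (rule conv_tendsto) (rule half_edge_mass_lim_died)
  qed (auto simp: cls_of_None e)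
  then show "whp (\<lambda>n \<omega>. \<bar>real (card {v\<in>cell k d n \<omega>. snd (B.run n \<omega> (B.explore_root n (cls_of \<Delta> {} b (dg n)) (wt n) r True v))})
        - pmf (law True) k * conv k (half_edge_limit \<Delta> b r) d * real (sz n True)\<bar> \<le> e * real (sz n True))"
    unfolding eq by simp
  have "whp (\<lambda>n \<omega>. real (card {v\<in>?V n. \<not> B.fresh n \<omega> (B.explore_root n (cls_of \<Delta> {} b (dg n)) (wt n) r True v) {(True, v)}}) \<le> e * real (sz n True))"
    by (rule few_nonfresh[where V = ?V and s = True and k = k and cls = "\<lambda>n. cls_of \<Delta> {} b (dg n)" and \<Delta> = \<Delta> and wt = wt, OF _ _ e]) (auto simp: cls_of_None)
  then show "whp (\<lambda>n \<omega>. real (card {v\<in>cell k d n \<omega>. \<not> B.fresh n \<omega> (B.explore_root n (cls_of \<Delta> {} b (dg n)) (wt n) r True v) {(True, v)}}) \<le> e * real (sz n True))"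
  proof (rule whp_mono, intro always_eventually allI ballI impI)
    fix n \<omega>
    assume h: "real (card {v\<in>?V n. \<not> B.fresh n \<omega> (B.explore_root n (cls_of \<Delta> {} b (dg n)) (wt n) r True v) {(True, v)}}) \<le> e * real (sz n True)"
    have "card {v\<in>cell k d n \<omega>. \<not> B.fresh n \<omega> (B.explore_root n (cls_of \<Delta> {} b (dg n)) (wt n) r True v) {(True, v)}} \<le>
       card {v\<in>?V n. \<not> B.fresh n \<omega> (B.explore_root n (cls_of \<Delta> {} b (dg n)) (wt n) r True v) {(True, v)}}"
      by (rule card_mono) (auto simp: cell_def)
    then show "real (card {v\<in>cell k d n \<omega>. \<not> B.fresh n \<omega> (B.explore_root n (cls_of \<Delta> {} b (dg n)) (wt n) r True v) {(True, v)}}) \<le> e * real (sz n True)"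
      using h by linarith
  qed
qed

lemma finite_cell [simp]: "finite (cell k d n \<omega>)" by (simp add: cell_def)

lemma card_filter_split: "finite A \<Longrightarrow> real (card A) = real (card {v\<in>A. P v}) + real (card {v\<in>A. \<not> P v})"
proof -
  assume f: "finite A"
  have "A = {v\<in>A. P v} \<union> {v\<in>A. \<not> P v}" by auto
  then have "card A = card ({v\<in>A. P v} \<union> {v\<in>A. \<not> P v})" by (rule arg_cong)
  also have "\<dots> = card {v\<in>A. P v} + card {v\<in>A. \<not> P v}" by (rule card_Un_disjoint) (use f in auto)
  finally show ?thesis by simp
qed

text \<open>
  Large degrees count as surviving: a vertex whose exploration dies has a component of bounded
  size.
\<close>

lemma cell_large_upper:
  assumes \<delta>: "\<delta> > 0"
  shows "\<exists>K0. \<forall>K\<ge>K0. whp (\<lambda>n \<omega>. real (card {v\<in>cell k d n \<omega>. large K n \<omega> (True, v)}) \<le> (cell_limit k d + \<delta>) * real (sz n True))"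
proof -
  let ?p = "pmf (law True) k"
  have "(\<lambda>r. ?p * conv k (half_edge_limit r False r) d) \<longlonglongrightarrow> ?p * conv k (\<lambda>c. share c \<eta>r) d"
    by (intro tendsto_mult tendsto_const conv_tendsto half_edge_limit_died_lim)
  then have "\<forall>\<^sub>F r in sequentially. ?p * conv k (half_edge_limit r False r) d > ?p * conv k (\<lambda>c. share c \<eta>r) d - \<delta> / 3"
    by (rule order_tendstoD) (use \<delta> in simp)
  then obtain r where r: "?p * conv k (half_edge_limit r False r) d > ?p * conv k (\<lambda>c. share c \<eta>r) d - \<delta> / 3"
    by (auto simp: eventually_sequentially)
  define K0 where "K0 = 1 + k * explored_size r (Suc r)"
  have d3: "\<delta> / 3 > 0" using \<delta> by simp
  have "whp (\<lambda>n \<omega>. real (card {v\<in>cell k d n \<omega>. large K n \<omega> (True, v)}) \<le> (cell_limit k d + \<delta>) * real (sz n True))" if K: "K \<ge> K0" for K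
  proof (rule whp_mono[OF whp_conj[OF cell_lln(1)[OF d3] cell_lln(2)[OF d3, where \<Delta> = r and b = False and r = r]]],
      intro always_eventually allI ballI impI)
    fix n \<omega>
    let ?N = "real (sz n True)"
    let ?D = "\<lambda>v. snd (B.run n \<omega> (B.explore_root n (cls_of r {} False (dg n)) (wt n) r True v))"
    assume w: "\<omega> \<in> B.MM n" and h: "\<bar>real (card (cell k d n \<omega>)) - ?p * conv k (\<lambda>c. share c 1) d * ?N\<bar> \<le> \<delta> / 3 * ?N \<and>
       \<bar>real (card {v\<in>cell k d n \<omega>. ?D v}) - ?p * conv k (half_edge_limit r False r) d * ?N\<bar> \<le> \<delta> / 3 * ?N"
    have "card {v\<in>cell k d n \<omega>. large K n \<omega> (True, v)} \<le> card {v\<in>cell k d n \<omega>. \<not> ?D v}"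
    proof (rule card_mono)
      show "{v\<in>cell k d n \<omega>. large K n \<omega> (True, v)} \<subseteq> {v\<in>cell k d n \<omega>. \<not> ?D v}"
      proof
        fix v assume v: "v \<in> {v\<in>cell k d n \<omega>. large K n \<omega> (True, v)}"
        then have v1: "v \<in> {1..sz n True}" "dg n True v = k" by (auto simp: cell_def)
        have "\<not> ?D v"
        proof
          assume D: "?D v"
          have "card (B.component n {} \<omega> (True, v)) \<le> K"
            by (rule died_large_complement[OF w v1(1) D]) (use v1(2) K K0_def in simp)
          then show False using v by (simp add: large_def)
        qed
        then show "v \<in> {v\<in>cell k d n \<omega>. \<not> ?D v}" using v by simp
      qed
    qed simp
    then have "real (card {v\<in>cell k d n \<omega>. large K n \<omega> (True, v)}) \<le> real (card (cell k d n \<omega>)) - real (card {v\<in>cell k d n \<omega>. ?D v})"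
      using card_filter_split[of "cell k d n \<omega>" ?D] by simp
    also have "\<dots> \<le> ?p * conv k (\<lambda>c. share c 1) d * ?N - ?p * conv k (half_edge_limit r False r) d * ?N + 2 * (\<delta> / 3 * ?N)"
      using h by linarith
    also have "\<dots> \<le> ?p * conv k (\<lambda>c. share c 1) d * ?N - (?p * conv k (\<lambda>c. share c \<eta>r) d - \<delta> / 3) * ?N + 2 * (\<delta> / 3 * ?N)"
    proof -
      have "(?p * conv k (\<lambda>c. share c \<eta>r) d - \<delta> / 3) * ?N \<le> ?p * conv k (half_edge_limit r False r) d * ?N"
        using r by (intro mult_right_mono) auto
      then show ?thesis by linarith
    qed
    finally show "real (card {v\<in>cell k d n \<omega>. large K n \<omega> (True, v)}) \<le> (cell_limit k d + \<delta>) * ?N"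
      by (simp add: cell_limit_def algebra_simps)
  qed
  then show ?thesis by blast
qed

lemma component_neighbour:
  assumes w: "\<omega> \<in> B.MM n" and z: "z \<in> B.HE n s"
  shows "B.component n {} \<omega> (\<not> s, fst (B.partner n s \<omega> z)) = B.component n {} \<omega> (s, fst z)"
proof -
  have "((s, fst z), (\<not> s, fst (B.partner n s \<omega> z))) \<in> B.adj n {} \<omega>"
    by (rule B.adjI[OF z]) (simp_all add: B.blocked_def)
  then have "(\<not> s, fst (B.partner n s \<omega> z)) \<in> B.component n {} \<omega> (s, fst z)"
    unfolding B.component_def by (intro ImageI[OF r_into_rtrancl]) simp_all
  then show ?thesis by (rule B.component_eq[OF w])
qed

text \<open>
  Large degrees count as dying: a vertex whose exploration survives for \<open>K\<close>
  generations, in a fresh run, has a component with more than \<open>K\<close> vertices.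
\<close>

lemma cell_large_lower:
  assumes \<delta>: "\<delta> > 0"
  shows "whp (\<lambda>n \<omega>. real (card {v\<in>cell k d n \<omega>. large K n \<omega> (True, v)}) \<ge> (cell_limit k d - \<delta>) * real (sz n True))"
proof -
  let ?p = "pmf (law True) k"
  have d4: "\<delta> / 4 > 0" using \<delta> by simp
  obtain \<Delta> where \<Delta>: "\<And>r. conv k (half_edge_limit \<Delta> True r) d \<le> conv k (\<lambda>c. share c \<eta>r) d + \<delta> / 4"
    using half_edge_limit_alive_bound[OF d4] by blast
  show ?thesis
  proof (rule whp_mono[OF whp_conj[OF whp_conj[OF cell_lln(1)[OF d4] cell_lln(2)[OF d4, where \<Delta> = \<Delta> and b = True and r = K]]
       cell_lln(3)[OF d4, where \<Delta> = \<Delta> and b = True and r = K]]], intro always_eventually allI ballI impI)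
    fix n \<omega>
    let ?N = "real (sz n True)"
    let ?explore_root = "\<lambda>v. B.explore_root n (cls_of \<Delta> {} True (dg n)) (wt n) K True v"
    let ?D = "\<lambda>v. snd (B.run n \<omega> (?explore_root v))"
    let ?f = "\<lambda>v. B.fresh n \<omega> (?explore_root v) {(True, v)}"
    assume w: "\<omega> \<in> B.MM n" and h: "(\<bar>real (card (cell k d n \<omega>)) - ?p * conv k (\<lambda>c. share c 1) d * ?N\<bar> \<le> \<delta> / 4 * ?N \<and>
       \<bar>real (card {v\<in>cell k d n \<omega>. ?D v}) - ?p * conv k (half_edge_limit \<Delta> True K) d * ?N\<bar> \<le> \<delta> / 4 * ?N) \<and>
       real (card {v\<in>cell k d n \<omega>. \<not> ?f v}) \<le> \<delta> / 4 * ?N"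
    have sub: "{v\<in>cell k d n \<omega>. \<not> ?D v} \<subseteq> {v\<in>cell k d n \<omega>. large K n \<omega> (True, v)} \<union> {v\<in>cell k d n \<omega>. \<not> ?f v}"
    proof
      fix v assume v: "v \<in> {v\<in>cell k d n \<omega>. \<not> ?D v}"
      then have v1: "v \<in> {1..sz n True}" and nd: "\<not> ?D v" by (auto simp: cell_def)
      have "large K n \<omega> (True, v)" if f: "?f v"
      proof -
        from alive_attached[OF w v1 nd f] obtain z where z: "z \<in> B.HE n True" "fst z = v"
          "card (B.component n {} \<omega> (\<not> True, fst (B.partner n True \<omega> z))) \<ge> Suc K" by blast
        then show ?thesis using component_neighbour[OF w z(1)] by (simp add: large_def)
      qed
      then show "v \<in> {v\<in>cell k d n \<omega>. large K n \<omega> (True, v)} \<union> {v\<in>cell k d n \<omega>. \<not> ?f v}" using v by auto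
    qed
    have "card {v\<in>cell k d n \<omega>. \<not> ?D v} \<le> card ({v\<in>cell k d n \<omega>. large K n \<omega> (True, v)} \<union> {v\<in>cell k d n \<omega>. \<not> ?f v})"
      by (rule card_mono[OF _ sub]) simp
    also have "\<dots> \<le> card {v\<in>cell k d n \<omega>. large K n \<omega> (True, v)} + card {v\<in>cell k d n \<omega>. \<not> ?f v}" by (rule card_Un_le)
    finally have 1: "real (card (cell k d n \<omega>)) - real (card {v\<in>cell k d n \<omega>. ?D v}) \<le>
       real (card {v\<in>cell k d n \<omega>. large K n \<omega> (True, v)}) + \<delta> / 4 * ?N"
      using h card_filter_split[of "cell k d n \<omega>" ?D] by simp
    have "?p * conv k (half_edge_limit \<Delta> True K) d \<le> ?p * (conv k (\<lambda>c. share c \<eta>r) d + \<delta> / 4)"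
      by (rule mult_left_mono[OF \<Delta>]) simp
    also have "\<dots> \<le> ?p * conv k (\<lambda>c. share c \<eta>r) d + \<delta> / 4"
      using pmf_le_1[of "law True" k] \<delta> by (simp add: algebra_simps mult_left_le)
    finally have "?p * conv k (half_edge_limit \<Delta> True K) d * ?N \<le> (?p * conv k (\<lambda>c. share c \<eta>r) d + \<delta> / 4) * ?N"
      by (rule mult_right_mono) simp
    then have 2: "?p * conv k (half_edge_limit \<Delta> True K) d * ?N \<le> ?p * conv k (\<lambda>c. share c \<eta>r) d * ?N + \<delta> / 4 * ?N"
      by (simp only: distrib_right)
    have 3: "(cell_limit k d - \<delta>) * ?N = ?p * conv k (\<lambda>c. share c 1) d * ?N - ?p * conv k (\<lambda>c. share c \<eta>r) d * ?N - 4 * (\<delta> / 4 * ?N)"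
      by (simp add: cell_limit_def algebra_simps)
    have h1: "\<bar>real (card (cell k d n \<omega>)) - ?p * conv k (\<lambda>c. share c 1) d * ?N\<bar> \<le> \<delta> / 4 * ?N"
      and h2: "\<bar>real (card {v\<in>cell k d n \<omega>. ?D v}) - ?p * conv k (half_edge_limit \<Delta> True K) d * ?N\<bar> \<le> \<delta> / 4 * ?N"
      using h by blast+
    show "real (card {v\<in>cell k d n \<omega>. large K n \<omega> (True, v)}) \<ge> (cell_limit k d - \<delta>) * ?N"
      unfolding 3 using 1 2 h1 h2 by linarith
  qed
qed


definition left_part :: "nat \<Rightarrow> (nat \<times> nat \<Rightarrow> nat \<times> nat) \<Rightarrow> nat \<Rightarrow> nat set" where
  "left_part n \<omega> v = {u. (True, u) \<in> B.component n {} \<omega> (True, v)}"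

lemma left_part_eq:
  assumes w: "\<omega> \<in> B.MM n" and v: "v \<in> {1..sz n True}"
  shows "left_part n \<omega> v = {u\<in>{1..sz n True}. B.component n {} \<omega> (True, u) = B.component n {} \<omega> (True, v)}"
proof
  show "left_part n \<omega> v \<subseteq> {u\<in>{1..sz n True}. B.component n {} \<omega> (True, u) = B.component n {} \<omega> (True, v)}"
  proof
    fix u assume "u \<in> left_part n \<omega> v"
    then have u: "(True, u) \<in> B.component n {} \<omega> (True, v)" by (simp add: left_part_def)
    have "(True, u) \<in> B.vertex_set n"
      using B.component_vertex_set[OF w, of "(True, v)" "{}"] u v by (auto simp: B.vertex_set_def)
    then show "u \<in> {u\<in>{1..sz n True}. B.component n {} \<omega> (True, u) = B.component n {} \<omega> (True, v)}"
      using B.component_eq[OF w u] by (simp add: B.vertex_set_def)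
  qed
  show "{u\<in>{1..sz n True}. B.component n {} \<omega> (True, u) = B.component n {} \<omega> (True, v)} \<subseteq> left_part n \<omega> v"
  proof
    fix u assume u: "u \<in> {u\<in>{1..sz n True}. B.component n {} \<omega> (True, u) = B.component n {} \<omega> (True, v)}"
    have "(True, u) \<in> B.component n {} \<omega> (True, u)" by (rule B.component_self)
    then show "u \<in> left_part n \<omega> v" using u by (simp add: left_part_def)
  qed
qed

text \<open>
  Upper bound: a largest component is either large, so that its part of the cell is bounded by
  \<open>cell_large_upper\<close>, or negligible. Lower bound, if the limit is positive: all but
  few large left vertices lie in the giant, so the giant has a left part that is not negligible;
  a different component with at least as many left vertices would be large and outside the
  giant. Hence the largest component is the giant.
\<close>

lemma largest_cell_count:
  assumes \<delta>: "\<delta> > 0"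
  shows "whp (\<lambda>n \<omega>. \<forall>v0\<in>{1..sz n True}. (\<forall>v\<in>{1..sz n True}. card (left_part n \<omega> v) \<le> card (left_part n \<omega> v0)) \<longrightarrow>
     \<bar>real (card (left_part n \<omega> v0 \<inter> cell k d n \<omega>)) - cell_limit k d * real (sz n True)\<bar> \<le> \<delta> * real (sz n True))"
proof -
  define e where "e = \<delta> / 4"
  have e: "e > 0" using \<delta> by (simp add: e_def)
  define m where "m = mean (law True)"
  have m1: "m \<ge> 1" unfolding m_def by (rule mean_ge_1)
  have e': "e / (2 * m) > 0" using e m1 by simp
  obtain \<theta> where \<theta>: "\<theta> > 0" and UI: "\<forall>\<^sub>F n in sequentially. \<forall>A. A \<subseteq> {1..sz n False} \<longrightarrow> real (card A) \<le> \<theta> * real (sz n False) \<longrightarrow>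
     (\<Sum>v\<in>A. real (dg n False v)) \<le> e / (2 * m) * real (sz n False)"
    using uniform_integrability[OF e', of False] by blast
  define \<gamma> where "\<gamma> = min (\<theta> / 2) (\<rho> / 2)"
  have \<gamma>: "\<gamma> > 0" "2 * \<gamma> \<le> \<theta>" "\<gamma> < \<rho>" using \<theta> \<rho>_pos by (auto simp: \<gamma>_def)
  obtain K1 where K1: "\<And>K. K \<ge> K1 \<Longrightarrow> whp (\<lambda>n \<omega>. real (card {v\<in>cell k d n \<omega>. large K n \<omega> (True, v)}) \<le> (cell_limit k d + e) * real (sz n True))"
    using cell_large_upper[OF e] by blast
  obtain K2 where K2: "\<And>K. K \<ge> K2 \<Longrightarrow> whp (\<lambda>n \<omega>. real (card {v\<in>{1..sz n False}. card (B.component n {} \<omega> (False, v)) > K}) \<le> (\<rho> + \<gamma>) * real (sz n False))"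
    using right_large_upper[OF \<gamma>(1)] by blast
  define K where "K = max K1 K2"
  have hm: "\<forall>\<^sub>F n in sequentially. real (B.h n) / real (sz n True) < 2 * m"
    by (rule order_tendstoD(2)[OF h_over_sz]) (use m1 in \<open>simp add: m_def\<close>)
  have ev1: "\<forall>\<^sub>F n in sequentially. real K / e \<le> real (sz n True)"
    using sz_real_lim[of True] unfolding filterlim_at_top by blast
  have ev2: "\<forall>\<^sub>F n in sequentially. (real K + 1) / (\<rho> - \<gamma>) \<le> real (sz n False)"
    using sz_real_lim[of False] unfolding filterlim_at_top by blast
  have U: "whp (\<lambda>n \<omega>. real (card {v\<in>cell k d n \<omega>. large K n \<omega> (True, v)}) \<le> (cell_limit k d + e) * real (sz n True))"
    by (rule K1) (simp add: K_def)
  have R: "whp (\<lambda>n \<omega>. real (card {v\<in>{1..sz n False}. large K n \<omega> (False, v)}) \<le> (\<rho> + \<gamma>) * real (sz n False))"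
    unfolding large_def by (rule K2) (simp add: K_def)
  show ?thesis
  proof (rule whp_mono[OF whp_conj[OF whp_conj[OF U cell_large_lower[OF e, of k d K]] whp_conj[OF R giant[OF \<gamma>(1)]]]],
      use UI hm ev1 ev2 sz_pos[of True] in eventually_elim, intro ballI impI)
    fix n \<omega> v0
    let ?NT = "real (sz n True)" and ?NF = "real (sz n False)"
    let ?c = "\<lambda>a. B.component n {} \<omega> a"
    assume ui: "\<forall>A. A \<subseteq> {1..sz n False} \<longrightarrow> real (card A) \<le> \<theta> * ?NF \<longrightarrow> (\<Sum>v\<in>A. real (dg n False v)) \<le> e / (2 * m) * ?NF"
      and hm: "real (B.h n) / ?NT < 2 * m" and n1: "real K / e \<le> ?NT" and n2: "(real K + 1) / (\<rho> - \<gamma>) \<le> ?NF"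
      and NT: "0 < sz n True" and w: "\<omega> \<in> B.MM n"
      and H: "(real (card {v\<in>cell k d n \<omega>. large K n \<omega> (True, v)}) \<le> (cell_limit k d + e) * ?NT \<and>
         (cell_limit k d - e) * ?NT \<le> real (card {v\<in>cell k d n \<omega>. large K n \<omega> (True, v)})) \<and>
         (real (card {v\<in>{1..sz n False}. large K n \<omega> (False, v)}) \<le> (\<rho> + \<gamma>) * ?NF \<and>
         (\<exists>c. (\<rho> - \<gamma>) * ?NF \<le> real (card {b\<in>{1..sz n False}. ?c (False, b) = c})))"
      and v0: "v0 \<in> {1..sz n True}" and max: "\<forall>v\<in>{1..sz n True}. card (left_part n \<omega> v) \<le> card (left_part n \<omega> v0)"
    have U: "real (card {v\<in>cell k d n \<omega>. large K n \<omega> (True, v)}) \<le> (cell_limit k d + e) * ?NT"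
      and L: "(cell_limit k d - e) * ?NT \<le> real (card {v\<in>cell k d n \<omega>. large K n \<omega> (True, v)})"
      and R: "real (card {v\<in>{1..sz n False}. large K n \<omega> (False, v)}) \<le> (\<rho> + \<gamma>) * ?NF" using H by blast+
    obtain c where c: "(\<rho> - \<gamma>) * ?NF \<le> real (card {b\<in>{1..sz n False}. ?c (False, b) = c})" using H by blast
    have KN: "real K \<le> e * ?NT" using n1 e by (simp add: divide_le_eq mult.commute)
    have KF: "real K + 1 \<le> (\<rho> - \<gamma>) * ?NF" using n2 \<gamma> by (simp add: divide_le_eq mult.commute)
    let ?G = "{b\<in>{1..sz n False}. ?c (False, b) = c}"
    have cG: "card ?G > K" using c KF by linarith
    have G_large: "?G \<subseteq> {v\<in>{1..sz n False}. large K n \<omega> (False, v)}"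
    proof
      fix b assume b: "b \<in> ?G"
      have "Pair False ` ?G \<subseteq> ?c (False, b)"
      proof (rule image_subsetI)
        fix b' assume "b' \<in> ?G"
        then have "?c (False, b') = ?c (False, b)" using b by simp
        then show "(False, b') \<in> ?c (False, b)" using B.component_self[of "(False, b')" n "{}" \<omega>] by simp
      qed
      moreover have "finite (?c (False, b))" by (rule B.finite_component[OF w]) (use b in \<open>auto simp: B.vertex_set_def\<close>)
      ultimately have "card (Pair False ` ?G) \<le> card (?c (False, b))" by (rule card_mono[rotated])
      moreover have "card (Pair False ` ?G) = card ?G" by (rule card_image) (auto simp: inj_on_def)
      ultimately show "b \<in> {v\<in>{1..sz n False}. large K n \<omega> (False, v)}" using b cG by (simp add: large_def)
    qed
    let ?A = "{v\<in>{1..sz n False}. large K n \<omega> (False, v)} - ?G"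
    have "card ?A = card {v\<in>{1..sz n False}. large K n \<omega> (False, v)} - card ?G"
      by (rule card_Diff_subset[OF _ G_large]) simp
    moreover have "card ?G \<le> card {v\<in>{1..sz n False}. large K n \<omega> (False, v)}" by (rule card_mono[OF _ G_large]) simp
    ultimately have "real (card ?A) = real (card {v\<in>{1..sz n False}. large K n \<omega> (False, v)}) - real (card ?G)" by simp
    then have "real (card ?A) \<le> (\<rho> + \<gamma>) * ?NF - (\<rho> - \<gamma>) * ?NF" using R c by linarith
    also have "\<dots> = 2 * \<gamma> * ?NF" by (simp add: algebra_simps)
    also have "\<dots> \<le> \<theta> * ?NF" by (rule mult_right_mono[OF \<gamma>(2)]) simp
    finally have A1: "real (card ?A) \<le> \<theta> * ?NF" .
    have "(\<Sum>v\<in>?A. real (dg n False v)) \<le> e / (2 * m) * ?NF" by (rule ui[rule_format, OF _ A1]) blast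
    also have "\<dots> \<le> e / (2 * m) * (2 * m * ?NT)"
    proof (rule mult_left_mono)
      have "?NF \<le> real (B.h n)" using sz_le_h[of n False] by simp
      also have "\<dots> \<le> 2 * m * ?NT" using hm NT by (simp add: divide_less_eq)
      finally show "?NF \<le> 2 * m * ?NT" .
    qed (use e' in simp)
    also have "\<dots> = e * ?NT" using m1 by simp
    finally have A2: "(\<Sum>v\<in>?A. real (dg n False v)) \<le> e * ?NT" .
    (* Each left vertex has a half-edge, and its partner lies in the same component. So the large left
       vertices outside the giant are at most as many as the half-edges of the right vertices in ?A. *)
    let ?D = "{v\<in>{1..sz n True}. large K n \<omega> (True, v) \<and> ?c (True, v) \<noteq> c}"
    let ?H = "{z\<in>B.HE n False. fst z \<in> ?A}"
    have "card ?D \<le> card ?H"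
    proof (rule card_inj_on_le[of "\<lambda>v. B.partner n True \<omega> (v, 1)"])
      have h1: "(v, 1) \<in> B.HE n True" if "v \<in> {1..sz n True}" for v
        using dg_pos[OF that] that by (auto simp: B.HE_def)
      show "inj_on (\<lambda>v. B.partner n True \<omega> (v, 1)) ?D"
      proof (rule inj_onI)
        fix v v' assume v: "v \<in> ?D" "v' \<in> ?D" "B.partner n True \<omega> (v, 1) = B.partner n True \<omega> (v', 1)"
        have "(v, 1::nat) = B.partner n (\<not> True) \<omega> (B.partner n True \<omega> (v, 1))"
          by (rule B.partner_partner[OF w h1, symmetric]) (use v in simp)
        also have "\<dots> = B.partner n (\<not> True) \<omega> (B.partner n True \<omega> (v', 1))" by (simp only: v(3))
        also have "\<dots> = (v', 1)" by (rule B.partner_partner[OF w h1]) (use v in simp)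
        finally show "v = v'" by simp
      qed
      show "(\<lambda>v. B.partner n True \<omega> (v, 1)) ` ?D \<subseteq> ?H"
      proof (rule image_subsetI)
        fix v assume v: "v \<in> ?D"
        have z: "(v, 1) \<in> B.HE n True" by (rule h1) (use v in simp)
        have p: "B.partner n True \<omega> (v, 1) \<in> B.HE n False" using B.partner_in[OF w z] by simp
        have ce: "?c (False, fst (B.partner n True \<omega> (v, 1))) = ?c (True, v)"
          using component_neighbour[OF w z] by simp
        have "fst (B.partner n True \<omega> (v, 1)) \<in> {1..sz n False}" using p by (auto simp: B.HE_def)
        then show "B.partner n True \<omega> (v, 1) \<in> ?H" using p v ce by (simp add: large_def)
      qed
    qed simp
    moreover have "real (card ?H) = (\<Sum>v\<in>?A. real (dg n False v))"
    proof -
      have "real (card ?H) = (\<Sum>z\<in>B.HE n False. of_bool (fst z \<in> ?A))"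
        by (simp add: of_bool_def sum.If_cases Int_def)
      also have "\<dots> = (\<Sum>v=1..sz n False. real (dg n False v) * of_bool (v \<in> ?A))" by (rule B.sum_HE)
      also have "\<dots> = (\<Sum>v\<in>?A. real (dg n False v))" by (intro sum.mono_neutral_cong_right) auto
      finally show ?thesis .
    qed
    ultimately have D: "real (card ?D) \<le> e * ?NT" using A2 by linarith
    let ?C = "left_part n \<omega> v0"
    have C: "?C = {u\<in>{1..sz n True}. ?c (True, u) = ?c (True, v0)}" by (rule left_part_eq[OF w v0])
    have fC: "finite ?C" unfolding C by simp
    have Csmall: "real (card ?C) \<le> e * ?NT" if nl: "\<not> large K n \<omega> (True, v0)"
    proof -
      have "card ?C = card (Pair True ` ?C)" by (rule card_image[symmetric]) (auto simp: inj_on_def)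
      also have "\<dots> \<le> card (?c (True, v0))"
        by (rule card_mono[OF B.finite_component[OF w]]) (use v0 in \<open>auto simp: B.vertex_set_def left_part_def\<close>)
      also have "\<dots> \<le> K" using nl by (simp add: large_def)
      finally show ?thesis using KN by linarith
    qed
    have Clarge: "?C \<inter> cell k d n \<omega> \<subseteq> {v\<in>cell k d n \<omega>. large K n \<omega> (True, v)}" if l: "large K n \<omega> (True, v0)"
      using l unfolding C large_def by auto
    have AA0: "(cell_limit k d + e) * ?NT \<ge> 0" using U of_nat_0_le_iff order_trans by blast
    have upper: "real (card (?C \<inter> cell k d n \<omega>)) \<le> (cell_limit k d + e) * ?NT + e * ?NT"
    proof (cases "large K n \<omega> (True, v0)")
      case True
      have "card (?C \<inter> cell k d n \<omega>) \<le> card {v\<in>cell k d n \<omega>. large K n \<omega> (True, v)}"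
        by (rule card_mono[OF _ Clarge[OF True]]) simp
      then show ?thesis using U e by (simp add: add_increasing2)
    next
      case False
      have "card (?C \<inter> cell k d n \<omega>) \<le> card ?C" by (rule card_mono[OF fC]) auto
      then show ?thesis using Csmall[OF False] AA0 by linarith
    qed
    have lower: "(cell_limit k d - 3 * e) * ?NT \<le> real (card (?C \<inter> cell k d n \<omega>))"
    proof (cases "cell_limit k d \<le> 3 * e")
      case True
      then have "(cell_limit k d - 3 * e) * ?NT \<le> 0" by (intro mult_nonpos_nonneg) auto
      then show ?thesis using of_nat_0_le_iff order_trans by blast
    next
      case False
      let ?E = "{v\<in>cell k d n \<omega>. ?c (True, v) = c}"
      have "{v\<in>cell k d n \<omega>. large K n \<omega> (True, v)} \<subseteq> ?E \<union> ?D" by (auto simp: cell_def)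
      then have "card {v\<in>cell k d n \<omega>. large K n \<omega> (True, v)} \<le> card (?E \<union> ?D)" by (rule card_mono[rotated]) simp
      also have "\<dots> \<le> card ?E + card ?D" by (rule card_Un_le)
      finally have E: "(cell_limit k d - e) * ?NT - e * ?NT \<le> real (card ?E)" using L D by linarith
      have eN: "e * ?NT > 0" using e NT by simp
      have "(3 * e) * ?NT < cell_limit k d * ?NT" using False NT by simp
      then have E2: "real (card ?E) > e * ?NT" using E by (simp add: left_diff_distrib)
      then have "?E \<noteq> {}" using eN by (intro notI) simp
      then obtain v1 where v1: "v1 \<in> ?E" by auto
      then have v1T: "v1 \<in> {1..sz n True}" by (simp add: cell_def)
      have "?E \<subseteq> left_part n \<omega> v1" unfolding left_part_eq[OF w v1T] using v1 by (auto simp: cell_def)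
      then have "card ?E \<le> card (left_part n \<omega> v1)" by (rule card_mono[rotated]) (simp add: left_part_eq[OF w v1T])
      also have "\<dots> \<le> card ?C" using max v1T by blast
      finally have Cbig: "real (card ?C) > e * ?NT" using E2 by linarith
      then have l: "large K n \<omega> (True, v0)" using Csmall by fastforce
      have "?c (True, v0) = c"
      proof (rule ccontr)
        assume ne: "?c (True, v0) \<noteq> c"
        have "?C \<subseteq> ?D" unfolding C using ne l by (auto simp: large_def)
        then have "card ?C \<le> card ?D" by (rule card_mono[rotated]) simp
        then show False using Cbig D by linarith
      qed
      then have "?E \<subseteq> ?C \<inter> cell k d n \<omega>" unfolding C by (auto simp: cell_def)
      then have "card ?E \<le> card (?C \<inter> cell k d n \<omega>)" by (rule card_mono[rotated]) simp
      then have "(cell_limit k d - e) * ?NT - e * ?NT \<le> real (card (?C \<inter> cell k d n \<omega>))" using E by linarith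
      then show ?thesis using eN by (simp add: left_diff_distrib)
    qed
    have "e * 4 = \<delta>" by (simp add: e_def)
    then have d4: "\<delta> * ?NT = 4 * (e * ?NT)" by (metis mult.commute mult.left_commute)
    have eN: "e * ?NT \<ge> 0" using e by simp
    have u': "real (card (?C \<inter> cell k d n \<omega>)) \<le> cell_limit k d * ?NT + 2 * (e * ?NT)" using upper by (simp add: distrib_right)
    have l': "cell_limit k d * ?NT - 3 * (e * ?NT) \<le> real (card (?C \<inter> cell k d n \<omega>))" using lower by (simp add: left_diff_distrib)
    show "\<bar>real (card (?C \<inter> cell k d n \<omega>)) - cell_limit k d * ?NT\<bar> \<le> \<delta> * ?NT"
      unfolding d4 using u' l' eN by linarith
  qed
qed

end

section \<open>The random intersection graph as a labelled matching\<close>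

text \<open>
  The right vertices are the groups, with the community vertices as half-edges, so that
  \<open>matchings\<close> is the set of all matchings of \<open>bipartite\<close>.
\<close>

locale rigc =
  fixes N M :: nat and dl :: "nat \<Rightarrow> nat" and Com :: "nat \<Rightarrow> lgraph"
  assumes simple: "\<And>a. a \<in> {1..M} \<Longrightarrow> simple_graph (Com a)"
    and connected: "\<And>a. a \<in> {1..M} \<Longrightarrow> connected_graph (Com a)"
    and balance: "(\<Sum>v=1..N. dl v) = (\<Sum>a=1..M. num_verts (Com a))"
begin

definition rsz :: "bool \<Rightarrow> nat" where "rsz s = (if s then N else M)"
definition rdg :: "bool \<Rightarrow> nat \<Rightarrow> nat" where "rdg s = (if s then dl else (\<lambda>a. num_verts (Com a)))"

sublocale bipartite rsz rdg
  by unfold_locales (use balance in \<open>simp add: rsz_def rdg_def\<close>)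

lemma HE_left: "HE True = half_edges N dl"
  by (simp add: HE_def half_edges_def rsz_def rdg_def)

lemma HE_right: "HE False = com_verts M Com"
  by (simp add: HE_def com_verts_def verts_of_def rsz_def rdg_def)

lemma MM_matchings: "MM = matchings N M dl Com"
  by (simp add: MM_def matchings_def HE_left HE_right)

lemma finite_edge_set: "a \<in> {1..M} \<Longrightarrow> finite (edge_set (Com a))"
proof -
  assume a: "a \<in> {1..M}"
  have "edge_set (Com a) \<subseteq> Pow (verts_of (Com a))" using simple[OF a] by (force simp: simple_graph_def)
  then show ?thesis by (rule finite_subset) (simp add: verts_of_def)
qed

lemma finite_com_edges: "finite (com_edges M Com)"
  unfolding com_edges_def by (intro finite_SigmaI finite_edge_set) auto

lemma edge_ends:
  assumes "(a, e) \<in> com_edges M Com"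
  obtains x y where "e = {x, y}" "x \<noteq> y" "(a, x) \<in> HE False" "(a, y) \<in> HE False" "a \<in> {1..M}"
proof -
  have a: "a \<in> {1..M}" "e \<in> edge_set (Com a)" using assms by (auto simp: com_edges_def)
  then obtain x y where "e = {x, y}" "x \<in> verts_of (Com a)" "y \<in> verts_of (Com a)" "x \<noteq> y"
    using simple[OF a(1)] unfolding simple_graph_def by blast
  then show ?thesis using a that unfolding HE_right com_verts_def by blast
qed

text \<open>
  The individual placed at a community vertex.
\<close>

definition owner :: "(nat \<times> nat \<Rightarrow> nat \<times> nat) \<Rightarrow> nat \<times> nat \<Rightarrow> nat" where
  "owner \<omega> z = fst (partner False \<omega> z)"

lemma matched_to_owner:
  assumes w: "\<omega> \<in> MM" and z: "z \<in> HE False" and v: "v \<in> {1..N}"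
  shows "matched_to dl \<omega> v z \<longleftrightarrow> v = owner \<omega> z"
proof
  assume "matched_to dl \<omega> v z"
  then obtain i where i: "i \<in> {1..dl v}" "\<omega> (v, i) = z" by (auto simp: matched_to_def)
  have "(v, i) \<in> HE True" using i v by (simp add: HE_left half_edges_def)
  then have "partner (\<not> True) \<omega> (partner True \<omega> (v, i)) = (v, i)" by (rule partner_partner[OF w])
  then have "partner False \<omega> z = (v, i)" using i(2) by (simp add: partner_def)
  then show "v = owner \<omega> z" by (simp add: owner_def)
next
  assume o: "v = owner \<omega> z"
  have p: "partner False \<omega> z \<in> HE True" using partner_in[OF w z] by simp
  have "partner (\<not> False) \<omega> (partner False \<omega> z) = z" by (rule partner_partner[OF w z])
  then have "\<omega> (partner False \<omega> z) = z" by (simp add: partner_def[of True])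
  then show "matched_to dl \<omega> v z" using p o
    unfolding matched_to_def owner_def HE_left half_edges_def
    by (intro bexI[of _ "snd (partner False \<omega> z)"]) (auto simp: mem_Sigma_iff)
qed

lemma owner_in: "\<omega> \<in> MM \<Longrightarrow> z \<in> HE False \<Longrightarrow> owner \<omega> z \<in> {1..N}"
  using partner_in[of \<omega> z False] by (auto simp: owner_def HE_left half_edges_def)

text \<open>
  Community edge \<open>p\<close> contributes to the multiplicity of the pair \<open>(v,
  w)\<close>.
\<close>

definition joins :: "(nat \<times> nat \<Rightarrow> nat \<times> nat) \<Rightarrow> nat \<Rightarrow> nat \<Rightarrow> nat \<times> nat set \<Rightarrow> bool" where
  "joins \<omega> v w p \<longleftrightarrow> (\<exists>j1 j2. snd p = {j1, j2} \<and> matched_to dl \<omega> v (fst p, j1) \<and> matched_to dl \<omega> w (fst p, j2))"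

lemma multiplicity_joins: "multiplicity M dl Com \<omega> v w = card {p\<in>com_edges M Com. joins \<omega> v w p}"
  unfolding multiplicity_def joins_def by (rule arg_cong[of _ _ card]) (simp add: case_prod_unfold)

lemma joins_owner:
  assumes w: "\<omega> \<in> MM" and v: "v \<in> {1..N}" and u: "u \<in> {1..N}" and xy: "x \<noteq> y" "(a, x) \<in> HE False" "(a, y) \<in> HE False"
  shows "joins \<omega> v u (a, {x, y}) \<longleftrightarrow>
     (owner \<omega> (a, x) = v \<and> owner \<omega> (a, y) = u) \<or> (owner \<omega> (a, y) = v \<and> owner \<omega> (a, x) = u)"
proof -
  have m: "matched_to dl \<omega> t (a, x) \<longleftrightarrow> t = owner \<omega> (a, x)" "matched_to dl \<omega> t (a, y) \<longleftrightarrow> t = owner \<omega> (a, y)"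
    if "t \<in> {1..N}" for t using matched_to_owner[OF w _ that] xy by auto
  have "joins \<omega> v u (a, {x, y}) \<longleftrightarrow> (matched_to dl \<omega> v (a, x) \<and> matched_to dl \<omega> u (a, y)) \<or>
      (matched_to dl \<omega> v (a, y) \<and> matched_to dl \<omega> u (a, x))"
    unfolding joins_def fst_conv snd_conv by (auto simp: doubleton_eq_iff)
  then show ?thesis using m[OF v] m[OF u] by auto
qed

text \<open>
  Counting a loop twice, a community edge adds to the degree of \<open>v\<close> the number of
  its ends at which \<open>v\<close> is placed.
\<close>

lemma edge_contribution:
  assumes w: "\<omega> \<in> MM" and v: "v \<in> {1..N}" and p: "p \<in> com_edges M Com"
  shows "2 * of_bool (joins \<omega> v v p) + (\<Sum>u\<in>{1..N} - {v}. of_bool (joins \<omega> v u p)) =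
     card {j \<in> snd p. owner \<omega> (fst p, j) = v}"
proof -
  obtain a e where pe: "p = (a, e)" by (cases p)
  obtain x y where xy: "e = {x, y}" "x \<noteq> y" "(a, x) \<in> HE False" "(a, y) \<in> HE False"
    using edge_ends[of a e] p pe by metis
  let ?ox = "owner \<omega> (a, x)" and ?oy = "owner \<omega> (a, y)"
  have ox: "?ox \<in> {1..N}" "?oy \<in> {1..N}" using owner_in[OF w] xy by auto
  have j: "joins \<omega> v u p \<longleftrightarrow> (?ox = v \<and> ?oy = u) \<or> (?oy = v \<and> ?ox = u)" if "u \<in> {1..N}" for u
    using joins_owner[OF w v that xy(2-4)] by (simp add: pe xy(1))
  have s: "(\<Sum>u\<in>{1..N} - {v}. of_bool (joins \<omega> v u p)) =
     (\<Sum>u\<in>{1..N} - {v}. if (?ox = v \<and> ?oy = u) \<or> (?oy = v \<and> ?ox = u) then 1 else (0::nat))"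
    by (rule sum.cong) (use j in auto)
  have c: "card {j \<in> snd p. owner \<omega> (fst p, j) = v} = of_bool (?ox = v) + of_bool (?oy = v)"
  proof -
    have "{j \<in> snd p. owner \<omega> (fst p, j) = v} = (if ?ox = v then {x} else {}) \<union> (if ?oy = v then {y} else {})"
      by (auto simp: pe xy(1))
    then show ?thesis using xy(2) by simp
  qed
  consider "?ox = v" "?oy = v" | "?ox = v" "?oy \<noteq> v" | "?ox \<noteq> v" "?oy = v" | "?ox \<noteq> v" "?oy \<noteq> v" by blast
  then show ?thesis
  proof cases
    case 1
    have "(\<Sum>u\<in>{1..N} - {v}. if (?ox = v \<and> ?oy = u) \<or> (?oy = v \<and> ?ox = u) then 1 else (0::nat)) = 0"
      by (rule sum.neutral) (use 1 in auto)
    then show ?thesis using 1 j[OF v] s c by simp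
  next
    case 2
    have "(\<Sum>u\<in>{1..N} - {v}. if (?ox = v \<and> ?oy = u) \<or> (?oy = v \<and> ?ox = u) then 1 else (0::nat)) =
       (\<Sum>u\<in>{1..N} - {v}. if u = ?oy then 1 else 0)"
      by (rule sum.cong) (use 2 in auto)
    also have "\<dots> = 1" using 2 ox by simp
    finally show ?thesis using 2 j[OF v] s c by simp
  next
    case 3
    have "(\<Sum>u\<in>{1..N} - {v}. if (?ox = v \<and> ?oy = u) \<or> (?oy = v \<and> ?ox = u) then 1 else (0::nat)) =
       (\<Sum>u\<in>{1..N} - {v}. if u = ?ox then 1 else 0)"
      by (rule sum.cong) (use 3 in auto)
    also have "\<dots> = 1" using 3 ox by simp
    finally show ?thesis using 3 j[OF v] s c by simp
  next
    case 4
    have "(\<Sum>u\<in>{1..N} - {v}. if (?ox = v \<and> ?oy = u) \<or> (?oy = v \<and> ?ox = u) then 1 else (0::nat)) = 0"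
      by (rule sum.neutral) (use 4 in auto)
    then show ?thesis using 4 j[OF v] s c by simp
  qed
qed

definition vweight :: "nat \<times> nat \<Rightarrow> nat" where
  "vweight z = vertex_degree (Com (fst z)) (snd z)"

text \<open>
  Exchange the order of counting: sum the ends of community edges at which \<open>v\<close> is
  placed over the community vertices instead of over the edges.
\<close>

lemma rigc_degree_sum:
  assumes w: "\<omega> \<in> MM" and v: "v \<in> {1..N}"
  shows "rigc_degree N M dl Com \<omega> v = (\<Sum>i=1..dl v. vweight (partner True \<omega> (v, i)))"
proof -
  let ?E = "com_edges M Com"
  have mult: "multiplicity M dl Com \<omega> v u = (\<Sum>p\<in>?E. of_bool (joins \<omega> v u p))" for u
    unfolding multiplicity_joins using finite_com_edges by (simp add: of_bool_def sum.If_cases Int_def)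
  have "rigc_degree N M dl Com \<omega> v =
     2 * (\<Sum>p\<in>?E. of_bool (joins \<omega> v v p)) + (\<Sum>u\<in>{1..N} - {v}. \<Sum>p\<in>?E. of_bool (joins \<omega> v u p))"
    by (simp only: rigc_degree_def mult)
  also have "(\<Sum>u\<in>{1..N} - {v}. \<Sum>p\<in>?E. of_bool (joins \<omega> v u p)) =
     (\<Sum>p\<in>?E. \<Sum>u\<in>{1..N} - {v}. of_bool (joins \<omega> v u p) :: nat)" by (rule sum.swap)
  also have "2 * (\<Sum>p\<in>?E. of_bool (joins \<omega> v v p)) + (\<Sum>p\<in>?E. \<Sum>u\<in>{1..N} - {v}. of_bool (joins \<omega> v u p) :: nat) =
     (\<Sum>p\<in>?E. 2 * of_bool (joins \<omega> v v p) + (\<Sum>u\<in>{1..N} - {v}. of_bool (joins \<omega> v u p)))"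
    by (simp only: sum_distrib_left sum.distrib)
  also have "\<dots> = (\<Sum>p\<in>?E. card {j \<in> snd p. owner \<omega> (fst p, j) = v})"
    by (rule sum.cong[OF refl]) (rule edge_contribution[OF w v])
  also have "\<dots> = (\<Sum>p\<in>?E. \<Sum>i=1..dl v. of_bool (fst (partner True \<omega> (v, i)) = fst p \<and> snd (partner True \<omega> (v, i)) \<in> snd p))"
  proof (rule sum.cong[OF refl])
    fix p assume p: "p \<in> ?E"
    obtain a e where pe: "p = (a, e)" by (cases p)
    obtain x y where xy: "e = {x, y}" "x \<noteq> y" "(a, x) \<in> HE False" "(a, y) \<in> HE False"
      using edge_ends[of a e] p pe by metis
    have eH: "(a, j) \<in> HE False" if "j \<in> e" for j using that xy by auto
    let ?I = "{i\<in>{1..dl v}. fst (partner True \<omega> (v, i)) = fst p \<and> snd (partner True \<omega> (v, i)) \<in> snd p}"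
    have vi: "(v, i) \<in> HE True" if "i \<in> {1..dl v}" for i using that v by (simp add: HE_left half_edges_def)
    have "bij_betw (\<lambda>i. snd (partner True \<omega> (v, i))) ?I {j \<in> snd p. owner \<omega> (fst p, j) = v}"
    proof (rule bij_betw_imageI)
      show "inj_on (\<lambda>i. snd (partner True \<omega> (v, i))) ?I"
      proof (rule inj_onI)
        fix i i' assume i: "i \<in> ?I" "i' \<in> ?I" "snd (partner True \<omega> (v, i)) = snd (partner True \<omega> (v, i'))"
        then have eq: "partner True \<omega> (v, i) = partner True \<omega> (v, i')" by (simp add: prod_eq_iff)
        have "(v, i) = partner (\<not> True) \<omega> (partner True \<omega> (v, i))"
          by (rule partner_partner[OF w vi, symmetric]) (use i in simp)
        also have "\<dots> = partner (\<not> True) \<omega> (partner True \<omega> (v, i'))" by (simp only: eq)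
        also have "\<dots> = (v, i')" by (rule partner_partner[OF w vi]) (use i in simp)
        finally show "i = i'" by simp
      qed
      show "(\<lambda>i. snd (partner True \<omega> (v, i))) ` ?I = {j \<in> snd p. owner \<omega> (fst p, j) = v}"
      proof (intro equalityI subsetI)
        fix j assume "j \<in> (\<lambda>i. snd (partner True \<omega> (v, i))) ` ?I"
        then obtain i where i: "i \<in> ?I" "j = snd (partner True \<omega> (v, i))" by blast
        have pz: "partner True \<omega> (v, i) = (fst p, j)" using i by (simp add: prod_eq_iff)
        have "partner (\<not> True) \<omega> (partner True \<omega> (v, i)) = (v, i)"
          by (rule partner_partner[OF w vi]) (use i in simp)
        then have "partner False \<omega> (fst p, j) = (v, i)" unfolding pz by simp
        then show "j \<in> {j \<in> snd p. owner \<omega> (fst p, j) = v}" using i by (simp add: owner_def)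
      next
        fix j assume j: "j \<in> {j \<in> snd p. owner \<omega> (fst p, j) = v}"
        have z: "(fst p, j) \<in> HE False" using eH j by (simp add: pe)
        obtain i where i: "partner False \<omega> (fst p, j) = (v, i)"
          using j by (cases "partner False \<omega> (fst p, j)") (simp add: owner_def)
        have "(v, i) \<in> HE True" using partner_in[OF w z] i by simp
        then have i1: "i \<in> {1..dl v}" by (simp add: HE_left half_edges_def)
        have "partner (\<not> False) \<omega> (partner False \<omega> (fst p, j)) = (fst p, j)" by (rule partner_partner[OF w z])
        then have pz: "partner True \<omega> (v, i) = (fst p, j)" unfolding i by simp
        show "j \<in> (\<lambda>i. snd (partner True \<omega> (v, i))) ` ?I"
          by (rule image_eqI[of _ _ i]) (use pz i1 j in simp_all)
      qed
    qed
    then have "card {j \<in> snd p. owner \<omega> (fst p, j) = v} = card ?I" by (rule bij_betw_same_card[symmetric])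
    also have "\<dots> = (\<Sum>i=1..dl v. of_bool (fst (partner True \<omega> (v, i)) = fst p \<and> snd (partner True \<omega> (v, i)) \<in> snd p))"
      by (simp add: of_bool_def sum.If_cases Int_def del: of_bool_conj)
    finally show "card {j \<in> snd p. owner \<omega> (fst p, j) = v} =
      (\<Sum>i=1..dl v. of_bool (fst (partner True \<omega> (v, i)) = fst p \<and> snd (partner True \<omega> (v, i)) \<in> snd p))" .
  qed
  also have "\<dots> = (\<Sum>i=1..dl v. \<Sum>p\<in>?E. of_bool (fst (partner True \<omega> (v, i)) = fst p \<and> snd (partner True \<omega> (v, i)) \<in> snd p))"
    by (rule sum.swap)
  also have "\<dots> = (\<Sum>i=1..dl v. vweight (partner True \<omega> (v, i)))"
  proof (rule sum.cong[OF refl])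
    fix i assume i: "i \<in> {1..dl v}"
    obtain a j where aj: "partner True \<omega> (v, i) = (a, j)" by (cases "partner True \<omega> (v, i)")
    have "(v, i) \<in> HE True" using i v by (simp add: HE_left half_edges_def)
    then have "(a, j) \<in> HE False" using partner_in[OF w, of "(v, i)" True] aj by simp
    then have a: "a \<in> {1..M}" by (simp add: HE_right com_verts_def)
    have "(\<Sum>p\<in>?E. of_bool (fst (partner True \<omega> (v, i)) = fst p \<and> snd (partner True \<omega> (v, i)) \<in> snd p)) =
       card {p\<in>?E. a = fst p \<and> j \<in> snd p}"
      using finite_com_edges by (simp add: aj of_bool_def sum.If_cases Int_def del: of_bool_conj)
    also have "{p\<in>?E. a = fst p \<and> j \<in> snd p} = Pair a ` {e\<in>edge_set (Com a). j \<in> e}"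
      using a by (auto simp: com_edges_def)
    also have "card \<dots> = card {e\<in>edge_set (Com a). j \<in> e}" by (rule card_image) (auto simp: inj_on_def)
    finally show "(\<Sum>p\<in>?E. of_bool (fst (partner True \<omega> (v, i)) = fst p \<and> snd (partner True \<omega> (v, i)) \<in> snd p)) =
        vweight (partner True \<omega> (v, i))"
      by (simp add: vweight_def vertex_degree_def aj)
  qed
  finally show ?thesis .
qed

subsection \<open>Components\<close>

lemma rigc_adj_iff:
  assumes "v \<in> {1..N}" "u \<in> {1..N}"
  shows "(v, u) \<in> rigc_adj N M dl Com \<omega> \<longleftrightarrow> (\<exists>p\<in>com_edges M Com. joins \<omega> v u p)"
  using assms finite_com_edges by (auto simp: rigc_adj_def multiplicity_joins card_gt_0_iff)

lemma adj_owner: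
  assumes w: "\<omega> \<in> MM" and z: "z \<in> HE False"
  shows "((False, fst z), (True, owner \<omega> z)) \<in> adj {} \<omega>" "((True, owner \<omega> z), (False, fst z)) \<in> adj {} \<omega>"
proof -
  show 1: "((False, fst z), (True, owner \<omega> z)) \<in> adj {} \<omega>"
    using adjI[OF z, of "{}" \<omega>] by (simp add: owner_def blocked_def)
  show "((True, owner \<omega> z), (False, fst z)) \<in> adj {} \<omega>" using sym_adj[OF w] 1 by (rule symD)
qed

lemma rigc_adj_component:
  assumes w: "\<omega> \<in> MM" and vu: "(v, u) \<in> rigc_adj N M dl Com \<omega>"
  shows "((True, v), (True, u)) \<in> (adj {} \<omega>)\<^sup>*"
proof -
  have v: "v \<in> {1..N}" "u \<in> {1..N}" using vu by (auto simp: rigc_adj_def)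
  then obtain p where p: "p \<in> com_edges M Com" "joins \<omega> v u p" using vu rigc_adj_iff by blast
  obtain a e where pe: "p = (a, e)" by (cases p)
  obtain x y where xy: "e = {x, y}" "x \<noteq> y" "(a, x) \<in> HE False" "(a, y) \<in> HE False"
    using edge_ends[of a e] p(1) pe by metis
  have "\<exists>j j'. (a, j) \<in> HE False \<and> (a, j') \<in> HE False \<and> owner \<omega> (a, j) = v \<and> owner \<omega> (a, j') = u"
    using p(2) joins_owner[OF w v xy(2-4)] xy(3,4) by (auto simp: pe xy(1))
  then obtain j j' where j: "(a, j) \<in> HE False" "(a, j') \<in> HE False" "owner \<omega> (a, j) = v" "owner \<omega> (a, j') = u" by blast
  have "((True, v), (False, a)) \<in> adj {} \<omega>" "((False, a), (True, u)) \<in> adj {} \<omega>"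
    using adj_owner[OF w j(1)] adj_owner[OF w j(2)] j(3,4) by simp_all
  then show ?thesis by (rule converse_rtrancl_into_rtrancl[OF _ r_into_rtrancl])
qed

text \<open>
  Along a path inside a community, consecutive owners are adjacent or equal.
\<close>

lemma community_connected:
  assumes w: "\<omega> \<in> MM" and a: "a \<in> {1..M}"
    and j: "(a, j) \<in> HE False" and path: "(j, j') \<in> {(u, w). {u, w} \<in> edge_set (Com a)}\<^sup>*"
  shows "(a, j') \<in> HE False \<and> (owner \<omega> (a, j), owner \<omega> (a, j')) \<in> (rigc_adj N M dl Com \<omega>)\<^sup>*"
  using path
proof (induct rule: rtrancl_induct)
  case base
  then show ?case using j by simp
next
  case (step y z)
  then have e: "{y, z} \<in> edge_set (Com a)" by simp
  then have p: "(a, {y, z}) \<in> com_edges M Com" using a by (simp add: com_edges_def)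
  obtain x1 x2 where x: "{y, z} = {x1, x2}" "x1 \<noteq> x2" "(a, x1) \<in> HE False" "(a, x2) \<in> HE False"
    using edge_ends[OF p] by metis
  then have yz: "y \<noteq> z" "(a, y) \<in> HE False" "(a, z) \<in> HE False" by (auto simp: doubleton_eq_iff)
  have "joins \<omega> (owner \<omega> (a, y)) (owner \<omega> (a, z)) (a, {y, z})"
    using joins_owner[OF w owner_in[OF w yz(2)] owner_in[OF w yz(3)] yz] by simp
  then have "(owner \<omega> (a, y), owner \<omega> (a, z)) \<in> rigc_adj N M dl Com \<omega>"
    using rigc_adj_iff[OF owner_in[OF w yz(2)] owner_in[OF w yz(3)]] p by blast
  then show ?case using step yz by (auto intro: rtrancl_into_rtrancl)
qed

text \<open>
  A community edge is a path of length 2 through its group. Conversely, the individuals of one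
  group are joined to each other because communities are connected; the induction along a
  bipartite path carries, at a group, the claim for all its individuals.
\<close>

lemma component_rigc:
  assumes w: "\<omega> \<in> MM" and v: "v \<in> {1..N}"
  shows "(rigc_adj N M dl Com \<omega>)\<^sup>* `` {v} = {u. (True, u) \<in> component {} \<omega> (True, v)}"
proof (intro equalityI subsetI)
  fix u assume "u \<in> (rigc_adj N M dl Com \<omega>)\<^sup>* `` {v}"
  then have "(v, u) \<in> (rigc_adj N M dl Com \<omega>)\<^sup>*" by simp
  then have "((True, v), (True, u)) \<in> (adj {} \<omega>)\<^sup>*"
  proof (induct rule: rtrancl_induct)
    case (step y z)
    then show ?case using rigc_adj_component[OF w step(2)] by (meson rtrancl_trans)
  qed simp
  then show "u \<in> {u. (True, u) \<in> component {} \<omega> (True, v)}" by (simp add: component_def)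
next
  fix u assume "u \<in> {u. (True, u) \<in> component {} \<omega> (True, v)}"
  then have path: "((True, v), (True, u)) \<in> (adj {} \<omega>)\<^sup>*" by (simp add: component_def)
  let ?R = "(rigc_adj N M dl Com \<omega>)\<^sup>*"
  let ?Q = "\<lambda>b. (fst b \<longrightarrow> (v, snd b) \<in> ?R) \<and> (\<not> fst b \<longrightarrow> (\<forall>j. (snd b, j) \<in> HE False \<longrightarrow> (v, owner \<omega> (snd b, j)) \<in> ?R))"
  have "?Q (True, u)" using path
  proof (induct rule: rtrancl_induct)
    case base
    then show ?case by simp
  next
    case (step b b')
    from step(2) obtain s z where z: "z \<in> HE s" "b = (s, fst z)" "b' = (\<not> s, fst (partner s \<omega> z))"
      by (auto simp: adj_def)
    show ?case
    proof (cases s)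
      case True
      have zH: "z \<in> HE True" using z(1) True by simp
      let ?y = "partner True \<omega> z"
      have y: "?y \<in> HE False" using partner_in[OF w zH] by simp
      have "partner (\<not> True) \<omega> ?y = z" by (rule partner_partner[OF w zH])
      then have oy: "owner \<omega> ?y = fst z" by (simp add: owner_def)
      have vz: "(v, fst z) \<in> ?R" using step(3) z(2) True by simp
      have a: "fst ?y \<in> {1..M}" and jy: "snd ?y \<in> verts_of (Com (fst ?y))"
        using y by (auto simp: HE_right com_verts_def)
      have "(v, owner \<omega> (fst ?y, j)) \<in> ?R" if j: "(fst ?y, j) \<in> HE False" for j
      proof -
        have "j \<in> verts_of (Com (fst ?y))" using j by (simp add: HE_right com_verts_def)
        then have "(snd ?y, j) \<in> {(u, w). {u, w} \<in> edge_set (Com (fst ?y))}\<^sup>*"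
          using connected[OF a] jy by (auto simp: connected_graph_def)
        then have "(owner \<omega> (fst ?y, snd ?y), owner \<omega> (fst ?y, j)) \<in> ?R"
          using community_connected[OF w a, of "snd ?y" j] y by simp
        then have "(fst z, owner \<omega> (fst ?y, j)) \<in> ?R" by (simp only: prod.collapse oy)
        then show ?thesis by (rule rtrancl_trans[OF vz])
      qed
      then show ?thesis using z(3) True by simp
    next
      case False
      have zH: "(fst z, snd z) \<in> HE False" using z(1) False by simp
      have "\<forall>j. (fst z, j) \<in> HE False \<longrightarrow> (v, owner \<omega> (fst z, j)) \<in> ?R" using step(3) z(2) False by simp
      then have "(v, owner \<omega> (fst z, snd z)) \<in> ?R" using zH by blast
      then show ?thesis using z(3) False by (simp add: owner_def)
    qed
  qed
  then show "u \<in> (rigc_adj N M dl Com \<omega>)\<^sup>* `` {v}" by simp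
qed

end

section \<open>Sums over tuples, and weak convergence of integer-valued laws\<close>

lemma has_sum_finite_sum:
  fixes f :: "'i \<Rightarrow> 'a \<Rightarrow> real"
  assumes "finite I" "\<And>i. i \<in> I \<Longrightarrow> (f i has_sum s i) A"
  shows "((\<lambda>x. \<Sum>i\<in>I. f i x) has_sum (\<Sum>i\<in>I. s i)) A"
  using assms by (induct I) (auto intro!: has_sum_add has_sum_0)

text \<open>
  Nonnegativity makes the product family summable: finite sets of tuples lie in finite boxes,
  where the sum of products is a product of sums.
\<close>

lemma has_sum_prod_PiE:
  fixes f :: "'i \<Rightarrow> 'b \<Rightarrow> real"
  assumes fin: "finite A" and f: "\<And>i. i \<in> A \<Longrightarrow> (f i has_sum s i) B" and nn: "\<And>i x. i \<in> A \<Longrightarrow> x \<in> B \<Longrightarrow> 0 \<le> f i x"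
  shows "((\<lambda>g. \<Prod>i\<in>A. f i (g i)) has_sum (\<Prod>i\<in>A. s i)) (A \<rightarrow>\<^sub>E B)"
proof -
  have s: "f i summable_on B" "infsum (f i) B = s i" if "i \<in> A" for i
    using f[OF that] by (auto simp: summable_on_def infsumI)
  have sm: "(\<lambda>g. \<Prod>i\<in>A. f i (g i)) summable_on (A \<rightarrow>\<^sub>E B)"
  proof (rule nonneg_bdd_above_summable_on)
    show "0 \<le> (\<Prod>i\<in>A. f i (g i))" if "g \<in> A \<rightarrow>\<^sub>E B" for g
      by (rule prod_nonneg) (use nn that in \<open>auto simp: PiE_def\<close>)
    show "bdd_above (sum (\<lambda>g. \<Prod>i\<in>A. f i (g i)) ` {X. X \<subseteq> A \<rightarrow>\<^sub>E B \<and> finite X})"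
    proof (rule bdd_aboveI2[where M = "\<Prod>i\<in>A. s i"])
      fix X assume X: "X \<in> {X. X \<subseteq> A \<rightarrow>\<^sub>E B \<and> finite X}"
      define G where "G = (\<Union>g\<in>X. g ` A)"
      have G: "finite G" "G \<subseteq> B" using X fin by (auto simp: G_def)
      have XG: "X \<subseteq> A \<rightarrow>\<^sub>E G"
      proof
        fix g assume g: "g \<in> X"
        then have "g \<in> A \<rightarrow>\<^sub>E B" using X by blast
        moreover have "g i \<in> G" if "i \<in> A" for i unfolding G_def using g that by blast
        ultimately show "g \<in> A \<rightarrow>\<^sub>E G" by (simp add: PiE_iff)
      qed
      have finG: "finite (A \<rightarrow>\<^sub>E G)" using fin G(1) by (auto intro: finite_PiE)
      have "(\<Sum>g\<in>X. \<Prod>i\<in>A. f i (g i)) \<le> (\<Sum>g\<in>A \<rightarrow>\<^sub>E G. \<Prod>i\<in>A. f i (g i))"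
      proof (rule sum_mono2[OF finG XG])
        fix g assume "g \<in> (A \<rightarrow>\<^sub>E G) - X"
        then show "0 \<le> (\<Prod>i\<in>A. f i (g i))" using G(2) by (intro prod_nonneg) (auto intro!: nn)
      qed
      also have "\<dots> = (\<Prod>i\<in>A. \<Sum>x\<in>G. f i x)" by (rule prod_sum_PiE[symmetric]) (use fin G in auto)
      also have "\<dots> \<le> (\<Prod>i\<in>A. s i)"
      proof (rule prod_mono)
        fix i assume i: "i \<in> A"
        have "(\<Sum>x\<in>G. f i x) \<le> infsum (f i) B"
          by (rule finite_sum_le_infsum[OF s(1)[OF i] G]) (use nn i in auto)
        then show "0 \<le> (\<Sum>x\<in>G. f i x) \<and> (\<Sum>x\<in>G. f i x) \<le> s i"
          using s(2)[OF i] G nn i by (auto intro!: sum_nonneg)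
      qed
      finally show "(\<Sum>g\<in>X. \<Prod>i\<in>A. f i (g i)) \<le> (\<Prod>i\<in>A. s i)" .
    qed
  qed
  have "infsum (\<lambda>g. \<Prod>i\<in>A. f i (g i)) (A \<rightarrow>\<^sub>E B) = (\<Prod>i\<in>A. infsum (f i) B)"
    by (rule infsum_prod_PiE[OF fin s(1) sm])
  also have "\<dots> = (\<Prod>i\<in>A. s i)" by (rule prod.cong) (use s(2) in auto)
  finally show ?thesis using has_sum_infsum[OF sm] by simp
qed

definition degree_tuples :: "nat \<Rightarrow> nat \<Rightarrow> (nat \<Rightarrow> nat) set" where
  "degree_tuples k d = {c \<in> {1..k} \<rightarrow>\<^sub>E UNIV. (\<Sum>i=1..k. c i) = d}"

lemma finite_degree_tuples: "finite (degree_tuples k d)"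
proof (rule finite_subset)
  show "degree_tuples k d \<subseteq> {1..k} \<rightarrow>\<^sub>E {..d}"
  proof
    fix c assume c: "c \<in> degree_tuples k d"
    have "c i \<le> d" if "i \<in> {1..k}" for i
      using c member_le_sum[of i "{1..k}" c] that by (auto simp: degree_tuples_def)
    then show "c \<in> {1..k} \<rightarrow>\<^sub>E {..d}" using c by (auto simp: degree_tuples_def PiE_def)
  qed
qed (auto intro: finite_PiE)

lemma conv_degree_tuples: "conv k g d = (\<Sum>c\<in>degree_tuples k d. \<Prod>i=1..k. g (c i))"
proof (induct k arbitrary: d)
  case 0
  have "degree_tuples 0 d = (if d = 0 then {\<lambda>_. undefined} else {})" by (auto simp: degree_tuples_def)
  then show ?case by simp
next
  case (Suc k)
  let ?S = "SIGMA x:{..d}. degree_tuples k (d - x)"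
  have "conv (Suc k) g d = (\<Sum>x\<le>d. \<Sum>c\<in>degree_tuples k (d - x). g x * (\<Prod>i=1..k. g (c i)))"
    by (simp add: Suc sum_distrib_left)
  also have "\<dots> = (\<Sum>(x, c)\<in>?S. g x * (\<Prod>i=1..k. g (c i)))"
    by (rule sum.Sigma) (auto simp: finite_degree_tuples)
  also have "\<dots> = (\<Sum>c\<in>degree_tuples (Suc k) d. \<Prod>i=1..Suc k. g (c i))"
  proof (rule sum.reindex_bij_witness[where i = "\<lambda>c. (c (Suc k), restrict c {1..k})" and j = "\<lambda>z. (snd z)(Suc k := fst z)"])
    fix p assume p: "p \<in> ?S"
    obtain x c where pc: "p = (x, c)" by (cases p)
    have xd: "x \<le> d" and c: "c \<in> {1..k} \<rightarrow>\<^sub>E UNIV" "(\<Sum>i=1..k. c i) = d - x"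
      using p pc by (auto simp: degree_tuples_def)
    have "restrict (c(Suc k := x)) {1..k} = c"
      using c(1) by (auto simp: fun_eq_iff restrict_def PiE_def extensional_def)
    then show "(((snd p)(Suc k := fst p)) (Suc k), restrict ((snd p)(Suc k := fst p)) {1..k}) = p"
      by (simp add: pc)
    have sm: "(\<Sum>i=1..k. (c(Suc k := x)) i) = (\<Sum>i=1..k. c i)" by (rule sum.cong) auto
    have "c(Suc k := x) \<in> {1..Suc k} \<rightarrow>\<^sub>E UNIV" using c(1) by (auto simp: PiE_def extensional_def)
    moreover have "(\<Sum>i=1..Suc k. (c(Suc k := x)) i) = d" using sm c(2) xd by simp
    ultimately show "(snd p)(Suc k := fst p) \<in> degree_tuples (Suc k) d"
      by (simp add: pc degree_tuples_def)
    have "(\<Prod>i=1..k. g ((c(Suc k := x)) i)) = (\<Prod>i=1..k. g (c i))" by (rule prod.cong) auto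
    then show "(\<Prod>i=1..Suc k. g (((snd p)(Suc k := fst p)) i)) = (case p of (x, c) \<Rightarrow> g x * (\<Prod>i=1..k. g (c i)))"
      by (simp add: pc mult.commute)
  next
    fix c assume c: "c \<in> degree_tuples (Suc k) d"
    then have s: "(\<Sum>i=1..k. c i) + c (Suc k) = d" and e: "c \<in> {1..Suc k} \<rightarrow>\<^sub>E UNIV" by (auto simp: degree_tuples_def)
    show "(snd (c (Suc k), restrict c {1..k}))(Suc k := fst (c (Suc k), restrict c {1..k})) = c"
      using e by (auto simp: fun_eq_iff restrict_def PiE_def extensional_def)
    have "(\<Sum>i=1..k. restrict c {1..k} i) = (\<Sum>i=1..k. c i)" by (rule sum.cong) auto
    then show "(c (Suc k), restrict c {1..k}) \<in> ?S" using s by (auto simp: degree_tuples_def)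
  qed
  finally show ?case .
qed

lemma finite_community_size:
  assumes "community_class \<H>" shows "finite {H\<in>\<H>. num_verts H = j}"
proof (rule finite_subset)
  show "{H\<in>\<H>. num_verts H = j} \<subseteq> LGraph j ` Pow (Pow {1..j})"
  proof
    fix H assume H: "H \<in> {H\<in>\<H>. num_verts H = j}"
    then have "simple_graph H" using assms by (auto simp: community_class_def)
    then have "edge_set H \<subseteq> Pow {1..j}" using H by (force simp: simple_graph_def verts_of_def)
    then show "H \<in> LGraph j ` Pow (Pow {1..j})" using H by (cases H) auto
  qed
qed auto

text \<open>
  There are finitely many communities of each size, so for nonnegative terms the sum may be
  taken size by size.
\<close>

lemma has_sum_by_size:
  fixes g :: "lgraph \<Rightarrow> real"
  assumes comm_class: "community_class \<H>" and nn: "\<And>H. H \<in> \<H> \<Longrightarrow> 0 \<le> g H"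
    and S: "(\<lambda>j. \<Sum>H\<in>{H\<in>\<H>. num_verts H = j}. g H) sums S"
  shows "(g has_sum S) \<H>"
proof -
  let ?Hj = "\<lambda>j. {H\<in>\<H>. num_verts H = j}"
  let ?L = "\<lambda>J. {H\<in>\<H>. num_verts H < J}"
  have fin: "finite (?Hj j)" for j by (rule finite_community_size[OF comm_class])
  have L: "?L J = (\<Union>j<J. ?Hj j)" for J by auto
  have finL: "finite (?L J)" for J unfolding L using fin by auto
  have sumL: "sum g (?L J) = (\<Sum>j<J. sum g (?Hj j))" for J
    unfolding L by (rule sum.UNION_disjoint) (use fin in auto)
  have lim: "(\<lambda>J. sum g (?L J)) \<longlonglongrightarrow> S" unfolding sumL using S by (simp add: sums_def)
  have upper: "sum g X \<le> S" if X: "finite X" "X \<subseteq> \<H>" for X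
  proof (rule LIMSEQ_le_const[OF lim], intro exI allI impI)
    fix J assume J: "J \<ge> Suc (Max (insert 0 (num_verts ` X)))"
    have "X \<subseteq> ?L J"
    proof
      fix H assume H: "H \<in> X"
      have "num_verts H \<le> Max (insert 0 (num_verts ` X))" by (rule Max_ge) (use X H in auto)
      then have "num_verts H < J" using J by linarith
      then show "H \<in> ?L J" using H X by auto
    qed
    then show "sum g X \<le> sum g (?L J)" by (rule sum_mono2[OF finL]) (use nn in auto)
  qed
  show ?thesis unfolding has_sum_def
  proof (rule tendstoI)
    fix e :: real assume e: "e > 0"
    have "\<forall>\<^sub>F J in sequentially. sum g (?L J) > S - e" by (rule order_tendstoD[OF lim]) (use e in simp)
    then obtain J where J: "sum g (?L J) > S - e" by (auto simp: eventually_sequentially)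
    show "\<forall>\<^sub>F X in finite_subsets_at_top \<H>. dist (sum g X) S < e"
      unfolding eventually_finite_subsets_at_top
    proof (intro exI conjI allI impI)
      show "finite (?L J)" "?L J \<subseteq> \<H>" using finL by auto
      fix X assume X: "finite X \<and> ?L J \<subseteq> X \<and> X \<subseteq> \<H>"
      have "sum g (?L J) \<le> sum g X" by (rule sum_mono2) (use X nn in auto)
      then show "dist (sum g X) S < e" using J upper[of X] X by (auto simp: dist_real_def)
    qed
  qed
qed

lemma pmf_uniform_degree:
  assumes "N > 0"
  shows "pmf (uniform_degree N d) k = real (card {v\<in>{1..N}. d v = k}) / real N"
proof -
  have ne: "{1..N} \<noteq> {}" using assms by auto
  have "pmf (uniform_degree N d) k = measure (measure_pmf (pmf_of_set {1..N})) (d -` {k})"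
    unfolding uniform_degree_def by (rule pmf_map)
  also have "\<dots> = real (card ({1..N} \<inter> d -` {k})) / real (card {1..N})"
    by (rule measure_pmf_of_set) (use ne in auto)
  also have "{1..N} \<inter> d -` {k} = {v\<in>{1..N}. d v = k}" by auto
  finally show ?thesis by simp
qed

lemma mean_uniform_degree:
  assumes "N > 0"
  shows "mean (uniform_degree N d) = (\<Sum>v=1..N. real (d v)) / real N"
proof -
  have ne: "{1..N} \<noteq> {}" using assms by auto
  have "mean (uniform_degree N d) = measure_pmf.expectation (pmf_of_set {1..N}) (\<lambda>v. real (d v))"
    by (simp add: mean_def uniform_degree_def)
  also have "\<dots> = (\<Sum>v=1..N. real (d v)) / real (card {1..N})"
    by (rule integral_pmf_of_set) (use ne in auto)
  finally show ?thesis by simp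
qed

text \<open>
  The mass at \<open>k\<close> is the increment of the distribution function between \<open>k -
  1/2\<close> and \<open>k + 1/2\<close>, both of which are points of continuity of an
  integer-valued limit law.
\<close>

lemma weak_conv_pmf:
  fixes P :: "nat \<Rightarrow> nat pmf"
  assumes "weak_conv_m (\<lambda>n. real_law (P n)) (real_law p)"
  shows "(\<lambda>n. pmf (P n) k) \<longlonglongrightarrow> pmf p k"
proof -
  have cdf_real: "cdf (real_law q) x = measure (measure_pmf q) {j. real j \<le> x}" for q x
    unfolding cdf_def real_law_def by (subst measure_distr) (auto intro: arg_cong[of _ _ "measure (measure_pmf q)"])
  have step: "(\<lambda>n. cdf (real_law (P n)) (real k - 1 / 2)) \<longlonglongrightarrow> cdf (real_law p) (real k - 1 / 2)"
    "(\<lambda>n. cdf (real_law (P n)) (real k + 1 / 2)) \<longlonglongrightarrow> cdf (real_law p) (real k + 1 / 2)" for k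
  proof -
    have c: "isCont (cdf (real_law p)) x" if x: "\<And>j. real j \<noteq> x" for x
    proof -
      interpret real_distribution "real_law p"
        unfolding real_law_def by (rule prob_space.real_distribution_distr[OF prob_space_measure_pmf]) simp
      have "measure (real_law p) {x} = measure (measure_pmf p) (real -` {x})"
        unfolding real_law_def by (subst measure_distr) auto
      also have "real -` {x} = {}" using x by auto
      finally have "measure (real_law p) {x} = 0" by simp
      then show ?thesis by (simp add: isCont_cdf)
    qed
    have m: "real j \<noteq> real k - 1 / 2" "real j \<noteq> real k + 1 / 2" for j
    proof -
      have "2 * j \<noteq> 2 * k + 1" "2 * j + 1 \<noteq> 2 * k" by presburger+
      then have "real (2 * j) \<noteq> real (2 * k + 1)" "real (2 * j + 1) \<noteq> real (2 * k)"
        by (simp_all only: of_nat_eq_iff not_False_eq_True)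
      then show "real j \<noteq> real k - 1 / 2" "real j \<noteq> real k + 1 / 2" by (auto simp: field_simps)
    qed
    show "(\<lambda>n. cdf (real_law (P n)) (real k - 1 / 2)) \<longlonglongrightarrow> cdf (real_law p) (real k - 1 / 2)"
      using assms c[OF m(1)] unfolding weak_conv_m_def weak_conv_def by blast
    show "(\<lambda>n. cdf (real_law (P n)) (real k + 1 / 2)) \<longlonglongrightarrow> cdf (real_law p) (real k + 1 / 2)"
      using assms c[OF m(2)] unfolding weak_conv_m_def weak_conv_def by blast
  qed
  have pm: "pmf q k = cdf (real_law q) (real k + 1 / 2) - cdf (real_law q) (real k - 1 / 2)" for q
  proof -
    have up: "{j. real j \<le> real k + 1 / 2} = {..k}"
    proof (rule set_eqI)
      fix j
      have "real j \<le> real k + 1 / 2 \<longleftrightarrow> j \<le> k"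
      proof
        assume "real j \<le> real k + 1 / 2"
        then have "real j < real (Suc k)" by simp
        then show "j \<le> k" by (simp only: of_nat_less_iff less_Suc_eq_le)
      next
        assume "j \<le> k"
        then have "real j \<le> real k" by (simp only: of_nat_le_iff)
        then show "real j \<le> real k + 1 / 2" by simp
      qed
      then show "j \<in> {j. real j \<le> real k + 1 / 2} \<longleftrightarrow> j \<in> {..k}" by simp
    qed
    have low: "{j. real j \<le> real k - 1 / 2} = {..<k}"
    proof (rule set_eqI)
      fix j
      have "real j \<le> real k - 1 / 2 \<longleftrightarrow> j < k"
      proof
        assume "real j \<le> real k - 1 / 2"
        then have "real j < real k" by simp
        then show "j < k" by (simp only: of_nat_less_iff)
      next
        assume "j < k"
        then have "real (Suc j) \<le> real k" by (simp only: of_nat_le_iff Suc_le_eq)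
        then show "real j \<le> real k - 1 / 2" by simp
      qed
      then show "j \<in> {j. real j \<le> real k - 1 / 2} \<longleftrightarrow> j \<in> {..<k}" by simp
    qed
    have "measure (measure_pmf q) {..k} = measure (measure_pmf q) ({..<k} \<union> {k})"
      by (rule arg_cong[of _ _ "measure (measure_pmf q)"]) auto
    also have "\<dots> = measure (measure_pmf q) {..<k} + measure (measure_pmf q) {k}"
      by (rule measure_pmf.finite_measure_Union) auto
    finally show ?thesis unfolding cdf_real up low by (simp add: pmf.rep_eq)
  qed
  show ?thesis using tendsto_diff[OF step(2)[of k] step(1)[of k]] by (simp only: pm)
qed

section \<open>The limiting proportion\<close>

text \<open>
  The convergence assumptions without supercriticality. They turn the model into a
  \<open>bipartite_seq\<close> with limit laws \<open>p\<close> and \<open>q\<close>.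
\<close>

locale rigc_seq =
  fixes \<H> :: "lgraph set" and N M :: "nat \<Rightarrow> nat" and dl :: "nat \<Rightarrow> nat \<Rightarrow> nat"
    and Com :: "nat \<Rightarrow> nat \<Rightarrow> lgraph" and p :: "nat pmf" and \<mu> :: "lgraph pmf" and q :: "nat pmf"
  assumes class_H: "community_class \<H>"
    and N_lim: "filterlim N at_top sequentially"
    and M_lim: "filterlim M at_top sequentially"
    and dl_pos: "\<And>n v. v \<in> {1..N n} \<Longrightarrow> dl n v \<ge> 1"
    and Com_in: "\<And>n a. a \<in> {1..M n} \<Longrightarrow> Com n a \<in> \<H>"
    and balance: "\<And>n. (\<Sum>v=1..N n. dl n v) = (\<Sum>a=1..M n. num_verts (Com n a))"
    and p_supp: "set_pmf p \<subseteq> {1..}"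
    and A: "weak_conv_m (\<lambda>n. real_law (uniform_degree (N n) (dl n))) (real_law p)"
    and B_fin: "finite_mean p"
    and B_lim: "(\<lambda>n. mean (uniform_degree (N n) (dl n))) \<longlonglongrightarrow> mean p"
    and mu_supp: "set_pmf \<mu> \<subseteq> \<H>"
    and C: "\<And>H. H \<in> \<H> \<Longrightarrow>
              (\<lambda>n. real (card {a \<in> {1..M n}. Com n a = H}) / real (M n)) \<longlonglongrightarrow> pmf \<mu> H"
    and q_def: "q = map_pmf num_verts \<mu>"
    and D_fin: "finite_mean q"
    and D_lim: "(\<lambda>n. mean (uniform_degree (M n) (\<lambda>a. num_verts (Com n a)))) \<longlonglongrightarrow> mean q"
begin

lemma N_pos: "\<forall>\<^sub>F n in sequentially. N n > 0"
  using N_lim unfolding filterlim_at_top by (metis (mono_tags) eventually_mono less_le_trans zero_less_one)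

lemma M_pos: "\<forall>\<^sub>F n in sequentially. M n > 0"
  using M_lim unfolding filterlim_at_top by (metis (mono_tags) eventually_mono less_le_trans zero_less_one)

sublocale R: rigc "N n" "M n" "dl n" "Com n" for n
proof
  fix a assume "a \<in> {1..M n}"
  then have "Com n a \<in> \<H>" by (rule Com_in)
  then show "simple_graph (Com n a)" "connected_graph (Com n a)"
    using class_H by (auto simp: community_class_def)
qed (rule balance)

definition law :: "bool \<Rightarrow> nat pmf" where "law s = (if s then p else q)"

abbreviation of_size :: "nat \<Rightarrow> lgraph set" where "of_size j \<equiv> {H\<in>\<H>. num_verts H = j}"

lemma pmf_q: "pmf q j = (\<Sum>H\<in>of_size j. pmf \<mu> H)"
proof -
  have "pmf q j = measure (measure_pmf \<mu>) (num_verts -` {j})" unfolding q_def by (rule pmf_map)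
  also have "\<dots> = measure (measure_pmf \<mu>) (of_size j)"
    by (rule measure_pmf.finite_measure_eq_AE) (use mu_supp in \<open>auto simp: AE_measure_pmf_iff\<close>)
  also have "\<dots> = (\<Sum>H\<in>of_size j. pmf \<mu> H)"
    by (rule measure_measure_pmf_finite) (rule finite_community_size[OF class_H])
  finally show ?thesis .
qed

text \<open>
  For fixed size \<open>j\<close> the sum over groups is a sum over finitely many communities,
  and their proportions converge.
\<close>

lemma community_sum_lim:
  fixes g :: "lgraph \<Rightarrow> nat"
  shows "(\<lambda>n. real (\<Sum>a\<in>{a\<in>{1..M n}. num_verts (Com n a) = j}. g (Com n a)) / real (M n))
     \<longlonglongrightarrow> (\<Sum>H\<in>of_size j. real (g H) * pmf \<mu> H)"
proof -
  have "real (\<Sum>a\<in>{a\<in>{1..M n}. num_verts (Com n a) = j}. g (Com n a)) / real (M n) =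
     (\<Sum>H\<in>of_size j. real (g H) * (real (card {a\<in>{1..M n}. Com n a = H}) / real (M n)))" for n
  proof -
    let ?S = "{a\<in>{1..M n}. num_verts (Com n a) = j}"
    have "(\<Sum>a\<in>?S. g (Com n a)) = (\<Sum>H\<in>of_size j. \<Sum>a\<in>{a\<in>?S. Com n a = H}. g (Com n a))"
      by (rule sum.group[symmetric]) (use finite_community_size[OF class_H] Com_in in auto)
    also have "\<dots> = (\<Sum>H\<in>of_size j. g H * card {a\<in>{1..M n}. Com n a = H})"
    proof (rule sum.cong[OF refl])
      fix H assume H: "H \<in> of_size j"
      have "{a\<in>?S. Com n a = H} = {a\<in>{1..M n}. Com n a = H}" using H by auto
      then show "(\<Sum>a\<in>{a\<in>?S. Com n a = H}. g (Com n a)) = g H * card {a\<in>{1..M n}. Com n a = H}" by simp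
    qed
    finally show ?thesis by (simp add: sum_divide_distrib)
  qed
  then show ?thesis by (simp only:) (intro tendsto_sum tendsto_mult tendsto_const C; simp)
qed

lemma size_lim: "filterlim (\<lambda>n. R.rsz n s) at_top sequentially"
  using N_lim M_lim by (cases s) (simp_all add: R.rsz_def)

lemma degree_pos: "v \<in> {1..R.rsz n s} \<Longrightarrow> R.rdg n s v \<ge> 1"
  using dl_pos Com_in class_H by (cases s) (auto simp: R.rsz_def R.rdg_def community_class_def)

lemma law_0: "pmf (law s) 0 = 0"
proof (cases s)
  case True
  have "0 \<notin> set_pmf p" using p_supp by auto
  then show ?thesis using True by (simp add: law_def set_pmf_iff)
next
  case False
  have "num_verts H \<noteq> 0" if "H \<in> \<H>" for H using class_H that by (force simp: community_class_def)
  then have none: "of_size 0 = {}" by blast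
  have "pmf q 0 = 0" unfolding pmf_q none by (rule sum.empty)
  then show ?thesis using False by (simp add: law_def)
qed

lemma degree_count_lim:
  "(\<lambda>n. real (card {v\<in>{1..R.rsz n s}. R.rdg n s v = j}) / real (R.rsz n s)) \<longlonglongrightarrow> pmf (law s) j"
proof (cases s)
  case True
  have "(\<lambda>n. real (card {v\<in>{1..N n}. dl n v = j}) / real (N n)) \<longlonglongrightarrow> pmf p j"
  proof (rule Lim_transform_eventually[OF weak_conv_pmf[OF A]])
    show "\<forall>\<^sub>F n in sequentially. pmf (uniform_degree (N n) (dl n)) j = real (card {v\<in>{1..N n}. dl n v = j}) / real (N n)"
      using N_pos by eventually_elim (rule pmf_uniform_degree)
  qed
  then show ?thesis using True by (simp add: R.rsz_def R.rdg_def law_def)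
next
  case False
  then show ?thesis using community_sum_lim[where j = j and g = "\<lambda>_. 1"]
    by (simp add: R.rsz_def R.rdg_def law_def pmf_q)
qed

lemma degree_mean_lim:
  "(\<lambda>n. (\<Sum>v=1..R.rsz n s. real (R.rdg n s v)) / real (R.rsz n s)) \<longlonglongrightarrow> mean (law s)"
proof (cases s)
  case True
  have "(\<lambda>n. (\<Sum>v=1..N n. real (dl n v)) / real (N n)) \<longlonglongrightarrow> mean p"
  proof (rule Lim_transform_eventually[OF B_lim])
    show "\<forall>\<^sub>F n in sequentially. mean (uniform_degree (N n) (dl n)) = (\<Sum>v=1..N n. real (dl n v)) / real (N n)"
      using N_pos by eventually_elim (rule mean_uniform_degree)
  qed
  then show ?thesis using True by (simp add: R.rsz_def R.rdg_def law_def)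
next
  case False
  have "(\<lambda>n. (\<Sum>a=1..M n. real (num_verts (Com n a))) / real (M n)) \<longlonglongrightarrow> mean q"
  proof (rule Lim_transform_eventually[OF D_lim])
    show "\<forall>\<^sub>F n in sequentially. mean (uniform_degree (M n) (\<lambda>a. num_verts (Com n a))) =
       (\<Sum>a=1..M n. real (num_verts (Com n a))) / real (M n)"
      using M_pos by eventually_elim (rule mean_uniform_degree)
  qed
  then show ?thesis using False by (simp add: R.rsz_def R.rdg_def law_def)
qed

sublocale S: bipartite_seq "\<lambda>n. R.rsz n" "\<lambda>n. R.rdg n" law
proof
  show "(\<Sum>v=1..R.rsz n True. R.rdg n True v) = (\<Sum>v=1..R.rsz n False. R.rdg n False v)" for n
    using balance[of n] by (simp add: R.rsz_def R.rdg_def)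
  show "finite_mean (law s)" for s using B_fin D_fin by (simp add: law_def)
qed (fact size_lim degree_pos law_0 degree_count_lim degree_mean_lim)+

text \<open>
  The limiting proportion of community vertices that lie in a copy of \<open>H\<close> and have
  degree \<open>c\<close> there.
\<close>

definition label_share :: "nat \<Rightarrow> lgraph \<Rightarrow> real" where
  "label_share c H = real (num_of_degree c H) * pmf \<mu> H / mean q"

lemma label_share_nonneg: "0 \<le> label_share c H"
  using S.mean_ge_1[of False] by (simp add: label_share_def law_def)

lemma label_count_lim:
  "(\<lambda>n. real (card {z\<in>R.HE n False. R.vweight n z = c \<and> R.rdg n False (fst z) = j}) / real (R.h n))
     \<longlonglongrightarrow> (\<Sum>H\<in>of_size j. label_share c H)"
proof -
  let ?S = "\<lambda>n. {a\<in>{1..M n}. num_verts (Com n a) = j}"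
  have "card {z\<in>R.HE n False. R.vweight n z = c \<and> R.rdg n False (fst z) = j} =
     (\<Sum>a\<in>?S n. num_of_degree c (Com n a))" for n
  proof -
    have "{z\<in>R.HE n False. R.vweight n z = c \<and> R.rdg n False (fst z) = j} =
       (SIGMA a:?S n. {x\<in>verts_of (Com n a). vertex_degree (Com n a) x = c})"
      unfolding R.HE_right com_verts_def R.vweight_def R.rdg_def by auto
    then show ?thesis by (simp add: num_of_degree_def verts_of_def)
  qed
  moreover have "(\<lambda>n. real (\<Sum>a\<in>?S n. num_of_degree c (Com n a)) / real (R.h n))
     \<longlonglongrightarrow> (\<Sum>H\<in>of_size j. real (num_of_degree c H) * pmf \<mu> H) / mean (law False)"
    by (rule S.over_h) (use community_sum_lim[where j = j and g = "num_of_degree c"] in \<open>simp add: R.rsz_def\<close>)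
  ultimately show ?thesis by (simp add: label_share_def law_def sum_divide_distrib)
qed

end

locale supercritical_rigc_seq = rigc_seq +
  fixes \<eta>l \<eta>r :: real
  assumes supercritical: "ext_mean (excess p) * ext_mean (excess q) > 1"
    and eta_l: "\<eta>l \<in> {0..1}" "\<eta>l = gen_fun (excess q) (gen_fun (excess p) \<eta>l)"
    and eta_l_least:
          "\<And>x. x \<in> {0..1} \<Longrightarrow> x = gen_fun (excess q) (gen_fun (excess p) x) \<Longrightarrow> \<eta>l \<le> x"
    and eta_r: "\<eta>r = gen_fun (excess p) \<eta>l"
begin

sublocale L: labelled_seq "\<lambda>n. R.rsz n" "\<lambda>n. R.rdg n" law \<eta>l \<eta>r "\<lambda>n s. R.vweight n"
  "\<lambda>c j. \<Sum>H\<in>of_size j. label_share c H"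
proof
  show "\<eta>l \<in> {0..1}" by (rule eta_l)
  show "\<eta>l = S.\<phi> False (S.\<phi> True \<eta>l)" using eta_l(2) by (simp add: S.\<phi>_def law_def)
  show "\<eta>l \<le> x" if "x \<in> {0..1}" "x = S.\<phi> False (S.\<phi> True x)" for x
    by (rule eta_l_least) (use that in \<open>simp_all add: S.\<phi>_def law_def\<close>)
  show "\<eta>r = S.\<phi> True \<eta>l" using eta_r by (simp add: S.\<phi>_def law_def)
  show "ext_mean (excess (law True)) * ext_mean (excess (law False)) > 1"
    using supercritical by (simp add: law_def)
qed (rule label_count_lim)

lemma has_sum_share:
  assumes y: "y \<in> {0..1}"
  shows "((\<lambda>H. label_share c H * y ^ (num_verts H - 1)) has_sum L.share c y) \<H>"
proof (rule has_sum_by_size[OF class_H])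
  show "0 \<le> label_share c H * y ^ (num_verts H - 1)" for H using label_share_nonneg y by simp
  have "(\<Sum>H\<in>of_size j. label_share c H * y ^ (num_verts H - 1)) = (\<Sum>H\<in>of_size j. label_share c H) * y ^ (j - 1)" for j
    unfolding sum_distrib_right by (rule sum.cong) auto
  then show "(\<lambda>j. \<Sum>H\<in>of_size j. label_share c H * y ^ (num_verts H - 1)) sums L.share c y"
    unfolding L.share_def using summable_sums[OF L.summable_share[OF y, of c]] by simp
qed

text \<open>
  Expand \<open>1 - \<eta>r ^ s\<close>: for a fixed tuple of degrees, the sums over tuples of
  communities factorise into \<open>share\<close> at 1 and at \<open>\<eta>r\<close>. Finitely
  many tuples of degrees have sum \<open>d\<close>, and summing over them gives convolution
  powers.
\<close>

lemma limit_proportion_eq: "limit_proportion \<H> p \<mu> \<eta>r k d = L.cell_limit k d"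
proof -
  have r: "\<eta>r \<in> {0..1}" by (rule L.eta_r_range)
  have tuple_sum: "((\<lambda>H. (1 - \<eta>r ^ (\<Sum>i=1..k. (num_verts (H i) - 1))) * (\<Prod>i=1..k. label_share (c i) (H i)))
     has_sum ((\<Prod>i=1..k. L.share (c i) 1) - (\<Prod>i=1..k. L.share (c i) \<eta>r))) ({1..k} \<rightarrow>\<^sub>E \<H>)" for c
  proof -
    have P: "((\<lambda>H. \<Prod>i=1..k. label_share (c i) (H i) * y ^ (num_verts (H i) - 1)) has_sum (\<Prod>i=1..k. L.share (c i) y))
       ({1..k} \<rightarrow>\<^sub>E \<H>)" if y: "y \<in> {0..1}" for y
      by (rule has_sum_prod_PiE) (use has_sum_share[OF y] label_share_nonneg y in auto)
    have one: "(1::real) \<in> {0..1}" by simp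
    have "((\<lambda>H. (\<Prod>i=1..k. label_share (c i) (H i) * 1 ^ (num_verts (H i) - 1)) -
         (\<Prod>i=1..k. label_share (c i) (H i) * \<eta>r ^ (num_verts (H i) - 1)))
       has_sum ((\<Prod>i=1..k. L.share (c i) 1) - (\<Prod>i=1..k. L.share (c i) \<eta>r))) ({1..k} \<rightarrow>\<^sub>E \<H>)"
      using has_sum_add[OF P[OF one] has_sum_uminusI[OF P[OF r]]] by simp
    then show ?thesis by (simp add: prod.distrib power_sum algebra_simps)
  qed
  have "((\<lambda>H. \<Sum>c\<in>degree_tuples k d. (1 - \<eta>r ^ (\<Sum>i=1..k. (num_verts (H i) - 1))) * (\<Prod>i=1..k. label_share (c i) (H i)))
     has_sum (\<Sum>c\<in>degree_tuples k d. (\<Prod>i=1..k. L.share (c i) 1) - (\<Prod>i=1..k. L.share (c i) \<eta>r))) ({1..k} \<rightarrow>\<^sub>E \<H>)"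
    by (rule has_sum_finite_sum[OF finite_degree_tuples tuple_sum])
  then have "(\<Sum>\<^sub>\<infinity>H\<in>{1..k} \<rightarrow>\<^sub>E \<H>. \<Sum>c\<in>degree_tuples k d. (1 - \<eta>r ^ (\<Sum>i=1..k. (num_verts (H i) - 1))) *
       (\<Prod>i=1..k. label_share (c i) (H i))) =
     conv k (\<lambda>c. L.share c 1) d - conv k (\<lambda>c. L.share c \<eta>r) d"
    unfolding conv_degree_tuples by (simp only: infsumI sum_subtractf)
  then show ?thesis
    unfolding limit_proportion_def L.cell_limit_def degree_tuples_def q_def[symmetric] label_share_def[symmetric]
    by (simp add: law_def)
qed

lemma largest_component_left_part:
  assumes w: "\<omega> \<in> matchings (N n) (M n) (dl n) (Com n)"
    and C: "largest_component (N n) (M n) (dl n) (Com n) \<omega> C"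
  obtains v0 where "v0 \<in> {1..N n}" "C = L.left_part n \<omega> v0"
    "\<And>v. v \<in> {1..N n} \<Longrightarrow> card (L.left_part n \<omega> v) \<le> card (L.left_part n \<omega> v0)"
proof -
  have w': "\<omega> \<in> R.MM n" using w by (simp add: R.MM_matchings)
  have comp: "(rigc_adj (N n) (M n) (dl n) (Com n) \<omega>)\<^sup>* `` {v} = L.left_part n \<omega> v" if "v \<in> {1..N n}" for v
    unfolding L.left_part_def by (rule R.component_rigc[OF w' that])
  have comps: "rigc_components (N n) (M n) (dl n) (Com n) \<omega> = L.left_part n \<omega> ` {1..N n}"
    unfolding rigc_components_def by (rule image_cong[OF refl comp])
  show ?thesis using C that unfolding largest_component_def comps by blast
qed

lemma left_part_subset:
  assumes w: "\<omega> \<in> R.MM n" and v: "v \<in> {1..N n}"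
  shows "L.left_part n \<omega> v \<subseteq> {1..N n}"
proof -
  have "v \<in> {1..R.rsz n True}" using v by (simp add: R.rsz_def)
  from L.left_part_eq[OF w this] show ?thesis by (auto simp: R.rsz_def)
qed

theorem largest_component_proportion:
  assumes C1: "\<And>n \<omega>. N n \<ge> 1 \<Longrightarrow> \<omega> \<in> matchings (N n) (M n) (dl n) (Com n) \<Longrightarrow>
               largest_component (N n) (M n) (dl n) (Com n) \<omega> (C\<^sub>1 n \<omega>)"
  shows "tendsto_in_prob (\<lambda>n. pmf_of_set (matchings (N n) (M n) (dl n) (Com n)))
             (\<lambda>n \<omega>. real (card {v \<in> C\<^sub>1 n \<omega>.
                              dl n v = k \<and> rigc_degree (N n) (M n) (dl n) (Com n) \<omega> v = d})
                     / real (N n))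
             (limit_proportion \<H> p \<mu> \<eta>r k d)"
  unfolding tendsto_in_prob_def
proof (intro allI impI)
  fix \<epsilon> :: real assume e: "\<epsilon> > 0"
  let ?X = "\<lambda>n \<omega>. real (card {v \<in> C\<^sub>1 n \<omega>. dl n v = k \<and> rigc_degree (N n) (M n) (dl n) (Com n) \<omega> v = d}) / real (N n)"
  let ?A = "limit_proportion \<H> p \<mu> \<eta>r k d"
  have "S.whp (\<lambda>n \<omega>. \<bar>?X n \<omega> - ?A\<bar> \<le> \<epsilon>)"
  proof (rule S.whp_mono[OF L.largest_cell_count[OF e, of k d]])
    show "\<forall>\<^sub>F n in sequentially. \<forall>\<omega>\<in>R.MM n.
       (\<forall>v0\<in>{1..R.rsz n True}. (\<forall>v\<in>{1..R.rsz n True}. card (L.left_part n \<omega> v) \<le> card (L.left_part n \<omega> v0)) \<longrightarrow>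
         \<bar>real (card (L.left_part n \<omega> v0 \<inter> L.cell k d n \<omega>)) - L.cell_limit k d * real (R.rsz n True)\<bar> \<le> \<epsilon> * real (R.rsz n True)) \<longrightarrow>
       \<bar>?X n \<omega> - ?A\<bar> \<le> \<epsilon>"
      using N_pos
    proof eventually_elim
      case (elim n)
      show ?case
      proof (intro ballI impI)
        fix \<omega> assume w: "\<omega> \<in> R.MM n"
          and all: "\<forall>v0\<in>{1..R.rsz n True}. (\<forall>v\<in>{1..R.rsz n True}. card (L.left_part n \<omega> v) \<le> card (L.left_part n \<omega> v0)) \<longrightarrow>
         \<bar>real (card (L.left_part n \<omega> v0 \<inter> L.cell k d n \<omega>)) - L.cell_limit k d * real (R.rsz n True)\<bar> \<le> \<epsilon> * real (R.rsz n True)"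
        have wm: "\<omega> \<in> matchings (N n) (M n) (dl n) (Com n)" using w by (simp add: R.MM_matchings)
        have "N n \<ge> 1" using elim by simp
        then obtain v0 where v0: "v0 \<in> {1..N n}" "C\<^sub>1 n \<omega> = L.left_part n \<omega> v0"
            "\<And>v. v \<in> {1..N n} \<Longrightarrow> card (L.left_part n \<omega> v) \<le> card (L.left_part n \<omega> v0)"
          using largest_component_left_part[OF wm C1[OF _ wm]] by blast
        have sz: "R.rsz n True = N n" by (simp add: R.rsz_def)
        have W: "L.label_sum n \<omega> v = rigc_degree (N n) (M n) (dl n) (Com n) \<omega> v" if v: "v \<in> {1..N n}" for v
          unfolding R.rigc_degree_sum[OF w v] L.label_sum_def by (simp add: R.rdg_def)
        have "{v \<in> C\<^sub>1 n \<omega>. dl n v = k \<and> rigc_degree (N n) (M n) (dl n) (Com n) \<omega> v = d} = L.left_part n \<omega> v0 \<inter> L.cell k d n \<omega>"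
        proof (rule set_eqI)
          fix v
          have "v \<in> {1..N n}" if "v \<in> L.left_part n \<omega> v0" using left_part_subset[OF w v0(1)] that by blast
          then show "v \<in> {v \<in> C\<^sub>1 n \<omega>. dl n v = k \<and> rigc_degree (N n) (M n) (dl n) (Com n) \<omega> v = d} \<longleftrightarrow>
             v \<in> L.left_part n \<omega> v0 \<inter> L.cell k d n \<omega>"
            unfolding v0(2) L.cell_def sz using W[of v] by (auto simp: R.rdg_def)
        qed
        moreover have "\<bar>real (card (L.left_part n \<omega> v0 \<inter> L.cell k d n \<omega>)) - L.cell_limit k d * real (N n)\<bar> \<le> \<epsilon> * real (N n)"
          using all v0(1,3) unfolding sz by blast
        moreover have "\<bar>x / m - a\<bar> \<le> \<epsilon>" if "\<bar>x - a * m\<bar> \<le> \<epsilon> * m" "m > 0" for x m a :: real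
        proof -
          have "x / m - a = (x - a * m) / m" using that(2) by (simp add: field_simps)
          then show ?thesis using that by (simp add: abs_div pos_divide_le_eq)
        qed
        ultimately show "\<bar>?X n \<omega> - ?A\<bar> \<le> \<epsilon>" using elim unfolding limit_proportion_eq by simp
      qed
    qed
  qed
  then have "(\<lambda>n. real (card {\<omega>\<in>R.MM n. \<not> \<bar>?X n \<omega> - ?A\<bar> \<le> \<epsilon>}) / real (card (R.MM n))) \<longlonglongrightarrow> 0"
    unfolding S.whp_def .
  moreover have "measure_pmf.prob (pmf_of_set (matchings (N n) (M n) (dl n) (Com n))) {\<omega>. \<bar>?X n \<omega> - ?A\<bar> > \<epsilon>} =
     real (card {\<omega>\<in>R.MM n. \<not> \<bar>?X n \<omega> - ?A\<bar> \<le> \<epsilon>}) / real (card (R.MM n))" for n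
  proof -
    have "{\<omega>\<in>R.MM n. \<not> \<bar>?X n \<omega> - ?A\<bar> \<le> \<epsilon>} = R.MM n \<inter> {\<omega>. \<bar>?X n \<omega> - ?A\<bar> > \<epsilon>}" by auto
    then show ?thesis
      unfolding R.MM_matchings[symmetric] by (simp only: measure_pmf_of_set[OF R.MM_nonempty R.finite_MM])
  qed
  ultimately show "(\<lambda>n. measure_pmf.prob (pmf_of_set (matchings (N n) (M n) (dl n) (Com n))) {\<omega>. \<bar>?X n \<omega> - ?A\<bar> > \<epsilon>}) \<longlonglongrightarrow> 0"
    by (simp only:)
qed

end

theorem theorem2p7:
  fixes \<H> :: "lgraph set"
    and N M :: "nat \<Rightarrow> nat"
    and dl :: "nat \<Rightarrow> nat \<Rightarrow> nat"
    and Com :: "nat \<Rightarrow> nat \<Rightarrow> lgraph"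
    and p :: "nat pmf"
    and \<mu> :: "lgraph pmf"
    and q :: "nat pmf"
    and \<eta>l \<eta>r :: real
    and C\<^sub>1 :: "nat \<Rightarrow> (nat \<times> nat \<Rightarrow> nat \<times> nat) \<Rightarrow> nat set"
  assumes class_H: "community_class \<H>"
    and N_lim: "filterlim N at_top sequentially"
    and M_lim: "filterlim M at_top sequentially"
    and dl_pos: "\<And>n v. v \<in> {1..N n} \<Longrightarrow> dl n v \<ge> 1"
    and Com_in: "\<And>n a. a \<in> {1..M n} \<Longrightarrow> Com n a \<in> \<H>"
    and balance: "\<And>n. (\<Sum>v=1..N n. dl n v) = (\<Sum>a=1..M n. num_verts (Com n a))"
    and p_supp: "set_pmf p \<subseteq> {1..}"
    and A: "weak_conv_m (\<lambda>n. real_law (uniform_degree (N n) (dl n))) (real_law p)"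
    and B: "finite_mean p" "(\<lambda>n. mean (uniform_degree (N n) (dl n))) \<longlonglongrightarrow> mean p"
    and mu_supp: "set_pmf \<mu> \<subseteq> \<H>"
    and C: "\<And>H. H \<in> \<H> \<Longrightarrow>
              (\<lambda>n. real (card {a \<in> {1..M n}. Com n a = H}) / real (M n)) \<longlonglongrightarrow> pmf \<mu> H"
    and q_def: "q = map_pmf num_verts \<mu>"
    and D: "finite_mean q"
           "(\<lambda>n. mean (uniform_degree (M n) (\<lambda>a. num_verts (Com n a)))) \<longlonglongrightarrow> mean q"
    and supercritical: "ext_mean (excess p) * ext_mean (excess q) > 1"
    and eta_l: "\<eta>l \<in> {0..1}" "\<eta>l = gen_fun (excess q) (gen_fun (excess p) \<eta>l)"
    and eta_l_least:
          "\<And>x. x \<in> {0..1} \<Longrightarrow> x = gen_fun (excess q) (gen_fun (excess p) x) \<Longrightarrow> \<eta>l \<le> x"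
    and eta_r: "\<eta>r = gen_fun (excess p) \<eta>l"
    and C1: "\<And>n \<omega>. N n \<ge> 1 \<Longrightarrow> \<omega> \<in> matchings (N n) (M n) (dl n) (Com n) \<Longrightarrow>
               largest_component (N n) (M n) (dl n) (Com n) \<omega> (C\<^sub>1 n \<omega>)"
  shows "\<forall>k\<ge>1. \<forall>d.
           tendsto_in_prob (\<lambda>n. pmf_of_set (matchings (N n) (M n) (dl n) (Com n)))
             (\<lambda>n \<omega>. real (card {v \<in> C\<^sub>1 n \<omega>.
                              dl n v = k \<and> rigc_degree (N n) (M n) (dl n) (Com n) \<omega> v = d})
                     / real (N n))
             (limit_proportion \<H> p \<mu> \<eta>r k d)"
proof -
  interpret supercritical_rigc_seq \<H> N M dl Com p \<mu> q \<eta>l \<eta>r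
    by unfold_locales
      (fact class_H N_lim M_lim dl_pos Com_in balance p_supp A B mu_supp C q_def D supercritical
        eta_l eta_l_least eta_r)+
  show ?thesis
    by (intro allI impI) (rule largest_component_proportion[OF C1])
qed

end
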